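(* Let $\eta\in(0,1)$ and assume that (i) $\pi_{1N}\ge1/[\Delta(N)+1]$, $\pi_{\Delta(N)N}\le1-1/[\Delta(N)+1]$, and $\max_{1\le j\le\Delta(N)+1}\{\pi_{jN}-\pi_{j-1\,N}\}\to0$ as $N\to\infty$, where $\pi_{0N}=0$ and $\pi_{\Delta(N)+1\,N}=1$; (ii)' $\theta_N\in(0,1)$, $N\theta_N^2/\log^2N\to\infty$, and there exists $\nu\in(0,1)$ such that $\theta_N^{1-\nu}\Delta(N)\to0$ as $N\to\infty$; (iii) $\eta_N\to\eta$ and $\theta_N(\eta_N-\eta)\sqrt N=O(1)$ as $N\to\infty$. Then the intermediate efficiency $e_{\mathcal T\mathcal V}$ of $\mathcal T=\{\mathcal T_N\}$ with respect to $\mathcal V=\{\mathcal V_N\}$, under $\{P_{\theta_N}\times Q_{\theta_N}\}$, exists and is equal to $$e_{\mathcal T\mathcal V}(\eta)=\frac14\left[\frac{\sup_{0<t<1}A^*(t;\eta)}{\sup_{0<t<1}\bar A(t;\eta)}\right]^2=\frac14\left[\frac{\sup_{z\in\mathbb R}[G_1(z)-F_1(z)]/\sqrt{J_1(z)[1-J_1(z)]}}{\sup_{z\in\mathbb R}[G_1(z)-F_1(z)]}\right]^2 .$$ Moreover, for any such sequence of alternatives, $e_{\mathcal T\mathcal V}(\eta)\ge1$, with equality if and only if $A^*(t;\eta)$ attains its maximum at $t=1/2$.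
   Context: Setting. $X_1,\dots,X_m$ and $Y_1,\dots,Y_n$ are independent samples of i.i.d. real random variables with continuous distribution functions $F$ and $G$ (laws $P$ and $Q$), $m=m(N)$, $n=n(N)$, $m+n=N$, $\eta_N=m(N)/N$. The null hypothesis is $\mathbb H_0:F(z)\ge G(z)$ for all $z\in\mathbb R$, the alternative is $\mathbb H_1:F(z)<G(z)$ for some $z$; $\mathbb P_0$ denotes the set of product measures $P\times Q$ satisfying $\mathbb H_0$. Alternatives. $(F_1,G_1)$ is a fixed pair of continuous distribution functions satisfying $\mathbb H_1$; $J_1=\eta F_1+(1-\eta)G_1=F_0$, $J_1^{-1}$ its quantile function, and for $t\in(0,1)$ $$\bar A(t;\eta)=(G_1-F_1)\circ J_1^{-1}(t),\qquad A^*(t;\eta)=\frac{\bar A(t;\eta)}{\sqrt{t(1-t)}} .$$ (The supremum over $z$ with the weight $1/\sqrt{J_1(1-J_1)}$ is over $z$ with $0<J_1(z)<1$.) $P_{\theta_N}$ and $Q_{\theta_N}$ are the probability measures with distribution functions $(1-\theta_N)F_0+\theta_NF_1$ and $(1-\theta_N)F_0+\theta_NG_1$. For a natural number $S$, $\Pi_{\theta_N}^S=P_{\theta_N}^{m(S)}\times Q_{\theta_N}^{n(S)}$; $\pi=\{\Pi_{\theta_N}^N\}$. Statistics. $\hat F_m,\hat G_n$ are the empirical distribution functions of the two samples and $$\mathcal V_N=\sqrt{\frac{mn}{N}}\sup_{z\in\mathbb R}\{\hat G_n(z)-\hat F_m(z)\}.$$ $\Delta(N)$ is a non-decreasing sequence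 of natural numbers, $1<\Delta(N)\le N$, and $0<\pi_{1N}<\dots<\pi_{\Delta(N)N}<1$. For $j=1,\dots,\Delta(N)$, $$\ell_j(t)=-\sqrt{\frac{1-\pi_{jN}}{\pi_{jN}}}\,\mathbf 1(0\le t<\pi_{jN})+\sqrt{\frac{\pi_{jN}}{1-\pi_{jN}}}\,\mathbf 1(\pi_{jN}\le t\le1).$$ $R_i$ is the rank, in the pooled sample $X_1,\dots,X_m,Y_1,\dots,Y_n$, of its $i$-th element. With $c_{Ni}=-\sqrt{mn/N}\,m^{-1}$ for $1\le i\le m$ and $c_{Ni}=\sqrt{mn/N}\,n^{-1}$ for $m<i\le N$, $$\mathcal L_j=\sum_{i=1}^Nc_{Ni}\,\ell_j\Bigl(\frac{R_i-0.5}{N}\Bigr),\qquad \mathcal T_N=\max_{1\le j\le\Delta(N)}\{-\mathcal L_j\}.$$ Efficiency. Write $\mathcal U^{(I)}_N=\mathcal V_N$, $\mathcal U^{(II)}_N=\mathcal T_N$ (both tests reject for large values). For $\alpha\in(0,1)$ and $\bullet\in\{I,II\}$, $$u^{(\bullet)}_{\alpha N}=\inf\Bigl\{w:\sup_{P\times Q\in\mathbb P_0}P^{m(N)}\times Q^{n(N)}(\mathcal U^{(\bullet)}_N>w)\le\alpha\Bigr\}.$$ $\mathbb L$ is the set of sequences $\{\alpha_N\}\subset(0,1)$ with $\alpha_N\to0$, $N^{-1}\log\alpha_N\to0$. $\mathbb L^*=\mathbb L^*(\pi)$ is the set of $\{\alpha_N\}\in\mathbb L$ with $$0<\liminf_{N}\Pi_{\theta_N}^N(\mathcal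 U_N^{(II)}>u^{(II)}_{\alpha_NN})\le\limsup_N\Pi_{\theta_N}^N(\mathcal U_N^{(II)}>u^{(II)}_{\alpha_NN})<1 .$$ For $\{\alpha_N\}\in\mathbb L^*$ put $$M(N,\pi)=\inf\Bigl\{M\ge1:\Pi_{\theta_N}^N(\mathcal U_N^{(II)}>u^{(II)}_{\alpha_NN})\le\Pi_{\theta_N}^{M+k}(\mathcal U_{M+k}^{(I)}>u^{(I)}_{\alpha_N\,M+k})\text{ for all }k\ge0\Bigr\}.$$ The intermediate efficiency of $\mathcal T$ with respect to $\mathcal V$ under $\{P_{\theta_N}\times Q_{\theta_N}\}$ is said to exist and to equal $e_{\mathcal T\mathcal V}$ if $\mathbb L^*$ is nonempty and $e_{\mathcal T\mathcal V}=\lim_{N\to\infty}M(N,\pi)/N\in[0,\infty]$ exists and does not depend on the choice of $\{\alpha_N\}\in\mathbb L^*$. It is written $e_{\mathcal T\mathcal V}(\eta)$ to indicate dependence on $\eta$. *)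

theory Defs
  imports "HOL-Probability.Probability" "HOL-Library.Landau_Symbols"
begin

section \<open>Distribution functions\<close>

definition continuous_df :: "(real \<Rightarrow> real) \<Rightarrow> bool" where
  "continuous_df F \<longleftrightarrow> mono F \<and> continuous_on UNIV F \<and> (F \<longlongrightarrow> 0) at_bot \<and> (F \<longlongrightarrow> 1) at_top"

text \<open>The probability measure with continuous distribution function \<open>F\<close> is \<open>interval_measure F\<close>:\<close>

lemma continuous_df_law:
  assumes "continuous_df F"
  shows "real_distribution (interval_measure F)" and "cdf (interval_measure F) = F"
proof -
  have F: "\<And>x y. x \<le> y \<Longrightarrow> F x \<le> F y" "(F \<longlongrightarrow> 0) at_bot" "(F \<longlongrightarrow> 1) at_top"
    using assms by (auto simp: continuous_df_def mono_def)
  have c: "\<And>a. continuous (at_right a) F"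
    using assms by (auto simp: continuous_df_def continuous_on_eq_continuous_within
        intro: continuous_within_subset)
  show "real_distribution (interval_measure F)"
    by (rule real_distribution_interval_measure) (use F c in auto)
  show "cdf (interval_measure F) = F"
    by (rule cdf_interval_measure) (use F c in auto)
qed

definition quantile :: "(real \<Rightarrow> real) \<Rightarrow> real \<Rightarrow> real" where
  "quantile J t = Inf {z. t \<le> J z}"

definition mix_df :: "real \<Rightarrow> (real \<Rightarrow> real) \<Rightarrow> (real \<Rightarrow> real) \<Rightarrow> real \<Rightarrow> real" where
  "mix_df \<eta> F G z = \<eta> * F z + (1 - \<eta>) * G z"

definition A_bar :: "(real \<Rightarrow> real) \<Rightarrow> (real \<Rightarrow> real) \<Rightarrow> real \<Rightarrow> real \<Rightarrow> real" where
  "A_bar F G \<eta> t = (let z = quantile (mix_df \<eta> F G) t in G z - F z)"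

definition A_star :: "(real \<Rightarrow> real) \<Rightarrow> (real \<Rightarrow> real) \<Rightarrow> real \<Rightarrow> real \<Rightarrow> real" where
  "A_star F G \<eta> t = A_bar F G \<eta> t / sqrt (t * (1 - t))"

text \<open>\<open>contaminated J H \<theta>\<close> is the law with distribution function \<open>(1 - \<theta>) J + \<theta> H\<close>.\<close>

definition contaminated :: "(real \<Rightarrow> real) \<Rightarrow> (real \<Rightarrow> real) \<Rightarrow> real \<Rightarrow> real measure" where
  "contaminated J H \<theta> = interval_measure (\<lambda>z. (1 - \<theta>) * J z + \<theta> * H z)"


section \<open>Two-sample statistics\<close>

text \<open>
  A pair of samples \<open>X\<^sub>1, \<dots>, X\<^sub>a\<close> and \<open>Y\<^sub>1, \<dots>, Y\<^sub>b\<close> is a pair \<open>(x, y)\<close> of sequences of which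
  only \<open>x 0, \<dots>, x (a - 1)\<close> and \<open>y 0, \<dots>, y (b - 1)\<close> matter.
\<close>

type_synonym samples = "(nat \<Rightarrow> real) \<times> (nat \<Rightarrow> real)"

definition two_sample_law ::
    "nat \<Rightarrow> nat \<Rightarrow> real measure \<Rightarrow> real measure \<Rightarrow> samples measure" where
  "two_sample_law a b P Q = Pi\<^sub>M {..<a} (\<lambda>_. P) \<Otimes>\<^sub>M Pi\<^sub>M {..<b} (\<lambda>_. Q)"

definition ecdf :: "nat \<Rightarrow> (nat \<Rightarrow> real) \<Rightarrow> real \<Rightarrow> real" where
  "ecdf k x z = real (card {i. i < k \<and> x i \<le> z}) / real k"

definition V_stat :: "nat \<Rightarrow> nat \<Rightarrow> samples \<Rightarrow> real" where
  "V_stat a b = (\<lambda>(x, y).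
     sqrt (real a * real b / real (a + b)) * (SUP z. ecdf b y z - ecdf a x z))"

definition pooled :: "nat \<Rightarrow> samples \<Rightarrow> nat \<Rightarrow> real" where
  "pooled a = (\<lambda>(x, y) i. if i < a then x i else y (i - a))"

text \<open>Ties have probability zero under continuous distributions.\<close>

definition rank_in :: "nat \<Rightarrow> (nat \<Rightarrow> real) \<Rightarrow> nat \<Rightarrow> nat" where
  "rank_in k z i = card {j. j < k \<and> z j \<le> z i}"

definition score :: "real \<Rightarrow> real \<Rightarrow> real" where
  "score p t = (if t < p then - sqrt ((1 - p) / p) else sqrt (p / (1 - p)))"

definition reg_const :: "nat \<Rightarrow> nat \<Rightarrow> nat \<Rightarrow> real" where
  "reg_const a b i = (let s = sqrt (real a * real b / real (a + b)) in
     if i < a then - s / real a else s / real b)"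

definition L_stat :: "nat \<Rightarrow> nat \<Rightarrow> real \<Rightarrow> samples \<Rightarrow> real" where
  "L_stat a b p \<omega> = (\<Sum>i<a + b. reg_const a b i *
     score p ((real (rank_in (a + b) (pooled a \<omega>) i) - 1 / 2) / real (a + b)))"

definition T_stat :: "nat \<Rightarrow> nat \<Rightarrow> nat \<Rightarrow> (nat \<Rightarrow> real) \<Rightarrow> samples \<Rightarrow> real" where
  "T_stat a b d p \<omega> = (MAX j\<in>{1..d}. - L_stat a b (p j) \<omega>)"


section \<open>Intermediate efficiency\<close>

text \<open>
  Throughout, \<open>m S\<close> and \<open>n S\<close> are the sample sizes belonging to the total size \<open>S\<close>, and
  \<open>U S\<close> is the test statistic for that size.
\<close>

definition null_pairs :: "(real measure \<times> real measure) set" where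
  "null_pairs = {(P, Q). real_distribution P \<and> real_distribution Q \<and>
     continuous_on UNIV (cdf P) \<and> continuous_on UNIV (cdf Q) \<and> (\<forall>z. cdf P z \<ge> cdf Q z)}"

definition exceed_prob :: "(nat \<Rightarrow> nat) \<Rightarrow> (nat \<Rightarrow> nat) \<Rightarrow> (nat \<Rightarrow> samples \<Rightarrow> real) \<Rightarrow>
    nat \<Rightarrow> real measure \<Rightarrow> real measure \<Rightarrow> real \<Rightarrow> real" where
  "exceed_prob m n U S P Q w =
     \<P>(\<omega> in two_sample_law (m S) (n S) P Q. U S \<omega> > w)"

definition crit_value :: "(nat \<Rightarrow> nat) \<Rightarrow> (nat \<Rightarrow> nat) \<Rightarrow> (nat \<Rightarrow> samples \<Rightarrow> real) \<Rightarrow>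
    nat \<Rightarrow> real \<Rightarrow> real" where
  "crit_value m n U S \<alpha> =
     Inf {w. (SUP (P, Q)\<in>null_pairs. exceed_prob m n U S P Q w) \<le> \<alpha>}"

definition test_power :: "(nat \<Rightarrow> nat) \<Rightarrow> (nat \<Rightarrow> nat) \<Rightarrow> (nat \<Rightarrow> samples \<Rightarrow> real) \<Rightarrow>
    nat \<Rightarrow> real \<Rightarrow> real measure \<Rightarrow> real measure \<Rightarrow> real" where
  "test_power m n U S \<alpha> P Q = exceed_prob m n U S P Q (crit_value m n U S \<alpha>)"

definition levels :: "(nat \<Rightarrow> real) set" where
  "levels = {\<alpha>. (\<forall>N. 0 < \<alpha> N \<and> \<alpha> N < 1) \<and> \<alpha> \<longlonglongrightarrow> 0 \<and> (\<lambda>N. ln (\<alpha> N) / real N) \<longlonglongrightarrow> 0}"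

text \<open>In the following, \<open>P N\<close> and \<open>Q N\<close> are the alternatives with index \<open>N\<close>.\<close>

definition levels_star :: "(nat \<Rightarrow> nat) \<Rightarrow> (nat \<Rightarrow> nat) \<Rightarrow> (nat \<Rightarrow> samples \<Rightarrow> real) \<Rightarrow>
    (nat \<Rightarrow> real measure) \<Rightarrow> (nat \<Rightarrow> real measure) \<Rightarrow> (nat \<Rightarrow> real) set" where
  "levels_star m n U P Q = {\<alpha> \<in> levels.
     0 < liminf (\<lambda>N. ereal (test_power m n U N (\<alpha> N) (P N) (Q N))) \<and>
     limsup (\<lambda>N. ereal (test_power m n U N (\<alpha> N) (P N) (Q N))) < 1}"

text \<open>
  The infimum is taken in the extended reals, so that it is \<open>\<infinity>\<close> if no \<open>M\<close> qualifies.
  The alternative and the level keep the index \<open>N\<close> while the total sample size is \<open>M + k\<close>.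
\<close>

definition sample_size_needed :: "(nat \<Rightarrow> nat) \<Rightarrow> (nat \<Rightarrow> nat) \<Rightarrow>
    (nat \<Rightarrow> samples \<Rightarrow> real) \<Rightarrow> (nat \<Rightarrow> samples \<Rightarrow> real) \<Rightarrow>
    (nat \<Rightarrow> real measure) \<Rightarrow> (nat \<Rightarrow> real measure) \<Rightarrow> (nat \<Rightarrow> real) \<Rightarrow> nat \<Rightarrow> ereal" where
  "sample_size_needed m n U V P Q \<alpha> N =
     (INF M\<in>{M. 1 \<le> M \<and> (\<forall>k. test_power m n U N (\<alpha> N) (P N) (Q N)
                              \<le> test_power m n V (M + k) (\<alpha> N) (P N) (Q N))}. ereal (real M))"

definition has_intermediate_efficiency :: "(nat \<Rightarrow> nat) \<Rightarrow> (nat \<Rightarrow> nat) \<Rightarrow>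
    (nat \<Rightarrow> samples \<Rightarrow> real) \<Rightarrow> (nat \<Rightarrow> samples \<Rightarrow> real) \<Rightarrow>
    (nat \<Rightarrow> real measure) \<Rightarrow> (nat \<Rightarrow> real measure) \<Rightarrow> ereal \<Rightarrow> bool" where
  "has_intermediate_efficiency m n U V P Q e \<longleftrightarrow>
     levels_star m n U P Q \<noteq> {} \<and>
     (\<forall>\<alpha>\<in>levels_star m n U P Q.
        (\<lambda>N. sample_size_needed m n U V P Q \<alpha> N / ereal (real N)) \<longlonglongrightarrow> e)"

end

theory Submission
  imports Defs
begin

text \<open>
  Put \<open>b\<^sub>N = sqrt (m n / N) \<theta>\<^sub>N\<close>, the order of magnitude of the signal, and let \<open>Dmax\<close> and \<open>Amax\<close> be the
  suprema of \<open>A_bar\<close> and \<open>A_star\<close>. The efficiency comes from two facts about each statistic: where it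
  concentrates under the alternatives, and how fast its null tail decays at multiples of \<open>b\<^sub>N\<close>.

  Alternatives. Between the two mixtures the difference of distribution functions is \<open>\<theta>\<^sub>N (G\<^sub>1 - F\<^sub>1)\<close>.
  Therefore \<open>V\<close> with total sample size \<open>S\<close> concentrates around \<open>sqrt (S / N) b\<^sub>N Dmax\<close>. The \<open>j\<close>-th linear
  rank statistic is, up to the normalisation \<open>sqrt (\<pi>\<^sub>j (1 - \<pi>\<^sub>j))\<close>, the surplus of the second sample
  among the \<open>N \<pi>\<^sub>j\<close> smallest observations; it concentrates around \<open>b\<^sub>N\<close> times \<open>A_star\<close> near \<open>\<pi>\<^sub>j\<close>.
  Since the levels become dense and \<open>A_star\<close> is continuous, \<open>T\<close> concentrates around \<open>b\<^sub>N Amax\<close>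
  (\<open>T_small\<close>, \<open>T_large\<close>).

  Null hypothesis. To logarithmic order the tails are those of one normal variable, of variance \<open>1\<close>
  for \<open>T\<close> and of the largest variance \<open>1 / 4\<close> of an indicator for \<open>V\<close>: the probabilities of
  exceeding \<open>x b\<^sub>N\<close> are \<open>exp (- (1 / 2 + o(1)) x\<^sup>2 b\<^sub>N\<^sup>2)\<close> (\<open>null_T_upper\<close>, \<open>null_T_lower\<close>) and
  \<open>exp (- (2 + o(1)) x\<^sup>2 b\<^sub>N\<^sup>2)\<close>. The maximum over \<open>\<Delta>(N)\<close> levels, and likewise the supremum over \<open>z\<close>,
  costs only a polynomial factor, and \<open>b\<^sub>N\<^sup>2 / ln N \<longlongrightarrow> \<infinity>\<close>. Binomial tails are Gaussian in this range even
  at the extreme levels because \<open>\<theta>\<^sub>N \<Delta>(N) \<longlongrightarrow> 0\<close>. The lower bounds use a single event, a surplus at the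
  median. For \<open>T\<close> the supremum over the null hypothesis is attained at equal laws, because ranks are
  invariant and monotone (\<open>null_T_le_uniform\<close>).

  Conclusion. If the power of \<open>T\<close> stays away from \<open>0\<close> and \<open>1\<close>, its critical value is \<open>(1 + o(1)) Amax b\<^sub>N\<close>,
  so \<open>- ln \<alpha>\<^sub>N\<close> is \<open>(1 / 2 + o(1)) Amax\<^sup>2 b\<^sub>N\<^sup>2\<close> (\<open>level_lower\<close>, \<open>level_upper\<close>). At this level the critical value \<open>w\<close> of
  \<open>V\<close> satisfies \<open>2 w\<^sup>2 \<approx> Amax\<^sup>2 b\<^sub>N\<^sup>2 / 2\<close>, that is \<open>w \<approx> Amax b\<^sub>N / 2\<close>. Its signal \<open>sqrt (S / N) b\<^sub>N Dmax\<close> exceeds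
  this value for \<open>S / N > (Amax / (2 Dmax))\<^sup>2\<close> and falls short of it for smaller \<open>S / N\<close>; the power then
  tends to \<open>1\<close> and to \<open>0\<close> (\<open>V_power_high\<close>, \<open>V_power_low\<close>), which gives the limit in \<open>sample_size_limit\<close>.

  Such levels exist although \<open>T\<close> is discrete: under the alternatives no single value of \<open>T\<close> carries almost
  all of the mass (\<open>T_atoms\<close>), so some critical value has power away from \<open>0\<close> and \<open>1\<close>
  (\<open>levels_star_nonempty\<close>). Finally \<open>sqrt (t (1 - t)) \<le> 1 / 2\<close>, with equality only at \<open>t = 1 / 2\<close>, yields
  \<open>Amax \<ge> 2 Dmax\<close> and the equality case (\<open>efficiency_ge_1\<close>).
\<close>

section \<open>Exponential bounds for sums of independent indicators\<close>

text \<open>Hoeffding's lemma for an indicator. It does not see the variance \<open>p (1 - p)\<close>, which is why the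
  rank counts, whose levels may approach \<open>0\<close> and \<open>1\<close>, need the next bound instead.\<close>

lemma bernoulli_mgf_le_Hoeffding:
  fixes p v :: real
  assumes "0 \<le> p" "p \<le> 1"
  shows "1 + p * (exp v - 1) \<le> exp (p * v + v\<^sup>2 / 8)"
proof -
  have main: "1 + q * (exp h - 1) \<le> exp (q * h + h\<^sup>2 / 8)" if "0 \<le> h" "0 \<le> q" for q h :: real
  proof -
    have "0 < 1 + q * (exp h - 1)"
      using that by (intro add_pos_nonneg mult_nonneg_nonneg) auto
    moreover have "ln (1 + q * (exp h - 1)) \<le> q * h + h\<^sup>2 / 8"
      using Hoeffdings_lemma_aux[OF that] by (simp add: algebra_simps)
    ultimately show ?thesis by (metis exp_le_cancel_iff exp_ln)
  qed
  show ?thesis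
  proof (cases "0 \<le> v")
    case True
    then show ?thesis using main assms by blast
  next
    case False
    have "1 + p * (exp v - 1) = exp v * (1 + (1 - p) * (exp (- v) - 1))"
      by (simp add: exp_minus field_simps)
    also have "\<dots> \<le> exp v * exp ((1 - p) * (- v) + (- v)\<^sup>2 / 8)"
      using False assms by (intro mult_left_mono main) auto
    also have "\<dots> = exp (p * v + v\<^sup>2 / 8)"
      by (simp add: exp_add[symmetric] algebra_simps)
    finally show ?thesis .
  qed
qed

text \<open>Taylor's formula with the remainder bounded on the whole interval between \<open>0\<close> and \<open>x\<close>.\<close>

lemma exp_le_quadratic: "exp x \<le> 1 + x + x\<^sup>2 / 2 * exp \<bar>x\<bar>" for x :: real
proof -
  obtain t where t: "\<bar>t\<bar> \<le> \<bar>x\<bar>" "exp x = (\<Sum>m<2. x ^ m / fact m) + exp t / fact 2 * x ^ 2"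
    using Maclaurin_exp_le[of x 2] by blast
  have "exp t * x\<^sup>2 \<le> exp \<bar>x\<bar> * x\<^sup>2"
    using t(1) by (intro mult_right_mono) auto
  then show ?thesis
    using t(2) by (simp add: numeral_2_eq_2 field_simps)
qed

text \<open>For small \<open>v\<close> the exponent has the second-order term \<open>p (1 - p) v\<^sup>2 / 2\<close> of the normal distribution
  with the same variance; the factor \<open>exp \<bar>v\<bar>\<close> measures the distance from the Gaussian regime.\<close>

lemma bernoulli_mgf_le_Bernstein:
  fixes p v :: real
  assumes "0 \<le> p" "p \<le> 1"
  shows "1 + p * (exp v - 1) \<le> exp (p * v + p * (1 - p) * v\<^sup>2 * exp \<bar>v\<bar> / 2)"
proof -
  have bnd: "exp (c * v) \<le> 1 + c * v + (c * v)\<^sup>2 / 2 * exp \<bar>v\<bar>" if "\<bar>c\<bar> \<le> 1" for c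
  proof -
    have "\<bar>c * v\<bar> \<le> \<bar>v\<bar>" using that by (simp add: abs_mult mult_left_le_one_le)
    then have "(c * v)\<^sup>2 / 2 * exp \<bar>c * v\<bar> \<le> (c * v)\<^sup>2 / 2 * exp \<bar>v\<bar>"
      by (intro mult_left_mono) auto
    with exp_le_quadratic[of "c * v"] show ?thesis by linarith
  qed
  have "1 + p * (exp v - 1) = exp (p * v) * (p * exp ((1 - p) * v) + (1 - p) * exp ((- p) * v))"
    by (simp add: algebra_simps exp_add[symmetric] exp_minus)
  also have "\<dots> \<le> exp (p * v) *
      (p * (1 + (1 - p) * v + ((1 - p) * v)\<^sup>2 / 2 * exp \<bar>v\<bar>)
       + (1 - p) * (1 + (- p) * v + ((- p) * v)\<^sup>2 / 2 * exp \<bar>v\<bar>))"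
    using assms by (intro mult_left_mono add_mono bnd) auto
  also have "\<dots> = exp (p * v) * (1 + p * (1 - p) * v\<^sup>2 * exp \<bar>v\<bar> / 2)"
    by (simp add: field_simps power2_eq_square)
  also have "\<dots> \<le> exp (p * v) * exp (p * (1 - p) * v\<^sup>2 * exp \<bar>v\<bar> / 2)"
    by (intro mult_left_mono) auto
  finally show ?thesis by (simp add: exp_add)
qed

text \<open>The laws of the coordinates may differ, because a pooled sample is drawn from two laws.\<close>

locale real_product =
  fixes N :: nat and \<mu> :: "nat \<Rightarrow> real measure"
  assumes real_distribution_factor: "\<And>i. real_distribution (\<mu> i)"
begin

abbreviation "\<Omega> \<equiv> Pi\<^sub>M {..<N} \<mu>"

lemma sets_factor[simp, measurable_cong]: "sets (\<mu> i) = sets borel"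
  by (rule real_distribution.events_eq_borel[OF real_distribution_factor])

lemma space_factor[simp]: "space (\<mu> i) = UNIV"
  by (rule real_distribution.space_eq_univ[OF real_distribution_factor])

lemma prob_space_factor: "prob_space (\<mu> i)"
  using real_distribution_factor by (simp add: real_distribution_def)

sublocale product_prob_space \<mu> "{..<N}"
  by (rule product_prob_spaceI) (rule prob_space_factor)

sublocale finite_product_prob_space \<mu> "{..<N}"
  by unfold_locales simp

lemma sets_\<Omega>[measurable_cong]: "sets \<Omega> = sets (Pi\<^sub>M {..<N} (\<lambda>_. borel))"
  by (rule sets_PiM_cong) auto

lemma space_\<Omega>: "space \<Omega> = {..<N} \<rightarrow>\<^sub>E UNIV"
  by (simp add: space_PiM)

text \<open>Markov's inequality for the exponential moment of a weighted count.\<close>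

lemma chernoff:
  fixes v :: "nat \<Rightarrow> real" and B :: "nat \<Rightarrow> real set" and c :: real
  assumes [measurable]: "\<And>i. B i \<in> sets borel"
  shows "\<P>(z in \<Omega>. (\<Sum>i<N. v i * indicator (B i) (z i)) \<ge> c)
      \<le> exp (- c) * (\<Prod>i<N. 1 + measure (\<mu> i) (B i) * (exp (v i) - 1))"
proof -
  define S where "S z = (\<Sum>i<N. v i * indicator (B i) (z i))" for z :: "nat \<Rightarrow> real"
  have [measurable]: "S \<in> borel_measurable \<Omega>"
    unfolding S_def by measurable
  have expS: "exp (S z) = (\<Prod>i<N. 1 + indicator (B i) (z i) * (exp (v i) - 1))" for z
    unfolding S_def exp_sum[OF finite_lessThan]
    by (intro prod.cong) (auto simp: indicator_def)
  have int: "integrable (\<mu> i) (\<lambda>x. 1 + indicator (B i) x * (exp (v i) - 1))" for i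
    by (intro Bochner_Integration.integrable_add integrable_mult_left integrable_real_indicator)
       (auto simp: M.emeasure_eq_measure)
  have E: "(\<integral>z. exp (S z) \<partial>\<Omega>) = (\<Prod>i<N. 1 + measure (\<mu> i) (B i) * (exp (v i) - 1))"
    unfolding expS
  proof (subst product_integral_prod[OF finite_lessThan int], rule prod.cong[OF refl])
    fix i assume "i \<in> {..<N}"
    show "(\<integral>x. 1 + indicator (B i) x * (exp (v i) - 1) \<partial>\<mu> i)
        = 1 + measure (\<mu> i) (B i) * (exp (v i) - 1)"
      by (subst Bochner_Integration.integral_add)
         (auto simp: M.emeasure_eq_measure M.prob_space[simplified])
  qed
  have intS: "integrable \<Omega> (\<lambda>z. exp (S z))"
    unfolding expS by (rule product_integrable_prod[OF finite_lessThan int])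
  have "\<P>(z in \<Omega>. S z \<ge> c) = \<P>(z in \<Omega>. exp (S z) \<ge> exp c)"
    by simp
  also have "\<dots> \<le> (\<integral>z. exp (S z) \<partial>\<Omega>) / exp c"
    by (rule integral_Markov_inequality_measure[OF intS, where A="{}", simplified]) auto
  also have "\<dots> = exp (- c) * (\<integral>z. exp (S z) \<partial>\<Omega>)"
    by (simp add: exp_minus field_simps)
  finally show ?thesis
    by (simp only: E) (simp only: S_def)
qed

lemma chernoff_Hoeffding:
  fixes v :: "nat \<Rightarrow> real" and B :: "nat \<Rightarrow> real set" and c :: real
  assumes "\<And>i. B i \<in> sets borel"
  shows "\<P>(z in \<Omega>. (\<Sum>i<N. v i * indicator (B i) (z i)) \<ge> c)
      \<le> exp (- c + (\<Sum>i<N. v i * measure (\<mu> i) (B i)) + (\<Sum>i<N. (v i)\<^sup>2) / 8)"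
proof -
  have "\<P>(z in \<Omega>. (\<Sum>i<N. v i * indicator (B i) (z i)) \<ge> c)
      \<le> exp (- c) * (\<Prod>i<N. 1 + measure (\<mu> i) (B i) * (exp (v i) - 1))"
    by (rule chernoff[OF assms])
  also have "\<dots> \<le> exp (- c) * (\<Prod>i<N. exp (measure (\<mu> i) (B i) * v i + (v i)\<^sup>2 / 8))"
  proof (intro mult_left_mono prod_mono conjI bernoulli_mgf_le_Hoeffding)
    fix i
    have "measure (\<mu> i) (B i) \<le> 1" by (simp add: M.prob_le_1)
    then have "0 \<le> (1 - measure (\<mu> i) (B i)) + measure (\<mu> i) (B i) * exp (v i)"
      by (intro add_nonneg_nonneg) auto
    then show "0 \<le> 1 + measure (\<mu> i) (B i) * (exp (v i) - 1)" by (simp add: algebra_simps)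
  qed (auto simp: M.prob_le_1)
  also have "\<dots> = exp (- c + (\<Sum>i<N. v i * measure (\<mu> i) (B i)) + (\<Sum>i<N. (v i)\<^sup>2) / 8)"
    by (simp add: exp_sum[symmetric] exp_add[symmetric] sum.distrib sum_divide_distrib mult.commute)
  finally show ?thesis .
qed

lemma chernoff_Bernstein:
  fixes v :: "nat \<Rightarrow> real" and B :: "nat \<Rightarrow> real set" and c :: real
  assumes "\<And>i. B i \<in> sets borel" and "\<And>i. i < N \<Longrightarrow> \<bar>v i\<bar> \<le> w"
  shows "\<P>(z in \<Omega>. (\<Sum>i<N. v i * indicator (B i) (z i)) \<ge> c)
      \<le> exp (- c + (\<Sum>i<N. v i * measure (\<mu> i) (B i))
          + exp w / 2 * (\<Sum>i<N. (v i)\<^sup>2 * (measure (\<mu> i) (B i) * (1 - measure (\<mu> i) (B i)))))"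
proof -
  have "\<P>(z in \<Omega>. (\<Sum>i<N. v i * indicator (B i) (z i)) \<ge> c)
      \<le> exp (- c) * (\<Prod>i<N. 1 + measure (\<mu> i) (B i) * (exp (v i) - 1))"
    by (rule chernoff[OF assms(1)])
  also have "\<dots> \<le> exp (- c) * (\<Prod>i<N. exp (v i * measure (\<mu> i) (B i)
      + exp w / 2 * ((v i)\<^sup>2 * (measure (\<mu> i) (B i) * (1 - measure (\<mu> i) (B i))))))"
  proof (intro mult_left_mono prod_mono conjI)
    fix i assume i: "i \<in> {..<N}"
    have "measure (\<mu> i) (B i) \<le> 1" by (simp add: M.prob_le_1)
    then have "0 \<le> (1 - measure (\<mu> i) (B i)) + measure (\<mu> i) (B i) * exp (v i)"
      by (intro add_nonneg_nonneg) auto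
    then show "0 \<le> 1 + measure (\<mu> i) (B i) * (exp (v i) - 1)" by (simp add: algebra_simps)
    have "measure (\<mu> i) (B i) * (1 - measure (\<mu> i) (B i)) * (v i)\<^sup>2 * exp \<bar>v i\<bar> / 2
        \<le> measure (\<mu> i) (B i) * (1 - measure (\<mu> i) (B i)) * (v i)\<^sup>2 * exp w / 2"
      using assms(2)[of i] i \<open>measure (\<mu> i) (B i) \<le> 1\<close>
      by (intro divide_right_mono mult_left_mono mult_nonneg_nonneg) auto
    then have "exp (measure (\<mu> i) (B i) * v i
        + measure (\<mu> i) (B i) * (1 - measure (\<mu> i) (B i)) * (v i)\<^sup>2 * exp \<bar>v i\<bar> / 2)
      \<le> exp (v i * measure (\<mu> i) (B i)
      + exp w / 2 * ((v i)\<^sup>2 * (measure (\<mu> i) (B i) * (1 - measure (\<mu> i) (B i)))))"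
      by (simp add: algebra_simps)
    with bernoulli_mgf_le_Bernstein[of "measure (\<mu> i) (B i)" "v i"] \<open>measure (\<mu> i) (B i) \<le> 1\<close>
    show "1 + measure (\<mu> i) (B i) * (exp (v i) - 1) \<le> exp (v i * measure (\<mu> i) (B i)
      + exp w / 2 * ((v i)\<^sup>2 * (measure (\<mu> i) (B i) * (1 - measure (\<mu> i) (B i)))))"
      by (meson measure_nonneg order_trans)
  qed auto
  also have "\<dots> = exp (- c + (\<Sum>i<N. v i * measure (\<mu> i) (B i))
          + exp w / 2 * (\<Sum>i<N. (v i)\<^sup>2 * (measure (\<mu> i) (B i) * (1 - measure (\<mu> i) (B i)))))"
    by (simp add: exp_sum[symmetric] exp_add[symmetric] sum.distrib sum_distrib_left)
  finally show ?thesis .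
qed

end

section \<open>Lower bounds for binomial probabilities\<close>

text \<open>The \<open>n + 1\<close> binomial probabilities sum to \<open>1\<close>, and the one at the mean is the largest of them.\<close>

lemma binomial_mode:
  fixes n k :: nat
  assumes "k \<le> n" "0 < k" "k < n"
  defines "r \<equiv> real k / real n"
  shows "1 / (real n + 1) \<le> real (n choose k) * r ^ k * (1 - r) ^ (n - k)"
proof -
  define f where "f j = real (n choose j) * r ^ j * (1 - r) ^ (n - j)" for j
  have r: "0 < r" "r < 1" using assms by (auto simp: r_def)
  have step: "f (Suc j) * (real (Suc j) * (1 - r)) = f j * (real (n - j) * r)" if "j < n" for j
  proof -
    have "n - j = Suc (n - Suc j)" using that by simp
    moreover have "real (n choose Suc j) * real (Suc j) = real (n choose j) * real (n - j)"
      by (metis binomial_absorb_comp binomial_absorption mult.commute of_nat_mult)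
    ultimately show ?thesis by (simp add: f_def)
  qed
  have f0: "0 \<le> f j" for j using r by (simp add: f_def)
  have nr: "real n * r = real k" using assms by (simp add: r_def)
  have up: "f j \<le> f (Suc j)" if "j < k" for j
  proof -
    have "real (Suc j) * (1 - r) \<le> real (n - j) * r"
      using that \<open>k < n\<close> r nr by (simp add: of_nat_diff algebra_simps)
    then have "f j * (real (Suc j) * (1 - r)) \<le> f (Suc j) * (real (Suc j) * (1 - r))"
      unfolding step[OF less_trans[OF that \<open>k < n\<close>]] using f0 by (rule mult_left_mono)
    then show ?thesis using r by simp
  qed
  have down: "f (Suc j) \<le> f j" if "k \<le> j" "j < n" for j
  proof -
    have "real (n - j) * r \<le> real (Suc j) * (1 - r)"
      using that \<open>k < n\<close> r nr by (simp add: of_nat_diff algebra_simps)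
    then have "f (Suc j) * (real (Suc j) * (1 - r)) \<le> f j * (real (Suc j) * (1 - r))"
      unfolding step[OF that(2)] using f0 by (rule mult_left_mono)
    then show ?thesis using r by simp
  qed
  have "f j \<le> f k" if "j \<le> n" for j
  proof (cases "j \<le> k")
    case True
    then show ?thesis
      by (induction rule: inc_induct) (use up in \<open>auto intro: order_trans\<close>)
  next
    case False
    then have "k \<le> j" by simp
    then show ?thesis using that
      by (induction rule: dec_induct) (auto intro: order_trans[OF down])
  qed
  then have "(\<Sum>j\<le>n. f j) \<le> (\<Sum>j\<le>n. f k)" by (intro sum_mono) auto
  moreover have "(\<Sum>j\<le>n. f j) = 1"
    using binomial_ring[of r "1 - r" n] by (simp add: f_def)
  ultimately show ?thesis by (simp add: f_def field_simps)
qed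

lemma ln_one_plus_le_cubic:
  fixes h :: real
  assumes "- 1 < h"
  shows "ln (1 + h) \<le> h - h\<^sup>2 / 2 + h ^ 3 / 3"
proof -
  define g where "g x = x - x\<^sup>2 / 2 + x ^ 3 / 3 - ln (1 + x)" for x :: real
  have g': "(g has_real_derivative x ^ 3 / (1 + x)) (at x)" if "- 1 < x" for x
    unfolding g_def using that
    by (auto intro!: derivative_eq_intros simp: field_simps power2_eq_square power3_eq_cube)
  have "g 0 \<le> g h"
  proof (cases "0 \<le> h")
    case True
    then show ?thesis
      by (rule DERIV_nonneg_imp_nondecreasing) (auto intro!: exI g')
  next
    case False
    then have "h \<le> 0" by simp
    then show ?thesis
    proof (rule DERIV_nonpos_imp_nonincreasing)
      fix x assume x: "h \<le> x" "x \<le> 0"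
      with assms have "x ^ 3 / (1 + x) \<le> 0"
        by (intro divide_nonpos_pos) (auto simp: power3_eq_cube mult_le_0_iff zero_le_mult_iff)
      with x assms show "\<exists>y. (g has_real_derivative y) (at x) \<and> y \<le> 0"
        by (intro exI[of _ "x ^ 3 / (1 + x)"]) (auto intro: g')
    qed
  qed
  then show ?thesis by (simp add: g_def)
qed

text \<open>The left-hand side is the relative entropy of two Bernoulli laws. Its Taylor expansion at \<open>D = 0\<close>
  starts with \<open>D\<^sup>2 / (2 q (1 - q))\<close>; the constant \<open>100\<close> is a crude bound for the cubic term that holds
  for \<open>q\<close> away from \<open>0\<close> and \<open>1\<close>.\<close>

lemma kl_le:
  fixes q D :: real
  assumes q: "1 / 4 \<le> q" "q \<le> 3 / 4" and D: "\<bar>D\<bar> \<le> 1 / 8"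
  shows "(q + D) * ln ((q + D) / q) + (1 - q - D) * ln ((1 - q - D) / (1 - q))
    \<le> D\<^sup>2 / (2 * (q * (1 - q))) * (1 + 100 * \<bar>D\<bar>)"
proof -
  have part: "(c + d) * ln ((c + d) / c) \<le> d + d\<^sup>2 / (2 * c) + 8 * \<bar>d\<bar> ^ 3"
    if c: "1 / 4 \<le> c" and d: "\<bar>d\<bar> \<le> 1 / 8" for c d :: real
  proof -
    have "- 1 < d / c" using c d by (simp add: field_simps abs_le_iff)
    then have "ln (1 + d / c) \<le> d / c - (d / c)\<^sup>2 / 2 + (d / c) ^ 3 / 3"
      by (rule ln_one_plus_le_cubic)
    then have "(c + d) * ln ((c + d) / c) \<le> (c + d) * (d / c - (d / c)\<^sup>2 / 2 + (d / c) ^ 3 / 3)"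
      using c d by (intro mult_left_mono) (auto simp: add_divide_distrib)
    also have "\<dots> = d + d\<^sup>2 / (2 * c) + d ^ 3 * (d / (3 * c ^ 3) - 1 / (6 * c\<^sup>2))"
    proof -
      have "d / c * c = d" using c by simp
      define e where "e = d / c"
      have d': "d = e * c" using c by (simp add: e_def)
      have "(c + d) * (e - e\<^sup>2 / 2 + e ^ 3 / 3) = d + c * e\<^sup>2 / 2 + (- c * e ^ 3 / 6 + c * e ^ 4 / 3)"
        unfolding d' by (simp add: field_simps power2_eq_square power3_eq_cube power4_eq_xxxx)
      moreover have "c * e\<^sup>2 / 2 = d\<^sup>2 / (2 * c)" using c by (simp add: d' power2_eq_square)
      moreover have "- c * e ^ 3 / 6 + c * e ^ 4 / 3 = d ^ 3 * (d / (3 * c ^ 3) - 1 / (6 * c\<^sup>2))"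
        using c by (simp add: d' right_diff_distrib power2_eq_square power3_eq_cube power4_eq_xxxx)
          (simp add: mult.commute mult.left_commute)
      ultimately show ?thesis by (simp add: e_def)
    qed
    also have "\<bar>d ^ 3 * (d / (3 * c ^ 3) - 1 / (6 * c\<^sup>2))\<bar> \<le> \<bar>d\<bar> ^ 3 * 8"
    proof -
      have c2: "1 / c\<^sup>2 \<le> 16"
        using power_mono[OF c, of 2] c by (simp add: field_simps power2_eq_square)
      have c3: "1 / c ^ 3 \<le> 64"
        using power_mono[OF c, of 3] c by (simp add: field_simps power3_eq_cube)
      have "\<bar>d / (3 * c ^ 3)\<bar> = \<bar>d\<bar> * (1 / c ^ 3) / 3" using c by (simp add: abs_mult)
      also have "\<dots> \<le> 1 / 8 * 64 / 3"
        using d c3 c by (intro divide_right_mono mult_mono) auto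
      finally have A: "\<bar>d / (3 * c ^ 3)\<bar> \<le> 8 / 3" by simp
      have B: "\<bar>1 / (6 * c\<^sup>2)\<bar> \<le> 8 / 3" using c2 by simp
      have "\<bar>d / (3 * c ^ 3) - 1 / (6 * c\<^sup>2)\<bar> \<le> 8"
        using A B abs_triangle_ineq4[of "d / (3 * c ^ 3)" "1 / (6 * c\<^sup>2)"] by linarith
      then show ?thesis by (simp add: abs_mult power_abs mult_left_mono)
    qed
    then have "d ^ 3 * (d / (3 * c ^ 3) - 1 / (6 * c\<^sup>2)) \<le> 8 * \<bar>d\<bar> ^ 3" by linarith
    finally show ?thesis by simp
  qed
  have "(q + D) * ln ((q + D) / q) \<le> D + D\<^sup>2 / (2 * q) + 8 * \<bar>D\<bar> ^ 3"
    using part[of q D] q D by simp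
  moreover have "(1 - q - D) * ln ((1 - q - D) / (1 - q)) \<le> - D + D\<^sup>2 / (2 * (1 - q)) + 8 * \<bar>D\<bar> ^ 3"
    using part[of "1 - q" "- D"] q D by simp
  moreover have "D\<^sup>2 / (2 * q) + D\<^sup>2 / (2 * (1 - q)) = D\<^sup>2 / (2 * (q * (1 - q)))"
  proof -
    have "1 / q + 1 / (1 - q) = 1 / (q * (1 - q))"
      using q by (simp add: divide_simps)
    then have "D\<^sup>2 / 2 * (1 / q + 1 / (1 - q)) = D\<^sup>2 / 2 * (1 / (q * (1 - q)))" by simp
    then show ?thesis by (simp add: distrib_left)
  qed
  moreover have "16 * \<bar>D\<bar> ^ 3 \<le> D\<^sup>2 / (2 * (q * (1 - q))) * (100 * \<bar>D\<bar>)"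
  proof -
    have "q * (1 - q) \<le> 1 / 4" using mult_const_minus_self_real_le[of q 1] by simp
    moreover have "0 < q * (1 - q)" using q by simp
    ultimately have "2 \<le> 1 / (2 * (q * (1 - q)))" by (simp add: field_simps)
    then have "D\<^sup>2 * 2 * (100 * \<bar>D\<bar>) \<le> D\<^sup>2 * (1 / (2 * (q * (1 - q)))) * (100 * \<bar>D\<bar>)"
      by (intro mult_right_mono mult_left_mono) auto
    moreover have "\<bar>D\<bar> ^ 3 = D\<^sup>2 * \<bar>D\<bar>"
      by (simp add: power3_eq_cube power2_eq_square)
    moreover have "0 \<le> D\<^sup>2 * \<bar>D\<bar>" by simp
    ultimately have "16 * \<bar>D\<bar> ^ 3 \<le> D\<^sup>2 * (1 / (2 * (q * (1 - q)))) * (100 * \<bar>D\<bar>)" by linarith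
    then show ?thesis by simp
  qed
  moreover have "D\<^sup>2 / (2 * (q * (1 - q))) * (1 + 100 * \<bar>D\<bar>)
      = D\<^sup>2 / (2 * (q * (1 - q))) + D\<^sup>2 / (2 * (q * (1 - q))) * (100 * \<bar>D\<bar>)"
    by (simp only: distrib_left mult_1_right)
  ultimately show ?thesis by linarith
qed

text \<open>A change of measure: the binomial law with success probability \<open>k / n\<close> gives \<open>k\<close> at least the mass
  \<open>1 / (n + 1)\<close>, and passing to success probability \<open>q\<close> costs \<open>n\<close> times the relative entropy.\<close>

lemma binomial_pmf_lower:
  fixes n k :: nat and q D :: real
  assumes q: "1 / 4 \<le> q" "q \<le> 3 / 4" and n: "0 < n" and D: "D = real k / real n - q" "\<bar>D\<bar> \<le> 1 / 8"
  shows "exp (- real n * (D\<^sup>2 / (2 * (q * (1 - q))) * (1 + 100 * \<bar>D\<bar>))) / (real n + 1)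
     \<le> real (n choose k) * q ^ k * (1 - q) ^ (n - k)"
proof -
  define r where "r = real k / real n"
  have rD: "r = q + D" using D by (simp add: r_def)
  have r: "0 < r" "r < 1" using D(2) q unfolding rD by (auto simp: abs_le_iff)
  then have k: "0 < k" "k < n" using n unfolding r_def by (auto intro!: gr0I)
  define K where "K = r * ln (r / q) + (1 - r) * ln ((1 - r) / (1 - q))"
  have K: "K \<le> D\<^sup>2 / (2 * (q * (1 - q))) * (1 + 100 * \<bar>D\<bar>)"
    using kl_le[OF q D(2)] by (simp add: K_def rD algebra_simps)
  have "real n * K = real k * ln (r / q) + real (n - k) * ln ((1 - r) / (1 - q))"
    using n k by (simp add: K_def r_def field_simps of_nat_diff)
  then have "exp (- real n * K) = exp (- (real k * ln (r / q))) * exp (- (real (n - k) * ln ((1 - r) / (1 - q))))"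
    by (simp add: exp_add[symmetric])
  also have "exp (- (real k * ln (r / q))) = (q / r) ^ k"
    using r q by (simp add: exp_minus exp_of_nat_mult power_inverse[symmetric])
  also have "exp (- (real (n - k) * ln ((1 - r) / (1 - q)))) = ((1 - q) / (1 - r)) ^ (n - k)"
    using r q by (simp add: exp_minus exp_of_nat_mult power_inverse[symmetric])
  finally have eK: "exp (- real n * K) = (q / r) ^ k * ((1 - q) / (1 - r)) ^ (n - k)"
    by simp
  have e: "exp (- real n * K) * (r ^ k * (1 - r) ^ (n - k)) = q ^ k * (1 - q) ^ (n - k)"
    unfolding eK using r by (simp add: power_divide)
  have "exp (- real n * (D\<^sup>2 / (2 * (q * (1 - q))) * (1 + 100 * \<bar>D\<bar>))) \<le> exp (- real n * K)"
    using mult_left_mono[OF K, of "real n"] by simp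
  then have "exp (- real n * (D\<^sup>2 / (2 * (q * (1 - q))) * (1 + 100 * \<bar>D\<bar>))) / (real n + 1)
    \<le> exp (- real n * K) * (1 / (real n + 1))"
    by (simp add: divide_right_mono)
  also have "\<dots> \<le> exp (- real n * K) * (real (n choose k) * r ^ k * (1 - r) ^ (n - k))"
    using binomial_mode[of k n] k by (intro mult_left_mono) (auto simp: r_def)
  also have "\<dots> = real (n choose k) * (exp (- real n * K) * (r ^ k * (1 - r) ^ (n - k)))"
    by (simp add: mult_ac)
  also have "\<dots> = real (n choose k) * q ^ k * (1 - q) ^ (n - k)"
    unfolding e by (rule mult.assoc[symmetric])
  finally show ?thesis .
qed

section \<open>Ranks\<close>

text \<open>In a pooled sample of size \<open>N\<close> whose first \<open>a\<close> elements form the first sample, \<open>x_low\<close> and \<open>y_low\<close> count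
  the elements of each sample among the \<open>k\<close> smallest. The linear rank statistics depend on the data
  only through these counts.\<close>

definition x_low :: "nat \<Rightarrow> (nat \<Rightarrow> real) \<Rightarrow> nat \<Rightarrow> nat \<Rightarrow> nat" where
  "x_low a z N k = card {i. i < a \<and> rank_in N z i \<le> k}"

definition y_low :: "nat \<Rightarrow> (nat \<Rightarrow> real) \<Rightarrow> nat \<Rightarrow> nat \<Rightarrow> nat" where
  "y_low a z N k = card {i. a \<le> i \<and> i < N \<and> rank_in N z i \<le> k}"

lemma rank_in_less:
  assumes "j < N" "z i < z j"
  shows "rank_in N z i < rank_in N z j"
proof -
  have "j \<in> {l. l < N \<and> z l \<le> z j} - {l. l < N \<and> z l \<le> z i}" using assms by simp
  moreover have "{l. l < N \<and> z l \<le> z i} \<subseteq> {l. l < N \<and> z l \<le> z j}" using assms(2) by auto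
  ultimately have "{l. l < N \<and> z l \<le> z i} \<subset> {l. l < N \<and> z l \<le> z j}" by blast
  then show ?thesis
    unfolding rank_in_def by (rule psubset_card_mono[rotated]) simp
qed

lemma bij_betw_rank_in:
  assumes "inj_on z {..<N}"
  shows "bij_betw (rank_in N z) {..<N} {1..N}"
proof -
  have inj: "inj_on (rank_in N z) {..<N}"
  proof (rule inj_onI, rule ccontr)
    fix i j assume ij: "i \<in> {..<N}" "j \<in> {..<N}" "rank_in N z i = rank_in N z j" "i \<noteq> j"
    then have "z i \<noteq> z j" using assms by (auto dest: inj_onD)
    then show False
      using ij rank_in_less[of i N z j] rank_in_less[of j N z i] by (auto simp: neq_iff)
  qed
  have "rank_in N z i \<in> {1..N}" if "i < N" for i
  proof -
    have "card {j. j < N \<and> z j \<le> z i} \<le> card {..<N}" by (rule card_mono) auto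
    moreover have "0 < card {j. j < N \<and> z j \<le> z i}"
      unfolding card_gt_0_iff using that by auto
    ultimately show ?thesis by (simp add: rank_in_def)
  qed
  then have "rank_in N z ` {..<N} \<subseteq> {1..N}" by auto
  moreover have "card (rank_in N z ` {..<N}) = card {1..N}"
    using inj by (simp add: card_image)
  ultimately have "rank_in N z ` {..<N} = {1..N}" by (intro card_subset_eq) auto
  with inj show ?thesis by (simp add: bij_betw_def)
qed

lemma card_rank_le:
  assumes "inj_on z {..<N}" "k \<le> N"
  shows "card {i. i < N \<and> rank_in N z i \<le> k} = k"
proof -
  have "bij_betw (rank_in N z) {i. i < N \<and> rank_in N z i \<le> k} {1..k}"
  proof (rule bij_betw_subset[OF bij_betw_rank_in[OF assms(1)]])
    have im: "rank_in N z ` {..<N} = {1..N}"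
      using bij_betw_rank_in[OF assms(1)] by (simp add: bij_betw_def)
    show "rank_in N z ` {i. i < N \<and> rank_in N z i \<le> k} = {1..k}"
    proof
      show "rank_in N z ` {i. i < N \<and> rank_in N z i \<le> k} \<subseteq> {1..k}" using im by force
      show "{1..k} \<subseteq> rank_in N z ` {i. i < N \<and> rank_in N z i \<le> k}"
      proof
        fix r assume r: "r \<in> {1..k}"
        then have "r \<in> rank_in N z ` {..<N}" using im assms(2) by auto
        then show "r \<in> rank_in N z ` {i. i < N \<and> rank_in N z i \<le> k}" using r by auto
      qed
    qed
  qed auto
  then show ?thesis by (simp add: bij_betw_same_card)
qed

lemma x_low_add_y_low:
  assumes "inj_on z {..<N}" "k \<le> N" "a \<le> N"
  shows "x_low a z N k + y_low a z N k = k"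
proof -
  have "{i. i < N \<and> rank_in N z i \<le> k} =
      {i. i < a \<and> rank_in N z i \<le> k} \<union> {i. a \<le> i \<and> i < N \<and> rank_in N z i \<le> k}"
    using assms(3) by auto
  moreover have "card ({i. i < a \<and> rank_in N z i \<le> k} \<union> {i. a \<le> i \<and> i < N \<and> rank_in N z i \<le> k})
      = x_low a z N k + y_low a z N k"
    unfolding x_low_def y_low_def by (rule card_Un_disjoint) auto
  ultimately have "card {i. i < N \<and> rank_in N z i \<le> k} = x_low a z N k + y_low a z N k"
    by simp
  then show ?thesis using card_rank_le[OF assms(1,2)] by simp
qed

text \<open>Observations up to \<open>t\<close> have ranks at most their number; so counts below a fixed threshold, which are
  sums of independent indicators, bound the rank counts from either side.\<close>

lemma y_low_ge_count:
  assumes "card {i. i < N \<and> z i \<le> t} \<le> k" "a \<le> N"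
  shows "card {i. a \<le> i \<and> i < N \<and> z i \<le> t} \<le> y_low a z N k"
    and "card {i. i < a \<and> z i \<le> t} \<le> x_low a z N k"
proof -
  have "rank_in N z i \<le> k" if "i < N" "z i \<le> t" for i
  proof -
    have "rank_in N z i \<le> card {i. i < N \<and> z i \<le> t}"
      unfolding rank_in_def by (rule card_mono) (use that in auto)
    with assms show ?thesis by simp
  qed
  with assms(2) show "card {i. a \<le> i \<and> i < N \<and> z i \<le> t} \<le> y_low a z N k"
    and "card {i. i < a \<and> z i \<le> t} \<le> x_low a z N k"
    unfolding y_low_def x_low_def by (auto intro!: card_mono)
qed

lemma y_low_le_count:
  assumes "k \<le> card {i. i < N \<and> z i \<le> t}" "a \<le> N"
  shows "y_low a z N k \<le> card {i. a \<le> i \<and> i < N \<and> z i \<le> t}"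
    and "x_low a z N k \<le> card {i. i < a \<and> z i \<le> t}"
proof -
  have "z i \<le> t" if "i < N" "rank_in N z i \<le> k" for i
  proof (rule ccontr)
    assume "\<not> z i \<le> t"
    then have "card {i. i < N \<and> z i \<le> t} < rank_in N z i"
      unfolding rank_in_def by (intro psubset_card_mono) (use that in auto)
    with that assms show False by simp
  qed
  with assms(2) show "y_low a z N k \<le> card {i. a \<le> i \<and> i < N \<and> z i \<le> t}"
    and "x_low a z N k \<le> card {i. i < a \<and> z i \<le> t}"
    unfolding y_low_def x_low_def by (auto intro!: card_mono)
qed

text \<open>Moving the second sample down relative to the first can only put more of it among the
  \<open>k\<close> smallest observations.\<close>

lemma y_low_mono:
  assumes inj: "inj_on z {..<N}" "inj_on z' {..<N}" and k: "k \<le> N" "a \<le> N"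
    and order: "\<And>i j. \<lbrakk>j < a; a \<le> i; i < N; z' j < z' i\<rbrakk> \<Longrightarrow> z j < z i"
  shows "y_low a z N k \<le> y_low a z' N k"
proof (rule ccontr)
  assume less: "\<not> y_low a z N k \<le> y_low a z' N k"
  then have "x_low a z N k < x_low a z' N k"
    using x_low_add_y_low[OF inj(1) k] x_low_add_y_low[OF inj(2) k] by simp
  then have less': "\<not> x_low a z' N k \<le> x_low a z N k" by simp
  have fin': "finite {i. i < a \<and> rank_in N z i \<le> k}" by simp
  have "\<not> {i. i < a \<and> rank_in N z' i \<le> k} \<subseteq> {i. i < a \<and> rank_in N z i \<le> k}"
    using less' card_mono[OF fin'] unfolding x_low_def by blast
  then obtain j where j: "j < a" "rank_in N z' j \<le> k" "k < rank_in N z j"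
    by (force simp: subset_iff not_le)
  have fin: "finite {i. a \<le> i \<and> i < N \<and> rank_in N z' i \<le> k}" by simp
  have "\<not> {i. a \<le> i \<and> i < N \<and> rank_in N z i \<le> k} \<subseteq> {i. a \<le> i \<and> i < N \<and> rank_in N z' i \<le> k}"
    using less card_mono[OF fin] unfolding y_low_def by blast
  then obtain i where i: "a \<le> i" "i < N" "rank_in N z i \<le> k" "k < rank_in N z' i"
    by (force simp: subset_iff not_le)
  have "z' j < z' i"
  proof (rule ccontr)
    assume "\<not> z' j < z' i"
    then have "{l. l < N \<and> z' l \<le> z' i} \<subseteq> {l. l < N \<and> z' l \<le> z' j}" by auto
    then have "rank_in N z' i \<le> rank_in N z' j" unfolding rank_in_def by (rule card_mono[rotated]) simp
    with i j show False by simp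
  qed
  then have "z j < z i" using order i j by blast
  then have "rank_in N z j < rank_in N z i" using i rank_in_less by blast
  with i j show False by simp
qed

text \<open>Exchanging a low observation of the first sample with a high observation of the second one
  raises \<open>y_low\<close> by exactly one at every level in between, whatever the exact values are.\<close>

lemma y_low_swap:
  assumes x: "x < a" and y: "a \<le> y" "y < N" and st: "s \<le> t"
    and z: "z x \<le> s" "t < z y" and z': "t < z' x" "z' y \<le> s"
    and eq: "\<And>i. i \<noteq> x \<Longrightarrow> i \<noteq> y \<Longrightarrow> z' i = z i"
    and lo: "card {i. i < N \<and> i \<noteq> x \<and> i \<noteq> y \<and> z i \<le> s} < k"
    and hi: "k \<le> card {i. i < N \<and> i \<noteq> x \<and> i \<noteq> y \<and> z i \<le> t}"
  shows "y_low a z' N k = Suc (y_low a z N k)"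
proof -
  define rest where "rest = {i. i < N \<and> i \<noteq> x \<and> i \<noteq> y}"
  have xN: "x < N" and xy: "x \<noteq> y" using x y by auto
  have fin[simp]: "finite rest" by (simp add: rest_def)
  have xr[simp]: "x \<notin> rest" "y \<notin> rest" by (auto simp: rest_def)
  define c where "c u = card {i\<in>rest. z i \<le> u}" for u
  have rank: "rank_in N w i = card {j\<in>rest. w j \<le> w i} + of_bool (w x \<le> w i) + of_bool (w y \<le> w i)" for w i
  proof -
    have "{j. j < N \<and> w j \<le> w i} = {j\<in>rest. w j \<le> w i} \<union> {j\<in>{x}. w x \<le> w i} \<union> {j\<in>{y}. w y \<le> w i}"
      using xN y by (auto simp: rest_def)
    moreover have "card ({j\<in>rest. w j \<le> w i} \<union> {j\<in>{x}. w x \<le> w i} \<union> {j\<in>{y}. w y \<le> w i})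
      = card ({j\<in>rest. w j \<le> w i} \<union> {j\<in>{x}. w x \<le> w i}) + card {j\<in>{y}. w y \<le> w i}"
      by (rule card_Un_disjoint) (use xy xr in auto)
    moreover have "card ({j\<in>rest. w j \<le> w i} \<union> {j\<in>{x}. w x \<le> w i})
      = card {j\<in>rest. w j \<le> w i} + card {j\<in>{x}. w x \<le> w i}"
      by (rule card_Un_disjoint) (use xr in auto)
    moreover have "card {j\<in>{u}. w u \<le> w i} = of_bool (w u \<le> w i)" for u
      by (cases "w u \<le> w i") (auto simp: conj_commute cong: conj_cong)
    ultimately show ?thesis by (simp only: rank_in_def)
  qed
  have c': "card {j\<in>rest. z' j \<le> u} = c u" for u
    unfolding c_def by (rule arg_cong[where f=card]) (auto simp: rest_def eq)
  have mono: "c u \<le> c v" if "u \<le> v" for u v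
    unfolding c_def by (rule card_mono) (use that in auto)
  have cs: "c s < k" and ct: "k \<le> c t"
    using lo hi by (auto simp: c_def rest_def conj_ac cong: conj_cong)
  have zx: "rank_in N z x \<le> k"
    using rank[of z x] mono[OF z(1)] cs z st by (auto simp: c_def[symmetric] of_bool_def)
  have zy: "k < rank_in N z y"
    using rank[of z y] mono[of t "z y"] ct z by (auto simp: c_def[symmetric] of_bool_def)
  have z'x: "k < rank_in N z' x"
    using rank[of z' x] mono[of t "z' x"] ct z' by (auto simp: c' of_bool_def)
  have z'y: "rank_in N z' y \<le> k"
    using rank[of z' y] mono[OF z'(2)] cs z' st by (auto simp: c' of_bool_def)
  have same: "rank_in N z i \<le> k \<longleftrightarrow> rank_in N z' i \<le> k" if i: "i \<in> rest" for i
  proof -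
    have zi: "z' i = z i" using i eq by (auto simp: rest_def)
    consider "z i \<le> s" | "s < z i" "z i \<le> t" | "t < z i" by linarith
    then show ?thesis
    proof cases
      case 1
      then show ?thesis
        using rank[of z i] rank[of z' i] mono[OF 1] cs z z' st
        by (auto simp: c' zi c_def[symmetric] of_bool_def)
    next
      case 2
      then show ?thesis
        using rank[of z i] rank[of z' i] z z'
        by (auto simp: c' zi c_def[symmetric] of_bool_def)
    next
      case 3
      have "{l\<in>rest. z l \<le> t} \<subseteq> {l\<in>rest. z l \<le> z i}" using 3 by auto
      moreover have "i \<in> {l\<in>rest. z l \<le> z i} - {l\<in>rest. z l \<le> t}" using 3 i by simp
      ultimately have "{l\<in>rest. z l \<le> t} \<subset> {l\<in>rest. z l \<le> z i}" by blast
      then have "c t < c (z i)"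
        unfolding c_def by (rule psubset_card_mono[rotated]) simp
      then show ?thesis
        using rank[of z i] rank[of z' i] ct by (auto simp: c' zi c_def[symmetric])
    qed
  qed
  have "{i. a \<le> i \<and> i < N \<and> rank_in N z' i \<le> k} = insert y {i. a \<le> i \<and> i < N \<and> rank_in N z i \<le> k}"
  proof (rule set_eqI)
    fix i
    show "i \<in> {i. a \<le> i \<and> i < N \<and> rank_in N z' i \<le> k}
      \<longleftrightarrow> i \<in> insert y {i. a \<le> i \<and> i < N \<and> rank_in N z i \<le> k}"
      using same[of i] y z'y x by (cases "i = y"; cases "i = x") (auto simp: rest_def)
  qed
  moreover have "y \<notin> {i. a \<le> i \<and> i < N \<and> rank_in N z i \<le> k}" using zy by auto
  ultimately show ?thesis by (simp add: y_low_def)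
qed

section \<open>The rank statistics as functions of counts\<close>

text \<open>The number of ranks \<open>r\<close> with \<open>(r - 1 / 2) / N < p\<close>, see \<open>rank_below_level_iff\<close>.\<close>

definition level :: "nat \<Rightarrow> real \<Rightarrow> nat" where
  "level N p = nat \<lceil>real N * p - 1 / 2\<rceil>"

lemma level_bounds:
  assumes "0 < p" "p < 1"
  shows "\<bar>real (level N p) - real N * p\<bar> \<le> 1 / 2" "level N p \<le> N"
proof -
  have "0 \<le> \<lceil>real N * p - 1 / 2\<rceil>" 
    using assms mult_nonneg_nonneg[of "real N" p] by linarith
  then have "real (level N p) = of_int \<lceil>real N * p - 1 / 2\<rceil>"
    by (simp add: level_def)
  then show *: "\<bar>real (level N p) - real N * p\<bar> \<le> 1 / 2" by linarith
  have "real N * p \<le> real N" using assms by (simp add: mult_left_le)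
  then have "real (level N p) < real N + 1" using * by linarith
  then show "level N p \<le> N" by linarith
qed

lemma rank_below_level_iff:
  assumes "0 < p" "0 < N"
  shows "(real r - 1 / 2) / real N < p \<longleftrightarrow> r \<le> level N p"
proof -
  have *: "0 \<le> \<lceil>real N * p - 1 / 2\<rceil>"
    using assms mult_nonneg_nonneg[of "real N" p] by linarith
  have "(real r - 1 / 2) / real N < p \<longleftrightarrow> real r - 1 / 2 < real N * p"
    using assms by (simp add: field_simps)
  also have "\<dots> \<longleftrightarrow> int r \<le> \<lceil>real N * p - 1 / 2\<rceil>" by linarith
  also have "\<dots> \<longleftrightarrow> r \<le> level N p" using * by (simp add: level_def nat_le_iff le_nat_iff)
  finally show ?thesis .
qed

text \<open>The linear rank statistic with score \<open>\<ell>\<^sub>j\<close>, up to sign, as a standardised surplus of the second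
  sample among the smallest observations.\<close>

definition T_of_counts :: "nat \<Rightarrow> nat \<Rightarrow> real \<Rightarrow> (nat \<Rightarrow> real) \<Rightarrow> real" where
  "T_of_counts a b p z =
     (real (y_low a z (a + b) (level (a + b) p)) - real b * real (level (a + b) p) / real (a + b))
     / (sqrt (real a * real b / real (a + b)) * sqrt (p * (1 - p)))"

text \<open>The score takes two values, so the linear rank statistic is an affine function of the number of
  second-sample ranks below the level. Without ties exactly \<open>level\<close> ranks lie below it, and this
  eliminates the first sample.\<close>

lemma L_stat_eq_counts:
  assumes "0 < a" "0 < b" "0 < p" "p < 1" and inj: "inj_on (pooled a \<omega>) {..<a + b}"
  shows "- L_stat a b p \<omega> = T_of_counts a b p (pooled a \<omega>)"
proof -
  define N z k where "N = a + b" and "z = pooled a \<omega>" and "k = level N p"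
  define \<sigma> where "\<sigma> = sqrt (real a * real b / real N)"
  define q where "q = sqrt (p * (1 - p))"
  have N: "0 < N" and pos: "0 < \<sigma>" "0 < q" using assms by (auto simp: N_def \<sigma>_def q_def)
  have sq: "sqrt (p / (1 - p)) = p / q" "sqrt ((1 - p) / p) = (1 - p) / q"
  proof -
    have "q\<^sup>2 = p * (1 - p)" using assms by (simp add: q_def)
    then have "(p / q)\<^sup>2 = p / (1 - p)" "((1 - p) / q)\<^sup>2 = (1 - p) / p"
      using assms by (simp_all add: power_divide, simp_all add: power2_eq_square)
    then show "sqrt (p / (1 - p)) = p / q" "sqrt ((1 - p) / p) = (1 - p) / q"
      using assms pos by (auto intro: real_sqrt_unique)
  qed
  have sc: "score p ((real r - 1 / 2) / real N) = p / q - of_bool (r \<le> k) / q" for r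
  proof -
    have "score p ((real r - 1 / 2) / real N) = (if r \<le> k then - ((1 - p) / q) else p / q)"
      unfolding score_def sq rank_below_level_iff[OF \<open>0 < p\<close> N] k_def ..
    then show ?thesis by (simp add: diff_divide_distrib)
  qed
  have split: "(\<Sum>i<N. reg_const a b i * f i)
      = \<sigma> / real b * (\<Sum>i\<in>{a..<N}. f i) - \<sigma> / real a * (\<Sum>i<a. f i)" for f
  proof -
    have "(\<Sum>i<N. reg_const a b i * f i) = (\<Sum>i<a. reg_const a b i * f i) + (\<Sum>i\<in>{a..<N}. reg_const a b i * f i)"
      using sum.atLeastLessThan_concat[of 0 a N "\<lambda>i. reg_const a b i * f i"]
      by (simp add: N_def lessThan_atLeast0)
    also have "(\<Sum>i<a. reg_const a b i * f i) = - (\<sigma> / real a) * (\<Sum>i<a. f i)"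
      unfolding sum_distrib_left by (intro sum.cong) (auto simp: reg_const_def \<sigma>_def N_def Let_def)
    also have "(\<Sum>i\<in>{a..<N}. reg_const a b i * f i) = \<sigma> / real b * (\<Sum>i\<in>{a..<N}. f i)"
      unfolding sum_distrib_left by (intro sum.cong) (auto simp: reg_const_def \<sigma>_def N_def Let_def)
    finally show ?thesis by simp
  qed
  have "L_stat a b p \<omega> = (\<Sum>i<N. reg_const a b i * (p / q - of_bool (rank_in N z i \<le> k) / q))"
    by (simp add: L_stat_def sc[symmetric] N_def z_def)
  also have "\<dots> = \<sigma> / real b * (\<Sum>i\<in>{a..<N}. p / q - of_bool (rank_in N z i \<le> k) / q)
      - \<sigma> / real a * (\<Sum>i<a. p / q - of_bool (rank_in N z i \<le> k) / q)"
    by (rule split)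
  also have "(\<Sum>i\<in>{a..<N}. p / q - of_bool (rank_in N z i \<le> k) / q)
      = real b * p / q - real (y_low a z N k) / q"
    by (simp add: sum_subtractf sum_divide_distrib[symmetric] y_low_def N_def sum.If_cases of_bool_def
        Int_def conj_ac)
  also have "(\<Sum>i<a. p / q - of_bool (rank_in N z i \<le> k) / q) = real a * p / q - real (x_low a z N k) / q"
    by (simp add: sum_subtractf sum_divide_distrib[symmetric] x_low_def sum.If_cases of_bool_def
        Int_def conj_ac)
  also have "\<sigma> / real b * (real b * p / q - real (y_low a z N k) / q)
      - \<sigma> / real a * (real a * p / q - real (x_low a z N k) / q)
      = - (\<sigma> / q) * (real (y_low a z N k) / real b - real (x_low a z N k) / real a)"
    using assms pos by (simp add: field_simps)
  also have "real (x_low a z N k) = real k - real (y_low a z N k)"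
    using x_low_add_y_low[of z N k a] inj level_bounds[OF assms(3,4), of N]
    by (simp add: N_def z_def k_def)
  also have "real (y_low a z N k) / real b - (real k - real (y_low a z N k)) / real a
      = (real (y_low a z N k) - real b * real k / real N) / \<sigma>\<^sup>2"
  proof -
    have alg: "Y / B - (K - Y) / A = (Y - B * K / (A + B)) / (A * B / (A + B))"
      if "0 < A" "0 < B" for A B K Y :: real
    proof -
      have "(Y - B * K / (A + B)) / (A * B / (A + B)) = ((Y - B * K / (A + B)) * (A + B)) / (A * B)"
        by simp
      also have "(Y - B * K / (A + B)) * (A + B) = Y * (A + B) - B * K"
        using that by (simp add: left_diff_distrib)
      also have "(Y * (A + B) - B * K) / (A * B) = Y / B - (K - Y) / A"
        using that by (simp add: field_simps)
      finally show ?thesis ..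
    qed
    show ?thesis using alg[of "real a" "real b"] assms by (simp add: \<sigma>_def N_def)
  qed
  finally have L: "L_stat a b p \<omega> = - (\<sigma> / q) * ((real (y_low a z N k) - real b * real k / real N) / \<sigma>\<^sup>2)" .
  have alg: "- (- (s / r) * (D / s\<^sup>2)) = D / (s * r)" if "0 < s" "0 < r" for s r D :: real
    using that by (simp add: power2_eq_square field_simps)
  have T: "T_of_counts a b p (pooled a \<omega>) = (real (y_low a z N k) - real b * real k / real N) / (\<sigma> * q)"
    by (simp only: T_of_counts_def N_def z_def k_def \<sigma>_def q_def)
  show ?thesis unfolding L T by (rule alg[OF pos])
qed

section \<open>The pooled sample\<close>

definition split_at :: "nat \<Rightarrow> (nat \<Rightarrow> real) \<Rightarrow> samples" where
  "split_at a z = (z, \<lambda>i. z (a + i))"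

text \<open>One product measure on the pooled index set replaces the pair of product measures, so that all
  observations are coordinates of a single random vector.\<close>

definition pooled_law :: "nat \<Rightarrow> nat \<Rightarrow> real measure \<Rightarrow> real measure \<Rightarrow> (nat \<Rightarrow> real) measure" where
  "pooled_law a b P Q = Pi\<^sub>M {..<a + b} (\<lambda>i. if i < a then P else Q)"

lemma real_product_pooled:
  "real_distribution P \<Longrightarrow> real_distribution Q \<Longrightarrow> real_product (\<lambda>i. if i < a then P else Q)"
  by (rule real_product.intro) simp

lemma pooled_split_at[simp]: "pooled a (split_at a z) = z"
  by (auto simp: pooled_def split_at_def fun_eq_iff)

lemma sets_pooled_law:
  assumes "real_distribution P" "real_distribution Q"
  shows "sets (pooled_law a b P Q) = sets (Pi\<^sub>M {..<a + b} (\<lambda>_. borel))"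
    and "space (pooled_law a b P Q) = space (Pi\<^sub>M {..<a + b} (\<lambda>_. borel))"
proof -
  interpret real_product "a + b" "\<lambda>i. if i < a then P else Q"
    using assms by (rule real_product_pooled)
  show "sets (pooled_law a b P Q) = sets (Pi\<^sub>M {..<a + b} (\<lambda>_. borel))"
    unfolding pooled_law_def by (rule sets_\<Omega>)
  then show "space (pooled_law a b P Q) = space (Pi\<^sub>M {..<a + b} (\<lambda>_. borel))"
    by (rule sets_eq_imp_space_eq)
qed

text \<open>Both sides agree on boxes, which generate the product algebra.\<close>

lemma distr_two_sample_law:
  fixes a b :: nat
  assumes P: "real_distribution P" and Q: "real_distribution Q"
  defines "f \<equiv> \<lambda>\<omega>. restrict (pooled a \<omega>) {..<a + b}"
  shows "f \<in> two_sample_law a b P Q \<rightarrow>\<^sub>M Pi\<^sub>M {..<a + b} (\<lambda>_. borel)"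
    and "distr (two_sample_law a b P Q) (Pi\<^sub>M {..<a + b} (\<lambda>_. borel)) f = pooled_law a b P Q"
proof -
  interpret R: real_product "a + b" "\<lambda>i. if i < a then P else Q"
    using assms by (intro real_product_pooled)
  interpret X: real_product a "\<lambda>_. P" by (rule real_product.intro) (rule P)
  interpret Y: real_product b "\<lambda>_. Q" by (rule real_product.intro) (rule Q)
  have [simp, measurable_cong]: "sets P = sets borel" "sets Q = sets borel"
    using P Q by (auto simp: real_distribution.events_eq_borel)
  have [simp]: "space P = UNIV" "space Q = UNIV"
    using P Q by (auto simp: real_distribution.space_eq_univ)
  show meas: "f \<in> two_sample_law a b P Q \<rightarrow>\<^sub>M Pi\<^sub>M {..<a + b} (\<lambda>_. borel)"
    unfolding f_def
  proof (rule measurable_restrict)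
    fix i assume i: "i \<in> {..<a + b}"
    show "(\<lambda>\<omega>. pooled a \<omega> i) \<in> borel_measurable (two_sample_law a b P Q)"
    proof (cases "i < a")
      case True
      then have "(\<lambda>x. x i) \<in> Pi\<^sub>M {..<a} (\<lambda>_. P) \<rightarrow>\<^sub>M P"
        by (intro measurable_component_singleton) simp
      then have [measurable]: "(\<lambda>x. x i) \<in> borel_measurable (Pi\<^sub>M {..<a} (\<lambda>_. P))"
        by (simp cong: measurable_cong_sets)
      have "(\<lambda>\<omega>. fst \<omega> i) \<in> borel_measurable (two_sample_law a b P Q)"
        unfolding two_sample_law_def by measurable
      with True show ?thesis by (simp add: pooled_def case_prod_beta)
    next
      case False
      then have "(\<lambda>y. y (i - a)) \<in> Pi\<^sub>M {..<b} (\<lambda>_. Q) \<rightarrow>\<^sub>M Q"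
        using i by (intro measurable_component_singleton) auto
      then have [measurable]: "(\<lambda>y. y (i - a)) \<in> borel_measurable (Pi\<^sub>M {..<b} (\<lambda>_. Q))"
        by (simp cong: measurable_cong_sets)
      have "(\<lambda>\<omega>. snd \<omega> (i - a)) \<in> borel_measurable (two_sample_law a b P Q)"
        unfolding two_sample_law_def by measurable
      with False show ?thesis by (simp add: pooled_def case_prod_beta)
    qed
  qed
  show "distr (two_sample_law a b P Q) (Pi\<^sub>M {..<a + b} (\<lambda>_. borel)) f = pooled_law a b P Q"
    unfolding pooled_law_def
  proof (rule R.PiM_eqI)
    fix A :: "nat \<Rightarrow> real set"
    assume A: "\<And>i. i \<in> {..<a + b} \<Longrightarrow> A i \<in> sets (if i < a then P else Q)"
    then have A': "A i \<in> sets borel" if "i < a + b" for i using that by (auto split: if_splits)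
    have "emeasure (distr (two_sample_law a b P Q) (Pi\<^sub>M {..<a + b} (\<lambda>_. borel)) f) (Pi\<^sub>E {..<a + b} A)
        = emeasure (two_sample_law a b P Q) (f -` Pi\<^sub>E {..<a + b} A \<inter> space (two_sample_law a b P Q))"
      using A' by (intro emeasure_distr meas sets_PiM_I_finite) auto
    also have "f -` Pi\<^sub>E {..<a + b} A \<inter> space (two_sample_law a b P Q)
        = Pi\<^sub>E {..<a} A \<times> Pi\<^sub>E {..<b} (\<lambda>i. A (a + i))"
    proof (rule set_eqI, rule iffI)
      fix \<omega> assume "\<omega> \<in> f -` Pi\<^sub>E {..<a + b} A \<inter> space (two_sample_law a b P Q)"
      then obtain x y where \<omega>: "\<omega> = (x, y)" "x \<in> extensional {..<a}" "y \<in> extensional {..<b}"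
        and all: "\<And>i. i < a + b \<Longrightarrow> pooled a (x, y) i \<in> A i"
        by (cases \<omega>) (auto simp: two_sample_law_def space_pair_measure space_PiM f_def PiE_iff)
      have "x i \<in> A i" if "i < a" for i using all[of i] that by (simp add: pooled_def)
      moreover have "y i \<in> A (a + i)" if "i < b" for i using all[of "a + i"] that by (simp add: pooled_def)
      ultimately show "\<omega> \<in> Pi\<^sub>E {..<a} A \<times> Pi\<^sub>E {..<b} (\<lambda>i. A (a + i))"
        using \<omega> by (auto simp: PiE_iff)
    next
      fix \<omega> assume "\<omega> \<in> Pi\<^sub>E {..<a} A \<times> Pi\<^sub>E {..<b} (\<lambda>i. A (a + i))"
      then obtain x y where \<omega>: "\<omega> = (x, y)" "x \<in> extensional {..<a}" "y \<in> extensional {..<b}"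
        and x: "\<And>i. i < a \<Longrightarrow> x i \<in> A i" and y: "\<And>i. i < b \<Longrightarrow> y i \<in> A (a + i)"
        by (cases \<omega>) (auto simp: PiE_iff)
      have "pooled a (x, y) i \<in> A i" if "i < a + b" for i
        using x[of i] y[of "i - a"] that by (auto simp: pooled_def)
      then show "\<omega> \<in> f -` Pi\<^sub>E {..<a + b} A \<inter> space (two_sample_law a b P Q)"
        using \<omega> by (auto simp: two_sample_law_def space_pair_measure space_PiM f_def PiE_iff)
    qed
    also have "emeasure (two_sample_law a b P Q) (Pi\<^sub>E {..<a} A \<times> Pi\<^sub>E {..<b} (\<lambda>i. A (a + i)))
        = (\<Prod>i<a. emeasure P (A i)) * (\<Prod>i<b. emeasure Q (A (a + i)))"
    proof -
      have "emeasure (Pi\<^sub>M {..<a} (\<lambda>_. P)) (Pi\<^sub>E {..<a} A) = (\<Prod>i<a. emeasure P (A i))"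
        using A' by (intro X.emeasure_PiM) auto
      moreover have "emeasure (Pi\<^sub>M {..<b} (\<lambda>_. Q)) (Pi\<^sub>E {..<b} (\<lambda>i. A (a + i))) = (\<Prod>i<b. emeasure Q (A (a + i)))"
        using A' by (intro Y.emeasure_PiM) auto
      moreover have "Pi\<^sub>E {..<a} A \<in> sets (Pi\<^sub>M {..<a} (\<lambda>_. P))"
        "Pi\<^sub>E {..<b} (\<lambda>i. A (a + i)) \<in> sets (Pi\<^sub>M {..<b} (\<lambda>_. Q))"
        using A' by (auto intro!: sets_PiM_I_finite)
      ultimately show ?thesis
        unfolding two_sample_law_def by (simp add: Y.P.emeasure_pair_measure_Times)
    qed
    also have "(\<Prod>i<b. emeasure Q (A (a + i))) = (\<Prod>i\<in>{a..<a + b}. emeasure Q (A i))"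
      using prod.shift_bounds_nat_ivl[of "\<lambda>i. emeasure Q (A i)" 0 a b]
      by (simp add: lessThan_atLeast0 add.commute)
    also have "(\<Prod>i<a. emeasure P (A i)) * (\<Prod>i\<in>{a..<a + b}. emeasure Q (A i))
        = (\<Prod>i\<in>{..<a + b}. emeasure (if i < a then P else Q) (A i))"
    proof -
      have un: "{..<a + b} = {..<a} \<union> {a..<a + b}" by auto
      have "(\<Prod>i\<in>{..<a + b}. emeasure (if i < a then P else Q) (A i))
        = (\<Prod>i\<in>{..<a}. emeasure (if i < a then P else Q) (A i))
          * (\<Prod>i\<in>{a..<a + b}. emeasure (if i < a then P else Q) (A i))"
        unfolding un by (rule prod.union_disjoint) auto
      then show ?thesis by simp
    qed
    finally show "emeasure (distr (two_sample_law a b P Q) (Pi\<^sub>M {..<a + b} (\<lambda>_. borel)) f) (Pi\<^sub>E {..<a + b} A)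
      = (\<Prod>i\<in>{..<a + b}. emeasure (if i < a then P else Q) (A i))" .
  qed (simp_all add: R.sets_\<Omega>)
qed

lemma prob_two_sample_law:
  fixes U :: "samples \<Rightarrow> real" and w :: real
  assumes PQ: "real_distribution P" "real_distribution Q"
    and U: "\<And>\<omega>. U (split_at a (restrict (pooled a \<omega>) {..<a + b})) = U \<omega>"
    and meas: "(\<lambda>z. U (split_at a z)) \<in> borel_measurable (Pi\<^sub>M {..<a + b} (\<lambda>_. borel))"
  shows "\<P>(\<omega> in two_sample_law a b P Q. U \<omega> > w) = \<P>(z in pooled_law a b P Q. U (split_at a z) > w)"
proof -
  have sets: "{z \<in> space (Pi\<^sub>M {..<a + b} (\<lambda>_. borel)). U (split_at a z) > w} \<in> sets (Pi\<^sub>M {..<a + b} (\<lambda>_. borel))"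
    using meas by measurable
  have "\<P>(z in pooled_law a b P Q. U (split_at a z) > w)
      = measure (distr (two_sample_law a b P Q) (Pi\<^sub>M {..<a + b} (\<lambda>_. borel))
          (\<lambda>\<omega>. restrict (pooled a \<omega>) {..<a + b}))
          {z \<in> space (Pi\<^sub>M {..<a + b} (\<lambda>_. borel)). U (split_at a z) > w}"
    by (simp add: distr_two_sample_law(2)[OF PQ] sets_pooled_law(2)[OF PQ])
  also have "\<dots> = \<P>(\<omega> in two_sample_law a b P Q. U \<omega> > w)"
    using sets measurable_space[OF distr_two_sample_law(1)[OF PQ]]
    by (subst measure_distr[OF distr_two_sample_law(1)[OF PQ]])
       (auto intro!: arg_cong2[where f=measure] simp: U)
  finally show ?thesis ..
qed

lemma rank_in_cong: "(\<And>j. j < N \<Longrightarrow> z j = z' j) \<Longrightarrow> i < N \<Longrightarrow> rank_in N z i = rank_in N z' i"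
  unfolding rank_in_def by (intro arg_cong[where f=card]) auto

lemma measurable_rank_in[measurable]:
  assumes "i < N"
  shows "(\<lambda>z. rank_in N z i) \<in> Pi\<^sub>M {..<N} (\<lambda>_. borel) \<rightarrow>\<^sub>M count_space UNIV"
  unfolding rank_in_def
proof (rule measurable_card)
  fix j
  show "{z \<in> space (Pi\<^sub>M {..<N} (\<lambda>_. borel)). j \<in> {j. j < N \<and> z j \<le> z i}} \<in> sets (Pi\<^sub>M {..<N} (\<lambda>_. borel :: real measure))"
  proof (cases "j < N")
    case True
    then have [measurable]: "(\<lambda>z. z j) \<in> Pi\<^sub>M {..<N} (\<lambda>_. borel :: real measure) \<rightarrow>\<^sub>M borel"
        "(\<lambda>z. z i) \<in> Pi\<^sub>M {..<N} (\<lambda>_. borel :: real measure) \<rightarrow>\<^sub>M borel"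
      using assms by (auto intro!: measurable_component_singleton)
    have "{z \<in> space (Pi\<^sub>M {..<N} (\<lambda>_. borel)). z j \<le> (z i :: real)} \<in> sets (Pi\<^sub>M {..<N} (\<lambda>_. borel))"
      by measurable
    with True show ?thesis by simp
  qed simp
qed

lemma L_stat_cong:
  assumes "\<And>i. i < a + b \<Longrightarrow> rank_in (a + b) (pooled a \<omega>) i = rank_in (a + b) (pooled a \<omega>') i"
  shows "L_stat a b p \<omega> = L_stat a b p \<omega>'"
  unfolding L_stat_def using assms by (intro sum.cong) auto

lemma T_stat_cong:
  assumes "\<And>i. i < a + b \<Longrightarrow> rank_in (a + b) (pooled a \<omega>) i = rank_in (a + b) (pooled a \<omega>') i"
  shows "T_stat a b d p \<omega> = T_stat a b d p \<omega>'"
  unfolding T_stat_def using L_stat_cong[OF assms] by simp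

lemma T_stat_split_at: "T_stat a b d p (split_at a (restrict (pooled a \<omega>) {..<a + b})) = T_stat a b d p \<omega>"
  by (rule T_stat_cong) (auto intro!: rank_in_cong)

lemma measurable_T_stat:
  "(\<lambda>z. T_stat a b d p (split_at a z)) \<in> borel_measurable (Pi\<^sub>M {..<a + b} (\<lambda>_. borel))"
proof -
  have "(\<lambda>z. L_stat a b (p j) (split_at a z)) \<in> borel_measurable (Pi\<^sub>M {..<a + b} (\<lambda>_. borel))" for j
    unfolding L_stat_def pooled_split_at
  proof (rule borel_measurable_sum)
    fix i assume "i \<in> {..<a + b}"
    then have [measurable]: "(\<lambda>z. rank_in (a + b) z i) \<in> Pi\<^sub>M {..<a + b} (\<lambda>_. borel) \<rightarrow>\<^sub>M count_space UNIV"
      by (intro measurable_rank_in) simp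
    show "(\<lambda>z. reg_const a b i * score (p j) ((real (rank_in (a + b) z i) - 1 / 2) / real (a + b)))
      \<in> borel_measurable (Pi\<^sub>M {..<a + b} (\<lambda>_. borel))"
      by measurable
  qed
  then show ?thesis
    unfolding T_stat_def by (intro borel_measurable_Max) auto
qed

lemma V_stat_split_at: "V_stat a b (split_at a (restrict (pooled a \<omega>) {..<a + b})) = V_stat a b \<omega>"
proof -
  obtain x y where \<omega>: "\<omega> = (x, y)" by (cases \<omega>)
  have "ecdf a (restrict (pooled a \<omega>) {..<a + b}) = ecdf a x"
    unfolding ecdf_def by (intro ext arg_cong2[where f="(/)"] arg_cong[where f=real] arg_cong[where f=card])
      (auto simp: \<omega> pooled_def)
  moreover have "ecdf b (\<lambda>i. restrict (pooled a \<omega>) {..<a + b} (a + i)) = ecdf b y"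
    unfolding ecdf_def by (intro ext arg_cong2[where f="(/)"] arg_cong[where f=real] arg_cong[where f=card])
      (auto simp: \<omega> pooled_def)
  ultimately show ?thesis by (simp add: V_stat_def split_at_def \<omega>)
qed

lemma ecdf_bounds: "0 \<le> ecdf k x z" "ecdf k x z \<le> 1"
proof -
  have "card {i. i < k \<and> x i \<le> z} \<le> card {..<k}" by (rule card_mono) auto
  then show "0 \<le> ecdf k x z" "ecdf k x z \<le> 1" by (auto simp: ecdf_def divide_simps)
qed

lemma bdd_above_ecdf_diff: "bdd_above (range (\<lambda>z. ecdf b y z - ecdf a x z))"
proof (rule bdd_aboveI2)
  fix z show "ecdf b y z - ecdf a x z \<le> 1"
    using ecdf_bounds(1)[of a x z] ecdf_bounds(2)[of b y z] by linarith
qed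

text \<open>By right continuity of the empirical distribution functions the supremum may be taken over
  the rational numbers.\<close>

lemma V_stat_gt_iff:
  fixes a b :: nat
  assumes "0 < a" "0 < b"
  defines "\<sigma> \<equiv> sqrt (real a * real b / real (a + b))"
  shows "V_stat a b (x, y) > w \<longleftrightarrow> (\<exists>z. \<sigma> * (ecdf b y z - ecdf a x z) > w)"
    and "V_stat a b (x, y) > w \<longleftrightarrow> (\<exists>r::rat. \<sigma> * (ecdf b y (of_rat r) - ecdf a x (of_rat r)) > w)"
proof -
  have \<sigma>: "0 < \<sigma>" using assms by (simp add: \<sigma>_def)
  have "V_stat a b (x, y) > w \<longleftrightarrow> w / \<sigma> < (SUP z. ecdf b y z - ecdf a x z)"
    unfolding V_stat_def split \<sigma>_def[symmetric] using \<sigma> by (simp add: pos_divide_less_eq mult.commute)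
  also have "\<dots> \<longleftrightarrow> (\<exists>z. w / \<sigma> < ecdf b y z - ecdf a x z)"
    using less_cSUP_iff[OF _ bdd_above_ecdf_diff[of b y a x], of "w / \<sigma>"] by auto
  also have "\<dots> \<longleftrightarrow> (\<exists>z. \<sigma> * (ecdf b y z - ecdf a x z) > w)"
    using \<sigma> by (simp add: field_simps)
  finally show 1: "V_stat a b (x, y) > w \<longleftrightarrow> (\<exists>z. \<sigma> * (ecdf b y z - ecdf a x z) > w)" .
  have "\<exists>r::rat. ecdf b y (of_rat r) = ecdf b y z \<and> ecdf a x (of_rat r) = ecdf a x z" for z
  proof -
    define A where "A = {u \<in> x ` {..<a} \<union> y ` {..<b}. z < u}"
    obtain u where u: "z < u" "\<And>v. v \<in> A \<Longrightarrow> u \<le> v"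
    proof (cases "A = {}")
      case True
      then show ?thesis using that[of "z + 1"] by simp
    next
      case False
      have "finite A" by (simp add: A_def)
      then show ?thesis using False that[of "Min A"] by (auto simp: A_def)
    qed
    obtain r where r: "z < of_rat r" "of_rat r < u" using of_rat_dense[OF u(1)] by blast
    have eq: "v \<le> of_rat r \<longleftrightarrow> v \<le> z" if "v \<in> x ` {..<a} \<union> y ` {..<b}" for v
      using that r u(2)[of v] by (force simp: A_def)
    show ?thesis
      using eq by (intro exI[of _ r] conjI) (auto simp: ecdf_def intro!: arg_cong[where f=card] arg_cong2[where f="(/)"])
  qed
  with 1 show "V_stat a b (x, y) > w \<longleftrightarrow> (\<exists>r::rat. \<sigma> * (ecdf b y (of_rat r) - ecdf a x (of_rat r)) > w)"
    by metis
qed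

lemma measurable_ecdf:
  assumes "\<And>i. i < k \<Longrightarrow> c + i < N"
  shows "(\<lambda>z. ecdf k (\<lambda>i. z (c + i)) t) \<in> borel_measurable (Pi\<^sub>M {..<N} (\<lambda>_. borel))"
proof -
  have cm: "(\<lambda>z. card {i. i < k \<and> z (c + i) \<le> t}) \<in> Pi\<^sub>M {..<N} (\<lambda>_. borel) \<rightarrow>\<^sub>M count_space UNIV"
  proof (rule measurable_card)
    fix i
    show "{z \<in> space (Pi\<^sub>M {..<N} (\<lambda>_. borel)). i \<in> {i. i < k \<and> z (c + i) \<le> t}} \<in> sets (Pi\<^sub>M {..<N} (\<lambda>_. borel :: real measure))"
    proof (cases "i < k")
      case True
      then have [measurable]: "(\<lambda>z. z (c + i)) \<in> Pi\<^sub>M {..<N} (\<lambda>_. borel :: real measure) \<rightarrow>\<^sub>M borel"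
        using assms[of i] by (auto intro!: measurable_component_singleton)
      have "{z \<in> space (Pi\<^sub>M {..<N} (\<lambda>_. borel)). z (c + i) \<le> t} \<in> sets (Pi\<^sub>M {..<N} (\<lambda>_. borel))"
        by measurable
      with True show ?thesis by simp
    qed simp
  qed
  show ?thesis
    unfolding ecdf_def by (rule measurable_compose[OF cm, where g="\<lambda>n. real n / real k"]) simp
qed

lemma measurable_V_stat:
  assumes "0 < a" "0 < b"
  shows "(\<lambda>z. V_stat a b (split_at a z)) \<in> borel_measurable (Pi\<^sub>M {..<a + b} (\<lambda>_. borel))"
proof (rule borel_measurableI_greater)
  fix w
  have 1: "(\<lambda>z. ecdf a z t) \<in> borel_measurable (Pi\<^sub>M {..<a + b} (\<lambda>_. borel))" for t
    using measurable_ecdf[of a 0 "a + b" t] assms unfolding add_0 by simp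
  have 2: "(\<lambda>z. ecdf b (\<lambda>i. z (a + i)) t) \<in> borel_measurable (Pi\<^sub>M {..<a + b} (\<lambda>_. borel))" for t
    by (rule measurable_ecdf) simp
  note [measurable] = 1 2
  let ?M = "Pi\<^sub>M {..<a + b} (\<lambda>_. borel :: real measure)"
  let ?D = "\<lambda>z t. sqrt (real a * real b / real (a + b)) * (ecdf b (\<lambda>i. z (a + i)) t - ecdf a z t)"
  have "{z \<in> space ?M. w < ?D z t} \<in> sets ?M" for t by measurable
  then have "(\<Union>r::rat. {z \<in> space ?M. w < ?D z (of_rat r)}) \<in> sets ?M"
    by (intro sets.countable_UN) auto
  moreover have "{z \<in> space ?M. w < V_stat a b (split_at a z)} = (\<Union>r::rat. {z \<in> space ?M. w < ?D z (of_rat r)})"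
    unfolding split_at_def V_stat_gt_iff(2)[OF assms] by blast
  ultimately show "{z \<in> space ?M. w < V_stat a b (split_at a z)} \<in> sets ?M" by simp
qed

section \<open>Ties, independence and exchangeability\<close>

text \<open>A continuous distribution function has no jumps.\<close>

lemma measure_singleton_eq_0:
  assumes "real_distribution P" "continuous_on UNIV (cdf P)"
  shows "measure P {x} = 0"
proof -
  interpret real_distribution P by fact
  have "isCont (cdf P) x" using assms(2) by (simp add: continuous_on_eq_continuous_at)
  then show ?thesis using isCont_cdf by simp
qed

context real_product
begin

lemma measurable_coordinate[measurable]: "i < N \<Longrightarrow> (\<lambda>z. z i) \<in> borel_measurable \<Omega>"
  using measurable_component_singleton[of i "{..<N}" \<mu>] by (simp cong: measurable_cong_sets)

lemma AE_no_tie: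
  assumes atom: "\<And>i x. measure (\<mu> i) {x} = 0" and ij: "i < N" "j < N" "i \<noteq> j"
  shows "AE z in \<Omega>. z i \<noteq> z j"
proof -
  let ?I = "{..<N} - {j}"
  define A where "A = {z \<in> space \<Omega>. z i = z j}"
  have A: "A \<in> sets \<Omega>" using ij unfolding A_def by measurable
  have N: "?I \<union> {j} = {..<N}" using ij by auto
  have "emeasure (Pi\<^sub>M {j} \<mu>) ((\<lambda>y. merge ?I {j} (x, y)) -` A \<inter> space (Pi\<^sub>M {j} \<mu>)) = 0" for x
  proof -
    have "(\<lambda>y. merge ?I {j} (x, y)) -` A \<inter> space (Pi\<^sub>M {j} \<mu>) \<subseteq> Pi\<^sub>E {j} (\<lambda>_. {x i})"
    proof
      fix y assume "y \<in> (\<lambda>y. merge ?I {j} (x, y)) -` A \<inter> space (Pi\<^sub>M {j} \<mu>)"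
      then have "merge ?I {j} (x, y) i = merge ?I {j} (x, y) j" "y \<in> extensional {j}"
        by (auto simp: A_def space_PiM PiE_def)
      then show "y \<in> Pi\<^sub>E {j} (\<lambda>_. {x i})"
        using ij unfolding PiE_iff by (simp add: merge_def)
    qed
    moreover have "emeasure (Pi\<^sub>M {j} \<mu>) (Pi\<^sub>E {j} (\<lambda>_. {x i})) = (\<Prod>k\<in>{j}. emeasure (\<mu> k) {x i})"
      by (rule emeasure_PiM) auto
    moreover have "\<dots> = 0" using atom by (simp add: M.emeasure_eq_measure)
    moreover have "Pi\<^sub>E {j} (\<lambda>_. {x i}) \<in> sets (Pi\<^sub>M {j} \<mu>)"
      by (rule sets_PiM_I_finite) simp_all
    ultimately show ?thesis by (metis emeasure_mono le_zero_eq)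
  qed
  moreover have "emeasure (Pi\<^sub>M (?I \<union> {j}) \<mu>) A = (\<integral>\<^sup>+x. emeasure (Pi\<^sub>M {j} \<mu>)
      ((\<lambda>y. merge ?I {j} (x, y)) -` A \<inter> space (Pi\<^sub>M {j} \<mu>)) \<partial>Pi\<^sub>M ?I \<mu>)"
    by (rule emeasure_fold_integral) (simp, simp, simp, unfold N, rule A)
  ultimately have "emeasure (Pi\<^sub>M (?I \<union> {j}) \<mu>) A = 0" by simp
  then have "emeasure \<Omega> A = 0" unfolding N .
  then have "A \<in> null_sets \<Omega>" using A by (simp add: null_sets_def)
  then have "AE z in \<Omega>. z \<notin> A" by (rule AE_not_in)
  then show ?thesis by (rule AE_mp) (auto simp: A_def intro!: AE_I2)
qed

lemma AE_inj_on:
  assumes "\<And>i x. measure (\<mu> i) {x} = 0"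
  shows "AE z in \<Omega>. inj_on z {..<N}"
proof -
  have "AE z in \<Omega>. \<forall>p \<in> {..<N} \<times> {..<N}. fst p \<noteq> snd p \<longrightarrow> z (fst p) \<noteq> z (snd p)"
    unfolding AE_ball_countable[OF countable_finite[OF finite_cartesian_product[OF finite_lessThan finite_lessThan]]]
  proof
    fix p assume "p \<in> {..<N} \<times> {..<N}"
    then show "AE z in \<Omega>. fst p \<noteq> snd p \<longrightarrow> z (fst p) \<noteq> z (snd p)"
      using AE_no_tie[OF assms, of "fst p" "snd p"] by (cases "fst p = snd p") auto
  qed
  then show ?thesis by (rule AE_mp) (auto simp: inj_on_def intro!: AE_I2)
qed

text \<open>This makes it possible to vary one observation of each sample while all others are kept fixed.\<close>

lemma prob_two_coordinates_Int:
  assumes ij: "i < N" "j < N" "i \<noteq> j" and B: "B \<in> sets borel" "C \<in> sets borel"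
    and W: "W \<in> sets \<Omega>" and rest: "\<And>z u v. z \<in> space \<Omega> \<Longrightarrow> z(i := u, j := v) \<in> W \<longleftrightarrow> z \<in> W"
  shows "measure \<Omega> ({z \<in> space \<Omega>. z i \<in> B \<and> z j \<in> C} \<inter> W)
    = measure (\<mu> i) B * measure (\<mu> j) C * measure \<Omega> W"
proof -
  define I J where "I = {..<N} - {i, j}" and "J = {i, j}"
  have IJ: "I \<inter> J = {}" "finite I" "finite J" "I \<union> J = {..<N}" using ij by (auto simp: I_def J_def)
  interpret I: prob_space "Pi\<^sub>M I \<mu>" by (rule prob_space_PiM) (rule prob_space_factor)
  interpret J: prob_space "Pi\<^sub>M J \<mu>" by (rule prob_space_PiM) (rule prob_space_factor)
  define c :: "nat \<Rightarrow> real" where "c = restrict (\<lambda>_. 0) J"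
  have c: "c \<in> space (Pi\<^sub>M J \<mu>)" by (simp add: c_def space_PiM)
  define W0 where "W0 = {x \<in> space (Pi\<^sub>M I \<mu>). merge I J (x, c) \<in> W}"
  have mc: "(\<lambda>x. merge I J (x, c)) \<in> Pi\<^sub>M I \<mu> \<rightarrow>\<^sub>M \<Omega>"
    using measurable_compose[OF measurable_Pair2'[OF c] measurable_merge[of I J \<mu>]] IJ(4) by simp
  have W0: "W0 \<in> sets (Pi\<^sub>M I \<mu>)"
    unfolding W0_def using measurable_sets[OF mc W] by (simp add: vimage_def Int_def conj_commute)
  have main: "emeasure \<Omega> ({z \<in> space \<Omega>. z i \<in> B \<and> z j \<in> C} \<inter> W)
      = emeasure (Pi\<^sub>M I \<mu>) W0 * (emeasure (\<mu> i) B * emeasure (\<mu> j) C)"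
    if B: "B \<in> sets borel" "C \<in> sets borel" for B C
  proof -
    let ?E = "{z \<in> space \<Omega>. z i \<in> B \<and> z j \<in> C} \<inter> W"
    let ?R = "Pi\<^sub>E J (\<lambda>k. if k = i then B else C)"
    have E: "?E \<in> sets \<Omega>" using ij B W by measurable
    have "emeasure \<Omega> ?E = emeasure (distr (Pi\<^sub>M I \<mu> \<Otimes>\<^sub>M Pi\<^sub>M J \<mu>) \<Omega> (merge I J)) ?E"
      using distr_merge[OF IJ(1-3)] IJ(4) by simp
    also have "\<dots> = emeasure (Pi\<^sub>M I \<mu> \<Otimes>\<^sub>M Pi\<^sub>M J \<mu>) (merge I J -` ?E \<inter> space (Pi\<^sub>M I \<mu> \<Otimes>\<^sub>M Pi\<^sub>M J \<mu>))"
      using measurable_merge[of I J \<mu>] IJ(4) E by (intro emeasure_distr) auto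
    also have "merge I J -` ?E \<inter> space (Pi\<^sub>M I \<mu> \<Otimes>\<^sub>M Pi\<^sub>M J \<mu>) = W0 \<times> ?R"
    proof -
      have iff: "merge I J (x, y) \<in> ?E \<longleftrightarrow> x \<in> W0 \<and> y \<in> ?R"
        if x: "x \<in> space (Pi\<^sub>M I \<mu>)" and y: "y \<in> space (Pi\<^sub>M J \<mu>)" for x y
      proof -
        have sp: "merge I J (x, y) \<in> space \<Omega>" "merge I J (x, c) \<in> space \<Omega>"
          using x y c IJ(4) by (auto simp: space_PiM PiE_iff merge_def extensional_def)
        have "merge I J (x, y) = (merge I J (x, c))(i := y i, j := y j)"
          using ij by (auto simp: fun_eq_iff merge_def I_def J_def)
        then have "merge I J (x, y) \<in> W \<longleftrightarrow> merge I J (x, c) \<in> W"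
          using rest[OF sp(2)] by simp
        moreover have "merge I J (x, y) i = y i" "merge I J (x, y) j = y j"
          by (auto simp: merge_def I_def J_def)
        ultimately show ?thesis
          using sp x y ij by (auto simp: W0_def space_PiM J_def PiE_iff)
      qed
      have sub: "W0 \<subseteq> space (Pi\<^sub>M I \<mu>)" "?R \<subseteq> space (Pi\<^sub>M J \<mu>)"
        unfolding W0_def by (auto simp: space_PiM PiE_def)
      show ?thesis
      proof (rule set_eqI)
        fix p :: "(nat \<Rightarrow> real) \<times> (nat \<Rightarrow> real)"
        obtain x y where p: "p = (x, y)" by (cases p)
        show "p \<in> merge I J -` ?E \<inter> space (Pi\<^sub>M I \<mu> \<Otimes>\<^sub>M Pi\<^sub>M J \<mu>) \<longleftrightarrow> p \<in> W0 \<times> ?R"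
          using iff[of x y] sub unfolding p space_pair_measure vimage_eq Int_iff mem_Sigma_iff by blast
      qed
    qed
    also have "emeasure (Pi\<^sub>M I \<mu> \<Otimes>\<^sub>M Pi\<^sub>M J \<mu>) (W0 \<times> ?R) = emeasure (Pi\<^sub>M I \<mu>) W0 * emeasure (Pi\<^sub>M J \<mu>) ?R"
      using W0 B by (intro J.emeasure_pair_measure_Times) (auto intro!: sets_PiM_I_finite simp: IJ)
    also have "emeasure (Pi\<^sub>M J \<mu>) ?R = (\<Prod>k\<in>J. emeasure (\<mu> k) (if k = i then B else C))"
      using B by (intro emeasure_PiM IJ) auto
    also have "\<dots> = emeasure (\<mu> i) B * emeasure (\<mu> j) C"
      using ij by (simp add: J_def)
    finally show ?thesis .
  qed
  have "{z \<in> space \<Omega>. z i \<in> UNIV \<and> z j \<in> UNIV} \<inter> W = W" using sets.sets_into_space[OF W] by auto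
  then have "emeasure \<Omega> W = emeasure (Pi\<^sub>M I \<mu>) W0"
    using main[of UNIV UNIV] M.emeasure_space_1[unfolded space_factor] by simp
  then show ?thesis
    using main[OF B] by (simp add: P.emeasure_eq_measure M.emeasure_eq_measure I.emeasure_eq_measure
        ennreal_mult[symmetric] measure_nonneg mult_ac)
qed

end

definition low_set :: "nat \<Rightarrow> (nat \<Rightarrow> real) \<Rightarrow> nat \<Rightarrow> nat set" where
  "low_set N z k = {i. i < N \<and> rank_in N z i \<le> k}"

locale iid_product = real_product N "\<lambda>_. P" for N :: nat and P :: "real measure" +
  assumes continuous_cdf: "continuous_on UNIV (cdf P)"
begin

lemma AE_inj: "AE z in \<Omega>. inj_on z {..<N}"
  using measure_singleton_eq_0[OF real_distribution_factor continuous_cdf] by (intro AE_inj_on)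

lemma rank_in_measurable[measurable]: "i < N \<Longrightarrow> (\<lambda>z. rank_in N z i) \<in> \<Omega> \<rightarrow>\<^sub>M count_space UNIV"
  using measurable_rank_in[of i N] measurable_cong_sets[OF sets_\<Omega> refl] by blast

lemma low_set_event: "{z \<in> space \<Omega>. low_set N z k = K} \<in> sets \<Omega>"
proof (cases "K \<subseteq> {..<N}")
  case True
  have "low_set N z k = K \<longleftrightarrow> (\<forall>i\<in>{..<N}. rank_in N z i \<le> k \<longleftrightarrow> i \<in> K)" for z
    using True by (auto simp: low_set_def)
  moreover have "{z \<in> space \<Omega>. \<forall>i\<in>{..<N}. rank_in N z i \<le> k \<longleftrightarrow> i \<in> K} \<in> sets \<Omega>"
  proof (rule sets.sets_Collect_finite_All)
    fix i assume "i \<in> {..<N}"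
    then have [measurable]: "(\<lambda>z. rank_in N z i) \<in> \<Omega> \<rightarrow>\<^sub>M count_space UNIV" by simp
    show "{z \<in> space \<Omega>. rank_in N z i \<le> k \<longleftrightarrow> i \<in> K} \<in> sets \<Omega>" by measurable
  qed simp
  ultimately show ?thesis by simp
next
  case False
  then have e: "{z \<in> space \<Omega>. low_set N z k = K} = {}" by (auto simp: low_set_def)
  show ?thesis unfolding e by (rule sets.empty_sets)
qed

text \<open>The law of an i.i.d. sample is invariant under permutations of the indices.\<close>

lemma prob_low_set_eq:
  assumes K: "K \<subseteq> {..<N}" "K' \<subseteq> {..<N}" "card K = card K'"
  shows "\<P>(z in \<Omega>. low_set N z k = K) = \<P>(z in \<Omega>. low_set N z k = K')"
proof -
  have fin: "finite K" "finite K'" using K by (auto intro: finite_subset)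
  obtain f where f: "bij_betw f K K'" using finite_same_card_bij[OF fin K(3)] by blast
  have "card ({..<N} - K) = card ({..<N} - K')" using K fin by (simp add: card_Diff_subset)
  then obtain g where g: "bij_betw g ({..<N} - K) ({..<N} - K')"
    using finite_same_card_bij[of "{..<N} - K" "{..<N} - K'"] by auto
  \<comment> \<open>Any permutation that carries \<open>K\<close> to \<open>K'\<close> will do.\<close>
  define \<pi> where "\<pi> i = (if i \<in> K then f i else g i)" for i
  have "bij_betw \<pi> (K \<union> ({..<N} - K)) (K' \<union> ({..<N} - K'))"
    unfolding \<pi>_def by (rule bij_betw_disjoint_Un[OF f g]) auto
  then have \<pi>: "bij_betw \<pi> {..<N} {..<N}" using K by (simp add: Un_absorb1)
  have \<pi>K: "i \<in> K \<longleftrightarrow> \<pi> i \<in> K'" if "i < N" for i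
    using that bij_betwE[OF f] bij_betwE[OF g] by (auto simp: \<pi>_def)
  define t where "t z = restrict (\<lambda>i. z (\<pi> i)) {..<N}" for z :: "nat \<Rightarrow> real"
  have d: "distr \<Omega> \<Omega> t = \<Omega>"
    unfolding t_def using \<pi> prob_space_factor
    by (intro distr_PiM_reindex) (auto simp: bij_betw_def)
  have tm: "t \<in> \<Omega> \<rightarrow>\<^sub>M \<Omega>"
    unfolding t_def using \<pi> by (intro measurable_restrict measurable_component_singleton) (auto dest: bij_betwE)
  have rank: "rank_in N (t z) i = rank_in N z (\<pi> i)" if i: "i < N" for z i
  proof -
    have "bij_betw \<pi> {j. j < N \<and> t z j \<le> t z i} {j. j < N \<and> z j \<le> z (\<pi> i)}"
    proof (rule bij_betw_subset[OF \<pi>])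
      show "\<pi> ` {j. j < N \<and> t z j \<le> t z i} = {j. j < N \<and> z j \<le> z (\<pi> i)}"
      proof (rule set_eqI, rule iffI)
        fix j assume "j \<in> \<pi> ` {j. j < N \<and> t z j \<le> t z i}"
        then show "j \<in> {j. j < N \<and> z j \<le> z (\<pi> i)}"
          using i bij_betwE[OF \<pi>] by (auto simp: t_def)
      next
        fix j assume j: "j \<in> {j. j < N \<and> z j \<le> z (\<pi> i)}"
        then obtain l where "l < N" "j = \<pi> l" using \<pi> by (auto simp: bij_betw_def image_iff set_eq_iff)
        then show "j \<in> \<pi> ` {j. j < N \<and> t z j \<le> t z i}" using i j by (auto simp: t_def)
      qed
    qed auto
    then show ?thesis unfolding rank_in_def by (rule bij_betw_same_card)
  qed
  have low: "low_set N (t z) k = K \<longleftrightarrow> low_set N z k = K'" for z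
  proof
    assume L: "low_set N (t z) k = K"
    have "i \<in> low_set N z k \<longleftrightarrow> i \<in> K'" for i
    proof (cases "i < N")
      case True
      then obtain l where l: "l < N" "i = \<pi> l" using \<pi> by (auto simp: bij_betw_def image_iff set_eq_iff)
      then have "l \<in> low_set N (t z) k \<longleftrightarrow> i \<in> low_set N z k"
        using True by (simp add: low_set_def rank)
      then show ?thesis using L l \<pi>K by simp
    next
      case False
      then show ?thesis using K by (auto simp: low_set_def)
    qed
    then show "low_set N z k = K'" by blast
  next
    assume L: "low_set N z k = K'"
    have "i \<in> low_set N (t z) k \<longleftrightarrow> i \<in> K" for i
    proof (cases "i < N")
      case True
      then have "i \<in> low_set N (t z) k \<longleftrightarrow> \<pi> i \<in> low_set N z k"
        using bij_betwE[OF \<pi>] by (simp add: low_set_def rank)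
      then show ?thesis using L True \<pi>K by simp
    next
      case False
      then show ?thesis using K by (auto simp: low_set_def)
    qed
    then show "low_set N (t z) k = K" by blast
  qed
  have "\<P>(z in \<Omega>. low_set N z k = K) = measure (distr \<Omega> \<Omega> t) {z \<in> space \<Omega>. low_set N z k = K}"
    by (simp only: d)
  also have "\<dots> = \<P>(z in \<Omega>. low_set N z k = K')"
    using measurable_space[OF tm] low_set_event
    by (subst measure_distr[OF tm]) (auto intro!: arg_cong2[where f=measure] simp: low)
  finally show ?thesis .
qed

text \<open>The \<open>N choose k\<close> equally likely events are disjoint.\<close>

lemma prob_low_set_le:
  assumes K: "K \<subseteq> {..<N}"
  shows "real (N choose card K) * \<P>(z in \<Omega>. low_set N z k = K) \<le> 1"
proof -
  let ?\<K> = "{L. L \<subseteq> {..<N} \<and> card L = card K}"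
  have "real (N choose card K) * \<P>(z in \<Omega>. low_set N z k = K) = (\<Sum>L\<in>?\<K>. \<P>(z in \<Omega>. low_set N z k = K))"
    by (simp add: n_subsets)
  also have "\<dots> = (\<Sum>L\<in>?\<K>. \<P>(z in \<Omega>. low_set N z k = L))"
    using K by (intro sum.cong prob_low_set_eq) auto
  also have "\<dots> = measure \<Omega> (\<Union>L\<in>?\<K>. {z \<in> space \<Omega>. low_set N z k = L})"
    by (intro P.finite_measure_finite_Union[symmetric])
       (auto simp: disjoint_family_on_def intro: low_set_event)
  also have "\<dots> \<le> 1" by (rule P.prob_le_1)
  finally show ?thesis .
qed

text \<open>Each index is below \<open>t\<close> independently with probability \<open>F t\<close>.\<close>

lemma prob_exactly_below:
  assumes K: "K \<subseteq> {..<N}"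
  shows "\<P>(z in \<Omega>. {i. i < N \<and> z i \<le> t} = K) = cdf P t ^ card K * (1 - cdf P t) ^ (N - card K)"
    and "{z \<in> space \<Omega>. {i. i < N \<and> z i \<le> t} = K} \<in> sets \<Omega>"
proof -
  let ?B = "\<lambda>i. if i \<in> K then {..t} else {t<..}"
  have eq: "{z \<in> space \<Omega>. {i. i < N \<and> z i \<le> t} = K} = Pi\<^sub>E {..<N} ?B"
    using K by (auto simp: space_PiM PiE_iff set_eq_iff split: if_splits) force+
  have "measure \<Omega> (Pi\<^sub>E {..<N} ?B) = (\<Prod>i<N. measure P (?B i))"
    by (rule finite_measure_PiM_emb) auto
  also have "\<dots> = (\<Prod>i\<in>K. measure P (?B i)) * (\<Prod>i\<in>{..<N} - K. measure P (?B i))"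
    using prod.subset_diff[OF K finite_lessThan, of "\<lambda>i. measure P (?B i)"] by (simp only: mult.commute)
  also have "(\<Prod>i\<in>K. measure P (?B i)) = cdf P t ^ card K"
    by (simp add: cdf_def)
  also have "measure P {t<..} = 1 - cdf P t"
  proof -
    have "{t<..} = space P - {..t}" by auto
    then show ?thesis using M.prob_compl[of "{..t}"] by (simp add: cdf_def)
  qed
  then have "(\<Prod>i\<in>{..<N} - K. measure P (?B i)) = (1 - cdf P t) ^ (N - card K)"
    using K by (simp add: card_Diff_subset finite_subset)
  finally show "\<P>(z in \<Omega>. {i. i < N \<and> z i \<le> t} = K) = cdf P t ^ card K * (1 - cdf P t) ^ (N - card K)"
    by (simp add: eq)
  show "{z \<in> space \<Omega>. {i. i < N \<and> z i \<le> t} = K} \<in> sets \<Omega>"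
    unfolding eq by (auto intro!: sets_PiM_I_finite)
qed

text \<open>The set of the \<open>k\<close> smallest observations is uniform on the \<open>k\<close>-subsets, and so is the set of
  observations below \<open>t\<close>, given that there are \<open>k\<close> of them; for \<open>F t = k / N\<close> the latter
  condition costs at most a factor \<open>N + 1\<close>.\<close>

lemma prob_low_set_in_le:
  assumes k: "0 < k" "k < N" and t: "cdf P t = real k / real N"
    and S: "\<S> \<subseteq> {K. K \<subseteq> {..<N} \<and> card K = k}"
  shows "\<P>(z in \<Omega>. low_set N z k \<in> \<S>) \<le> (real N + 1) * \<P>(z in \<Omega>. {i. i < N \<and> z i \<le> t} \<in> \<S>)"
proof -
  define \<beta> where "\<beta> = cdf P t ^ k * (1 - cdf P t) ^ (N - k)"
  have fin: "finite \<S>" using finite_subset[OF S] by simp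
  have \<beta>: "1 \<le> (real N + 1) * (real (N choose k) * \<beta>)"
    using binomial_mode[of k N] k by (simp add: \<beta>_def t field_simps)
  have C: "0 < real (N choose k)" using k by (simp add: zero_less_binomial)
  have "\<P>(z in \<Omega>. low_set N z k \<in> \<S>) = measure \<Omega> (\<Union>K\<in>\<S>. {z \<in> space \<Omega>. low_set N z k = K})"
    by (intro arg_cong2[where f=measure]) auto
  also have "\<dots> = (\<Sum>K\<in>\<S>. \<P>(z in \<Omega>. low_set N z k = K))"
    using fin by (intro P.finite_measure_finite_Union) (auto simp: disjoint_family_on_def intro: low_set_event)
  also have "\<dots> \<le> (\<Sum>K\<in>\<S>. (real N + 1) * \<beta>)"
  proof (rule sum_mono)
    fix K assume "K \<in> \<S>"
    then have K: "K \<subseteq> {..<N}" "card K = k" using S by auto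
    have "real (N choose k) * \<P>(z in \<Omega>. low_set N z k = K) \<le> 1" using prob_low_set_le[OF K(1)] K(2) by simp
    also have "1 \<le> real (N choose k) * ((real N + 1) * \<beta>)" using \<beta> by (simp add: mult_ac)
    finally show "\<P>(z in \<Omega>. low_set N z k = K) \<le> (real N + 1) * \<beta>" using C by simp
  qed
  also have "\<dots> = (real N + 1) * (\<Sum>K\<in>\<S>. \<P>(z in \<Omega>. {i. i < N \<and> z i \<le> t} = K))"
    unfolding sum_distrib_left
  proof (rule sum.cong[OF refl])
    fix K assume "K \<in> \<S>"
    then have "K \<subseteq> {..<N}" "card K = k" using S by auto
    then show "(real N + 1) * \<beta> = (real N + 1) * \<P>(z in \<Omega>. {i. i < N \<and> z i \<le> t} = K)"
      by (simp only: prob_exactly_below(1) \<beta>_def)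
  qed
  also have "(\<Sum>K\<in>\<S>. \<P>(z in \<Omega>. {i. i < N \<and> z i \<le> t} = K))
      = measure \<Omega> (\<Union>K\<in>\<S>. {z \<in> space \<Omega>. {i. i < N \<and> z i \<le> t} = K})"
    using fin S by (intro P.finite_measure_finite_Union[symmetric])
      (auto simp: disjoint_family_on_def intro: prob_exactly_below(2))
  also have "(\<Union>K\<in>\<S>. {z \<in> space \<Omega>. {i. i < N \<and> z i \<le> t} = K})
      = {z \<in> space \<Omega>. {i. i < N \<and> z i \<le> t} \<in> \<S>}" by auto
  finally show ?thesis .
qed

text \<open>Sum \<open>prob_exactly_below\<close> over the sets with \<open>k1\<close> indices in the first and \<open>k2\<close> in the second sample.\<close>

lemma prob_counts_ge:
  assumes a: "a + b = N" and k: "k1 \<le> a" "k2 \<le> b"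
  shows "real (a choose k1) * real (b choose k2) * (cdf P t ^ (k1 + k2) * (1 - cdf P t) ^ (N - (k1 + k2)))
    \<le> \<P>(z in \<Omega>. card {i. i < a \<and> z i \<le> t} = k1 \<and> card {i. a \<le> i \<and> i < N \<and> z i \<le> t} = k2)"
proof -
  define \<K> where "\<K> = (\<lambda>(K, L). K \<union> L) ` ({K. K \<subseteq> {..<a} \<and> card K = k1} \<times> {L. L \<subseteq> {a..<N} \<and> card L = k2})"
  have inj: "inj_on (\<lambda>(K, L). K \<union> L) ({K. K \<subseteq> {..<a} \<and> card K = k1} \<times> {L. L \<subseteq> {a..<N} \<and> card L = k2})"
  proof (rule inj_on_inverseI[where g="\<lambda>M. (M \<inter> {..<a}, M \<inter> {a..<N})"])
    fix p assume "p \<in> {K. K \<subseteq> {..<a} \<and> card K = k1} \<times> {L. L \<subseteq> {a..<N} \<and> card L = k2}"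
    then show "((case p of (K, L) \<Rightarrow> K \<union> L) \<inter> {..<a}, (case p of (K, L) \<Rightarrow> K \<union> L) \<inter> {a..<N}) = p"
      by (cases p) force
  qed
  have card: "card \<K> = (a choose k1) * (b choose k2)"
    unfolding \<K>_def card_image[OF inj] card_cartesian_product
    using a n_subsets[of "{..<a}" k1] n_subsets[of "{a..<N}" k2] by auto
  have fin: "finite \<K>" unfolding \<K>_def by (intro finite_imageI finite_cartesian_product) auto
  have \<K>: "K \<subseteq> {..<N} \<and> card K = k1 + k2 \<and> card (K \<inter> {..<a}) = k1 \<and> card (K \<inter> {a..<N}) = k2" if "K \<in> \<K>" for K
  proof -
    obtain K1 L where K1: "K = K1 \<union> L" "K1 \<subseteq> {..<a}" "card K1 = k1" "L \<subseteq> {a..<N}" "card L = k2"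
      using \<open>K \<in> \<K>\<close> by (auto simp: \<K>_def)
    have f: "finite K1" "finite L" using K1 by (auto intro: finite_subset)
    have e: "K \<inter> {..<a} = K1" "K \<inter> {a..<N} = L" "K1 \<inter> L = {}" using K1 a by force+
    then show ?thesis using K1 f a by (auto simp: card_Un_disjoint)
  qed
  have "real (a choose k1) * real (b choose k2) * (cdf P t ^ (k1 + k2) * (1 - cdf P t) ^ (N - (k1 + k2)))
      = (\<Sum>K\<in>\<K>. \<P>(z in \<Omega>. {i. i < N \<and> z i \<le> t} = K))"
    using \<K> by (simp add: prob_exactly_below(1) card)
  also have "\<dots> = measure \<Omega> (\<Union>K\<in>\<K>. {z \<in> space \<Omega>. {i. i < N \<and> z i \<le> t} = K})"
    using fin \<K> by (intro P.finite_measure_finite_Union[symmetric])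
      (auto simp: disjoint_family_on_def intro!: prob_exactly_below(2))
  also have "\<dots> \<le> \<P>(z in \<Omega>. card {i. i < a \<and> z i \<le> t} = k1 \<and> card {i. a \<le> i \<and> i < N \<and> z i \<le> t} = k2)"
  proof (rule P.finite_measure_mono)
    show "(\<Union>K\<in>\<K>. {z \<in> space \<Omega>. {i. i < N \<and> z i \<le> t} = K})
      \<subseteq> {z \<in> space \<Omega>. card {i. i < a \<and> z i \<le> t} = k1 \<and> card {i. a \<le> i \<and> i < N \<and> z i \<le> t} = k2}"
    proof safe
      fix z assume "{i. i < N \<and> z i \<le> t} \<in> \<K>"
      moreover have "{i. i < N \<and> z i \<le> t} \<inter> {..<a} = {i. i < a \<and> z i \<le> t}"
        "{i. i < N \<and> z i \<le> t} \<inter> {a..<N} = {i. a \<le> i \<and> i < N \<and> z i \<le> t}" using a by auto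
      ultimately show "card {i. i < a \<and> z i \<le> t} = k1" "card {i. a \<le> i \<and> i < N \<and> z i \<le> t} = k2"
        using \<K> by metis+
    qed
    show "{z \<in> space \<Omega>. card {i. i < a \<and> z i \<le> t} = k1 \<and> card {i. a \<le> i \<and> i < N \<and> z i \<le> t} = k2} \<in> sets \<Omega>"
    proof -
      have cm: "(\<lambda>z. card {i. lo \<le> i \<and> i < hi \<and> z i \<le> t}) \<in> \<Omega> \<rightarrow>\<^sub>M count_space UNIV" if "hi \<le> N" for lo hi
      proof (rule measurable_card)
        fix i show "{z \<in> space \<Omega>. i \<in> {i. lo \<le> i \<and> i < hi \<and> z i \<le> t}} \<in> sets \<Omega>"
        proof (cases "lo \<le> i \<and> i < hi")
          case True
          then have [measurable]: "(\<lambda>z. z i) \<in> borel_measurable \<Omega>" using that by (intro measurable_coordinate) simp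
          have "{z \<in> space \<Omega>. z i \<le> t} \<in> sets \<Omega>" by measurable
          with True show ?thesis by simp
        qed simp
      qed
      have 1: "(\<lambda>z. card {i. i < a \<and> z i \<le> t}) \<in> \<Omega> \<rightarrow>\<^sub>M count_space UNIV"
      proof -
        have e: "{i. i < a \<and> z i \<le> t} = {i. 0 \<le> i \<and> i < a \<and> z i \<le> t}" for z :: "nat \<Rightarrow> real" by auto
        show ?thesis unfolding e by (rule cm) (use a in linarith)
      qed
      have 2: "(\<lambda>z. card {i. a \<le> i \<and> i < N \<and> z i \<le> t}) \<in> \<Omega> \<rightarrow>\<^sub>M count_space UNIV"
        by (rule cm) (rule order_refl)
      have ev: "{z \<in> space \<Omega>. f z = k} = f -` {k} \<inter> space \<Omega>" for f :: "(nat \<Rightarrow> real) \<Rightarrow> nat" and k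
        by auto
      have "{z \<in> space \<Omega>. card {i. i < a \<and> z i \<le> t} = k1} \<in> sets \<Omega>"
        unfolding ev by (rule measurable_sets[OF 1]) (rule sets_UNIV)
      moreover have "{z \<in> space \<Omega>. card {i. a \<le> i \<and> i < N \<and> z i \<le> t} = k2} \<in> sets \<Omega>"
        unfolding ev by (rule measurable_sets[OF 2]) (rule sets_UNIV)
      ultimately have "{z \<in> space \<Omega>. card {i. i < a \<and> z i \<le> t} = k1}
          \<inter> {z \<in> space \<Omega>. card {i. a \<le> i \<and> i < N \<and> z i \<le> t} = k2} \<in> sets \<Omega>"
        by (rule sets.Int)
      also have "{z \<in> space \<Omega>. card {i. i < a \<and> z i \<le> t} = k1}
          \<inter> {z \<in> space \<Omega>. card {i. a \<le> i \<and> i < N \<and> z i \<le> t} = k2}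
        = {z \<in> space \<Omega>. card {i. i < a \<and> z i \<le> t} = k1 \<and> card {i. a \<le> i \<and> i < N \<and> z i \<le> t} = k2}"
        by blast
      finally show ?thesis .
    qed
  qed
  finally show ?thesis .
qed

end

section \<open>Tail bounds for two samples\<close>

lemma cdf_surj:
  assumes "real_distribution P" "continuous_on UNIV (cdf P)" "0 < q" "q < 1"
  obtains t where "cdf P t = q"
proof -
  interpret real_distribution P by fact
  obtain u where u: "cdf P u < q"
    using order_tendstoD(2)[OF cdf_lim_at_bot \<open>0 < q\<close>] by (auto simp: eventually_at_bot_linorder)
  obtain v where v: "q < cdf P v"
    using order_tendstoD(1)[OF cdf_lim_at_top_prob \<open>q < 1\<close>] by (auto simp: eventually_at_top_linorder)
  have "u \<le> v" using u v cdf_nondecreasing[of v u] by linarith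
  then have "\<exists>t\<ge>u. t \<le> v \<and> cdf P t = q"
    using u v assms(2) by (intro IVT) (auto simp: continuous_on_eq_continuous_at)
  then show ?thesis using that by blast
qed

locale two_samples =
  fixes a b :: nat and P Q :: "real measure"
  assumes sizes: "0 < a" "0 < b"
    and laws: "real_distribution P" "real_distribution Q"
    and cont: "continuous_on UNIV (cdf P)" "continuous_on UNIV (cdf Q)"
begin

sublocale real_product "a + b" "\<lambda>i. if i < a then P else Q"
  by (rule real_product_pooled) (rule laws)+

sublocale X: real_distribution P by (rule laws)
sublocale Y: real_distribution Q by (rule laws)

definition \<sigma> :: real where "\<sigma> = sqrt (real a * real b / real (a + b))"

lemma \<sigma>_pos: "0 < \<sigma>" using sizes by (simp add: \<sigma>_def)

lemma \<sigma>_sq: "\<sigma>\<^sup>2 = real a * real b / real (a + b)" by (simp add: \<sigma>_def)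

text \<open>The normalisation makes the difference of two relative frequencies have variance at most \<open>1 / 4\<close>;
  this is the source of the exponent \<open>2\<close> in the tails of \<open>V_stat\<close>.\<close>

lemma \<sigma>_inverse: "\<sigma>\<^sup>2 / real a + \<sigma>\<^sup>2 / real b = 1"
proof -
  have "\<sigma>\<^sup>2 / real a = real b / real (a + b)" "\<sigma>\<^sup>2 / real b = real a / real (a + b)"
    using sizes by (simp_all add: \<sigma>_sq)
  then have "\<sigma>\<^sup>2 / real a + \<sigma>\<^sup>2 / real b = (real b + real a) / real (a + b)"
    by (simp only: add_divide_distrib)
  then show ?thesis using sizes by simp
qed

lemma pooled_law_eq: "pooled_law a b P Q = \<Omega>" by (simp add: pooled_law_def)

lemma AE_inj: "AE z in \<Omega>. inj_on z {..<a + b}"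
  by (rule AE_inj_on) (use measure_singleton_eq_0[OF laws(1) cont(1)] measure_singleton_eq_0[OF laws(2) cont(2)] in auto)

lemma sum_pooled:
  fixes f :: "nat \<Rightarrow> real"
  shows "(\<Sum>i<a + b. (if i < a then u else v) * f i) = u * (\<Sum>i<a. f i) + v * (\<Sum>i\<in>{a..<a + b}. f i)"
proof -
  have un: "{..<a + b} = {..<a} \<union> {a..<a + b}" by auto
  have "(\<Sum>i<a + b. (if i < a then u else v) * f i)
      = (\<Sum>i<a. (if i < a then u else v) * f i) + (\<Sum>i\<in>{a..<a + b}. (if i < a then u else v) * f i)"
    unfolding un by (rule sum.union_disjoint) auto
  also have "(\<Sum>i<a. (if i < a then u else v) * f i) = u * (\<Sum>i<a. f i)"
    unfolding sum_distrib_left by (rule sum.cong) auto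
  also have "(\<Sum>i\<in>{a..<a + b}. (if i < a then u else v) * f i) = v * (\<Sum>i\<in>{a..<a + b}. f i)"
    unfolding sum_distrib_left by (rule sum.cong) auto
  finally show ?thesis .
qed

abbreviation count_x :: "(nat \<Rightarrow> real) \<Rightarrow> real set \<Rightarrow> nat" where
  "count_x z B \<equiv> card {i. i < a \<and> z i \<in> B}"

abbreviation count_y :: "(nat \<Rightarrow> real) \<Rightarrow> real set \<Rightarrow> nat" where
  "count_y z B \<equiv> card {i. a \<le> i \<and> i < a + b \<and> z i \<in> B}"

text \<open>Weighted differences of the two counts are sums of independent terms, so the exponential bounds apply
  with one weight per sample.\<close>

lemma weighted_count:
  "(\<Sum>i<a + b. (if i < a then u else v) * indicator (if i < a then B else C) (z i))
    = u * real (count_x z B) + v * real (count_y z C)"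
proof -
  have "(\<Sum>i<a. indicator (if i < a then B else C) (z i)) = real (count_x z B)"
  proof -
    have "(\<Sum>i<a. indicator (if i < a then B else C) (z i)) = (\<Sum>i<a. of_bool (z i \<in> B) :: real)"
      by (rule sum.cong) (auto simp: indicator_def)
    also have "\<dots> = real (card ({..<a} \<inter> {i. z i \<in> B}))" by simp
    also have "{..<a} \<inter> {i. z i \<in> B} = {i. i < a \<and> z i \<in> B}" by auto
    finally show ?thesis .
  qed
  moreover have "(\<Sum>i\<in>{a..<a + b}. indicator (if i < a then B else C) (z i)) = real (count_y z C)"
  proof -
    have "(\<Sum>i\<in>{a..<a + b}. indicator (if i < a then B else C) (z i)) = (\<Sum>i\<in>{a..<a + b}. of_bool (z i \<in> C) :: real)"
      by (rule sum.cong) (auto simp: indicator_def)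
    also have "\<dots> = real (card ({a..<a + b} \<inter> {i. z i \<in> C}))" by simp
    also have "{a..<a + b} \<inter> {i. z i \<in> C} = {i. a \<le> i \<and> i < a + b \<and> z i \<in> C}" by auto
    finally show ?thesis .
  qed
  ultimately show ?thesis by (simp only: sum_pooled)
qed

lemma measurable_weighted_count:
  assumes [simp]: "B \<in> sets borel" "C \<in> sets borel"
  shows "(\<lambda>z. u * real (count_x z B) + v * real (count_y z C)) \<in> borel_measurable \<Omega>"
  unfolding weighted_count[symmetric]
proof (rule borel_measurable_sum)
  fix i assume "i \<in> {..<a + b}"
  then have m: "(\<lambda>z. z i) \<in> borel_measurable \<Omega>" by (intro measurable_coordinate) simp
  have "(if i < a then B else C) \<in> sets borel" by simp
  from measurable_compose[OF m borel_measurable_indicator[OF this]]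
  show "(\<lambda>z. (if i < a then u else v) * indicator (if i < a then B else C) (z i)) \<in> borel_measurable \<Omega>"
    by (rule borel_measurable_times[OF borel_measurable_const])
qed

lemma pooled_mean:
  "(\<Sum>i<a + b. (if i < a then u else v) * measure (if i < a then P else Q) (if i < a then B else C))
    = u * (real a * measure P B) + v * (real b * measure Q C)"
  by (simp add: sum_pooled)

lemma pooled_Hoeffding:
  assumes [simp]: "B \<in> sets borel" "C \<in> sets borel"
  shows "\<P>(z in \<Omega>. u * real (count_x z B) + v * real (count_y z C) \<ge> c)
    \<le> exp (- c + (u * (real a * measure P B) + v * (real b * measure Q C)) + (u\<^sup>2 * real a + v\<^sup>2 * real b) / 8)"
proof -
  have sq: "(\<Sum>i<a + b. (if i < a then u else v)\<^sup>2) = u\<^sup>2 * real a + v\<^sup>2 * real b"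
    using sum_pooled[of "u\<^sup>2" "v\<^sup>2" "\<lambda>_. 1"] by (simp add: if_distrib[of "\<lambda>x. x\<^sup>2"] cong: if_cong)
  show ?thesis
    using chernoff_Hoeffding[of "\<lambda>i. if i < a then B else C" c "\<lambda>i. if i < a then u else v"]
    unfolding weighted_count pooled_mean sq by simp
qed

lemma pooled_Bernstein:
  assumes [simp]: "B \<in> sets borel" "C \<in> sets borel" and w: "\<bar>u\<bar> \<le> w" "\<bar>v\<bar> \<le> w"
  shows "\<P>(z in \<Omega>. u * real (count_x z B) + v * real (count_y z C) \<ge> c)
    \<le> exp (- c + (u * (real a * measure P B) + v * (real b * measure Q C))
        + exp w / 2 * (u\<^sup>2 * (real a * (measure P B * (1 - measure P B)))
           + v\<^sup>2 * (real b * (measure Q C * (1 - measure Q C)))))"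
proof -
  have sq: "(\<Sum>i<a + b. (if i < a then u else v)\<^sup>2 * (measure (if i < a then P else Q) (if i < a then B else C)
      * (1 - measure (if i < a then P else Q) (if i < a then B else C))))
    = u\<^sup>2 * (real a * (measure P B * (1 - measure P B))) + v\<^sup>2 * (real b * (measure Q C * (1 - measure Q C)))"
    using sum_pooled[of "u\<^sup>2" "v\<^sup>2" "\<lambda>i. measure (if i < a then P else Q) (if i < a then B else C)
      * (1 - measure (if i < a then P else Q) (if i < a then B else C))"]
    by (simp add: if_distrib[of "\<lambda>x. x\<^sup>2"] cong: if_cong)
  show ?thesis
    using chernoff_Bernstein[of "\<lambda>i. if i < a then B else C" "\<lambda>i. if i < a then u else v" w c] w
    unfolding weighted_count pooled_mean sq by simp
qed

lemma ecdf_split_at: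
  "ecdf a (fst (split_at a z)) t = real (count_x z {..t}) / real a"
  "ecdf b (snd (split_at a z)) t = real (count_y z {..t}) / real b"
proof -
  show "ecdf a (fst (split_at a z)) t = real (count_x z {..t}) / real a"
    by (simp add: ecdf_def split_at_def)
  have bij: "bij_betw (\<lambda>i. a + i) {i. i < b \<and> z (a + i) \<le> t} {i. a \<le> i \<and> i < a + b \<and> z i \<in> {..t}}"
    by (rule bij_betwI[where g="\<lambda>i. i - a"]) auto
  show "ecdf b (snd (split_at a z)) t = real (count_y z {..t}) / real b"
    unfolding ecdf_def split_at_def snd_conv bij_betw_same_card[OF bij] ..
qed

lemma V_gt_iff_counts:
  "V_stat a b (split_at a z) > w
    \<longleftrightarrow> (\<exists>t. \<sigma> * (real (count_y z {..t}) / real b - real (count_x z {..t}) / real a) > w)"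
  using V_stat_gt_iff(1)[OF sizes, of w "fst (split_at a z)" "snd (split_at a z)"]
  by (simp add: \<sigma>_def ecdf_split_at)

lemma V_event[measurable]: "{z \<in> space \<Omega>. V_stat a b (split_at a z) > w} \<in> sets \<Omega>"
proof -
  have "(\<lambda>z. V_stat a b (split_at a z)) \<in> borel_measurable \<Omega>"
    using measurable_V_stat[OF sizes] measurable_cong_sets[OF sets_\<Omega> refl] by blast
  then show ?thesis by measurable
qed

lemma T_event: "{z \<in> space \<Omega>. T_stat a b d p (split_at a z) > w} \<in> sets \<Omega>"
proof -
  have "(\<lambda>z. T_stat a b d p (split_at a z)) \<in> borel_measurable \<Omega>"
    using measurable_T_stat[of a b d p] measurable_cong_sets[OF sets_\<Omega> refl] by blast
  then show ?thesis by measurable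
qed

text \<open>The supremum over a cell of the grid \<open>F t = k / N\<close> is bounded by evaluating the empirical
  distribution function of the second sample at its upper and that of the first sample at its
  lower end, which costs only \<open>1 / N\<close> in the mean.\<close>

lemma V_upper_tail:
  assumes d: "\<And>z. cdf Q z - cdf P z \<le> d" and x: "\<sigma> * d + 1 \<le> x"
  shows "\<P>(z in \<Omega>. V_stat a b (split_at a z) > x) \<le> real (a + b) * exp (- 2 * (x - \<sigma> * d - 1)\<^sup>2)"
proof -
  define N where "N = a + b"
  define y where "y = x - \<sigma> * d - 1"
  have y: "0 \<le> y" using x by (simp add: y_def)
  have N: "0 < N" using sizes by (simp add: N_def)
  have "\<exists>t. cdf P t = real k / real N" if "k \<in> {1..<N}" for k
  proof -
    have "0 < real k / real N" "real k / real N < 1" using that by auto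
    then show ?thesis using cdf_surj[OF laws(1) cont(1)] by metis
  qed
  then obtain \<tau> where \<tau>: "\<And>k. k \<in> {1..<N} \<Longrightarrow> cdf P (\<tau> k) = real k / real N" by metis
  define B where "B k = (if k = 1 then {} else {..\<tau> (k - 1)})" for k
  \<comment> \<open>For \<open>t\<close> in the \<open>k\<close>-th cell, \<open>{..t}\<close> lies between \<open>B k\<close> and \<open>C k\<close>; the first and the last cell are unbounded.\<close>
  define C where "C k = (if k = N then UNIV else {..\<tau> k})" for k
  have [simp]: "B k \<in> sets borel" "C k \<in> sets borel" for k by (auto simp: B_def C_def)
  have cell: "\<exists>k\<in>{1..N}. B k \<subseteq> {..t} \<and> {..t} \<subseteq> C k" for t
  proof -
    define S where "S = insert 1 {Suc l |l. l \<in> {1..<N} \<and> \<tau> l \<le> t}"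
    have S: "finite S" "S \<noteq> {}" unfolding S_def by auto
    define k where "k = Max S"
    have kS: "k \<in> S" using S by (simp add: k_def)
    have "k \<in> {1..N}" using kS N by (auto simp: S_def)
    moreover have "B k \<subseteq> {..t}" using kS by (auto simp: S_def B_def)
    moreover have "{..t} \<subseteq> C k"
    proof (cases "k = N")
      case False
      have "\<not> \<tau> k \<le> t"
      proof
        assume "\<tau> k \<le> t"
        then have "Suc k \<in> S" using False \<open>k \<in> {1..N}\<close> by (auto simp: S_def)
        then have "Suc k \<le> k" using Max_ge[OF S(1)] by (simp add: k_def)
        then show False by simp
      qed
      with False show ?thesis by (auto simp: C_def)
    qed (simp add: C_def)
    ultimately show ?thesis by blast
  qed
  have d0: "0 \<le> d"
  proof (rule tendsto_le[OF _ tendsto_const])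
    show "((\<lambda>z. cdf Q z - cdf P z) \<longlongrightarrow> 0) at_bot"
      using tendsto_diff[OF Y.cdf_lim_at_bot X.cdf_lim_at_bot] by simp
  qed (use d in \<open>auto intro: always_eventually\<close>)
  have gap: "measure Q (C k) - measure P (B k) \<le> d + 1 / real N" if k: "k \<in> {1..N}" for k
  proof -
    have B: "measure P (B k) = (real k - 1) / real N"
    proof (cases "k = 1")
      case False
      then have "k - 1 \<in> {1..<N}" using k by auto
      from \<tau>[OF this] False k show ?thesis by (simp add: B_def cdf_def2[symmetric] of_nat_diff)
    qed (simp add: B_def)
    have C: "measure Q (C k) \<le> real k / real N + d"
    proof (cases "k = N")
      case True
      then show ?thesis using N d0 by (simp add: C_def Y.prob_space[simplified])
    next
      case False
      then show ?thesis using \<tau>[of k] k d[of "\<tau> k"] by (simp add: C_def cdf_def2[symmetric])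
    qed
    show ?thesis using B C by (simp add: diff_divide_distrib)
  qed
  \<comment> \<open>The weight \<open>4 y\<close> minimises the Hoeffding exponent \<open>v\<^sup>2 / 8 - v y\<close>.\<close>
  define E where "E k = {z \<in> space \<Omega>. (- 4 * y * \<sigma> / real a) * real (count_x z (B k))
      + (4 * y * \<sigma> / real b) * real (count_y z (C k)) \<ge> 4 * y * x}" for k
  have \<sigma>N: "\<sigma> / real N \<le> 1"
  proof -
    have "\<sigma>\<^sup>2 \<le> (real N)\<^sup>2"
    proof -
      have "real a * real b \<le> real N * real N * 1" unfolding N_def by (simp add: mult_mono)
      also have "\<dots> \<le> real N * real N * real N" using N by (intro mult_left_mono) auto
      finally show ?thesis using N unfolding \<sigma>_sq N_def[symmetric] by (simp add: power2_eq_square divide_le_eq)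
    qed
    then have "\<sigma> \<le> real N" using \<sigma>_pos by (simp add: power2_le_iff_abs_le)
    then show ?thesis using N by (simp add: divide_le_eq)
  qed
  have PE: "measure \<Omega> (E k) \<le> exp (- 2 * y\<^sup>2)" if k: "k \<in> {1..N}" for k
  proof -
    have "measure \<Omega> (E k) \<le> exp (- (4 * y * x) + ((- 4 * y * \<sigma> / real a) * (real a * measure P (B k))
        + (4 * y * \<sigma> / real b) * (real b * measure Q (C k)))
        + ((- 4 * y * \<sigma> / real a)\<^sup>2 * real a + (4 * y * \<sigma> / real b)\<^sup>2 * real b) / 8)"
      unfolding E_def by (rule pooled_Hoeffding) auto
    also have "(- 4 * y * \<sigma> / real a) * (real a * measure P (B k))
        + (4 * y * \<sigma> / real b) * (real b * measure Q (C k)) = 4 * y * \<sigma> * (measure Q (C k) - measure P (B k))"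
      using sizes by (simp add: field_simps)
    also have "(- 4 * y * \<sigma> / real a)\<^sup>2 * real a + (4 * y * \<sigma> / real b)\<^sup>2 * real b
        = 16 * y\<^sup>2 * (\<sigma>\<^sup>2 / real a + \<sigma>\<^sup>2 / real b)"
      using sizes by (simp add: power2_eq_square field_simps)
    also have "\<sigma>\<^sup>2 / real a + \<sigma>\<^sup>2 / real b = 1" by (rule \<sigma>_inverse)
    also have "exp (- (4 * y * x) + 4 * y * \<sigma> * (measure Q (C k) - measure P (B k)) + 16 * y\<^sup>2 * 1 / 8)
        \<le> exp (- 2 * y\<^sup>2)"
    proof -
      have "4 * y * \<sigma> * (measure Q (C k) - measure P (B k)) \<le> 4 * y * \<sigma> * (d + 1 / real N)"
        using y \<sigma>_pos gap[OF k] by (intro mult_left_mono) auto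
      also have "\<dots> = 4 * y * (\<sigma> * d + \<sigma> / real N)" by (simp add: algebra_simps)
      also have "\<dots> \<le> 4 * y * (\<sigma> * d + 1)" using y \<sigma>N by (intro mult_left_mono) auto
      also have "\<dots> = 4 * y * x - 4 * y\<^sup>2" by (simp add: y_def power2_eq_square algebra_simps)
      finally show ?thesis by simp
    qed
    finally show ?thesis .
  qed
  have Em: "E k \<in> sets \<Omega>" for k
    unfolding E_def by (rule borel_measurable_le[OF borel_measurable_const measurable_weighted_count]) simp_all
  have "\<P>(z in \<Omega>. V_stat a b (split_at a z) > x) \<le> measure \<Omega> (\<Union>k\<in>{1..N}. E k)"
  proof (rule P.finite_measure_mono)
    show "{z \<in> space \<Omega>. V_stat a b (split_at a z) > x} \<subseteq> (\<Union>k\<in>{1..N}. E k)"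
    proof
      fix z assume "z \<in> {z \<in> space \<Omega>. V_stat a b (split_at a z) > x}"
      then obtain t where z: "z \<in> space \<Omega>"
        and t: "\<sigma> * (real (count_y z {..t}) / real b - real (count_x z {..t}) / real a) > x"
        by (auto simp: V_gt_iff_counts)
      obtain k where k: "k \<in> {1..N}" "B k \<subseteq> {..t}" "{..t} \<subseteq> C k" using cell by blast
      have "count_y z {..t} \<le> count_y z (C k)" "count_x z (B k) \<le> count_x z {..t}"
        using k by (auto intro!: card_mono)
      then have "real (count_y z {..t}) / real b - real (count_x z {..t}) / real a
          \<le> real (count_y z (C k)) / real b - real (count_x z (B k)) / real a"
        by (intro diff_mono divide_right_mono) auto
      then have "\<sigma> * (real (count_y z {..t}) / real b - real (count_x z {..t}) / real a)
          \<le> \<sigma> * (real (count_y z (C k)) / real b - real (count_x z (B k)) / real a)"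
        using \<sigma>_pos by (intro mult_left_mono) auto
      then have "x \<le> \<sigma> * (real (count_y z (C k)) / real b - real (count_x z (B k)) / real a)"
        using t by linarith
      then have "4 * y * x \<le> 4 * y * (\<sigma> * (real (count_y z (C k)) / real b - real (count_x z (B k)) / real a))"
        using y by (intro mult_left_mono) auto
      then have "z \<in> E k" using z by (simp add: E_def algebra_simps)
      with k show "z \<in> (\<Union>k\<in>{1..N}. E k)" by blast
    qed
    show "(\<Union>k\<in>{1..N}. E k) \<in> sets \<Omega>" using Em by blast
  qed
  also have "\<dots> \<le> (\<Sum>k\<in>{1..N}. measure \<Omega> (E k))"
    using Em by (intro P.finite_measure_subadditive_finite) auto
  also have "\<dots> \<le> (\<Sum>k\<in>{1..N}. exp (- 2 * y\<^sup>2))" by (intro sum_mono PE)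
  finally show ?thesis by (simp add: N_def y_def)
qed

text \<open>The supremum is at least the difference at the single point \<open>t\<close>.\<close>

lemma V_lower_tail:
  assumes d: "d \<le> cdf Q t - cdf P t" and x: "x \<le> \<sigma> * d"
  shows "1 - exp (- 2 * (\<sigma> * d - x)\<^sup>2) \<le> \<P>(z in \<Omega>. V_stat a b (split_at a z) > x)"
proof -
  define y where "y = \<sigma> * d - x"
  have y: "0 \<le> y" using x by (simp add: y_def)
  define E where "E = {z \<in> space \<Omega>. (4 * y * \<sigma> / real a) * real (count_x z {..t})
      + (- 4 * y * \<sigma> / real b) * real (count_y z {..t}) \<ge> - 4 * y * x}"
  have "measure \<Omega> E \<le> exp (- (- 4 * y * x) + ((4 * y * \<sigma> / real a) * (real a * measure P {..t})
      + (- 4 * y * \<sigma> / real b) * (real b * measure Q {..t}))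
      + ((4 * y * \<sigma> / real a)\<^sup>2 * real a + (- 4 * y * \<sigma> / real b)\<^sup>2 * real b) / 8)"
    unfolding E_def by (rule pooled_Hoeffding) auto
  also have "(4 * y * \<sigma> / real a) * (real a * measure P {..t})
      + (- 4 * y * \<sigma> / real b) * (real b * measure Q {..t}) = - 4 * y * \<sigma> * (cdf Q t - cdf P t)"
    using sizes by (simp add: field_simps cdf_def2)
  also have "(4 * y * \<sigma> / real a)\<^sup>2 * real a + (- 4 * y * \<sigma> / real b)\<^sup>2 * real b
      = 16 * y\<^sup>2 * (\<sigma>\<^sup>2 / real a + \<sigma>\<^sup>2 / real b)"
    using sizes by (simp add: power2_eq_square field_simps)
  also have "\<sigma>\<^sup>2 / real a + \<sigma>\<^sup>2 / real b = 1" by (rule \<sigma>_inverse)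
  also have "exp (- (- 4 * y * x) + - 4 * y * \<sigma> * (cdf Q t - cdf P t) + 16 * y\<^sup>2 * 1 / 8) \<le> exp (- 2 * y\<^sup>2)"
  proof -
    have "4 * y * \<sigma> * d \<le> 4 * y * \<sigma> * (cdf Q t - cdf P t)"
      using y \<sigma>_pos d by (intro mult_left_mono) auto
    moreover have "4 * y * \<sigma> * d = 4 * y * x + 4 * y\<^sup>2" by (simp add: y_def power2_eq_square algebra_simps)
    ultimately show ?thesis by simp
  qed
  finally have E: "measure \<Omega> E \<le> exp (- 2 * y\<^sup>2)" .
  have Em: "E \<in> sets \<Omega>"
    unfolding E_def by (rule borel_measurable_le[OF borel_measurable_const measurable_weighted_count]) simp_all
  have "1 - measure \<Omega> E = measure \<Omega> (space \<Omega> - E)" using Em by (simp add: P.prob_compl)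
  also have "\<dots> \<le> \<P>(z in \<Omega>. V_stat a b (split_at a z) > x)"
  proof (rule P.finite_measure_mono)
    show "space \<Omega> - E \<subseteq> {z \<in> space \<Omega>. x < V_stat a b (split_at a z)}"
    proof
      fix z assume "z \<in> space \<Omega> - E"
      then have z: "z \<in> space \<Omega>"
        and less: "(4 * y * \<sigma> / real a) * real (count_x z {..t}) + (- 4 * y * \<sigma> / real b) * real (count_y z {..t}) < - 4 * y * x"
        by (auto simp: E_def)
      have "4 * y * x < 4 * y * (\<sigma> * (real (count_y z {..t}) / real b - real (count_x z {..t}) / real a))"
        using less by (simp add: algebra_simps)
      then have "x < \<sigma> * (real (count_y z {..t}) / real b - real (count_x z {..t}) / real a)"
        using y by (simp add: mult_less_cancel_left)
      then show "z \<in> {z \<in> space \<Omega>. x < V_stat a b (split_at a z)}"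
        using z by (auto simp: V_gt_iff_counts)
    qed
  qed (rule V_event)
  finally show ?thesis using E by (simp add: y_def)
qed

end

section \<open>Tail bounds for the rank counts\<close>

context real_product
begin

lemma measurable_y_low: "(\<lambda>z. y_low a z N k) \<in> \<Omega> \<rightarrow>\<^sub>M count_space UNIV"
  unfolding y_low_def
proof (rule measurable_card)
  fix i
  show "{z \<in> space \<Omega>. i \<in> {i. a \<le> i \<and> i < N \<and> rank_in N z i \<le> k}} \<in> sets \<Omega>"
  proof (cases "a \<le> i \<and> i < N")
    case True
    then have m: "(\<lambda>z. rank_in N z i) \<in> \<Omega> \<rightarrow>\<^sub>M count_space UNIV"
      using measurable_rank_in[of i N] measurable_cong_sets[OF sets_\<Omega> refl] by blast
    have "(\<lambda>z. rank_in N z i) -` {..k} \<inter> space \<Omega> \<in> sets \<Omega>"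
      by (rule measurable_sets[OF m]) (rule sets_UNIV)
    also have "(\<lambda>z. rank_in N z i) -` {..k} \<inter> space \<Omega> = {z \<in> space \<Omega>. i \<in> {i. a \<le> i \<and> i < N \<and> rank_in N z i \<le> k}}"
      using True by auto
    finally show ?thesis .
  next
    case False
    then have e: "{z \<in> space \<Omega>. i \<in> {i. a \<le> i \<and> i < N \<and> rank_in N z i \<le> k}} = {}" by auto
    show ?thesis unfolding e by (rule sets.empty_sets)
  qed
qed

lemma y_low_event: "{z \<in> space \<Omega>. Pr (y_low a z N k)} \<in> sets \<Omega>"
proof -
  have "(\<lambda>z. y_low a z N k) -` {n. Pr n} \<inter> space \<Omega> \<in> sets \<Omega>"
    by (rule measurable_sets[OF measurable_y_low]) (rule sets_UNIV)
  also have "(\<lambda>z. y_low a z N k) -` {n. Pr n} \<inter> space \<Omega> = {z \<in> space \<Omega>. Pr (y_low a z N k)}" by auto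
  finally show ?thesis .
qed

end

context two_samples
begin

lemma count_add: "count_x z {..t} + count_y z {..t} = card {i. i < a + b \<and> z i \<le> t}"
proof -
  have "{i. i < a + b \<and> z i \<le> t} = {i. i < a \<and> z i \<in> {..t}} \<union> {i. a \<le> i \<and> i < a + b \<and> z i \<in> {..t}}"
    by auto
  moreover have "card ({i. i < a \<and> z i \<in> {..t}} \<union> {i. a \<le> i \<and> i < a + b \<and> z i \<in> {..t}})
      = count_x z {..t} + count_y z {..t}"
    by (rule card_Un_disjoint) auto
  ultimately show ?thesis by (simp only:)
qed

text \<open>If \<open>k\<close> observations lie below a threshold and \<open>y\<close> of them come from the second sample, the difference
  of the empirical distribution functions is a multiple of the surplus of \<open>y\<close> over its expected share.
  This is the common ground of the two statistics.\<close>

lemma frequency_difference: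
  "y / real b - (k - y) / real a = (y - real b * (k / real (a + b))) / \<sigma>\<^sup>2"
proof -
  have "(y - real b * (k / real (a + b))) / \<sigma>\<^sup>2
      = ((y - real b * (k / real (a + b))) * real (a + b)) / (real a * real b)"
    by (simp add: \<sigma>_sq)
  also have "(y - real b * (k / real (a + b))) * real (a + b) = y * (real a + real b) - real b * k"
    using sizes by (simp add: left_diff_distrib)
  also have "(y * (real a + real b) - real b * k) / (real a * real b) = y / real b - (k - y) / real a"
    using sizes by (simp add: field_simps)
  finally show ?thesis ..
qed

lemma inverse_sum: "1 / real a + 1 / real b = 1 / \<sigma>\<^sup>2"
proof -
  have "\<sigma>\<^sup>2 * (1 / real a + 1 / real b) = 1" using \<sigma>_inverse by (simp add: distrib_left)
  then show ?thesis using \<sigma>_pos by (simp add: field_simps)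
qed

text \<open>Under equal laws the rank count has the hypergeometric distribution. By \<open>prob_low_set_in_le\<close> it is
  dominated, up to a factor \<open>N + 1\<close>, by the counts below the \<open>k / N\<close>-quantile; there the surplus is a
  weighted sum of independent indicators of variance \<open>\<sigma>\<^sup>2 q (1 - q)\<close>, and Bernstein's bound yields the
  Gaussian exponent \<open>1 / 2\<close> in the limit \<open>w \<longlongrightarrow> 0\<close>. The conditioning on the total count gives the variance
  of the difference of both samples, smaller than that of the second sample alone.\<close>

lemma y_low_null_tail:
  assumes QP: "Q = P" and k: "0 < k" "k < a + b" and q: "q = real k / real (a + b)"
    and s: "0 < s" and w: "s / (q * (1 - q) * real a) \<le> w" "s / (q * (1 - q) * real b) \<le> w"
  shows "\<P>(z in \<Omega>. real (y_low a z (a + b) k) \<ge> real b * q + s)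
    \<le> (real (a + b) + 1) * exp (- (s\<^sup>2 / (\<sigma>\<^sup>2 * (q * (1 - q)))) * (1 - exp w / 2))"
proof -
  define N where "N = a + b"
  interpret I: iid_product "a + b" P
    by (intro iid_product.intro real_product.intro iid_product_axioms.intro) (use laws cont in auto)
  have \<Omega>: "Pi\<^sub>M {..<a + b} (\<lambda>_. P) = \<Omega>" unfolding QP if_cancel ..
  have q01: "0 < q" "q < 1" using k by (auto simp: q)
  have alg: "(- r / A) * (K - Y) + (r / B) * Y = r * (Y / B - (K - Y) / A)" for r A B K Y :: real
    by (simp add: algebra_simps)
  obtain t where t: "cdf P t = q" using cdf_surj[OF laws(1) cont(1) q01] .
  have alg2: "- A + 0 + e / 2 * A = - A * (1 - e / 2)" for A e :: real
    by (simp add: algebra_simps)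
  define \<S> where "\<S> = {K. K \<subseteq> {..<a + b} \<and> card K = k \<and> real b * q + s \<le> real (card (K \<inter> {a..<a + b}))}"
  \<comment> \<open>The minimiser of the quadratic exponent \<open>(q (1 - q) r\<^sup>2 / 2 - r s) / \<sigma>\<^sup>2\<close>.\<close>
  define r\<^sub>0 where "r\<^sub>0 = s / (q * (1 - q))"
  have r\<^sub>0: "0 < r\<^sub>0" using s q01 by (simp add: r\<^sub>0_def)
  have finS: "finite \<S>" by (rule finite_subset[of _ "Pow {..<a + b}"]) (auto simp: \<S>_def)
  have low: "{z \<in> space \<Omega>. low_set (a + b) z k \<in> \<S>} \<in> sets \<Omega>"
  proof -
    have "(\<Union>K\<in>\<S>. {z \<in> space \<Omega>. low_set (a + b) z k = K}) \<in> sets \<Omega>"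
      using finS I.low_set_event[of k] unfolding \<Omega> by (intro sets.finite_UN) auto
    also have "(\<Union>K\<in>\<S>. {z \<in> space \<Omega>. low_set (a + b) z k = K}) = {z \<in> space \<Omega>. low_set (a + b) z k \<in> \<S>}" by auto
    finally show ?thesis .
  qed
  have "\<P>(z in \<Omega>. real (y_low a z (a + b) k) \<ge> real b * q + s) \<le> \<P>(z in \<Omega>. low_set (a + b) z k \<in> \<S>)"
  proof (rule P.finite_measure_mono_AE[OF _ low])
    show "AE z in \<Omega>. z \<in> {z \<in> space \<Omega>. real b * q + s \<le> real (y_low a z (a + b) k)}
        \<longrightarrow> z \<in> {z \<in> space \<Omega>. low_set (a + b) z k \<in> \<S>}"
      using AE_inj
    proof (rule AE_mp, intro AE_I2 impI)
      fix z assume inj: "inj_on z {..<a + b}" and z: "z \<in> {z \<in> space \<Omega>. real b * q + s \<le> real (y_low a z (a + b) k)}"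
      have "low_set (a + b) z k \<inter> {a..<a + b} = {i. a \<le> i \<and> i < a + b \<and> rank_in (a + b) z i \<le> k}"
        by (auto simp: low_set_def)
      then have "card (low_set (a + b) z k \<inter> {a..<a + b}) = y_low a z (a + b) k" by (simp add: y_low_def)
      moreover have "card (low_set (a + b) z k) = k"
        using card_rank_le[OF inj, of k] k by (simp add: low_set_def)
      moreover have "low_set (a + b) z k \<subseteq> {..<a + b}" by (auto simp: low_set_def)
      ultimately show "z \<in> {z \<in> space \<Omega>. low_set (a + b) z k \<in> \<S>}" using z by (simp add: \<S>_def)
    qed
  qed
  also have "\<dots> \<le> (real (a + b) + 1) * \<P>(z in \<Omega>. {i. i < a + b \<and> z i \<le> t} \<in> \<S>)"
    using I.prob_low_set_in_le[OF k t[unfolded q], of \<S>] unfolding \<Omega> by (auto simp: \<S>_def)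
  also have "\<dots> \<le> (real (a + b) + 1) * exp (- (s\<^sup>2 / (\<sigma>\<^sup>2 * (q * (1 - q)))) * (1 - exp w / 2))"
  proof (rule mult_left_mono)
  have "\<P>(z in \<Omega>. {i. i < a + b \<and> z i \<le> t} \<in> \<S>)
      \<le> \<P>(z in \<Omega>. (- r\<^sub>0 / real a) * real (count_x z {..t}) + (r\<^sub>0 / real b) * real (count_y z {..t}) \<ge> r\<^sub>0 * s / \<sigma>\<^sup>2)"
  proof (rule P.finite_measure_mono)
    show "{z \<in> space \<Omega>. {i. i < a + b \<and> z i \<le> t} \<in> \<S>} \<subseteq> {z \<in> space \<Omega>. r\<^sub>0 * s / \<sigma>\<^sup>2
        \<le> (- r\<^sub>0 / real a) * real (count_x z {..t}) + (r\<^sub>0 / real b) * real (count_y z {..t})}"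
    proof safe
      fix z assume z: "{i. i < a + b \<and> z i \<le> t} \<in> \<S>"
      have "{i. i < a + b \<and> z i \<le> t} \<inter> {a..<a + b} = {i. a \<le> i \<and> i < a + b \<and> z i \<in> {..t}}" by auto
      then have y: "real b * q + s \<le> real (count_y z {..t})" using z by (simp add: \<S>_def)
      have "count_x z {..t} + count_y z {..t} = k"
        unfolding count_add using z by (simp add: \<S>_def)
      then have x: "real (count_x z {..t}) = real k - real (count_y z {..t})" by linarith
      have "(- r\<^sub>0 / real a) * real (count_x z {..t}) + (r\<^sub>0 / real b) * real (count_y z {..t})
          = r\<^sub>0 * (real (count_y z {..t}) / real b - (real k - real (count_y z {..t})) / real a)"
        unfolding x by (rule alg)
      also have "\<dots> = r\<^sub>0 * ((real (count_y z {..t}) - real b * q) / \<sigma>\<^sup>2)"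
        by (simp only: frequency_difference q)
      also have "\<dots> \<ge> r\<^sub>0 * (s / \<sigma>\<^sup>2)"
        using y r\<^sub>0 by (intro mult_left_mono divide_right_mono) auto
      finally show "r\<^sub>0 * s / \<sigma>\<^sup>2 \<le> (- r\<^sub>0 / real a) * real (count_x z {..t}) + (r\<^sub>0 / real b) * real (count_y z {..t})"
        by simp
    qed
    show "{z \<in> space \<Omega>. r\<^sub>0 * s / \<sigma>\<^sup>2
        \<le> (- r\<^sub>0 / real a) * real (count_x z {..t}) + (r\<^sub>0 / real b) * real (count_y z {..t})} \<in> sets \<Omega>"
      by (rule borel_measurable_le[OF borel_measurable_const measurable_weighted_count]) simp_all
  qed
  also have "\<dots> \<le> exp (- (r\<^sub>0 * s / \<sigma>\<^sup>2) + ((- r\<^sub>0 / real a) * (real a * measure P {..t}) + (r\<^sub>0 / real b) * (real b * measure Q {..t}))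
      + exp w / 2 * ((- r\<^sub>0 / real a)\<^sup>2 * (real a * (measure P {..t} * (1 - measure P {..t})))
           + (r\<^sub>0 / real b)\<^sup>2 * (real b * (measure Q {..t} * (1 - measure Q {..t})))))"
  proof (rule pooled_Bernstein)
    have "r\<^sub>0 / real a \<le> w" "r\<^sub>0 / real b \<le> w" using w by (simp_all add: r\<^sub>0_def)
    then show "\<bar>- r\<^sub>0 / real a\<bar> \<le> w" "\<bar>r\<^sub>0 / real b\<bar> \<le> w" using r\<^sub>0 by simp_all
  qed simp_all
  also have "(- r\<^sub>0 / real a) * (real a * measure P {..t}) + (r\<^sub>0 / real b) * (real b * measure Q {..t}) = 0"
    using sizes by (simp add: QP)
  also have "(- r\<^sub>0 / real a)\<^sup>2 * (real a * (measure P {..t} * (1 - measure P {..t})))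
           + (r\<^sub>0 / real b)\<^sup>2 * (real b * (measure Q {..t} * (1 - measure Q {..t})))
      = r\<^sub>0\<^sup>2 * (q * (1 - q)) * (1 / real a + 1 / real b)"
    using sizes by (simp add: QP t[unfolded cdf_def2] power2_eq_square field_simps)
  also have "\<dots> = s\<^sup>2 / (\<sigma>\<^sup>2 * (q * (1 - q)))"
    unfolding inverse_sum r\<^sub>0_def using q01 by (simp add: power2_eq_square)
  also have "r\<^sub>0 * s / \<sigma>\<^sup>2 = s\<^sup>2 / (\<sigma>\<^sup>2 * (q * (1 - q)))"
    by (simp add: r\<^sub>0_def power2_eq_square)
  also have "- (s\<^sup>2 / (\<sigma>\<^sup>2 * (q * (1 - q)))) + 0 + exp w / 2 * (s\<^sup>2 / (\<sigma>\<^sup>2 * (q * (1 - q))))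
      = - (s\<^sup>2 / (\<sigma>\<^sup>2 * (q * (1 - q)))) * (1 - exp w / 2)"
    by (rule alg2)
  finally show "\<P>(z in \<Omega>. {i. i < a + b \<and> z i \<le> t} \<in> \<S>)
      \<le> exp (- (s\<^sup>2 / (\<sigma>\<^sup>2 * (q * (1 - q)))) * (1 - exp w / 2))" .
  qed simp
  finally show ?thesis .
qed

text \<open>Both counts are binomial and deviate from their means by the same amount \<open>s\<close> in opposite directions.
  The exponents \<open>s\<^sup>2 / (2 a q (1 - q))\<close> and \<open>s\<^sup>2 / (2 b q (1 - q))\<close> add up to the one with
  \<open>\<sigma>\<^sup>2\<close> by \<open>inverse_sum\<close>.\<close>

lemma counts_null_lower:
  assumes QP: "Q = P" and t: "cdf P t = q" and q: "q = real k / real (a + b)" "1 / 4 \<le> q" "q \<le> 3 / 4"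
    and s: "s = real k2 - real b * q" "\<bar>s\<bar> \<le> real a / 8" "\<bar>s\<bar> \<le> real b / 8"
  shows "k2 \<le> k"
    and "exp (- (s\<^sup>2 / (2 * \<sigma>\<^sup>2 * (q * (1 - q)))) * (1 + 100 * (\<bar>s\<bar> / real a + \<bar>s\<bar> / real b))) / (real (a + b) + 1)\<^sup>2
      \<le> \<P>(z in \<Omega>. count_x z {..t} = k - k2 \<and> count_y z {..t} = k2)"
proof -
  interpret I: iid_product "a + b" P
    by (intro iid_product.intro real_product.intro iid_product_axioms.intro) (use laws cont in auto)
  have \<Omega>: "Pi\<^sub>M {..<a + b} (\<lambda>_. P) = \<Omega>" unfolding QP if_cancel ..
  have "(real a + real b) * q = real k" using sizes by (simp add: q(1))
  then have kq: "real k = real a * q + real b * q" by (simp only: distrib_right)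
  have k1: "real k - real k2 = real a * q - s" using kq s(1) by simp
  have aq: "real a / 4 \<le> real a * q" "real a * q \<le> real a * (3 / 4)" "real b / 4 \<le> real b * q" "real b * q \<le> real b * (3 / 4)"
    using mult_left_mono[OF q(2), of "real a"] mult_left_mono[OF q(3), of "real a"]
      mult_left_mono[OF q(2), of "real b"] mult_left_mono[OF q(3), of "real b"] by simp_all
  have "0 < real a * q - s" using aq(1) s(2) sizes by linarith
  then show le: "k2 \<le> k" using k1 by linarith
  have k1': "real (k - k2) = real a * q - s" using k1 le by (simp add: of_nat_diff)
  have "real (k - k2) \<le> real a" "real k2 \<le> real b"
    using k1' s aq sizes by linarith+
  then have kab: "k - k2 \<le> a" "k2 \<le> b" by auto
  define E where "E D = D\<^sup>2 / (2 * (q * (1 - q))) * (1 + 100 * \<bar>D\<bar>)" for D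
  have A: "exp (- real a * E (- s / real a)) / (real a + 1)
      \<le> real (a choose (k - k2)) * q ^ (k - k2) * (1 - q) ^ (a - (k - k2))"
    unfolding E_def
  proof (rule binomial_pmf_lower)
    show "- s / real a = real (k - k2) / real a - q" using sizes unfolding k1' by (simp add: diff_divide_distrib)
    show "\<bar>- s / real a\<bar> \<le> 1 / 8" using s(2) sizes by (simp add: divide_le_eq)
  qed (use q sizes in auto)
  have B: "exp (- real b * E (s / real b)) / (real b + 1)
      \<le> real (b choose k2) * q ^ k2 * (1 - q) ^ (b - k2)"
    unfolding E_def
  proof (rule binomial_pmf_lower)
    show "s / real b = real k2 / real b - q" using sizes unfolding s(1) by (simp add: diff_divide_distrib)
    show "\<bar>s / real b\<bar> \<le> 1 / 8" using s(3) sizes by (simp add: divide_le_eq)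
  qed (use q sizes in auto)
  have q01: "0 < q * (1 - q)" using q(2,3) by (intro mult_pos_pos) linarith+
  have EE: "real a * E (- s / real a) + real b * E (s / real b)
      \<le> s\<^sup>2 / (2 * \<sigma>\<^sup>2 * (q * (1 - q))) * (1 + 100 * (\<bar>s\<bar> / real a + \<bar>s\<bar> / real b))"
  proof -
    have "real n * E (r / real n) \<le> s\<^sup>2 / (2 * (q * (1 - q))) * (1 + 100 * (\<bar>s\<bar> / real a + \<bar>s\<bar> / real b)) * (1 / real n)"
      if n: "n \<in> {a, b}" and r: "\<bar>r\<bar> = \<bar>s\<bar>" for n r
    proof -
      have n0: "0 < n" using n sizes by auto
      have "\<bar>r / real n\<bar> \<le> \<bar>s\<bar> / real a + \<bar>s\<bar> / real b" using n r by auto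
      then have "E (r / real n) \<le> (r / real n)\<^sup>2 / (2 * (q * (1 - q))) * (1 + 100 * (\<bar>s\<bar> / real a + \<bar>s\<bar> / real b))"
        unfolding E_def using q01 by (intro mult_left_mono) auto
      then have "real n * E (r / real n) \<le> real n * ((r / real n)\<^sup>2 / (2 * (q * (1 - q))) * (1 + 100 * (\<bar>s\<bar> / real a + \<bar>s\<bar> / real b)))"
        by (intro mult_left_mono) auto
      also have "real n * ((r / real n)\<^sup>2 / (2 * (q * (1 - q))) * (1 + 100 * (\<bar>s\<bar> / real a + \<bar>s\<bar> / real b)))
          = r\<^sup>2 / (2 * (q * (1 - q))) * (1 + 100 * (\<bar>s\<bar> / real a + \<bar>s\<bar> / real b)) * (1 / real n)"
        using n0 by (simp add: power_divide power2_eq_square[of "real n"])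
      also have "r\<^sup>2 = s\<^sup>2" using r by (metis power2_abs)
      finally show ?thesis .
    qed
    from this[of a "- s"] this[of b s]
    have "real a * E (- s / real a) + real b * E (s / real b)
      \<le> s\<^sup>2 / (2 * (q * (1 - q))) * (1 + 100 * (\<bar>s\<bar> / real a + \<bar>s\<bar> / real b)) * (1 / real a + 1 / real b)"
      by (simp only: distrib_left) auto
    also have "\<dots> = s\<^sup>2 / (2 * \<sigma>\<^sup>2 * (q * (1 - q))) * (1 + 100 * (\<bar>s\<bar> / real a + \<bar>s\<bar> / real b))"
      unfolding inverse_sum by (simp add: mult_ac)
    finally show ?thesis .
  qed
  have "exp (- (s\<^sup>2 / (2 * \<sigma>\<^sup>2 * (q * (1 - q)))) * (1 + 100 * (\<bar>s\<bar> / real a + \<bar>s\<bar> / real b))) / (real (a + b) + 1)\<^sup>2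
      \<le> exp (- (real a * E (- s / real a) + real b * E (s / real b))) / ((real a + 1) * (real b + 1))"
  proof (rule frac_le)
    show "(real a + 1) * (real b + 1) \<le> (real (a + b) + 1)\<^sup>2"
      unfolding power2_eq_square by (intro mult_mono) auto
  qed (use EE in \<open>auto simp: add_pos_nonneg\<close>)
  also have "\<dots> = (exp (- real a * E (- s / real a)) / (real a + 1)) * (exp (- real b * E (s / real b)) / (real b + 1))"
    by (simp add: exp_add[symmetric])
  also have "\<dots> \<le> (real (a choose (k - k2)) * q ^ (k - k2) * (1 - q) ^ (a - (k - k2)))
      * (real (b choose k2) * q ^ k2 * (1 - q) ^ (b - k2))"
    using q(2,3) by (intro mult_mono A B) auto
  also have "\<dots> = real (a choose (k - k2)) * real (b choose k2) * (q ^ (k - k2 + k2) * (1 - q) ^ (a + b - (k - k2 + k2)))"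
  proof -
    have "a + b - (k - k2 + k2) = (a - (k - k2)) + (b - k2)" using kab le by linarith
    then show ?thesis by (simp only: power_add) (simp add: mult_ac)
  qed
  also have "\<dots> \<le> \<P>(z in \<Omega>. count_x z {..t} = k - k2 \<and> count_y z {..t} = k2)"
    using I.prob_counts_ge[OF refl kab, of t] unfolding \<Omega> t atMost_iff .
  finally show "exp (- (s\<^sup>2 / (2 * \<sigma>\<^sup>2 * (q * (1 - q)))) * (1 + 100 * (\<bar>s\<bar> / real a + \<bar>s\<bar> / real b))) / (real (a + b) + 1)\<^sup>2
      \<le> \<P>(z in \<Omega>. count_x z {..t} = k - k2 \<and> count_y z {..t} = k2)" .
qed

text \<open>The rank count lies between \<open>count_y z {..t}\<close> and \<open>k - count_x z {..t}\<close> for every \<open>t\<close>, so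
  it concentrates where these two do if \<open>k\<close> is the expected number of observations below \<open>t\<close>.\<close>

lemma y_low_deviation:
  assumes k: "k \<le> a + b" and t: "real a * cdf P t + real b * cdf Q t = real k"
    and \<kappa>: "0 < \<kappa>" "real a * (cdf P t * (1 - cdf P t)) \<le> \<kappa>" "real b * (cdf Q t * (1 - cdf Q t)) \<le> \<kappa>"
    and s: "0 \<le> s" "s \<le> \<kappa>"
  shows "\<P>(z in \<Omega>. \<bar>real (y_low a z (a + b) k) - real b * cdf Q t\<bar> \<ge> s) \<le> 4 * exp (- (s\<^sup>2 / (4 * \<kappa>)))"
proof -
  define r\<^sub>0 where "r\<^sub>0 = s / (2 * \<kappa>)"
  have r\<^sub>0: "0 \<le> r\<^sub>0" "r\<^sub>0 \<le> 1 / 2" using s \<kappa> by (auto simp: r\<^sub>0_def field_simps)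
  define E where "E u v = {z \<in> space \<Omega>. u * real (count_x z {..t}) + v * real (count_y z {..t})
      \<ge> r\<^sub>0 * s + u * (real a * cdf P t) + v * (real b * cdf Q t)}" for u v
  have exp2: "exp (1 / 2) \<le> (2 :: real)"
  proof -
    have "exp (1 / 2 :: real) ^ 2 = exp 1" by (simp add: exp_of_nat_mult[symmetric])
    also have "\<dots> \<le> 2 ^ 2" using exp_le by simp
    finally show ?thesis by (rule power2_le_imp_le) simp
  qed
  have PE: "measure \<Omega> (E u v) \<le> exp (- (s\<^sup>2 / (4 * \<kappa>)))"
    if uv: "\<bar>u\<bar> = r\<^sub>0 \<and> v = 0 \<or> u = 0 \<and> \<bar>v\<bar> = r\<^sub>0" for u v
  proof -
    have "measure \<Omega> (E u v) \<le> exp (- (r\<^sub>0 * s + u * (real a * cdf P t) + v * (real b * cdf Q t))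
        + (u * (real a * measure P {..t}) + v * (real b * measure Q {..t}))
        + exp (1 / 2) / 2 * (u\<^sup>2 * (real a * (measure P {..t} * (1 - measure P {..t})))
           + v\<^sup>2 * (real b * (measure Q {..t} * (1 - measure Q {..t})))))"
      unfolding E_def by (rule pooled_Bernstein) (use uv r\<^sub>0 in auto)
    also have "\<dots> = exp (- (r\<^sub>0 * s) + exp (1 / 2) / 2 * (u\<^sup>2 * (real a * (cdf P t * (1 - cdf P t)))
           + v\<^sup>2 * (real b * (cdf Q t * (1 - cdf Q t)))))"
      by (simp add: cdf_def2[symmetric])
    also have "\<dots> \<le> exp (- (r\<^sub>0 * s) + 1 * (r\<^sub>0\<^sup>2 * \<kappa>))"
    proof -
      have "u\<^sup>2 * (real a * (cdf P t * (1 - cdf P t))) + v\<^sup>2 * (real b * (cdf Q t * (1 - cdf Q t))) \<le> r\<^sub>0\<^sup>2 * \<kappa>"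
      proof -
        consider "u\<^sup>2 = r\<^sub>0\<^sup>2" "v = 0" | "u = 0" "v\<^sup>2 = r\<^sub>0\<^sup>2" using uv by (metis power2_abs)
        then show ?thesis
          by cases (use mult_left_mono[OF \<kappa>(2), of "r\<^sub>0\<^sup>2"] mult_left_mono[OF \<kappa>(3), of "r\<^sub>0\<^sup>2"] in auto)
      qed
      moreover have "0 \<le> u\<^sup>2 * (real a * (cdf P t * (1 - cdf P t))) + v\<^sup>2 * (real b * (cdf Q t * (1 - cdf Q t)))"
        by (intro add_nonneg_nonneg mult_nonneg_nonneg)
           (auto simp: X.cdf_nonneg Y.cdf_nonneg X.cdf_bounded_prob Y.cdf_bounded_prob)
      ultimately have "exp (1 / 2) / 2 * (u\<^sup>2 * (real a * (cdf P t * (1 - cdf P t))) + v\<^sup>2 * (real b * (cdf Q t * (1 - cdf Q t))))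
          \<le> 1 * (r\<^sub>0\<^sup>2 * \<kappa>)"
        using exp2 by (intro mult_mono) auto
      then show ?thesis by simp
    qed
    also have "- (r\<^sub>0 * s) + 1 * (r\<^sub>0\<^sup>2 * \<kappa>) = - (s\<^sup>2 / (4 * \<kappa>))"
      using \<kappa>(1) by (simp add: r\<^sub>0_def power2_eq_square field_simps)
    finally show ?thesis .
  qed
  have Em: "E u v \<in> sets \<Omega>" for u v
    unfolding E_def by (rule borel_measurable_le[OF borel_measurable_const measurable_weighted_count]) simp_all
  let ?U = "(E r\<^sub>0 0 \<union> E (- r\<^sub>0) 0) \<union> (E 0 r\<^sub>0 \<union> E 0 (- r\<^sub>0))"
  have "\<P>(z in \<Omega>. \<bar>real (y_low a z (a + b) k) - real b * cdf Q t\<bar> \<ge> s) \<le> measure \<Omega> ?U"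
  proof (rule P.finite_measure_mono_AE)
    show "AE z in \<Omega>. z \<in> {z \<in> space \<Omega>. s \<le> \<bar>real (y_low a z (a + b) k) - real b * cdf Q t\<bar>} \<longrightarrow> z \<in> ?U"
      using AE_inj
    proof (rule AE_mp, intro AE_I2 impI)
      fix z assume inj: "inj_on z {..<a + b}"
        and z: "z \<in> {z \<in> space \<Omega>. s \<le> \<bar>real (y_low a z (a + b) k) - real b * cdf Q t\<bar>}"
      define L where "L = real (y_low a z (a + b) k)"
      define x y where "x = real (count_x z {..t})" and "y = real (count_y z {..t})"
      have "x_low a z (a + b) k + y_low a z (a + b) k = k"
        by (rule x_low_add_y_low[OF inj k]) simp
      then have xl: "real (x_low a z (a + b) k) = real k - L" by (simp add: L_def)
      have "(y \<le> L \<and> x \<le> real k - L) \<or> (L \<le> y \<and> real k - L \<le> x)"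
      proof (cases "card {i. i < a + b \<and> z i \<le> t} \<le> k")
        case True
        have "count_y z {..t} \<le> y_low a z (a + b) k" "count_x z {..t} \<le> x_low a z (a + b) k"
          using y_low_ge_count[OF True, of a] by simp_all
        then have "y \<le> L" "x \<le> real k - L"
          unfolding x_def y_def xl[symmetric] by (simp_all only: L_def of_nat_le_iff)
        then show ?thesis by simp
      next
        case False
        then have "k \<le> card {i. i < a + b \<and> z i \<le> t}" by simp
        from y_low_le_count[OF this, of a]
        have "y_low a z (a + b) k \<le> count_y z {..t}" "x_low a z (a + b) k \<le> count_x z {..t}"
          by simp_all
        then have "L \<le> y" "real k - L \<le> x"
          unfolding x_def y_def xl[symmetric] by (simp_all only: L_def of_nat_le_iff)
        then show ?thesis by simp
      qed
      then have "s \<le> y - real b * cdf Q t \<or> s \<le> real b * cdf Q t - y \<or> s \<le> x - real a * cdf P t \<or> s \<le> real a * cdf P t - x"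
        using z t by (auto simp: L_def[symmetric] abs_if split: if_splits)
      then have "r\<^sub>0 * s \<le> r\<^sub>0 * (y - real b * cdf Q t) \<or> r\<^sub>0 * s \<le> r\<^sub>0 * (real b * cdf Q t - y)
          \<or> r\<^sub>0 * s \<le> r\<^sub>0 * (x - real a * cdf P t) \<or> r\<^sub>0 * s \<le> r\<^sub>0 * (real a * cdf P t - x)"
        using r\<^sub>0(1) by (metis mult_left_mono)
      then show "z \<in> ?U" using z by (auto simp: E_def x_def y_def algebra_simps)
    qed
  qed (use Em in auto)
  also have "\<dots> \<le> (measure \<Omega> (E r\<^sub>0 0) + measure \<Omega> (E (- r\<^sub>0) 0)) + (measure \<Omega> (E 0 r\<^sub>0) + measure \<Omega> (E 0 (- r\<^sub>0)))"
    by (intro order.trans[OF measure_Un_le] add_mono measure_Un_le sets.Un Em)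
  also have "\<dots> \<le> 4 * exp (- (s\<^sup>2 / (4 * \<kappa>)))"
    using PE[of r\<^sub>0 0] PE[of "- r\<^sub>0" 0] PE[of 0 r\<^sub>0] PE[of 0 "- r\<^sub>0"] r\<^sub>0(1) by simp
  finally show ?thesis .
qed

end

section \<open>Reduction of the null hypothesis to the uniform law\<close>

definition uniform_law :: "real measure" where
  "uniform_law = interval_measure (\<lambda>x. max 0 (min 1 x))"

lemma continuous_df_clamp: "continuous_df (\<lambda>x. max 0 (min 1 x))"
  unfolding continuous_df_def
proof (intro conjI)
  show "mono (\<lambda>x::real. max 0 (min 1 x))" by (auto simp: mono_def)
  show "continuous_on UNIV (\<lambda>x::real. max 0 (min 1 x))" by (intro continuous_intros)
  have "eventually (\<lambda>x::real. max 0 (min 1 x) = 0) at_bot"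
    using eventually_le_at_bot[of 0] by eventually_elim auto
  then show "((\<lambda>x::real. max 0 (min 1 x)) \<longlongrightarrow> 0) at_bot" by (rule tendsto_eventually)
  have "eventually (\<lambda>x::real. max 0 (min 1 x) = 1) at_top"
    using eventually_ge_at_top[of 1] by eventually_elim auto
  then show "((\<lambda>x::real. max 0 (min 1 x)) \<longlongrightarrow> 1) at_top" by (rule tendsto_eventually)
qed

lemma uniform_law: "real_distribution uniform_law" "cdf uniform_law = (\<lambda>x. max 0 (min 1 x))"
  unfolding uniform_law_def by (rule continuous_df_law[OF continuous_df_clamp])+

lemma continuous_cdf_uniform: "continuous_on UNIV (cdf uniform_law)"
  using continuous_df_clamp by (simp add: uniform_law continuous_df_def)

text \<open>The probability integral transform.\<close>

lemma distr_cdf_uniform: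
  assumes P: "real_distribution P" "continuous_on UNIV (cdf P)"
  shows "distr P borel (cdf P) = uniform_law"
proof (rule cdf_unique)
  interpret P: real_distribution P by fact
  have mono: "mono (cdf P)" by (simp add: mono_def P.cdf_nondecreasing)
  have [measurable]: "cdf P \<in> borel_measurable P"
    using borel_measurable_mono[OF mono] by (simp cong: measurable_cong_sets)
  show rd: "real_distribution (distr P borel (cdf P))" by (rule P.real_distribution_distr) measurable
  then interpret D: real_distribution "distr P borel (cdf P)" .
  show "real_distribution uniform_law" by (rule uniform_law)
  have c: "cdf (distr P borel (cdf P)) u = measure P {x. cdf P x \<le> u}" for u
    by (simp add: cdf_def2 measure_distr vimage_def)
  have mid: "cdf (distr P borel (cdf P)) u = u" if u: "0 < u" "u < 1" for u
  proof -
    obtain t where t: "cdf P t = u" using cdf_surj[OF P u] .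
    obtain v where v: "cdf P v = (u + 1) / 2" using cdf_surj[OF P, of "(u + 1) / 2"] u by auto
    define A where "A = {x. cdf P x \<le> u}"
    have A: "closed A" "A \<noteq> {}" "bdd_above A"
    proof -
      show "closed A" unfolding A_def using P(2) by (intro closed_Collect_le) auto
      show "A \<noteq> {}" using t by (auto simp: A_def)
      have "x \<le> v" if "x \<in> A" for x
      proof (rule ccontr)
        assume "\<not> x \<le> v"
        then have "cdf P v \<le> cdf P x" by (intro P.cdf_nondecreasing) simp
        then show False using v that u by (simp add: A_def)
      qed
      then show "bdd_above A" by (rule bdd_aboveI)
    qed
    have S: "Sup A \<in> A" using closed_contains_Sup[OF A(2,3,1)] .
    have "A = {..Sup A}"
      using S A(3) by (auto simp: A_def intro: cSup_upper order_trans[OF P.cdf_nondecreasing])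
    then have "measure P A = cdf P (Sup A)" unfolding cdf_def2 by (rule arg_cong)
    moreover have "cdf P (Sup A) = u"
    proof (rule antisym)
      show "cdf P (Sup A) \<le> u" using S by (simp add: A_def)
      have "t \<le> Sup A" using t A(3) by (intro cSup_upper) (auto simp: A_def)
      then show "u \<le> cdf P (Sup A)" using t P.cdf_nondecreasing by auto
    qed
    ultimately show ?thesis unfolding c A_def[symmetric] by simp
  qed
  show "cdf (distr P borel (cdf P)) = cdf uniform_law"
  proof (rule ext)
    fix u :: real
    consider "u < 0" | "u = 0" | "0 < u" "u < 1" | "1 \<le> u" by linarith
    then show "cdf (distr P borel (cdf P)) u = cdf uniform_law u"
    proof cases
      case 1
      then have "{x. cdf P x \<le> u} = {}" using P.cdf_nonneg by (auto simp: not_le intro: less_le_trans)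
      with 1 show ?thesis by (simp add: c uniform_law)
    next
      case 2
      have "cdf (distr P borel (cdf P)) 0 \<le> e" if "0 < e" for e
      proof -
        have "cdf (distr P borel (cdf P)) 0 \<le> cdf (distr P borel (cdf P)) (min e (1/2))"
          using that by (intro D.cdf_nondecreasing) auto
        also have "\<dots> = min e (1/2)" using that by (intro mid) auto
        finally show ?thesis by simp
      qed
      then have "cdf (distr P borel (cdf P)) 0 \<le> 0" by (rule field_le_epsilon[of _ 0, simplified])
      then show ?thesis using 2 D.cdf_nonneg[of 0] by (simp add: uniform_law)
    next
      case 3
      then show ?thesis using mid by (simp add: uniform_law)
    next
      case 4
      then have "{x. cdf P x \<le> u} = space P"
        using P.cdf_bounded_prob by (auto intro: order_trans)
      with 4 show ?thesis by (simp add: c uniform_law P.prob_space[simplified])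
    qed
  qed
qed

lemma T_stat_eq_Max:
  assumes "0 < a" "0 < b" "\<And>j. j \<in> {1..d} \<Longrightarrow> 0 < p j \<and> p j < 1" "inj_on z {..<a + b}"
  shows "T_stat a b d p (split_at a z) = (MAX j\<in>{1..d}. T_of_counts a b (p j) z)"
proof -
  have "- L_stat a b (p j) (split_at a z) = T_of_counts a b (p j) z" if "j \<in> {1..d}" for j
    using L_stat_eq_counts[of a b "p j" "split_at a z"] assms that by simp
  then have "(\<lambda>j. - L_stat a b (p j) (split_at a z)) ` {1..d} = (\<lambda>j. T_of_counts a b (p j) z) ` {1..d}"
    by (intro image_cong) auto
  then show ?thesis by (simp add: T_stat_def)
qed

lemma T_of_counts_mono:
  assumes "0 < a" "0 < b" "0 < p" "p < 1"
    and "y_low a z (a + b) (level (a + b) p) \<le> y_low a z' (a + b) (level (a + b) p)"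
  shows "T_of_counts a b p z \<le> T_of_counts a b p z'"
  unfolding T_of_counts_def using assms by (intro divide_right_mono) auto

lemma T_of_counts_strict_mono:
  assumes "0 < a" "0 < b" "0 < p" "p < 1"
    and "y_low a z (a + b) (level (a + b) p) < y_low a z' (a + b) (level (a + b) p)"
  shows "T_of_counts a b p z < T_of_counts a b p z'"
proof -
  have "0 < sqrt (real a * real b / real (a + b)) * sqrt (p * (1 - p))" using assms by simp
  then show ?thesis unfolding T_of_counts_def using assms(5) by (intro divide_strict_right_mono) auto
qed

lemma Max_mono_image:
  fixes f g :: "nat \<Rightarrow> real"
  assumes "finite I" "I \<noteq> {}" "\<And>i. i \<in> I \<Longrightarrow> f i \<le> g i"
  shows "(MAX i\<in>I. f i) \<le> (MAX i\<in>I. g i)"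
proof (rule Max.boundedI)
  fix x assume "x \<in> f ` I"
  then obtain i where i: "i \<in> I" "x = f i" by auto
  have "g i \<le> (MAX i\<in>I. g i)" using assms(1) i by (intro Max_ge) auto
  then show "x \<le> (MAX i\<in>I. g i)" using assms(3)[OF i(1)] i(2) by linarith
qed (use assms in auto)

lemma Max_strict_mono_image:
  fixes f g :: "nat \<Rightarrow> real"
  assumes "finite I" "I \<noteq> {}" "\<And>i. i \<in> I \<Longrightarrow> f i < g i"
  shows "(MAX i\<in>I. f i) < (MAX i\<in>I. g i)"
proof -
  have "(MAX i\<in>I. f i) \<in> f ` I" using assms by (intro Max_in) auto
  then obtain i where i: "i \<in> I" "(MAX i\<in>I. f i) = f i" by auto
  have "g i \<le> (MAX i\<in>I. g i)" using assms(1) i by (intro Max_ge) auto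
  then show ?thesis using assms(3)[OF i(1)] i(2) by linarith
qed

lemma two_samples_uniform: "0 < a \<Longrightarrow> 0 < b \<Longrightarrow> two_samples a b uniform_law uniform_law"
  by (intro two_samples.intro uniform_law continuous_cdf_uniform)

text \<open>Applying \<open>F\<close> to the first and \<open>G\<close> to the second sample makes all observations uniform.
  Because \<open>G \<le> F\<close>, an observation of the first sample that lies below one of the second afterwards did
  so before; hence the transformation can only increase the rank counts.\<close>

lemma (in two_samples) null_T_le_uniform:
  assumes le: "\<And>z. cdf Q z \<le> cdf P z" and d: "1 \<le> d" and p: "\<And>j. j \<in> {1..d} \<Longrightarrow> 0 < p j \<and> p j < 1"
  shows "\<P>(z in \<Omega>. T_stat a b d p (split_at a z) > w)
    \<le> \<P>(z in pooled_law a b uniform_law uniform_law. T_stat a b d p (split_at a z) > w)"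
proof -
  interpret U: two_samples a b uniform_law uniform_law by (rule two_samples_uniform[OF sizes])
  define h where "h i = (if i < a then cdf P else cdf Q)" for i :: nat
  define t where "t z = restrict (\<lambda>i. h i (z i)) {..<a + b}" for z
  have monoP: "mono (cdf P)" "mono (cdf Q)" by (simp_all add: mono_def X.cdf_nondecreasing Y.cdf_nondecreasing)
  have hm: "h i \<in> borel_measurable borel" for i
    using borel_measurable_mono[OF monoP(1)] borel_measurable_mono[OF monoP(2)] by (simp add: h_def)
  have tm: "t \<in> \<Omega> \<rightarrow>\<^sub>M U.\<Omega>"
    unfolding t_def
  proof (rule measurable_restrict)
    fix i assume "i \<in> {..<a + b}"
    then have "(\<lambda>z. z i) \<in> borel_measurable \<Omega>" by (intro measurable_coordinate) simp
    from measurable_compose[OF this hm] show "(\<lambda>z. h i (z i)) \<in> \<Omega> \<rightarrow>\<^sub>M (if i < a then uniform_law else uniform_law)"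
      using measurable_cong_sets[OF refl U.X.events_eq_borel] by auto
  qed
  have dist: "distr \<Omega> U.\<Omega> t = U.\<Omega>"
  proof (rule U.PiM_eqI)
    fix A :: "nat \<Rightarrow> real set"
    assume A: "\<And>i. i \<in> {..<a + b} \<Longrightarrow> A i \<in> sets (if i < a then uniform_law else uniform_law)"
    then have A': "A i \<in> sets borel" if "i < a + b" for i
      using that U.X.events_eq_borel by (auto split: if_splits)
    have pre: "h i -` A i \<in> sets borel" if "i < a + b" for i
      using measurable_sets[OF hm A'[OF that]] by simp
    have "emeasure (distr \<Omega> U.\<Omega> t) (Pi\<^sub>E {..<a + b} A) = emeasure \<Omega> (t -` Pi\<^sub>E {..<a + b} A \<inter> space \<Omega>)"
      using A by (intro emeasure_distr tm sets_PiM_I_finite) auto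
    also have "t -` Pi\<^sub>E {..<a + b} A \<inter> space \<Omega> = Pi\<^sub>E {..<a + b} (\<lambda>i. h i -` A i)"
      unfolding space_\<Omega> t_def by (auto simp: PiE_iff)
    also have "emeasure \<Omega> (Pi\<^sub>E {..<a + b} (\<lambda>i. h i -` A i))
        = (\<Prod>i\<in>{..<a + b}. emeasure (if i < a then P else Q) (h i -` A i))"
      using pre by (intro emeasure_PiM) auto
    also have "\<dots> = (\<Prod>i\<in>{..<a + b}. emeasure (if i < a then uniform_law else uniform_law) (A i))"
    proof (rule prod.cong[OF refl])
      fix i assume "i \<in> {..<a + b}"
      then have i: "i < a + b" by simp
      have "emeasure uniform_law (A i) = emeasure (distr P borel (cdf P)) (A i)"
        "emeasure uniform_law (A i) = emeasure (distr Q borel (cdf Q)) (A i)"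
        using distr_cdf_uniform[OF laws(1) cont(1)] distr_cdf_uniform[OF laws(2) cont(2)] by simp_all
      moreover have "cdf P \<in> borel_measurable P" "cdf Q \<in> borel_measurable Q"
        using borel_measurable_mono[OF monoP(1)] borel_measurable_mono[OF monoP(2)]
          measurable_cong_sets[OF X.events_eq_borel refl] measurable_cong_sets[OF Y.events_eq_borel refl] by auto
      ultimately show "emeasure (if i < a then P else Q) (h i -` A i)
          = emeasure (if i < a then uniform_law else uniform_law) (A i)"
        using A'[OF i] by (auto simp: h_def emeasure_distr)
    qed
    finally show "emeasure (distr \<Omega> U.\<Omega> t) (Pi\<^sub>E {..<a + b} A)
      = (\<Prod>i\<in>{..<a + b}. emeasure (if i < a then uniform_law else uniform_law) (A i))" .
  qed simp_all
  have AEt: "AE z in \<Omega>. inj_on (t z) {..<a + b}"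
  proof -
    have "AE u in distr \<Omega> U.\<Omega> t. inj_on u {..<a + b}" unfolding dist by (rule U.AE_inj)
    then show ?thesis by (rule AE_distrD[OF tm])
  qed
  let ?T = "\<lambda>z. T_stat a b d p (split_at a z)"
  have "\<P>(z in \<Omega>. ?T z > w) \<le> measure \<Omega> (t -` {u \<in> space U.\<Omega>. ?T u > w} \<inter> space \<Omega>)"
  proof (rule P.finite_measure_mono_AE)
    show "t -` {u \<in> space U.\<Omega>. ?T u > w} \<inter> space \<Omega> \<in> sets \<Omega>"
      by (rule measurable_sets[OF tm]) (rule U.T_event)
    show "AE z in \<Omega>. z \<in> {z \<in> space \<Omega>. ?T z > w} \<longrightarrow> z \<in> t -` {u \<in> space U.\<Omega>. ?T u > w} \<inter> space \<Omega>"
      using AE_inj AEt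
    proof (rule AE_mp[OF _ AE_mp], intro AE_I2 impI)
      fix z assume inj: "inj_on (t z) {..<a + b}" "inj_on z {..<a + b}" and z: "z \<in> {z \<in> space \<Omega>. ?T z > w}"
      have "y_low a z (a + b) k \<le> y_low a (t z) (a + b) k" if k: "k \<le> a + b" for k
      proof (rule y_low_mono[OF inj(2,1) k])
        fix i j assume ij: "j < a" "a \<le> i" "i < a + b" "t z j < t z i"
        then have "cdf P (z j) < cdf Q (z i)" by (simp add: t_def h_def)
        also have "\<dots> \<le> cdf P (z i)" by (rule le)
        finally show "z j < z i" using X.cdf_nondecreasing[of "z i" "z j"] by linarith
      qed simp
      then have "T_of_counts a b (p j) z \<le> T_of_counts a b (p j) (t z)" if "j \<in> {1..d}" for j
        using p[OF that] sizes level_bounds(2)[of "p j" "a + b"] by (intro T_of_counts_mono) auto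
      then have "(MAX j\<in>{1..d}. T_of_counts a b (p j) z) \<le> (MAX j\<in>{1..d}. T_of_counts a b (p j) (t z))"
        using d by (intro Max_mono_image) auto
      moreover have "?T z = (MAX j\<in>{1..d}. T_of_counts a b (p j) z)"
        by (rule T_stat_eq_Max[OF sizes p inj(2)])
      moreover have "?T (t z) = (MAX j\<in>{1..d}. T_of_counts a b (p j) (t z))"
        by (rule T_stat_eq_Max[OF sizes p inj(1)])
      ultimately have "?T z \<le> ?T (t z)" by simp
      then show "z \<in> t -` {u \<in> space U.\<Omega>. ?T u > w} \<inter> space \<Omega>"
        using z measurable_space[OF tm, of z] by auto
    qed
  qed
  also have "\<dots> = measure (distr \<Omega> U.\<Omega> t) {u \<in> space U.\<Omega>. ?T u > w}"
    by (rule measure_distr[symmetric, OF tm U.T_event])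
  finally show ?thesis by (simp only: dist U.pooled_law_eq)
qed

text \<open>Under the uniform law every ordering of the observations has positive probability, so \<open>T_stat\<close>
  attains each of its tie-free values with positive probability.\<close>

lemma uniform_T_atom_pos:
  assumes ab: "0 < a" "0 < b" and inj: "inj_on z0 {..<a + b}"
  shows "0 < \<P>(z in pooled_law a b uniform_law uniform_law.
    T_stat a b d p (split_at a z) = T_stat a b d p (split_at a z0))"
proof -
  interpret U: two_samples a b uniform_law uniform_law by (rule two_samples_uniform[OF ab])
  define N where "N = a + b"
  have N: "0 < N" using ab by (simp add: N_def)
  define r where "r = rank_in N z0"
  have r: "r i \<in> {1..N}" "inj_on r {..<N}" if "i < N" for i
    using bij_betw_rank_in[OF inj[folded N_def]] that by (auto simp: r_def bij_betw_def)
  define C where "C k = {(real k - 1) / real N <.. real k / real N}" for k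
  have mC: "measure uniform_law (C k) = 1 / real N" if "k \<in> {1..N}" for k
  proof -
    have "measure uniform_law (C k) = cdf uniform_law (real k / real N) - cdf uniform_law ((real k - 1) / real N)"
      unfolding C_def using that N
      by (subst U.X.cdf_diff_eq) (auto simp: divide_strict_right_mono)
    also have "\<dots> = real k / real N - (real k - 1) / real N"
      using that N by (simp add: uniform_law max_def min_def divide_le_eq)
    also have "\<dots> = 1 / real N" by (simp add: diff_divide_distrib)
    finally show ?thesis .
  qed
  \<comment> \<open>On this box the observations are ordered like those of \<open>z0\<close>.\<close>
  define A where "A = Pi\<^sub>E {..<N} (\<lambda>i. C (r i))"
  have "measure U.\<Omega> A = (\<Prod>i<N. measure (if i < a then uniform_law else uniform_law) (C (r i)))"
    unfolding A_def N_def by (rule U.finite_measure_PiM_emb) (auto simp: C_def U.X.events_eq_borel)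
  also have "\<dots> = (\<Prod>i<N. 1 / real N)" using r mC by (intro prod.cong) auto
  also have "\<dots> > 0" using N by (simp add: prod_pos)
  finally have pos: "0 < measure U.\<Omega> A" .
  have rank: "rank_in N z i = rank_in N z0 i" if z: "z \<in> A" and i: "i < N" for z i
  proof -
    have mem: "z j \<in> C (r j)" if "j < N" for j using z that by (auto simp: A_def)
    have "z j \<le> z i \<longleftrightarrow> z0 j \<le> z0 i" if j: "j < N" for j
    proof -
      have lt: "z k < z l" if kl: "k < N" "l < N" "z0 k < z0 l" for k l
      proof -
        have "r k < r l" unfolding r_def using kl by (intro rank_in_less)
        then have "real (r k) / real N \<le> (real (r l) - 1) / real N" using N by (intro divide_right_mono) auto
        then show ?thesis using mem[OF kl(1)] mem[OF kl(2)] by (auto simp: C_def)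
      qed
      show ?thesis
      proof (cases "z0 i" "z0 j" rule: linorder_cases)
        case less
        then show ?thesis using lt[OF i j] by auto
      next
        case equal
        then have "i = j" using inj i j by (auto simp: N_def dest: inj_onD)
        then show ?thesis by simp
      next
        case greater
        then show ?thesis using lt[OF j i] by auto
      qed
    qed
    then have "{j. j < N \<and> z j \<le> z i} = {j. j < N \<and> z0 j \<le> z0 i}" by blast
    then show ?thesis by (simp add: rank_in_def)
  qed
  let ?T = "\<lambda>z. T_stat a b d p (split_at a z)"
  have mT: "?T \<in> borel_measurable U.\<Omega>"
    using measurable_T_stat[of a b d p] measurable_cong_sets[OF U.sets_\<Omega> refl] by blast
  have "measure U.\<Omega> A \<le> \<P>(z in U.\<Omega>. ?T z = ?T z0)"
  proof (rule U.P.finite_measure_mono)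
    show "A \<subseteq> {z \<in> space U.\<Omega>. ?T z = ?T z0}"
    proof
      fix z assume z: "z \<in> A"
      then have "z \<in> space U.\<Omega>" unfolding U.space_\<Omega> A_def N_def by (auto simp: PiE_iff)
      moreover have "?T z = ?T z0" using rank[OF z] by (intro T_stat_cong) (simp add: N_def)
      ultimately show "z \<in> {z \<in> space U.\<Omega>. ?T z = ?T z0}" by simp
    qed
    show "{z \<in> space U.\<Omega>. ?T z = ?T z0} \<in> sets U.\<Omega>"
      using measurable_sets[OF mT, of "{?T z0}"] by (simp add: vimage_def Int_def conj_commute)
  qed
  with pos show ?thesis by (simp only: U.pooled_law_eq)
qed

section \<open>Atoms of the rank statistic\<close>

text \<open>Exchanging the first observation of each sample, when one is low and the other is high, changes
  the maximum over the middle levels. Such exchanges have a probability that is bounded away from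
  \<open>0\<close>, so no single value of \<open>T_stat\<close> can carry almost all of the mass.\<close>

lemma (in two_samples) T_atom_le:
  assumes st: "s \<le> t" and J: "J \<subseteq> {1..d}" "J \<noteq> {}" and p: "\<And>j. j \<in> J \<Longrightarrow> 0 < p j \<and> p j < 1"
    and G: "G \<in> sets \<Omega>"
    and middle: "\<And>z. z \<in> G \<Longrightarrow> T_stat a b d p (split_at a z) = (MAX j\<in>J. T_of_counts a b (p j) z)"
    and R: "R \<in> sets \<Omega>"
    and rest: "\<And>z j. z \<in> R \<Longrightarrow> j \<in> J \<Longrightarrow>
      card {i. i < a + b \<and> z i \<le> s} < level (a + b) (p j) \<and> level (a + b) (p j) + 2 \<le> card {i. i < a + b \<and> z i \<le> t}"
  shows "\<P>(z in \<Omega>. T_stat a b d p (split_at a z) = w)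
    \<le> 1 - min (cdf P s * (1 - cdf Q t)) ((1 - cdf P t) * cdf Q s) + measure \<Omega> (space \<Omega> - G) + measure \<Omega> (space \<Omega> - R)"
proof -
  define N where "N = a + b"
  define k where "k j = level N (p j)" for j
  have i0: "0 < N" "a < N" "0 \<noteq> a" using sizes by (auto simp: N_def)
  define R' where "R' = {z \<in> space \<Omega>. \<forall>j\<in>J. card {i. i < N \<and> i \<noteq> 0 \<and> i \<noteq> a \<and> z i \<le> s} < k j
      \<and> k j \<le> card {i. i < N \<and> i \<noteq> 0 \<and> i \<noteq> a \<and> z i \<le> t}}"
  define M where "M z = (MAX j\<in>J. T_of_counts a b (p j) z)" for z
  define g1 g2 where "g1 z = z(0 := s, a := t + 1)" and "g2 z = z(0 := t + 1, a := s)" for z :: "nat \<Rightarrow> real"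
  \<comment> \<open>\<open>W1\<close> and \<open>W2\<close> do not depend on the two exchanged coordinates and are disjoint, since \<open>M (g1 z) < M (g2 z)\<close>.
  On \<open>E1\<close> the value \<open>w\<close> occurs only inside \<open>W1\<close>, on \<open>E2\<close> only inside \<open>W2\<close>.\<close>
  define W1 W2 where "W1 = {z \<in> R'. M (g1 z) = w}" and "W2 = {z \<in> R'. M (g2 z) = w}"
  define E1 E2 where "E1 = {z \<in> space \<Omega>. z 0 \<in> {..s} \<and> z a \<in> {t<..}}" and "E2 = {z \<in> space \<Omega>. z 0 \<in> {t<..} \<and> z a \<in> {..s}}"
  have finJ: "finite J" using J by (auto intro: finite_subset)
  \<comment> \<open>Dropping the coordinates \<open>0\<close> and \<open>a\<close> lowers a count by at most \<open>2\<close>; hence the margin in the hypothesis.\<close>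
  have RR': "R \<subseteq> R'"
  proof
    fix z assume z: "z \<in> R"
    have "card {i. i < N \<and> i \<noteq> 0 \<and> i \<noteq> a \<and> z i \<le> s} \<le> card {i. i < N \<and> z i \<le> s}"
      by (rule card_mono) auto
    moreover have "card {i. i < N \<and> z i \<le> t} \<le> card ({i. i < N \<and> i \<noteq> 0 \<and> i \<noteq> a \<and> z i \<le> t} \<union> {0, a})"
      by (rule card_mono) auto
    moreover have "card ({i. i < N \<and> i \<noteq> 0 \<and> i \<noteq> a \<and> z i \<le> t} \<union> {0, a}) \<le> card {i. i < N \<and> i \<noteq> 0 \<and> i \<noteq> a \<and> z i \<le> t} + card {0, a}"
      by (rule card_Un_le)
    moreover have "card {0, a} \<le> 2" by (simp add: card_insert_if)
    ultimately have "card {i. i < N \<and> i \<noteq> 0 \<and> i \<noteq> a \<and> z i \<le> s} < k j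
      \<and> k j \<le> card {i. i < N \<and> i \<noteq> 0 \<and> i \<noteq> a \<and> z i \<le> t}" if "j \<in> J" for j
      using rest[OF z that] unfolding N_def[symmetric] k_def[symmetric] by linarith
    then show "z \<in> R'" using z sets.sets_into_space[OF R] by (auto simp: R'_def)
  qed
  have swap: "y_low a z' N (k j) = Suc (y_low a z N (k j))"
    if "u \<in> R'" "j \<in> J" "z 0 \<le> s" "t < z a" "t < z' 0" "z' a \<le> s"
      "\<And>i. i \<noteq> 0 \<Longrightarrow> i \<noteq> a \<Longrightarrow> z i = u i" "\<And>i. i \<noteq> 0 \<Longrightarrow> i \<noteq> a \<Longrightarrow> z' i = u i" for u z z' j
  proof (rule y_low_swap[OF sizes(1) order_refl i0(2) st that(3-6)])
    have e: "{i. i < N \<and> i \<noteq> 0 \<and> i \<noteq> a \<and> z i \<le> v} = {i. i < N \<and> i \<noteq> 0 \<and> i \<noteq> a \<and> u i \<le> v}" for v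
      using that(7) by auto
    show "card {i. i < N \<and> i \<noteq> 0 \<and> i \<noteq> a \<and> z i \<le> s} < k j" "k j \<le> card {i. i < N \<and> i \<noteq> 0 \<and> i \<noteq> a \<and> z i \<le> t}"
      unfolding e using that(1,2) by (auto simp: R'_def)
  qed (use that in auto)
  have M1: "M z = M (g1 z)" if z: "z \<in> E1" "z \<in> R'" for z
  proof -
    have "y_low a z N (k j) = y_low a (g1 z) N (k j)" if "j \<in> J" for j
      using swap[OF z(2) that, of z "g2 z"] swap[OF z(2) that, of "g1 z" "g2 z"] z i0
      by (simp add: E1_def g1_def g2_def)
    then have "T_of_counts a b (p j) z = T_of_counts a b (p j) (g1 z)" if "j \<in> J" for j
      using that by (simp add: T_of_counts_def k_def N_def)
    then show ?thesis unfolding M_def by (metis (no_types, lifting) image_cong)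
  qed
  have M2: "M z = M (g2 z)" if z: "z \<in> E2" "z \<in> R'" for z
  proof -
    have "y_low a z N (k j) = y_low a (g2 z) N (k j)" if "j \<in> J" for j
      using swap[OF z(2) that, of "g1 z" z] swap[OF z(2) that, of "g1 z" "g2 z"] z i0
      by (simp add: E2_def g1_def g2_def)
    then have "T_of_counts a b (p j) z = T_of_counts a b (p j) (g2 z)" if "j \<in> J" for j
      using that by (simp add: T_of_counts_def k_def N_def)
    then show ?thesis unfolding M_def by (metis (no_types, lifting) image_cong)
  qed
  have strict: "M (g1 z) < M (g2 z)" if z: "z \<in> R'" for z
    unfolding M_def
  proof (rule Max_strict_mono_image[OF finJ J(2)])
    fix j assume j: "j \<in> J"
    have "y_low a (g2 z) N (k j) = Suc (y_low a (g1 z) N (k j))"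
      by (rule swap[OF z j]) (use i0 in \<open>auto simp: g1_def g2_def\<close>)
    then show "T_of_counts a b (p j) (g1 z) < T_of_counts a b (p j) (g2 z)"
      using p[OF j] sizes by (intro T_of_counts_strict_mono) (auto simp: k_def N_def)
  qed
  have "False" if "z \<in> W1" "z \<in> W2" for z
    using strict[of z] that by (simp add: W1_def W2_def)
  then have disj: "W1 \<inter> W2 = {}" by blast
  have coord: "(\<lambda>z. z i) \<in> borel_measurable \<Omega>" if "i < N" for i
    using that unfolding N_def by (rule measurable_coordinate)
  have R'm: "R' \<in> sets \<Omega>"
  proof -
    have cm: "(\<lambda>z. card {i. i < N \<and> i \<noteq> 0 \<and> i \<noteq> a \<and> z i \<le> v}) \<in> \<Omega> \<rightarrow>\<^sub>M count_space UNIV" for v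
    proof (rule measurable_card)
      fix i show "{z \<in> space \<Omega>. i \<in> {i. i < N \<and> i \<noteq> 0 \<and> i \<noteq> a \<and> z i \<le> v}} \<in> sets \<Omega>"
      proof (cases "i < N \<and> i \<noteq> 0 \<and> i \<noteq> a")
        case True
        have "(\<lambda>z. z i) -` {..v} \<inter> space \<Omega> \<in> sets \<Omega>" using True by (intro measurable_sets[OF coord]) auto
        also have "(\<lambda>z. z i) -` {..v} \<inter> space \<Omega> = {z \<in> space \<Omega>. i \<in> {i. i < N \<and> i \<noteq> 0 \<and> i \<noteq> a \<and> z i \<le> v}}"
          using True by auto
        finally show ?thesis .
      next
        case False
        then have e: "{z \<in> space \<Omega>. i \<in> {i. i < N \<and> i \<noteq> 0 \<and> i \<noteq> a \<and> z i \<le> v}} = {}" by auto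
        show ?thesis unfolding e by (rule sets.empty_sets)
      qed
    qed
    have ev: "{z \<in> space \<Omega>. Pr (card {i. i < N \<and> i \<noteq> 0 \<and> i \<noteq> a \<and> z i \<le> v})} \<in> sets \<Omega>" for Pr v
    proof -
      have "(\<lambda>z. card {i. i < N \<and> i \<noteq> 0 \<and> i \<noteq> a \<and> z i \<le> v}) -` {n. Pr n} \<inter> space \<Omega> \<in> sets \<Omega>"
        by (rule measurable_sets[OF cm]) (rule sets_UNIV)
      also have "(\<lambda>z. card {i. i < N \<and> i \<noteq> 0 \<and> i \<noteq> a \<and> z i \<le> v}) -` {n. Pr n} \<inter> space \<Omega>
          = {z \<in> space \<Omega>. Pr (card {i. i < N \<and> i \<noteq> 0 \<and> i \<noteq> a \<and> z i \<le> v})}" by auto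
      finally show ?thesis .
    qed
    have "(\<Inter>j\<in>J. {z \<in> space \<Omega>. card {i. i < N \<and> i \<noteq> 0 \<and> i \<noteq> a \<and> z i \<le> s} < k j}
        \<inter> {z \<in> space \<Omega>. k j \<le> card {i. i < N \<and> i \<noteq> 0 \<and> i \<noteq> a \<and> z i \<le> t}}) \<in> sets \<Omega>"
    proof (rule sets.finite_INT[OF finJ J(2)], rule sets.Int)
      fix j assume "j \<in> J"
      show "{z \<in> space \<Omega>. card {i. i < N \<and> i \<noteq> 0 \<and> i \<noteq> a \<and> z i \<le> s} < k j} \<in> sets \<Omega>" by (rule ev)
      show "{z \<in> space \<Omega>. k j \<le> card {i. i < N \<and> i \<noteq> 0 \<and> i \<noteq> a \<and> z i \<le> t}} \<in> sets \<Omega>" by (rule ev)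
    qed
    also have "(\<Inter>j\<in>J. {z \<in> space \<Omega>. card {i. i < N \<and> i \<noteq> 0 \<and> i \<noteq> a \<and> z i \<le> s} < k j}
        \<inter> {z \<in> space \<Omega>. k j \<le> card {i. i < N \<and> i \<noteq> 0 \<and> i \<noteq> a \<and> z i \<le> t}}) = R'"
      using J(2) by (auto simp: R'_def)
    finally show ?thesis .
  qed
  have gm: "(\<lambda>z. z(0 := u, a := v)) \<in> \<Omega> \<rightarrow>\<^sub>M \<Omega>" for u v :: real
  proof -
    have "(\<lambda>z. z(0 := u)) \<in> \<Omega> \<rightarrow>\<^sub>M \<Omega>"
      by (rule measurable_fun_upd[where J="{..<a + b}"]) (use i0 in \<open>auto simp: N_def\<close>)
    then show ?thesis
      by (rule measurable_fun_upd[where J="{..<a + b}", rotated]) (use i0 in \<open>auto simp: N_def\<close>)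
  qed
  have Mm: "M \<in> borel_measurable \<Omega>"
    unfolding M_def
  proof (rule borel_measurable_Max[OF finJ])
    fix j assume "j \<in> J"
    show "T_of_counts a b (p j) \<in> borel_measurable \<Omega>"
      unfolding T_of_counts_def by (rule measurable_compose[OF measurable_y_low]) simp
  qed
  have Wm: "W1 \<in> sets \<Omega>" "W2 \<in> sets \<Omega>"
  proof -
    have "R' \<inter> ((\<lambda>z. M (g1 z)) -` {w} \<inter> space \<Omega>) \<in> sets \<Omega>"
      unfolding g1_def by (rule sets.Int[OF R'm], rule measurable_sets[OF measurable_compose[OF gm Mm]]) simp
    also have "R' \<inter> ((\<lambda>z. M (g1 z)) -` {w} \<inter> space \<Omega>) = W1" by (auto simp: W1_def R'_def)
    finally show "W1 \<in> sets \<Omega>" .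
    have "R' \<inter> ((\<lambda>z. M (g2 z)) -` {w} \<inter> space \<Omega>) \<in> sets \<Omega>"
      unfolding g2_def by (rule sets.Int[OF R'm], rule measurable_sets[OF measurable_compose[OF gm Mm]]) simp
    also have "R' \<inter> ((\<lambda>z. M (g2 z)) -` {w} \<inter> space \<Omega>) = W2" by (auto simp: W2_def R'_def)
    finally show "W2 \<in> sets \<Omega>" .
  qed
  have upd: "z(0 := u, a := v) \<in> space \<Omega> \<longleftrightarrow> z \<in> space \<Omega>" if "z \<in> space \<Omega>" for z u v
    using that i0 unfolding space_\<Omega> by (auto simp: PiE_iff extensional_def N_def)
  have updR: "z(0 := u, a := v) \<in> R' \<longleftrightarrow> z \<in> R'" if "z \<in> space \<Omega>" for z u v
  proof -
    have e: "{i. i < N \<and> i \<noteq> 0 \<and> i \<noteq> a \<and> (z(0 := u, a := v)) i \<le> x} = {i. i < N \<and> i \<noteq> 0 \<and> i \<noteq> a \<and> z i \<le> x}" for x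
      by auto
    show ?thesis unfolding R'_def mem_Collect_eq e using upd[OF that] that by blast
  qed
  have gupd: "g1 (z(0 := u, a := v)) = g1 z" "g2 (z(0 := u, a := v)) = g2 z" for z u v
    using i0 by (auto simp: g1_def g2_def fun_eq_iff)
  have P1: "measure \<Omega> (E1 \<inter> W1) = cdf P s * (1 - cdf Q t) * measure \<Omega> W1"
    and P2: "measure \<Omega> (E2 \<inter> W2) = (1 - cdf P t) * cdf Q s * measure \<Omega> W2"
    and PE1: "measure \<Omega> E1 = cdf P s * (1 - cdf Q t)" and PE2: "measure \<Omega> E2 = (1 - cdf P t) * cdf Q s"
  proof -
    have compl: "measure P {t<..} = 1 - cdf P t" "measure Q {t<..} = 1 - cdf Q t"
    proof -
      have e: "{t<..} = space P - {..t}" "{t<..} = space Q - {..t}" by auto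
      show "measure P {t<..} = 1 - cdf P t" unfolding e(1) cdf_def2 by (rule X.prob_compl) simp
      show "measure Q {t<..} = 1 - cdf Q t" unfolding e(2) cdf_def2 by (rule Y.prob_compl) simp
    qed
    have i0': "0 < a + b" "a < a + b" using i0 by (simp_all add: N_def)
    show "measure \<Omega> (E1 \<inter> W1) = cdf P s * (1 - cdf Q t) * measure \<Omega> W1"
      unfolding E1_def
      by (subst prob_two_coordinates_Int[OF i0' i0(3) _ _ Wm(1)])
         (use sizes updR gupd in \<open>auto simp: compl cdf_def2[symmetric] W1_def\<close>)
    show "measure \<Omega> (E2 \<inter> W2) = (1 - cdf P t) * cdf Q s * measure \<Omega> W2"
      unfolding E2_def
      by (subst prob_two_coordinates_Int[OF i0' i0(3) _ _ Wm(2)])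
         (use sizes updR gupd in \<open>auto simp: compl cdf_def2[symmetric] W2_def\<close>)
    have "E1 \<inter> space \<Omega> = E1" "E2 \<inter> space \<Omega> = E2" by (auto simp: E1_def E2_def)
    moreover have "measure \<Omega> (E1 \<inter> space \<Omega>) = cdf P s * (1 - cdf Q t) * measure \<Omega> (space \<Omega>)"
      unfolding E1_def
      by (subst prob_two_coordinates_Int[OF i0' i0(3) _ _ sets.top])
         (use sizes upd in \<open>auto simp: compl cdf_def2[symmetric]\<close>)
    moreover have "measure \<Omega> (E2 \<inter> space \<Omega>) = (1 - cdf P t) * cdf Q s * measure \<Omega> (space \<Omega>)"
      unfolding E2_def
      by (subst prob_two_coordinates_Int[OF i0' i0(3) _ _ sets.top])
         (use sizes upd in \<open>auto simp: compl cdf_def2[symmetric]\<close>)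
    ultimately show "measure \<Omega> E1 = cdf P s * (1 - cdf Q t)" "measure \<Omega> E2 = (1 - cdf P t) * cdf Q s"
      by (simp_all add: P.prob_space)
  qed
  have Em: "E1 \<in> sets \<Omega>" "E2 \<in> sets \<Omega>"
  proof -
    have "((\<lambda>z. z 0) -` {..s} \<inter> space \<Omega>) \<inter> ((\<lambda>z. z a) -` {t<..} \<inter> space \<Omega>) \<in> sets \<Omega>"
      by (intro sets.Int measurable_sets[OF coord]) (use i0 in auto)
    also have "((\<lambda>z. z 0) -` {..s} \<inter> space \<Omega>) \<inter> ((\<lambda>z. z a) -` {t<..} \<inter> space \<Omega>) = E1" by (auto simp: E1_def)
    finally show "E1 \<in> sets \<Omega>" .
    have "((\<lambda>z. z 0) -` {t<..} \<inter> space \<Omega>) \<inter> ((\<lambda>z. z a) -` {..s} \<inter> space \<Omega>) \<in> sets \<Omega>"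
      by (intro sets.Int measurable_sets[OF coord]) (use i0 in auto)
    also have "((\<lambda>z. z 0) -` {t<..} \<inter> space \<Omega>) \<inter> ((\<lambda>z. z a) -` {..s} \<inter> space \<Omega>) = E2" by (auto simp: E2_def)
    finally show "E2 \<in> sets \<Omega>" .
  qed
  have WW: "measure \<Omega> W1 + measure \<Omega> W2 \<le> 1"
    using P.finite_measure_Union[OF Wm disj] P.prob_le_1[of "W1 \<union> W2"] by simp
  have EE: "measure \<Omega> (space \<Omega> - (E1 \<union> E2)) = 1 - measure \<Omega> E1 - measure \<Omega> E2"
  proof -
    have "E1 \<inter> E2 = {}" using st by (auto simp: E1_def E2_def)
    then have "measure \<Omega> (E1 \<union> E2) = measure \<Omega> E1 + measure \<Omega> E2" using Em by (intro P.finite_measure_Union)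
    then show ?thesis using P.prob_compl[of "E1 \<union> E2"] Em by simp
  qed
  let ?T = "\<lambda>z. T_stat a b d p (split_at a z)"
  let ?U = "((space \<Omega> - G) \<union> (space \<Omega> - R)) \<union> ((space \<Omega> - (E1 \<union> E2)) \<union> ((E1 \<inter> W1) \<union> (E2 \<inter> W2)))"
  have "\<P>(z in \<Omega>. ?T z = w) \<le> measure \<Omega> ?U"
  proof (rule P.finite_measure_mono)
    show "{z \<in> space \<Omega>. ?T z = w} \<subseteq> ?U"
    proof
      fix z assume "z \<in> {z \<in> space \<Omega>. ?T z = w}"
      then have z: "z \<in> space \<Omega>" "?T z = w" by auto
      show "z \<in> ?U"
      proof (cases "z \<in> G \<and> z \<in> R \<and> (z \<in> E1 \<or> z \<in> E2)")
        case True
        then have "M z = w" using middle z by (simp add: M_def)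
        moreover have "z \<in> R'" using True RR' by auto
        ultimately show ?thesis using True M1 M2 by (auto simp: W1_def W2_def)
      qed (use z in auto)
    qed
    show "?U \<in> sets \<Omega>" using G R Em Wm by (intro sets.Un sets.Diff sets.top sets.Int) auto
  qed
  also have "\<dots> \<le> (measure \<Omega> (space \<Omega> - G) + measure \<Omega> (space \<Omega> - R))
      + (measure \<Omega> (space \<Omega> - (E1 \<union> E2)) + (measure \<Omega> (E1 \<inter> W1) + measure \<Omega> (E2 \<inter> W2)))"
    using G R Em Wm
    by (intro order.trans[OF measure_Un_le] add_mono measure_Un_le order_refl sets.Un sets.Diff sets.top sets.Int) auto
  also have "measure \<Omega> (space \<Omega> - (E1 \<union> E2)) + (measure \<Omega> (E1 \<inter> W1) + measure \<Omega> (E2 \<inter> W2))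
      \<le> 1 - min (measure \<Omega> E1) (measure \<Omega> E2)"
  proof -
    define e1 e2 w1 w2 where "e1 = measure \<Omega> E1" and "e2 = measure \<Omega> E2" and "w1 = measure \<Omega> W1" and "w2 = measure \<Omega> W2"
    have "0 \<le> e1" "0 \<le> e2" "0 \<le> w1" "0 \<le> w2" by (simp_all add: e1_def e2_def w1_def w2_def)
    moreover have "e1 * w1 \<le> max e1 e2 * w1" "e2 * w2 \<le> max e1 e2 * w2"
      using calculation by (auto intro: mult_right_mono)
    moreover have "max e1 e2 * (w1 + w2) \<le> max e1 e2 * 1"
      using WW calculation by (intro mult_left_mono) (auto simp: w1_def w2_def)
    moreover have "measure \<Omega> (E1 \<inter> W1) = e1 * w1" "measure \<Omega> (E2 \<inter> W2) = e2 * w2"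
      by (simp_all add: P1 P2 PE1 PE2 e1_def e2_def w1_def w2_def)
    ultimately show ?thesis
      unfolding EE e1_def[symmetric] e2_def[symmetric] by (simp add: distrib_left)
  qed
  finally show ?thesis by (simp add: PE1 PE2)
qed

section \<open>Critical values\<close>

definition null_sup :: "(nat \<Rightarrow> nat) \<Rightarrow> (nat \<Rightarrow> nat) \<Rightarrow> (nat \<Rightarrow> samples \<Rightarrow> real) \<Rightarrow> nat \<Rightarrow> real \<Rightarrow> real" where
  "null_sup m n U S w = (SUP (P, Q)\<in>null_pairs. exceed_prob m n U S P Q w)"

lemma prob_space_two_sample_law:
  assumes "real_distribution P" "real_distribution Q"
  shows "prob_space (two_sample_law a b P Q)"
proof -
  interpret X: prob_space "Pi\<^sub>M {..<a} (\<lambda>_. P)"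
    using assms by (intro prob_space_PiM) (simp add: real_distribution_def)
  interpret Y: prob_space "Pi\<^sub>M {..<b} (\<lambda>_. Q)"
    using assms by (intro prob_space_PiM) (simp add: real_distribution_def)
  interpret pair_prob_space "Pi\<^sub>M {..<a} (\<lambda>_. P)" "Pi\<^sub>M {..<b} (\<lambda>_. Q)" ..
  show ?thesis unfolding two_sample_law_def by (rule P.prob_space_axioms)
qed

lemma exceed_prob_le_1:
  assumes "real_distribution P" "real_distribution Q"
  shows "exceed_prob m n U S P Q w \<le> 1"
  unfolding exceed_prob_def using prob_space.prob_le_1[OF prob_space_two_sample_law[OF assms]] .

lemma null_pairs_iff:
  "(P, Q) \<in> null_pairs \<longleftrightarrow> real_distribution P \<and> real_distribution Q \<and>
     continuous_on UNIV (cdf P) \<and> continuous_on UNIV (cdf Q) \<and> (\<forall>z. cdf Q z \<le> cdf P z)"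
  by (simp add: null_pairs_def)

lemma uniform_in_null_pairs: "(uniform_law, uniform_law) \<in> null_pairs"
  by (simp add: null_pairs_iff uniform_law(1) continuous_cdf_uniform)

lemma bdd_above_null: "bdd_above ((\<lambda>(P, Q). exceed_prob m n U S P Q w) ` null_pairs)"
  by (rule bdd_aboveI[of _ 1]) (auto simp: null_pairs_iff intro!: exceed_prob_le_1)

lemma null_sup_ge:
  assumes "(P, Q) \<in> null_pairs"
  shows "exceed_prob m n U S P Q w \<le> null_sup m n U S w"
  unfolding null_sup_def using cSUP_upper[OF assms bdd_above_null[of m n U S w]] by simp

lemma null_sup_le:
  assumes "\<And>P Q. (P, Q) \<in> null_pairs \<Longrightarrow> exceed_prob m n U S P Q w \<le> B"
  shows "null_sup m n U S w \<le> B"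
  unfolding null_sup_def using uniform_in_null_pairs by (intro cSUP_least) (auto intro: assms)

text \<open>A statistic that is bounded and measurable, so that its critical values are characterised by
  \<open>null_sup\<close>.\<close>

locale regular_statistic =
  fixes m n :: "nat \<Rightarrow> nat" and U :: "nat \<Rightarrow> samples \<Rightarrow> real" and S :: nat and B :: real
  assumes bounded: "\<And>\<omega>. \<bar>U S \<omega>\<bar> \<le> B"
    and event: "\<And>P Q w. real_distribution P \<Longrightarrow> real_distribution Q \<Longrightarrow>
      {\<omega> \<in> space (two_sample_law (m S) (n S) P Q). U S \<omega> > w} \<in> sets (two_sample_law (m S) (n S) P Q)"
begin

lemma exceed_prob_antimono:
  assumes "real_distribution P" "real_distribution Q" "w \<le> w'"
  shows "exceed_prob m n U S P Q w' \<le> exceed_prob m n U S P Q w"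
proof -
  interpret prob_space "two_sample_law (m S) (n S) P Q"
    using assms by (intro prob_space_two_sample_law)
  show ?thesis unfolding exceed_prob_def
    by (rule finite_measure_mono) (use assms event in auto)
qed

lemma null_sup_antimono: "w \<le> w' \<Longrightarrow> null_sup m n U S w' \<le> null_sup m n U S w"
  by (rule null_sup_le, rule order_trans[OF exceed_prob_antimono null_sup_ge])
     (auto simp: null_pairs_iff)

lemma exceed_prob_eq_0: "B \<le> w \<Longrightarrow> exceed_prob m n U S P Q w = 0"
proof -
  assume "B \<le> w"
  then have "{\<omega> \<in> space (two_sample_law (m S) (n S) P Q). U S \<omega> > w} = {}"
    using bounded by (auto simp: abs_le_iff not_less intro: order_trans)
  then show ?thesis unfolding exceed_prob_def by (simp only: measure_empty)
qed

lemma exceed_prob_eq_1: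
  assumes "real_distribution P" "real_distribution Q" "w < - B"
  shows "exceed_prob m n U S P Q w = 1"
proof -
  interpret prob_space "two_sample_law (m S) (n S) P Q"
    using assms by (intro prob_space_two_sample_law)
  have "w < U S \<omega>" for \<omega> using bounded[of \<omega>] assms(3) by (simp add: abs_le_iff)
  then show ?thesis unfolding exceed_prob_def using prob_space by simp
qed

context
  fixes \<alpha> :: real
  assumes \<alpha>: "0 < \<alpha>" "\<alpha> < 1"
begin

lemma level_set: "bdd_below {w. null_sup m n U S w \<le> \<alpha>}" "{w. null_sup m n U S w \<le> \<alpha>} \<noteq> {}"
proof -
  have "- B \<le> w" if "null_sup m n U S w \<le> \<alpha>" for w
  proof (rule ccontr)
    assume "\<not> - B \<le> w"
    then have "exceed_prob m n U S uniform_law uniform_law w = 1"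
      by (intro exceed_prob_eq_1 uniform_law) simp
    then show False using null_sup_ge[OF uniform_in_null_pairs, of m n U S w] that \<alpha> by simp
  qed
  then show "bdd_below {w. null_sup m n U S w \<le> \<alpha>}" by (intro bdd_belowI[of _ "- B"]) simp
  have "null_sup m n U S B \<le> \<alpha>"
    by (rule null_sup_le) (use exceed_prob_eq_0 \<alpha> in auto)
  then show "{w. null_sup m n U S w \<le> \<alpha>} \<noteq> {}" by blast
qed

lemma crit_value_eq: "crit_value m n U S \<alpha> = Inf {w. null_sup m n U S w \<le> \<alpha>}"
  by (simp add: crit_value_def null_sup_def)

lemma crit_value_le: "null_sup m n U S w \<le> \<alpha> \<Longrightarrow> crit_value m n U S \<alpha> \<le> w"
  unfolding crit_value_eq by (rule cInf_lower[OF _ level_set(1)]) simp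

lemma le_crit_value: "\<alpha> < null_sup m n U S w \<Longrightarrow> w \<le> crit_value m n U S \<alpha>"
  unfolding crit_value_eq
proof (rule cInf_greatest[OF level_set(2)])
  fix w' assume "\<alpha> < null_sup m n U S w" "w' \<in> {w. null_sup m n U S w \<le> \<alpha>}"
  then show "w \<le> w'" using null_sup_antimono[of w' w] by (cases "w \<le> w'") auto
qed

lemma null_sup_le_if_crit_less: "crit_value m n U S \<alpha> < w \<Longrightarrow> null_sup m n U S w \<le> \<alpha>"
proof -
  assume "crit_value m n U S \<alpha> < w"
  then obtain w' where "null_sup m n U S w' \<le> \<alpha>" "w' < w"
    unfolding crit_value_eq using cInf_lessD[OF level_set(2)] by auto
  then show ?thesis using null_sup_antimono[of w' w] by simp
qed

lemma less_null_sup_if_less_crit: "w < crit_value m n U S \<alpha> \<Longrightarrow> \<alpha> < null_sup m n U S w"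
  using crit_value_le[of w] by (cases "null_sup m n U S w \<le> \<alpha>") auto

end

end

lemma exceed_prob_T:
  assumes "real_distribution P" "real_distribution Q"
  shows "exceed_prob m n (\<lambda>N. T_stat (m N) (n N) (\<Delta> N) (p N)) S P Q w
    = \<P>(z in pooled_law (m S) (n S) P Q. T_stat (m S) (n S) (\<Delta> S) (p S) (split_at (m S) z) > w)"
  unfolding exceed_prob_def
  by (rule prob_two_sample_law[OF assms T_stat_split_at measurable_T_stat])

lemma exceed_prob_V:
  assumes "real_distribution P" "real_distribution Q" "0 < m S" "0 < n S"
  shows "exceed_prob m n (\<lambda>N. V_stat (m N) (n N)) S P Q w
    = \<P>(z in pooled_law (m S) (n S) P Q. V_stat (m S) (n S) (split_at (m S) z) > w)"
  unfolding exceed_prob_def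
  by (rule prob_two_sample_law[OF assms(1,2) V_stat_split_at measurable_V_stat[OF assms(3,4)]])

lemma event_two_sample_law:
  fixes U :: "samples \<Rightarrow> real"
  assumes PQ: "real_distribution P" "real_distribution Q"
    and U: "\<And>\<omega>. U (split_at a (restrict (pooled a \<omega>) {..<a + b})) = U \<omega>"
    and meas: "(\<lambda>z. U (split_at a z)) \<in> borel_measurable (Pi\<^sub>M {..<a + b} (\<lambda>_. borel))"
  shows "{\<omega> \<in> space (two_sample_law a b P Q). U \<omega> > w} \<in> sets (two_sample_law a b P Q)"
proof -
  have "(\<lambda>\<omega>. U (split_at a (restrict (pooled a \<omega>) {..<a + b}))) \<in> borel_measurable (two_sample_law a b P Q)"
    by (rule measurable_compose[OF distr_two_sample_law(1)[OF PQ] meas])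
  then have "U \<in> borel_measurable (two_sample_law a b P Q)" by (simp add: U)
  then show ?thesis by measurable
qed

text \<open>The statistic depends on the finitely many possible rank vectors only.\<close>

lemma finite_range_T_stat: "finite (range (\<lambda>\<omega>. T_stat a b d p \<omega>))"
proof -
  define ranks where "ranks \<omega> = restrict (rank_in (a + b) (pooled a \<omega>)) {..<a + b}" for \<omega> :: samples
  have "rank_in (a + b) z i \<le> a + b" for z i
  proof -
    have "card {j. j < a + b \<and> z j \<le> z i} \<le> card {..<a + b}" by (rule card_mono) auto
    then show ?thesis by (simp add: rank_in_def)
  qed
  then have "range ranks \<subseteq> Pi\<^sub>E {..<a + b} (\<lambda>_. {..a + b})"
    unfolding ranks_def by (intro image_subsetI) (simp add: restrict_PiE_iff)
  then have fin: "finite (range ranks)" by (rule finite_subset) (auto intro!: finite_PiE)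
  have "T_stat a b d p \<omega> = T_stat a b d p (inv ranks (ranks \<omega>))" for \<omega>
  proof (rule T_stat_cong)
    fix i assume "i < a + b"
    moreover define \<omega>' where "\<omega>' = inv ranks (ranks \<omega>)"
    have "ranks \<omega>' = ranks \<omega>" by (simp add: \<omega>'_def f_inv_into_f)
    then have "ranks \<omega>' i = ranks \<omega> i" by simp
    ultimately show "rank_in (a + b) (pooled a \<omega>) i = rank_in (a + b) (pooled a (inv ranks (ranks \<omega>))) i"
      unfolding \<omega>'_def[symmetric] by (simp add: ranks_def)
  qed
  then have "range (\<lambda>\<omega>. T_stat a b d p \<omega>) \<subseteq> (\<lambda>r. T_stat a b d p (inv ranks r)) ` range ranks" by auto
  then show ?thesis using fin by (rule finite_subset[OF _ finite_imageI])
qed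

lemma T_regular:
  obtains B where "regular_statistic m n (\<lambda>N. T_stat (m N) (n N) (\<Delta> N) (p N)) S B"
proof -
  let ?V = "range (\<lambda>\<omega>. \<bar>T_stat (m S) (n S) (\<Delta> S) (p S) \<omega>\<bar>)"
  have fin: "finite ?V"
    using finite_imageI[OF finite_range_T_stat, of abs "m S" "n S" "\<Delta> S" "p S"] by (simp add: image_image)
  show ?thesis
  proof (rule that[of "Max ?V"], unfold_locales)
    show "\<bar>T_stat (m S) (n S) (\<Delta> S) (p S) \<omega>\<bar> \<le> Max ?V" for \<omega> using fin by (intro Max_ge) auto
  qed (rule event_two_sample_law[OF _ _ T_stat_split_at measurable_T_stat])
qed

lemma V_regular:
  assumes "0 < m S" "0 < n S"
  shows "regular_statistic m n (\<lambda>N. V_stat (m N) (n N)) S (sqrt (real (m S) * real (n S) / real (m S + n S)))"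
proof
  let ?\<sigma> = "sqrt (real (m S) * real (n S) / real (m S + n S))"
  fix \<omega> :: samples
  obtain x y where \<omega>: "\<omega> = (x, y)" by (cases \<omega>)
  have "\<bar>SUP z. ecdf (n S) y z - ecdf (m S) x z\<bar> \<le> 1"
  proof (rule cSup_abs_le)
    show "\<bar>v\<bar> \<le> 1" if range: "v \<in> range (\<lambda>z. ecdf (n S) y z - ecdf (m S) x z)" for v
    proof -
      obtain z where v: "v = ecdf (n S) y z - ecdf (m S) x z" using range by auto
      show ?thesis
        using ecdf_bounds[of "n S" y z] ecdf_bounds[of "m S" x z] unfolding v by linarith
    qed
  qed simp
  then have "?\<sigma> * \<bar>SUP z. ecdf (n S) y z - ecdf (m S) x z\<bar> \<le> ?\<sigma> * 1" by (intro mult_left_mono) auto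
  then show "\<bar>V_stat (m S) (n S) \<omega>\<bar> \<le> ?\<sigma>" by (simp add: \<omega> V_stat_def abs_mult)
qed (rule event_two_sample_law[OF _ _ V_stat_split_at measurable_V_stat[OF assms]])

text \<open>The least favourable null pair is a pair of equal laws, all of which give the ranks the same
  distribution.\<close>

lemma null_sup_T:
  assumes ab: "0 < m S" "0 < n S" and d: "1 \<le> \<Delta> S" and p: "\<And>j. j \<in> {1..\<Delta> S} \<Longrightarrow> 0 < p S j \<and> p S j < 1"
  shows "null_sup m n (\<lambda>N. T_stat (m N) (n N) (\<Delta> N) (p N)) S w
    = \<P>(z in pooled_law (m S) (n S) uniform_law uniform_law. T_stat (m S) (n S) (\<Delta> S) (p S) (split_at (m S) z) > w)"
proof (rule antisym)
  show "null_sup m n (\<lambda>N. T_stat (m N) (n N) (\<Delta> N) (p N)) S w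
    \<le> \<P>(z in pooled_law (m S) (n S) uniform_law uniform_law. T_stat (m S) (n S) (\<Delta> S) (p S) (split_at (m S) z) > w)"
  proof (rule null_sup_le)
    fix P Q assume "(P, Q) \<in> null_pairs"
    then have PQ: "real_distribution P" "real_distribution Q" "continuous_on UNIV (cdf P)" "continuous_on UNIV (cdf Q)"
      and le: "\<And>z. cdf Q z \<le> cdf P z" by (auto simp: null_pairs_iff)
    interpret two_samples "m S" "n S" P Q by (intro two_samples.intro ab PQ)
    show "exceed_prob m n (\<lambda>N. T_stat (m N) (n N) (\<Delta> N) (p N)) S P Q w
      \<le> \<P>(z in pooled_law (m S) (n S) uniform_law uniform_law. T_stat (m S) (n S) (\<Delta> S) (p S) (split_at (m S) z) > w)"
      unfolding exceed_prob_T[where m=m and n=n and S=S, OF PQ(1,2)] pooled_law_eq by (rule null_T_le_uniform[OF le d p])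
  qed
  show "\<P>(z in pooled_law (m S) (n S) uniform_law uniform_law. T_stat (m S) (n S) (\<Delta> S) (p S) (split_at (m S) z) > w)
    \<le> null_sup m n (\<lambda>N. T_stat (m N) (n N) (\<Delta> N) (p N)) S w"
    using null_sup_ge[OF uniform_in_null_pairs, of m n "\<lambda>N. T_stat (m N) (n N) (\<Delta> N) (p N)" S w]
    unfolding exceed_prob_T[where m=m and n=n and S=S, OF uniform_law(1) uniform_law(1)] .
qed

text \<open>Null pairs satisfy \<open>G - F \<le> 0\<close>, so \<open>V_upper_tail\<close> applies with \<open>d = 0\<close>.\<close>

lemma null_sup_V_le:
  assumes ab: "0 < m S" "0 < n S" and w: "1 \<le> w"
  shows "null_sup m n (\<lambda>N. V_stat (m N) (n N)) S w \<le> real (m S + n S) * exp (- 2 * (w - 1)\<^sup>2)"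
proof (rule null_sup_le)
  fix P Q assume "(P, Q) \<in> null_pairs"
  then have PQ: "real_distribution P" "real_distribution Q" "continuous_on UNIV (cdf P)" "continuous_on UNIV (cdf Q)"
    and le: "\<And>z. cdf Q z - cdf P z \<le> 0" by (auto simp: null_pairs_iff)
  interpret two_samples "m S" "n S" P Q by (intro two_samples.intro ab PQ)
  show "exceed_prob m n (\<lambda>N. V_stat (m N) (n N)) S P Q w \<le> real (m S + n S) * exp (- 2 * (w - 1)\<^sup>2)"
    unfolding exceed_prob_V[where m=m and n=n and S=S, OF PQ(1,2) ab] pooled_law_eq using V_upper_tail[OF le, of w] w by simp
qed

text \<open>Under the uniform law, a surplus of more than \<open>\<tau>\<close> second-sample observations among the \<open>k\<close>
  observations below the \<open>k / N\<close>-quantile has at least Gaussian probability. This single event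
  raises both statistics, which is why it yields lower bounds for both of their null tails.\<close>

lemma uniform_surplus_lower:
  assumes ab: "0 < a" "0 < b" and q: "q = real k / real (a + b)" "1 / 4 \<le> q" "q \<le> 3 / 4"
    and \<tau>: "0 \<le> \<tau>" "\<tau> + 1 \<le> real a / 8" "\<tau> + 1 \<le> real b / 8"
  defines "v \<equiv> real a * real b / real (a + b)"
  obtains t k2 where "\<tau> < real k2 - real b * q" "k2 \<le> k"
    and "exp (- ((\<tau> + 1)\<^sup>2 / (2 * v * (q * (1 - q)))) * (1 + 100 * ((\<tau> + 1) / v))) / (real (a + b) + 1)\<^sup>2
      \<le> \<P>(z in pooled_law a b uniform_law uniform_law. card {i. i < a \<and> z i \<le> t} = k - k2
            \<and> card {i. a \<le> i \<and> i < a + b \<and> z i \<le> t} = k2)"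
proof -
  interpret two_samples a b uniform_law uniform_law by (rule two_samples_uniform[OF ab])
  have v: "v = \<sigma>\<^sup>2" "0 < v" using ab by (simp_all add: v_def \<sigma>_sq)
  have q01: "0 < q" "q < 1" "0 < q * (1 - q)" using q(2,3) by auto
  obtain t where t: "cdf uniform_law t = q" using cdf_surj[OF laws(1) cont(1) q01(1,2)] .
  define k2 where "k2 = nat (\<lfloor>real b * q + \<tau>\<rfloor> + 1)"
  have "0 \<le> real b * q + \<tau>" using q01 \<tau> by simp
  then have "real k2 = of_int (\<lfloor>real b * q + \<tau>\<rfloor> + 1)" by (simp add: k2_def)
  then have s: "\<tau> < real k2 - real b * q" "real k2 - real b * q \<le> \<tau> + 1" by linarith+
  define s where "s = real k2 - real b * q"
  have s': "0 < s" "s \<le> \<tau> + 1" "\<bar>s\<bar> \<le> real a / 8" "\<bar>s\<bar> \<le> real b / 8"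
    using s \<tau> by (auto simp: s_def)
  note lower = counts_null_lower[OF refl t q s_def s'(3,4)]
  have sum: "\<bar>s\<bar> / real a + \<bar>s\<bar> / real b = s / v"
  proof -
    have "\<bar>s\<bar> / real a + \<bar>s\<bar> / real b = s * (1 / real a + 1 / real b)"
      using s'(1) by (simp add: distrib_left)
    then show ?thesis by (simp add: inverse_sum v(1))
  qed
  have "s\<^sup>2 / (2 * v * (q * (1 - q))) * (1 + 100 * (s / v))
      \<le> (\<tau> + 1)\<^sup>2 / (2 * v * (q * (1 - q))) * (1 + 100 * ((\<tau> + 1) / v))"
    using s' v(2) q01 \<tau>(1)
    by (intro mult_mono divide_right_mono add_left_mono mult_left_mono power_mono) auto
  then have "exp (- ((\<tau> + 1)\<^sup>2 / (2 * v * (q * (1 - q)))) * (1 + 100 * ((\<tau> + 1) / v))) / (real (a + b) + 1)\<^sup>2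
      \<le> exp (- (s\<^sup>2 / (2 * v * (q * (1 - q)))) * (1 + 100 * (s / v))) / (real (a + b) + 1)\<^sup>2"
    by (intro divide_right_mono) auto
  also have "\<dots> \<le> \<P>(z in \<Omega>. count_x z {..t} = k - k2 \<and> count_y z {..t} = k2)"
    using lower(2) by (simp only: sum v(1))
  finally have "exp (- ((\<tau> + 1)\<^sup>2 / (2 * v * (q * (1 - q)))) * (1 + 100 * ((\<tau> + 1) / v))) / (real (a + b) + 1)\<^sup>2
      \<le> \<P>(z in pooled_law a b uniform_law uniform_law. card {i. i < a \<and> z i \<le> t} = k - k2
            \<and> card {i. a \<le> i \<and> i < a + b \<and> z i \<le> t} = k2)"
    unfolding pooled_law_eq atMost_iff .
  with s(1) lower(1) show ?thesis by (rule that)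
qed

text \<open>At the point \<open>t\<close> supplied by \<open>uniform_surplus_lower\<close> the empirical distribution functions differ by
  the surplus divided by \<open>v\<close>.\<close>

lemma uniform_V_ge:
  assumes ab: "0 < a" "0 < b" and q: "q = real k / real (a + b)" "1 / 4 \<le> q" "q \<le> 3 / 4"
    and w: "0 \<le> w"
  defines "v \<equiv> real a * real b / real (a + b)"
  assumes small: "sqrt v * w + 1 \<le> real a / 8" "sqrt v * w + 1 \<le> real b / 8"
  shows "exp (- ((sqrt v * w + 1)\<^sup>2 / (2 * v * (q * (1 - q)))) * (1 + 100 * ((sqrt v * w + 1) / v))) / (real (a + b) + 1)\<^sup>2
    \<le> \<P>(z in pooled_law a b uniform_law uniform_law. V_stat a b (split_at a z) > w)"
proof -
  interpret two_samples a b uniform_law uniform_law by (rule two_samples_uniform[OF ab])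
  have v: "sqrt v = \<sigma>" "0 < v" using ab by (simp_all add: v_def \<sigma>_def)
  have 0: "0 \<le> sqrt v * w" unfolding v(1) using w \<sigma>_pos by (intro mult_nonneg_nonneg) auto
  obtain t k2 where k2: "sqrt v * w < real k2 - real b * q" "k2 \<le> k"
    and lower: "exp (- ((sqrt v * w + 1)\<^sup>2 / (2 * v * (q * (1 - q)))) * (1 + 100 * ((sqrt v * w + 1) / v))) / (real (a + b) + 1)\<^sup>2
      \<le> \<P>(z in pooled_law a b uniform_law uniform_law. card {i. i < a \<and> z i \<le> t} = k - k2
            \<and> card {i. a \<le> i \<and> i < a + b \<and> z i \<le> t} = k2)"
    by (rule uniform_surplus_lower[OF ab q 0 small, folded v_def]) blast
  have "\<P>(z in pooled_law a b uniform_law uniform_law. card {i. i < a \<and> z i \<le> t} = k - k2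
            \<and> card {i. a \<le> i \<and> i < a + b \<and> z i \<le> t} = k2)
      \<le> \<P>(z in pooled_law a b uniform_law uniform_law. V_stat a b (split_at a z) > w)"
    unfolding pooled_law_eq
  proof (rule P.finite_measure_mono[OF _ V_event], rule subsetI)
    fix z assume z: "z \<in> {z \<in> space \<Omega>. card {i. i < a \<and> z i \<le> t} = k - k2 \<and> card {i. a \<le> i \<and> i < a + b \<and> z i \<le> t} = k2}"
    then have c: "card {i. i < a \<and> z i \<le> t} = k - k2" "card {i. a \<le> i \<and> i < a + b \<and> z i \<le> t} = k2" by simp_all
    have "\<sigma> * (real (count_y z {..t}) / real b - real (count_x z {..t}) / real a)
        = \<sigma> * (real k2 / real b - (real k - real k2) / real a)"
      using k2(2) by (simp add: c of_nat_diff)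
    also have "\<dots> = \<sigma> * ((real k2 - real b * q) / \<sigma>\<^sup>2)"
      by (simp only: frequency_difference q(1))
    also have "\<dots> = (real k2 - real b * q) / \<sigma>" using \<sigma>_pos by (simp add: power2_eq_square)
    also have "\<dots> > w" using k2(1) \<sigma>_pos by (simp add: v pos_less_divide_eq mult.commute)
    finally have "w < V_stat a b (split_at a z)" unfolding V_gt_iff_counts by blast
    then show "z \<in> {z \<in> space \<Omega>. w < V_stat a b (split_at a z)}" using z by simp
  qed
  with lower show ?thesis by (rule order_trans)
qed

text \<open>When exactly \<open>k\<close> observations lie below \<open>t\<close>, the rank count at level \<open>k\<close> is the count below \<open>t\<close>.\<close>

lemma uniform_T_ge:
  assumes ab: "0 < a" "0 < b" and p: "\<And>j. j \<in> {1..d} \<Longrightarrow> 0 < p j \<and> p j < 1" and j: "j \<in> {1..d}"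
    and q: "q = real (level (a + b) (p j)) / real (a + b)" "1 / 4 \<le> q" "q \<le> 3 / 4"
    and w: "0 \<le> w"
  defines "v \<equiv> real a * real b / real (a + b)" and "\<rho> \<equiv> sqrt (p j * (1 - p j))"
  assumes small: "sqrt v * \<rho> * w + 1 \<le> real a / 8" "sqrt v * \<rho> * w + 1 \<le> real b / 8"
  shows "exp (- ((sqrt v * \<rho> * w + 1)\<^sup>2 / (2 * v * (q * (1 - q)))) * (1 + 100 * ((sqrt v * \<rho> * w + 1) / v))) / (real (a + b) + 1)\<^sup>2
    \<le> \<P>(z in pooled_law a b uniform_law uniform_law. T_stat a b d p (split_at a z) > w)"
proof -
  interpret two_samples a b uniform_law uniform_law by (rule two_samples_uniform[OF ab])
  define k where "k = level (a + b) (p j)"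
  have v: "sqrt v = \<sigma>" "0 < v" using ab by (simp_all add: v_def \<sigma>_def)
  have \<rho>: "0 < \<rho>" using p[OF j] by (simp add: \<rho>_def)
  have 0: "0 \<le> sqrt v * \<rho> * w" unfolding v(1) using w \<sigma>_pos \<rho> by (intro mult_nonneg_nonneg) auto
  obtain t k2 where k2: "sqrt v * \<rho> * w < real k2 - real b * q" "k2 \<le> k"
    and lower: "exp (- ((sqrt v * \<rho> * w + 1)\<^sup>2 / (2 * v * (q * (1 - q)))) * (1 + 100 * ((sqrt v * \<rho> * w + 1) / v))) / (real (a + b) + 1)\<^sup>2
      \<le> \<P>(z in pooled_law a b uniform_law uniform_law. card {i. i < a \<and> z i \<le> t} = k - k2
            \<and> card {i. a \<le> i \<and> i < a + b \<and> z i \<le> t} = k2)"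
    by (rule uniform_surplus_lower[OF ab q[folded k_def] 0 small, folded v_def]) blast
  have "\<P>(z in pooled_law a b uniform_law uniform_law. card {i. i < a \<and> z i \<le> t} = k - k2
            \<and> card {i. a \<le> i \<and> i < a + b \<and> z i \<le> t} = k2)
      \<le> \<P>(z in pooled_law a b uniform_law uniform_law. T_stat a b d p (split_at a z) > w)"
    unfolding pooled_law_eq
  proof (rule P.finite_measure_mono_AE[OF _ T_event], rule AE_mp[OF AE_inj], intro AE_I2 impI)
    fix z assume inj: "inj_on z {..<a + b}"
      and z: "z \<in> {z \<in> space \<Omega>. card {i. i < a \<and> z i \<le> t} = k - k2 \<and> card {i. a \<le> i \<and> i < a + b \<and> z i \<le> t} = k2}"
    then have c: "card {i. i < a \<and> z i \<le> t} = k - k2" "card {i. a \<le> i \<and> i < a + b \<and> z i \<le> t} = k2" by simp_all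
    have tot: "card {i. i < a + b \<and> z i \<le> t} = k"
      unfolding count_add[symmetric] using k2(2) c by simp
    have "y_low a z (a + b) k = k2"
      using y_low_ge_count(1)[of "a + b" z t k a] y_low_le_count(1)[of k "a + b" z t a] tot c(2) by simp
    then have "T_of_counts a b (p j) z = (real k2 - real b * q) / (\<sigma> * \<rho>)"
      by (simp add: T_of_counts_def k_def[symmetric] q(1) \<sigma>_def \<rho>_def)
    also have "\<dots> > w" using k2(1) \<sigma>_pos \<rho> by (simp add: v pos_less_divide_eq mult_ac)
    finally have "w < T_of_counts a b (p j) z" .
    also have "\<dots> \<le> (MAX j\<in>{1..d}. T_of_counts a b (p j) z)" using j by (intro Max_ge) auto
    also have "\<dots> = T_stat a b d p (split_at a z)" by (rule T_stat_eq_Max[OF ab p inj, symmetric])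
    finally show "z \<in> {z \<in> space \<Omega>. w < T_stat a b d p (split_at a z)}" using z by simp
  qed
  with lower show ?thesis by (rule order_trans)
qed

section \<open>The functions \<open>A_bar\<close> and \<open>A_star\<close>\<close>

lemma continuous_df_bounds:
  assumes "continuous_df F"
  shows "0 \<le> F z" "F z \<le> 1"
proof -
  have F: "mono F" "(F \<longlongrightarrow> 0) at_bot" "(F \<longlongrightarrow> 1) at_top" using assms by (auto simp: continuous_df_def)
  show "0 \<le> F z"
    by (rule tendsto_upperbound[OF F(2)])
       (auto intro: eventually_mono[OF eventually_le_at_bot[of z]] monoD[OF F(1)])
  show "F z \<le> 1"
    by (rule tendsto_lowerbound[OF F(3)])
       (auto intro: eventually_mono[OF eventually_ge_at_top[of z]] monoD[OF F(1)])
qed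

lemma continuous_df_convex:
  assumes F: "continuous_df F" and G: "continuous_df G" and l: "0 \<le> l" "l \<le> 1"
  shows "continuous_df (\<lambda>z. (1 - l) * F z + l * G z)"
proof -
  have F': "mono F" "continuous_on UNIV F" "(F \<longlongrightarrow> 0) at_bot" "(F \<longlongrightarrow> 1) at_top"
    and G': "mono G" "continuous_on UNIV G" "(G \<longlongrightarrow> 0) at_bot" "(G \<longlongrightarrow> 1) at_top"
    using F G by (auto simp: continuous_df_def)
  show ?thesis
    unfolding continuous_df_def
  proof (intro conjI)
    show "mono (\<lambda>z. (1 - l) * F z + l * G z)"
      using F'(1) G'(1) l by (auto simp: mono_def intro!: add_mono mult_left_mono)
    show "continuous_on UNIV (\<lambda>z. (1 - l) * F z + l * G z)"
      by (intro continuous_intros F' G')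
    have "((\<lambda>z. (1 - l) * F z + l * G z) \<longlongrightarrow> (1 - l) * 0 + l * 0) at_bot"
      by (intro tendsto_intros F' G')
    then show "((\<lambda>z. (1 - l) * F z + l * G z) \<longlongrightarrow> 0) at_bot" by simp
    have "((\<lambda>z. (1 - l) * F z + l * G z) \<longlongrightarrow> (1 - l) * 1 + l * 1) at_top"
      by (intro tendsto_intros F' G')
    then show "((\<lambda>z. (1 - l) * F z + l * G z) \<longlongrightarrow> 1) at_top" by simp
  qed
qed

locale df_pair =
  fixes F G J :: "real \<Rightarrow> real" and \<eta> :: real
  assumes F: "continuous_df F" and G: "continuous_df G" and ex: "\<exists>z. F z < G z"
    and \<eta>: "0 < \<eta>" "\<eta> < 1" and J: "J = mix_df \<eta> F G"
begin

definition "c = min \<eta> (1 - \<eta>)"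
definition "D z = G z - F z"
definition "A z = D z / sqrt (J z * (1 - J z))"

lemma c: "0 < c" "c \<le> \<eta>" "c \<le> 1 - \<eta>" using \<eta> by (auto simp: c_def)

lemma J_eq: "J z = \<eta> * F z + (1 - \<eta>) * G z" by (simp add: J mix_df_def)

lemma J_df: "continuous_df J"
proof -
  have "J = (\<lambda>z. (1 - (1 - \<eta>)) * F z + (1 - \<eta>) * G z)" by (simp add: fun_eq_iff J_eq)
  then show ?thesis using continuous_df_convex[OF F G, of "1 - \<eta>"] \<eta> by simp
qed

lemmas F01 = continuous_df_bounds[OF F] and G01 = continuous_df_bounds[OF G] and J01 = continuous_df_bounds[OF J_df]

lemma cont: "continuous_on UNIV F" "continuous_on UNIV G" "continuous_on UNIV J"
  using F G J_df by (auto simp: continuous_df_def)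

lemma mono: "x \<le> y \<Longrightarrow> F x \<le> F y" "x \<le> y \<Longrightarrow> G x \<le> G y" "x \<le> y \<Longrightarrow> J x \<le> J y"
  using F G J_df by (auto simp: continuous_df_def mono_def)

lemma c_mult_le: "c * F z \<le> J z" "c * G z \<le> J z" "c * (1 - F z) \<le> 1 - J z" "c * (1 - G z) \<le> 1 - J z"
proof -
  have "c * F z \<le> \<eta> * F z" "c * G z \<le> (1 - \<eta>) * G z"
    "c * (1 - F z) \<le> \<eta> * (1 - F z)" "c * (1 - G z) \<le> (1 - \<eta>) * (1 - G z)"
    using c F01[of z] G01[of z] by (auto intro: mult_right_mono)
  moreover have "0 \<le> \<eta> * F z" "0 \<le> (1 - \<eta>) * G z" "0 \<le> \<eta> * (1 - F z)" "0 \<le> (1 - \<eta>) * (1 - G z)"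
    using \<eta> F01[of z] G01[of z] by auto
  moreover have "1 - J z = \<eta> * (1 - F z) + (1 - \<eta>) * (1 - G z)" by (simp add: J_eq algebra_simps)
  ultimately show "c * F z \<le> J z" "c * G z \<le> J z" "c * (1 - F z) \<le> 1 - J z" "c * (1 - G z) \<le> 1 - J z"
    unfolding J_eq[of z] by linarith+
qed

text \<open>\<open>F\<close> and \<open>G\<close> are at most \<open>J / c\<close>, and \<open>1 - F\<close> and \<open>1 - G\<close> at most \<open>(1 - J) / c\<close>; hence \<open>G - F\<close> vanishes
  linearly where \<open>J\<close> approaches \<open>0\<close> or \<open>1\<close>. This keeps \<open>A_star\<close> bounded and makes its supremum a maximum.\<close>

lemma abs_D_le: "\<bar>D z\<bar> \<le> 2 / c * (J z * (1 - J z))"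
proof -
  have "c * \<bar>D z\<bar> \<le> J z"
  proof -
    have "\<bar>D z\<bar> \<le> max (F z) (G z)" using F01[of z] G01[of z] by (auto simp: D_def)
    then have "c * \<bar>D z\<bar> \<le> c * max (F z) (G z)" using c by (intro mult_left_mono) auto
    also have "\<dots> \<le> J z" using c_mult_le[of z] by (simp add: max_def)
    finally show ?thesis .
  qed
  moreover have "c * \<bar>D z\<bar> \<le> 1 - J z"
  proof -
    have "\<bar>D z\<bar> \<le> max (1 - F z) (1 - G z)" using F01[of z] G01[of z] by (auto simp: D_def)
    then have "c * \<bar>D z\<bar> \<le> c * max (1 - F z) (1 - G z)" using c by (intro mult_left_mono) auto
    also have "\<dots> \<le> 1 - J z" using c_mult_le[of z] by (simp add: max_def)
    finally show ?thesis .
  qed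
  moreover have "min (J z) (1 - J z) \<le> 2 * (J z * (1 - J z))"
  proof (cases "J z \<le> 1 / 2")
    case True
    then have "J z * 1 \<le> J z * (2 * (1 - J z))" using J01[of z] by (intro mult_left_mono) auto
    moreover have "J z * (2 * (1 - J z)) = 2 * (J z * (1 - J z))" by (rule mult.left_commute)
    ultimately show ?thesis by linarith
  next
    case False
    then have "(1 - J z) * 1 \<le> (1 - J z) * (2 * J z)" using J01[of z] by (intro mult_left_mono) auto
    also have "(1 - J z) * (2 * J z) = 2 * (J z * (1 - J z))" by simp
    finally have "1 - J z \<le> 2 * (J z * (1 - J z))" by (simp only: mult_1_right)
    then show ?thesis by (rule min.coboundedI2)
  qed
  ultimately have "c * \<bar>D z\<bar> \<le> 2 * (J z * (1 - J z))" by linarith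
  then show ?thesis using c by (simp add: pos_le_divide_eq mult.commute)
qed

text \<open>As functions of \<open>J\<close>, both distribution functions are Lipschitz.\<close>

lemma D_lipschitz: "\<bar>D x - D y\<bar> \<le> 2 / c * \<bar>J x - J y\<bar>"
proof -
  have main: "c * \<bar>F u - F v\<bar> \<le> \<bar>J u - J v\<bar> \<and> c * \<bar>G u - G v\<bar> \<le> \<bar>J u - J v\<bar>" if "v \<le> u" for u v
  proof -
    have d: "0 \<le> F u - F v" "0 \<le> G u - G v" using mono that by auto
    have e: "J u - J v = \<eta> * (F u - F v) + (1 - \<eta>) * (G u - G v)" by (simp add: J_eq algebra_simps)
    have "c * (F u - F v) \<le> \<eta> * (F u - F v)" "c * (G u - G v) \<le> (1 - \<eta>) * (G u - G v)"
      using c d by (auto intro: mult_right_mono)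
    moreover have "0 \<le> \<eta> * (F u - F v)" "0 \<le> (1 - \<eta>) * (G u - G v)" using \<eta> d by auto
    ultimately show ?thesis using d e by linarith
  qed
  have "c * \<bar>F x - F y\<bar> \<le> \<bar>J x - J y\<bar>" "c * \<bar>G x - G y\<bar> \<le> \<bar>J x - J y\<bar>"
    by (cases "y \<le> x"; use main[of y x] main[of x y] in \<open>auto simp: abs_minus_commute\<close>)+
  moreover have "c * \<bar>D x - D y\<bar> \<le> c * \<bar>F x - F y\<bar> + c * \<bar>G x - G y\<bar>"
    unfolding distrib_left[symmetric] using c by (intro mult_left_mono) (auto simp: D_def)
  ultimately have "c * \<bar>D x - D y\<bar> \<le> \<bar>J x - J y\<bar> + \<bar>J x - J y\<bar>"
    by (meson add_mono order_trans)
  then have "c * \<bar>D x - D y\<bar> \<le> 2 * \<bar>J x - J y\<bar>" by (simp only: mult_2)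
  then show ?thesis using c by (simp add: pos_le_divide_eq mult.commute)
qed

lemma J_pos_if_D: "D z \<noteq> 0 \<Longrightarrow> 0 < J z \<and> J z < 1"
proof -
  assume "D z \<noteq> 0"
  then have "0 < 2 / c * (J z * (1 - J z))" using abs_D_le[of z] by linarith
  then have "0 < J z * (1 - J z)" using c(1) by (elim zero_less_mult_pos) simp
  then show ?thesis using J01[of z] by (auto simp: zero_less_mult_iff)
qed

text \<open>Where \<open>J (1 - J)\<close> is small, \<open>f\<close> is smaller than \<open>f z0\<close>. The remaining points form a compact set, on
  which \<open>f\<close> is continuous.\<close>

lemma attains_max:
  assumes f: "\<And>z. f z \<le> C * sqrt (J z * (1 - J z))" and C: "0 < C"
    and cf: "continuous_on {z. 0 < J z \<and> J z < 1} f" and z0: "0 < f z0"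
  obtains z where "0 < J z" "J z < 1" "\<And>y. f y \<le> f z"
proof -
  define v where "v z = J z * (1 - J z)" for z
  have "0 < C * sqrt (v z0)" using f[of z0] z0 unfolding v_def by linarith
  then have v0: "0 < v z0" using C by (simp add: zero_less_mult_iff)
  define \<tau> where "\<tau> = min (v z0) ((f z0 / (2 * C))\<^sup>2)"
  have \<tau>: "0 < \<tau>" using v0 z0 C by (simp add: \<tau>_def)
  define K where "K = {z. \<tau> \<le> v z}"
  have lim: "(J \<longlongrightarrow> 0) at_bot" "(J \<longlongrightarrow> 1) at_top" using J_df by (auto simp: continuous_df_def)
  obtain u1 where u1: "\<And>z. z \<le> u1 \<Longrightarrow> J z < \<tau>"
    using order_tendstoD(2)[OF lim(1) \<tau>] by (auto simp: eventually_at_bot_linorder)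
  obtain u2 where u2: "\<And>z. u2 \<le> z \<Longrightarrow> 1 - \<tau> < J z"
    using order_tendstoD(1)[OF lim(2), of "1 - \<tau>"] \<tau> by (auto simp: eventually_at_top_linorder)
  have "K \<subseteq> {u1..u2}"
  proof
    fix z assume "z \<in> K"
    then have z: "\<tau> \<le> J z * (1 - J z)" by (simp add: K_def v_def)
    have "J z * (1 - J z) \<le> J z * 1" "J z * (1 - J z) \<le> 1 * (1 - J z)"
      using J01[of z] by (intro mult_left_mono mult_right_mono; simp)+
    then show "z \<in> {u1..u2}" using z u1[of z] u2[of z] by fastforce
  qed
  moreover have "closed K"
    unfolding K_def v_def using cont(3) by (intro closed_Collect_le continuous_intros) auto
  ultimately have "compact K"
    using compact_Int_closed[OF compact_Icc[of u1 u2], of K] by (simp add: Int_absorb1)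
  moreover have "z0 \<in> K" by (simp add: K_def \<tau>_def)
  moreover have K01: "K \<subseteq> {z. 0 < J z \<and> J z < 1}"
  proof
    fix z assume "z \<in> K"
    then have "0 < J z * (1 - J z)" using \<tau> by (simp add: K_def v_def)
    then show "z \<in> {z. 0 < J z \<and> J z < 1}" using J01[of z] by (auto simp: zero_less_mult_iff)
  qed
  ultimately obtain z where z: "z \<in> K" "\<And>y. y \<in> K \<Longrightarrow> f y \<le> f z"
    using continuous_attains_sup[of K f] continuous_on_subset[OF cf] by blast
  have "f y \<le> f z" for y
  proof (cases "y \<in> K")
    case False
    then have "v y < (f z0 / (2 * C))\<^sup>2" by (simp add: K_def \<tau>_def)
    then have "sqrt (v y) < f z0 / (2 * C)"
      using z0 C by (intro real_less_lsqrt) auto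
    then have "C * sqrt (v y) < C * (f z0 / (2 * C))" using C by (intro mult_strict_left_mono)
    then have "f y < f z0 / 2" using f[of y] C by (simp add: v_def)
    also have "\<dots> < f z0" using z0 by simp
    finally show ?thesis using z(2)[OF \<open>z0 \<in> K\<close>] by simp
  qed (rule z)
  with z(1) K01 show ?thesis by (intro that[of z]) auto
qed

lemma ex_D_max: "\<exists>z. 0 < J z \<and> J z < 1 \<and> (\<forall>y. D y \<le> D z)"
proof -
  obtain z0 where z0: "0 < D z0" using ex by (auto simp: D_def)
  have "D z \<le> 2 / c * sqrt (J z * (1 - J z))" for z
  proof -
    have v: "0 \<le> J z * (1 - J z)" "J z * (1 - J z) \<le> 1"
      using J01[of z] mult_le_one[of "J z" "1 - J z"] by auto
    have "J z * (1 - J z) = sqrt (J z * (1 - J z)) * sqrt (J z * (1 - J z))" using v by simp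
    also have "\<dots> \<le> sqrt (J z * (1 - J z)) * 1" using v by (intro mult_left_mono) auto
    finally have "2 / c * (J z * (1 - J z)) \<le> 2 / c * sqrt (J z * (1 - J z))"
      using c by (intro mult_left_mono) auto
    then show ?thesis using abs_D_le[of z] by linarith
  qed
  moreover have "continuous_on {z. 0 < J z \<and> J z < 1} D"
    unfolding D_def using cont by (intro continuous_on_subset[OF continuous_on_diff]) auto
  ultimately show ?thesis using attains_max[of D "2 / c" z0] c z0 by (metis divide_pos_pos zero_less_numeral)
qed

lemma A_le: "\<bar>A z\<bar> \<le> 2 / c * sqrt (J z * (1 - J z))"
proof (cases "D z = 0")
  case True
  then show ?thesis using c J01[of z] by (simp add: A_def)
next
  case False
  then have v: "0 < J z * (1 - J z)" using J_pos_if_D by auto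
  have "\<bar>A z\<bar> = \<bar>D z\<bar> / sqrt (J z * (1 - J z))" using v by (simp add: A_def)
  also have "\<dots> \<le> 2 / c * (J z * (1 - J z)) / sqrt (J z * (1 - J z))"
    using abs_D_le v by (intro divide_right_mono) auto
  also have "\<dots> = 2 / c * (J z * (1 - J z) / sqrt (J z * (1 - J z)))" by simp
  also have "J z * (1 - J z) / sqrt (J z * (1 - J z)) = sqrt (J z * (1 - J z))"
    using v by (intro real_div_sqrt) simp
  finally show ?thesis .
qed

lemma ex_A_max: "\<exists>z. 0 < J z \<and> J z < 1 \<and> (\<forall>y. A y \<le> A z)"
proof -
  obtain z0 where z0: "0 < D z0" using ex by (auto simp: D_def)
  then have "0 < A z0" using J_pos_if_D[of z0] by (simp add: A_def)
  moreover have "A z \<le> 2 / c * sqrt (J z * (1 - J z))" for z using A_le[of z] by linarith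
  moreover have "continuous_on {z. 0 < J z \<and> J z < 1} A"
    unfolding A_def D_def
    by (intro continuous_intros continuous_on_subset[OF cont(1)] continuous_on_subset[OF cont(2)]
        continuous_on_subset[OF cont(3)]) auto
  ultimately show ?thesis using attains_max[of A "2 / c" z0] c by (metis divide_pos_pos zero_less_numeral)
qed

definition "zD = (SOME z. 0 < J z \<and> J z < 1 \<and> (\<forall>y. D y \<le> D z))"
definition "zA = (SOME z. 0 < J z \<and> J z < 1 \<and> (\<forall>y. A y \<le> A z))"
definition "Dmax = D zD"
definition "Amax = A zA"

lemma zD: "0 < J zD" "J zD < 1" "D y \<le> Dmax"
  using someI_ex[OF ex_D_max] by (auto simp: zD_def[symmetric] Dmax_def)

lemma zA: "0 < J zA" "J zA < 1" "A y \<le> Amax"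
  using someI_ex[OF ex_A_max] by (auto simp: zA_def[symmetric] Amax_def)

lemma Dmax_pos: "0 < Dmax"
proof -
  obtain z0 where "0 < D z0" using ex by (auto simp: D_def)
  then show ?thesis using zD(3)[of z0] by linarith
qed

lemma Amax_pos: "0 < Amax"
proof -
  have "0 < A zD" using Dmax_pos zD by (simp add: A_def Dmax_def)
  then show ?thesis using zA(3)[of zD] by linarith
qed

lemma J_quantile:
  assumes "0 < t" "t < 1"
  shows "J (quantile J t) = t"
proof -
  have lim: "(J \<longlongrightarrow> 0) at_bot" "(J \<longlongrightarrow> 1) at_top" using J_df by (auto simp: continuous_df_def)
  obtain u where u: "\<And>z. z \<le> u \<Longrightarrow> J z < t"
    using order_tendstoD(2)[OF lim(1) assms(1)] by (auto simp: eventually_at_bot_linorder)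
  obtain v where v: "t < J v"
    using order_tendstoD(1)[OF lim(2) assms(2)] by (auto simp: eventually_at_top_linorder)
  let ?S = "{z. t \<le> J z}"
  have S: "closed ?S" "?S \<noteq> {}" "bdd_below ?S"
  proof -
    show "closed ?S" using cont(3) by (intro closed_Collect_le) auto
    show "?S \<noteq> {}" using v by (auto intro: less_imp_le)
    have "u \<le> z" if "t \<le> J z" for z using u[of z] that by (cases "u \<le> z") auto
    then show "bdd_below ?S" by (intro bdd_belowI[of _ u]) auto
  qed
  have q: "quantile J t \<in> ?S" unfolding quantile_def by (rule closed_contains_Inf[OF S(2,3,1)])
  obtain w where w: "J w = t"
  proof -
    have "u \<le> v" using mono(3)[of v u] u[of u] v by (cases "u \<le> v") auto
    then have "\<exists>w\<ge>u. w \<le> v \<and> J w = t"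
      using u[of u] v cont(3) by (intro IVT) (auto simp: continuous_on_eq_continuous_at)
    then show ?thesis using that by blast
  qed
  have "quantile J t \<le> w" unfolding quantile_def using w S(3) by (intro cInf_lower) auto
  then have "J (quantile J t) \<le> t" using mono(3) w by auto
  with q show ?thesis by auto
qed

lemma D_eq_if_J_eq: "J x = J y \<Longrightarrow> D x = D y"
  using D_lipschitz[of x y] by simp

lemma A_bar_eq:
  assumes "0 < t" "t < 1"
  shows "\<exists>z. J z = t \<and> A_bar F G \<eta> t = D z \<and> A_star F G \<eta> t = A z"
  using J_quantile[OF assms]
  by (intro exI[of _ "quantile J t"]) (auto simp: A_bar_def A_star_def A_def D_def J[symmetric] Let_def)

lemma A_bar_J:
  assumes "0 < J z" "J z < 1"
  shows "A_bar F G \<eta> (J z) = D z" "A_star F G \<eta> (J z) = A z"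
proof -
  obtain y where "J y = J z" "A_bar F G \<eta> (J z) = D y" "A_star F G \<eta> (J z) = A y"
    using A_bar_eq[OF assms] by auto
  then show "A_bar F G \<eta> (J z) = D z" "A_star F G \<eta> (J z) = A z"
    using D_eq_if_J_eq[of y z] by (auto simp: A_def)
qed

lemma SUP_eqs:
  "(SUP t\<in>{0<..<1}. A_bar F G \<eta> t) = Dmax" "(SUP t\<in>{0<..<1}. A_star F G \<eta> t) = Amax"
  "(SUP z. G z - F z) = Dmax"
  "(SUP z\<in>{z. 0 < J z \<and> J z < 1}. (G z - F z) / sqrt (J z * (1 - J z))) = Amax"
proof -
  show "(SUP t\<in>{0<..<1}. A_bar F G \<eta> t) = Dmax"
  proof (rule cSup_eq_maximum)
    show "Dmax \<in> A_bar F G \<eta> ` {0<..<1}" using A_bar_J[OF zD(1,2)] zD by (auto simp: Dmax_def image_iff intro!: bexI[of _ "J zD"])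
    fix x assume "x \<in> A_bar F G \<eta> ` {0<..<1}"
    then obtain t where "0 < t" "t < 1" "x = A_bar F G \<eta> t" by auto
    then show "x \<le> Dmax" using A_bar_eq[of t] zD(3) by auto
  qed
  show "(SUP t\<in>{0<..<1}. A_star F G \<eta> t) = Amax"
  proof (rule cSup_eq_maximum)
    show "Amax \<in> A_star F G \<eta> ` {0<..<1}" using A_bar_J[OF zA(1,2)] zA by (auto simp: Amax_def image_iff intro!: bexI[of _ "J zA"])
    fix x assume "x \<in> A_star F G \<eta> ` {0<..<1}"
    then obtain t where "0 < t" "t < 1" "x = A_star F G \<eta> t" by auto
    then show "x \<le> Amax" using A_bar_eq[of t] zA(3) by auto
  qed
  show "(SUP z. G z - F z) = Dmax"
    by (rule cSup_eq_maximum) (use zD(3) in \<open>auto simp: Dmax_def D_def\<close>)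
  show "(SUP z\<in>{z. 0 < J z \<and> J z < 1}. (G z - F z) / sqrt (J z * (1 - J z))) = Amax"
  proof (rule cSup_eq_maximum)
    show "Amax \<in> (\<lambda>z. (G z - F z) / sqrt (J z * (1 - J z))) ` {z. 0 < J z \<and> J z < 1}"
      using zA by (auto simp: Amax_def A_def D_def)
    fix x assume "x \<in> (\<lambda>z. (G z - F z) / sqrt (J z * (1 - J z))) ` {z. 0 < J z \<and> J z < 1}"
    then obtain z where "x = A z" by (auto simp: A_def D_def)
    then show "x \<le> Amax" using zA(3) by simp
  qed
qed

lemma sqrt_variance_le: "0 < t \<Longrightarrow> t < 1 \<Longrightarrow> sqrt (t * (1 - t)) \<le> 1 / 2 \<and> (sqrt (t * (1 - t)) = 1 / 2 \<longleftrightarrow> t = 1 / 2)" for t :: real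
proof -
  assume t: "0 < t" "t < 1"
  have e: "t * (1 - t) = (1 / 2)\<^sup>2 - (t - 1 / 2)\<^sup>2" by (simp add: power2_eq_square algebra_simps)
  have le: "t * (1 - t) \<le> (1 / 2)\<^sup>2" unfolding e by simp
  have "sqrt (t * (1 - t)) \<le> sqrt ((1 / 2)\<^sup>2)" using le by (rule real_sqrt_le_mono)
  moreover have "sqrt (t * (1 - t)) = 1 / 2 \<longleftrightarrow> t * (1 - t) = (1 / 2)\<^sup>2"
  proof
    assume "sqrt (t * (1 - t)) = 1 / 2"
    then have "(sqrt (t * (1 - t)))\<^sup>2 = (1 / 2)\<^sup>2" by (simp only:)
    then show "t * (1 - t) = (1 / 2)\<^sup>2" using t by simp
  next
    assume "t * (1 - t) = (1 / 2)\<^sup>2"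
    then show "sqrt (t * (1 - t)) = 1 / 2" by (simp only: real_sqrt_abs)
  qed
  moreover have "t * (1 - t) = (1 / 2)\<^sup>2 \<longleftrightarrow> t = 1 / 2" unfolding e by simp
  ultimately show ?thesis by simp
qed

text \<open>\<open>A = D / sqrt (J (1 - J))\<close>, and the denominator is at most \<open>1 / 2\<close>, with equality only for \<open>J = 1 / 2\<close>.\<close>

lemma A_zD_ge: "2 * Dmax \<le> A zD" "A zD = 2 * Dmax \<longleftrightarrow> J zD = 1 / 2"
proof -
  define r where "r = sqrt (J zD * (1 - J zD))"
  have r: "0 < r" "r \<le> 1 / 2" "r = 1 / 2 \<longleftrightarrow> J zD = 1 / 2"
    using zD sqrt_variance_le[OF zD(1,2)] by (auto simp: r_def)
  have A: "A zD = Dmax / r" by (simp add: A_def Dmax_def r_def)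
  have "r * (2 * Dmax) \<le> 1 / 2 * (2 * Dmax)" using r Dmax_pos by (intro mult_right_mono) auto
  then show "2 * Dmax \<le> A zD" unfolding A using r by (simp add: pos_le_divide_eq mult.commute)
  have "A zD = 2 * Dmax \<longleftrightarrow> r = 1 / 2"
    unfolding A using r Dmax_pos by (auto simp: divide_eq_eq)
  with r(3) show "A zD = 2 * Dmax \<longleftrightarrow> J zD = 1 / 2" by simp
qed

text \<open>If \<open>Amax = 2 Dmax\<close>, then \<open>A\<close> attains its maximum at \<open>zD\<close>, where \<open>J = 1 / 2\<close>. Conversely a maximum of
  \<open>A_star\<close> at \<open>1 / 2\<close> means \<open>Amax = 2 D z\<close> for a point with \<open>J z = 1 / 2\<close>.\<close>

lemma efficiency_ge_1:
  defines "e \<equiv> 1 / 4 * (Amax / Dmax)\<^sup>2"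
  shows "1 \<le> e" "e = 1 \<longleftrightarrow> (\<forall>t\<in>{0<..<1}. A_star F G \<eta> t \<le> A_star F G \<eta> (1 / 2))"
proof -
  have ge: "2 * Dmax \<le> Amax" using A_zD_ge(1) zA(3)[of zD] by linarith
  have e: "e = (Amax / (2 * Dmax))\<^sup>2" by (simp add: e_def power_divide power_mult_distrib)
  have r1: "1 \<le> Amax / (2 * Dmax)" using ge Dmax_pos by simp
  show "1 \<le> e" unfolding e using power_mono[OF r1, of 2] by simp
  have "e = 1 \<longleftrightarrow> Amax / (2 * Dmax) = 1"
    unfolding e using r1 by (simp add: power2_eq_1_iff)
  also have "\<dots> \<longleftrightarrow> Amax = 2 * Dmax" using Dmax_pos by (simp add: divide_eq_eq)
  also have "\<dots> \<longleftrightarrow> (\<forall>t\<in>{0<..<1}. A_star F G \<eta> t \<le> A_star F G \<eta> (1 / 2))"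
  proof
    assume eq: "Amax = 2 * Dmax"
    then have "A zD = 2 * Dmax" using A_zD_ge(1) zA(3)[of zD] by linarith
    then have half: "J zD = 1 / 2" and "A zD = Amax" using A_zD_ge(2) eq by auto
    then have "A_star F G \<eta> (J zD) = Amax" using A_bar_J(2)[OF zD(1,2)] by simp
    then have "A_star F G \<eta> (1 / 2) = Amax" by (simp only: half)
    then show "\<forall>t\<in>{0<..<1}. A_star F G \<eta> t \<le> A_star F G \<eta> (1 / 2)"
      using A_bar_eq zA(3) by fastforce
  next
    assume max: "\<forall>t\<in>{0<..<1}. A_star F G \<eta> t \<le> A_star F G \<eta> (1 / 2)"
    obtain y where y: "J y = 1 / 2" "A_star F G \<eta> (1 / 2) = A y" using A_bar_eq[of "1 / 2"] by auto
    have "sqrt (1 / 2 * (1 - 1 / 2)) = (1 / 2 :: real)" using sqrt_variance_le[of "1 / 2"] by simp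
    then have "sqrt (J y * (1 - J y)) = 1 / 2" by (simp only: y(1))
    then have "A y = D y / (1 / 2)" by (simp only: A_def)
    then have "A y = 2 * D y" by simp
    moreover have "Amax \<le> A y"
      using bspec[OF max, of "J zA"] zA(1,2) A_bar_J(2)[OF zA(1,2)] y(2) by (simp add: Amax_def)
    ultimately show "Amax = 2 * Dmax" using zD(3)[of y] ge by linarith
  qed
  finally show "e = 1 \<longleftrightarrow> (\<forall>t\<in>{0<..<1}. A_star F G \<eta> t \<le> A_star F G \<eta> (1 / 2))" .
qed

end

section \<open>Asymptotics under the null hypothesis\<close>

lemma sqrt_divide_self: "0 < x \<Longrightarrow> sqrt x / x = 1 / sqrt x"
proof -
  assume x: "0 < x"
  then have sq: "sqrt x * sqrt x = x" by simp
  have "sqrt x / (sqrt x * sqrt x) = sqrt x / sqrt x / sqrt x" by (simp only: divide_divide_eq_left)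
  also have "\<dots> = 1 / sqrt x" using x by simp
  finally show ?thesis by (simp only: sq)
qed

text \<open>The exponent of the lower bounds \<open>uniform_V_ge\<close> and \<open>uniform_T_ge\<close>, including the polynomial
  factor, is asymptotically \<open>2 r\<^sup>2 w\<^sup>2\<close>.\<close>

lemma surplus_exponent:
  fixes v w \<rho> q M :: "nat \<Rightarrow> real" and r \<delta> :: real
  assumes v: "filterlim v at_top sequentially" and w: "filterlim w at_top sequentially"
    and wv: "(\<lambda>N. w N / sqrt (v N)) \<longlonglongrightarrow> 0" and \<rho>: "\<rho> \<longlonglongrightarrow> r" and q: "q \<longlonglongrightarrow> 1 / 2"
    and M: "(\<lambda>N. ln (M N + 1) / (w N)\<^sup>2) \<longlonglongrightarrow> 0" "\<And>N. 0 \<le> M N" and \<delta>: "0 < \<delta>"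
  shows "eventually (\<lambda>N. sqrt (v N) * \<rho> N * w N + 1 \<le> v N / 8) sequentially"
    and "eventually (\<lambda>N. exp (- ((2 * r\<^sup>2 + \<delta>) * (w N)\<^sup>2))
      \<le> exp (- ((sqrt (v N) * \<rho> N * w N + 1)\<^sup>2 / (2 * v N * (q N * (1 - q N))))
          * (1 + 100 * ((sqrt (v N) * \<rho> N * w N + 1) / v N))) / (M N + 1)\<^sup>2) sequentially"
proof -
  define \<tau> where "\<tau> N = sqrt (v N) * \<rho> N * w N + 1" for N
  have pos: "eventually (\<lambda>N. 0 < v N \<and> 0 < w N) sequentially"
    using filterlim_at_top_dense[THEN iffD1, OF v, rule_format, of 0]
      filterlim_at_top_dense[THEN iffD1, OF w, rule_format, of 0] by eventually_elim auto
  have sv: "filterlim (\<lambda>N. sqrt (v N)) at_top sequentially"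
    by (rule filterlim_compose[OF sqrt_at_top v])
  have i1: "(\<lambda>N. 1 / v N) \<longlonglongrightarrow> 0"
    using tendsto_inverse_0_at_top[OF v] by (simp add: inverse_eq_divide)
  have i2: "(\<lambda>N. 1 / (sqrt (v N) * w N)) \<longlonglongrightarrow> 0"
    using tendsto_inverse_0_at_top[OF filterlim_at_top_mult_at_top[OF sv w]] by (simp add: inverse_eq_divide)
  have t1: "(\<lambda>N. \<tau> N / v N) \<longlonglongrightarrow> 0"
  proof (rule Lim_transform_eventually)
    have "(\<lambda>N. \<rho> N * (w N / sqrt (v N)) + 1 / v N) \<longlonglongrightarrow> r * 0 + 0" by (intro tendsto_intros \<rho> wv i1)
    then show "(\<lambda>N. \<rho> N * (w N / sqrt (v N)) + 1 / v N) \<longlonglongrightarrow> 0" by simp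
    show "eventually (\<lambda>N. \<rho> N * (w N / sqrt (v N)) + 1 / v N = \<tau> N / v N) sequentially"
      using pos
    proof eventually_elim
      case (elim N)
      have "\<tau> N / v N = \<rho> N * w N * (sqrt (v N) / v N) + 1 / v N" by (simp add: \<tau>_def add_divide_distrib)
      also have "sqrt (v N) / v N = 1 / sqrt (v N)" using elim by (intro sqrt_divide_self) simp
      finally show ?case by simp
    qed
  qed
  have t1e: "eventually (\<lambda>N. \<tau> N / v N < 1 / 8) sequentially" by (rule order_tendstoD(2)[OF t1]) simp
  show "eventually (\<lambda>N. sqrt (v N) * \<rho> N * w N + 1 \<le> v N / 8) sequentially"
    using t1e pos
    by eventually_elim (auto simp: \<tau>_def[symmetric] divide_less_eq)
  have t2: "(\<lambda>N. \<tau> N / (sqrt (v N) * w N)) \<longlonglongrightarrow> r"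
  proof (rule Lim_transform_eventually)
    have "(\<lambda>N. \<rho> N + 1 / (sqrt (v N) * w N)) \<longlonglongrightarrow> r + 0" by (intro tendsto_intros \<rho> i2)
    then show "(\<lambda>N. \<rho> N + 1 / (sqrt (v N) * w N)) \<longlonglongrightarrow> r" by simp
    show "eventually (\<lambda>N. \<rho> N + 1 / (sqrt (v N) * w N) = \<tau> N / (sqrt (v N) * w N)) sequentially"
      using pos by eventually_elim (auto simp: \<tau>_def add_divide_distrib)
  qed
  define E where "E N = (\<tau> N)\<^sup>2 / (2 * v N * (q N * (1 - q N))) * (1 + 100 * (\<tau> N / v N)) + 2 * ln (M N + 1)" for N
  have lim: "(\<lambda>N. E N / (w N)\<^sup>2) \<longlonglongrightarrow> 2 * r\<^sup>2"
  proof (rule Lim_transform_eventually)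
    have "(\<lambda>N. (\<tau> N / (sqrt (v N) * w N))\<^sup>2 * (1 / (2 * (q N * (1 - q N)))) * (1 + 100 * (\<tau> N / v N))
        + 2 * (ln (M N + 1) / (w N)\<^sup>2))
      \<longlonglongrightarrow> r\<^sup>2 * (1 / (2 * (1 / 2 * (1 - 1 / 2)))) * (1 + 100 * 0) + 2 * 0"
      by (intro tendsto_intros t1 t2 q M(1)) auto
    moreover have "r\<^sup>2 * (1 / (2 * (1 / 2 * (1 - 1 / 2)))) * (1 + 100 * 0) + 2 * 0 = 2 * r\<^sup>2" by simp
    ultimately show "(\<lambda>N. (\<tau> N / (sqrt (v N) * w N))\<^sup>2 * (1 / (2 * (q N * (1 - q N)))) * (1 + 100 * (\<tau> N / v N))
        + 2 * (ln (M N + 1) / (w N)\<^sup>2)) \<longlonglongrightarrow> 2 * r\<^sup>2" by (simp only:)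
    show "eventually (\<lambda>N. (\<tau> N / (sqrt (v N) * w N))\<^sup>2 * (1 / (2 * (q N * (1 - q N)))) * (1 + 100 * (\<tau> N / v N))
        + 2 * (ln (M N + 1) / (w N)\<^sup>2) = E N / (w N)\<^sup>2) sequentially"
      using pos
    proof eventually_elim
      case (elim N)
      have "(\<tau> N / (sqrt (v N) * w N))\<^sup>2 = (\<tau> N)\<^sup>2 / (v N * (w N)\<^sup>2)"
        using elim by (simp add: power_divide power_mult_distrib)
      then show ?case by (simp add: E_def add_divide_distrib mult_ac)
    qed
  qed
  have "eventually (\<lambda>N. E N / (w N)\<^sup>2 < 2 * r\<^sup>2 + \<delta>) sequentially"
    using \<delta> by (intro order_tendstoD(2)[OF lim]) simp
  then show "eventually (\<lambda>N. exp (- ((2 * r\<^sup>2 + \<delta>) * (w N)\<^sup>2))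
      \<le> exp (- ((sqrt (v N) * \<rho> N * w N + 1)\<^sup>2 / (2 * v N * (q N * (1 - q N))))
          * (1 + 100 * ((sqrt (v N) * \<rho> N * w N + 1) / v N))) / (M N + 1)\<^sup>2) sequentially"
    using pos
  proof eventually_elim
    case (elim N)
    have M1: "0 < M N + 1" using M(2)[of N] by simp
    have "exp (2 * ln (M N + 1)) = (M N + 1)\<^sup>2"
      using M1 exp_of_nat_mult[of 2 "ln (M N + 1)"] by simp
    then have "exp (- E N) = exp (- ((\<tau> N)\<^sup>2 / (2 * v N * (q N * (1 - q N)))) * (1 + 100 * (\<tau> N / v N))) / (M N + 1)\<^sup>2"
      by (simp add: E_def exp_diff exp_minus field_simps)
    moreover have "E N \<le> (2 * r\<^sup>2 + \<delta>) * (w N)\<^sup>2" using elim by (simp add: divide_less_eq)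
    ultimately show ?case unfolding \<tau>_def by (metis exp_le_cancel_iff neg_le_iff_le)
  qed
qed

text \<open>The levels \<open>\<pi>\<^sub>j\<^sub>N\<close> are written \<open>p N j\<close>, and \<open>J\<close> is the distribution function from which both
  alternatives depart by a step of relative size \<open>\<theta> N\<close>.\<close>

locale efficiency_setting = df_pair F G J \<eta> for F G J \<eta> +
  fixes m n \<Delta> :: "nat \<Rightarrow> nat" and p :: "nat \<Rightarrow> nat \<Rightarrow> real" and \<theta> :: "nat \<Rightarrow> real"
  assumes size: "\<And>N. N \<ge> 1 \<Longrightarrow> m N + n N = N"
    and \<Delta>: "\<And>N. N \<ge> 2 \<Longrightarrow> 1 < \<Delta> N \<and> \<Delta> N \<le> N"
    and p01: "\<And>N. N \<ge> 2 \<Longrightarrow> 0 < p N 1 \<and> strict_mono_on {1..\<Delta> N} (p N) \<and> p N (\<Delta> N) < 1"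
    and p_ends: "\<And>N. N \<ge> 2 \<Longrightarrow> p N 0 = 0 \<and> p N (\<Delta> N + 1) = 1"
    and p_lower: "\<And>N. N \<ge> 2 \<Longrightarrow> p N 1 \<ge> 1 / (real (\<Delta> N) + 1)"
    and p_upper: "\<And>N. N \<ge> 2 \<Longrightarrow> p N (\<Delta> N) \<le> 1 - 1 / (real (\<Delta> N) + 1)"
    and gap: "(\<lambda>N. MAX j\<in>{1..\<Delta> N + 1}. p N j - p N (j - 1)) \<longlonglongrightarrow> 0"
    and \<theta>01: "\<And>N. N \<ge> 2 \<Longrightarrow> 0 < \<theta> N \<and> \<theta> N < 1"
    and signal: "filterlim (\<lambda>N. real N * (\<theta> N)\<^sup>2 / (ln (real N))\<^sup>2) at_top sequentially"
    and \<theta>\<Delta>': "\<exists>\<nu>. 0 < \<nu> \<and> \<nu> < 1 \<and> (\<lambda>N. \<theta> N powr (1 - \<nu>) * real (\<Delta> N)) \<longlonglongrightarrow> 0"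
    and ratio: "(\<lambda>N. real (m N) / real N) \<longlonglongrightarrow> \<eta>"
begin

text \<open>\<open>b\<close> is the order of magnitude of the signal, \<open>u\<close> bounds the relative error that rounding the levels
  makes in their variances, and \<open>\<omega>\<close> is the limit of \<open>v / N\<close>.\<close>

definition "v N = real (m N) * real (n N) / real (m N + n N)"
definition "b N = sqrt (v N) * \<theta> N"
definition "u N = 2 * real (\<Delta> N) / real N"
definition "\<omega> = \<eta> * (1 - \<eta>)"

lemma \<omega>: "0 < \<omega>" using \<eta> by (simp add: \<omega>_def)

lemma ev2: "eventually (\<lambda>N. 2 \<le> N) sequentially" by (rule eventually_ge_at_top)

lemma ratio_n: "(\<lambda>N. real (n N) / real N) \<longlonglongrightarrow> 1 - \<eta>"
proof (rule Lim_transform_eventually[OF tendsto_diff[OF tendsto_const ratio]])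
  show "eventually (\<lambda>N. 1 - real (m N) / real N = real (n N) / real N) sequentially"
    using ev2
  proof eventually_elim
    case (elim N)
    have "real (m N) + real (n N) = real N" using size[of N] elim by (metis of_nat_add order_trans one_le_numeral)
    then show ?case using elim by (simp add: field_simps)
  qed
qed

lemma sizes_pos: "eventually (\<lambda>N. 0 < m N \<and> 0 < n N) sequentially"
proof -
  have "0 < 1 - \<eta>" using \<eta> by simp
  from order_tendstoD(1)[OF ratio \<eta>(1)] order_tendstoD(1)[OF ratio_n this]
  show ?thesis by eventually_elim (auto simp: zero_less_divide_iff)
qed

lemma v_over_N: "(\<lambda>N. v N / real N) \<longlonglongrightarrow> \<omega>"
proof (rule Lim_transform_eventually)
  show "(\<lambda>N. (real (m N) / real N) * (real (n N) / real N)) \<longlonglongrightarrow> \<omega>"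
    unfolding \<omega>_def by (intro tendsto_intros ratio ratio_n)
  show "eventually (\<lambda>N. (real (m N) / real N) * (real (n N) / real N) = v N / real N) sequentially"
    using ev2 by eventually_elim (simp add: v_def size)
qed

lemma v_at_top: "filterlim v at_top sequentially"
proof -
  have "filterlim (\<lambda>N. v N / real N * real N) at_top sequentially"
    by (rule filterlim_tendsto_pos_mult_at_top[OF v_over_N \<omega> filterlim_real_sequentially])
  moreover have "eventually (\<lambda>N. v N / real N * real N = v N) sequentially"
    using ev2 by eventually_elim simp
  ultimately show ?thesis by (rule filterlim_mono_eventually[OF _ order_refl order_refl, of _ _ _ v]) 
qed

lemma v_nonneg: "0 \<le> v N" by (simp add: v_def)

lemma v_le: "v N \<le> real (m N)" "v N \<le> real (n N)"
proof -
  have "real (m N) * real (n N) \<le> real (m N) * real (m N + n N)" "real (m N) * real (n N) \<le> real (m N + n N) * real (n N)"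
    by (intro mult_left_mono mult_right_mono; simp)+
  then show "v N \<le> real (m N)" "v N \<le> real (n N)"
    unfolding v_def by (cases "m N + n N = 0"; simp add: divide_le_eq mult_ac)+
qed

text \<open>The extreme levels are at least of order \<open>1 / \<Delta>(N)\<close>, so the signal \<open>\<theta>\<^sub>N\<close> is of smaller order than
  every level.\<close>

lemma \<theta>\<Delta>: "(\<lambda>N. \<theta> N * real (\<Delta> N)) \<longlonglongrightarrow> 0"
proof -
  obtain \<nu> where \<nu>: "0 < \<nu>" "\<nu> < 1" "(\<lambda>N. \<theta> N powr (1 - \<nu>) * real (\<Delta> N)) \<longlonglongrightarrow> 0" using \<theta>\<Delta>' by blast
  show ?thesis
  proof (rule tendsto_sandwich[OF _ _ tendsto_const \<nu>(3)])
    show "eventually (\<lambda>N. 0 \<le> \<theta> N * real (\<Delta> N)) sequentially"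
      using ev2 by eventually_elim (use \<theta>01 in \<open>auto simp: less_imp_le\<close>)
    show "eventually (\<lambda>N. \<theta> N * real (\<Delta> N) \<le> \<theta> N powr (1 - \<nu>) * real (\<Delta> N)) sequentially"
      using ev2
    proof eventually_elim
      case (elim N)
      have "\<theta> N powr 1 \<le> \<theta> N powr (1 - \<nu>)" using \<theta>01[OF elim] \<nu> by (intro powr_mono') auto
      then show ?case using \<theta>01[OF elim] by (intro mult_right_mono) auto
    qed
  qed
qed

lemma \<theta>_lim: "\<theta> \<longlonglongrightarrow> 0"
proof (rule tendsto_sandwich[OF _ _ tendsto_const \<theta>\<Delta>])
  show "eventually (\<lambda>N. 0 \<le> \<theta> N) sequentially"
    using ev2 by eventually_elim (use \<theta>01 in \<open>auto simp: less_imp_le\<close>)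
  show "eventually (\<lambda>N. \<theta> N \<le> \<theta> N * real (\<Delta> N)) sequentially"
    using ev2
  proof eventually_elim
    case (elim N)
    have "\<theta> N * 1 \<le> \<theta> N * real (\<Delta> N)" using \<theta>01[OF elim] \<Delta>[OF elim] by (intro mult_left_mono) auto
    then show ?case by simp
  qed
qed

lemma ln_at_top_nat: "filterlim (\<lambda>N. ln (real N)) at_top sequentially"
  by (rule filterlim_compose[OF ln_at_top filterlim_real_sequentially])

lemma N\<theta>2_at_top: "filterlim (\<lambda>N. real N * (\<theta> N)\<^sup>2) at_top sequentially"
proof -
  have "filterlim (\<lambda>N. real N * (\<theta> N)\<^sup>2 / (ln (real N))\<^sup>2 * (ln (real N))\<^sup>2) at_top sequentially"
    by (rule filterlim_at_top_mult_at_top[OF signal filterlim_pow_at_top[OF _ ln_at_top_nat]]) simp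
  moreover have "eventually (\<lambda>N. real N * (\<theta> N)\<^sup>2 / (ln (real N))\<^sup>2 * (ln (real N))\<^sup>2 = real N * (\<theta> N)\<^sup>2) sequentially"
    using ev2 by eventually_elim simp
  ultimately show ?thesis by (rule filterlim_mono_eventually[OF _ order_refl order_refl])
qed

lemma ln_over_N\<theta>2: "(\<lambda>N. ln (real N) / (real N * (\<theta> N)\<^sup>2)) \<longlonglongrightarrow> 0"
proof (rule Lim_transform_eventually)
  have "(\<lambda>N. inverse (real N * (\<theta> N)\<^sup>2 / (ln (real N))\<^sup>2) * inverse (ln (real N))) \<longlonglongrightarrow> 0 * 0"
    by (intro tendsto_mult tendsto_inverse_0_at_top signal ln_at_top_nat)
  then show "(\<lambda>N. inverse (real N * (\<theta> N)\<^sup>2 / (ln (real N))\<^sup>2) * inverse (ln (real N))) \<longlonglongrightarrow> 0" by simp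
  show "eventually (\<lambda>N. inverse (real N * (\<theta> N)\<^sup>2 / (ln (real N))\<^sup>2) * inverse (ln (real N)) = ln (real N) / (real N * (\<theta> N)\<^sup>2)) sequentially"
    using ev2
  proof eventually_elim
    case (elim N)
    then have "0 < ln (real N)" by simp
    then show ?case by (simp add: inverse_eq_divide power2_eq_square)
  qed
qed

lemma b_sq: "2 \<le> N \<Longrightarrow> (b N)\<^sup>2 = v N * (\<theta> N)\<^sup>2"
  by (simp add: b_def power_mult_distrib v_nonneg)

lemma b_sq': "2 \<le> N \<Longrightarrow> (b N)\<^sup>2 = v N / real N * (real N * (\<theta> N)\<^sup>2)"
  by (simp add: b_sq)

lemma b_sq_at_top: "filterlim (\<lambda>N. (b N)\<^sup>2) at_top sequentially"
proof -
  have "filterlim (\<lambda>N. v N / real N * (real N * (\<theta> N)\<^sup>2)) at_top sequentially"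
    by (rule filterlim_tendsto_pos_mult_at_top[OF v_over_N \<omega> N\<theta>2_at_top])
  moreover have "eventually (\<lambda>N. v N / real N * (real N * (\<theta> N)\<^sup>2) = (b N)\<^sup>2) sequentially"
    using ev2 by eventually_elim (simp only: b_sq')
  ultimately show ?thesis by (rule filterlim_mono_eventually[OF _ order_refl order_refl])
qed

lemma b_nonneg: "2 \<le> N \<Longrightarrow> 0 \<le> b N"
  using \<theta>01[of N] v_nonneg[of N] by (simp add: b_def)

lemma b_at_top: "filterlim b at_top sequentially"
proof -
  have "filterlim (\<lambda>N. sqrt ((b N)\<^sup>2)) at_top sequentially"
    by (rule filterlim_compose[OF sqrt_at_top b_sq_at_top])
  moreover have "eventually (\<lambda>N. sqrt ((b N)\<^sup>2) = b N) sequentially"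
    using ev2 by eventually_elim (simp add: b_nonneg)
  ultimately show ?thesis by (rule filterlim_mono_eventually[OF _ order_refl order_refl])
qed

text \<open>Polynomial factors are negligible against \<open>exp (b\<^sup>2)\<close>.\<close>

lemma ln_over_b_sq: "(\<lambda>N. ln (real N) / (b N)\<^sup>2) \<longlonglongrightarrow> 0"
proof (rule Lim_transform_eventually)
  have "(\<lambda>N. ln (real N) / (real N * (\<theta> N)\<^sup>2) / (v N / real N)) \<longlonglongrightarrow> 0 / \<omega>"
    using \<omega> by (intro tendsto_divide ln_over_N\<theta>2 v_over_N) simp
  then show "(\<lambda>N. ln (real N) / (real N * (\<theta> N)\<^sup>2) / (v N / real N)) \<longlonglongrightarrow> 0" by simp
  show "eventually (\<lambda>N. ln (real N) / (real N * (\<theta> N)\<^sup>2) / (v N / real N) = ln (real N) / (b N)\<^sup>2) sequentially"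
    using ev2 by eventually_elim (simp only: b_sq' divide_divide_eq_left mult.commute)
qed

lemma ln_affine_over_b_sq:
  assumes "0 \<le> C"
  shows "(\<lambda>N. ln (C * real N + 1) / (b N)\<^sup>2) \<longlonglongrightarrow> 0"
proof (rule tendsto_sandwich[OF _ _ tendsto_const])
  have "(\<lambda>N. ln (C + 1) * inverse ((b N)\<^sup>2) + ln (real N) / (b N)\<^sup>2) \<longlonglongrightarrow> ln (C + 1) * 0 + 0"
    by (intro tendsto_intros tendsto_inverse_0_at_top b_sq_at_top ln_over_b_sq)
  then show "(\<lambda>N. ln (C + 1) * inverse ((b N)\<^sup>2) + ln (real N) / (b N)\<^sup>2) \<longlonglongrightarrow> 0" by simp
  show "eventually (\<lambda>N. 0 \<le> ln (C * real N + 1) / (b N)\<^sup>2) sequentially"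
    using assms by (intro always_eventually allI divide_nonneg_nonneg) auto
  show "eventually (\<lambda>N. ln (C * real N + 1) / (b N)\<^sup>2 \<le> ln (C + 1) * inverse ((b N)\<^sup>2) + ln (real N) / (b N)\<^sup>2) sequentially"
    using ev2
  proof eventually_elim
    case (elim N)
    have "C * real N + 1 \<le> (C + 1) * real N" using elim by (simp add: distrib_right)
    then have "ln (C * real N + 1) \<le> ln ((C + 1) * real N)" using assms elim
      by (subst ln_le_cancel_iff) (auto intro: add_nonneg_pos)
    also have "\<dots> = ln (C + 1) + ln (real N)" using assms elim by (intro ln_mult_pos) auto
    finally have "ln (C * real N + 1) / (b N)\<^sup>2 \<le> (ln (C + 1) + ln (real N)) / (b N)\<^sup>2"
      by (intro divide_right_mono) auto
    then show ?case by (simp add: add_divide_distrib inverse_eq_divide)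
  qed
qed

lemma u_lim: "u \<longlonglongrightarrow> 0"
proof (rule tendsto_sandwich[OF _ _ tendsto_const])
  have "(\<lambda>N. 2 * (\<theta> N * real (\<Delta> N))) \<longlonglongrightarrow> 2 * 0" by (intro tendsto_intros \<theta>\<Delta>)
  then show "(\<lambda>N. 2 * (\<theta> N * real (\<Delta> N))) \<longlonglongrightarrow> 0" by simp
  show "eventually (\<lambda>N. 0 \<le> u N) sequentially" by (simp add: u_def)
  show "eventually (\<lambda>N. u N \<le> 2 * (\<theta> N * real (\<Delta> N))) sequentially"
    using ev2 filterlim_at_top_dense[THEN iffD1, OF N\<theta>2_at_top, rule_format, of 1]
  proof eventually_elim
    case (elim N)
    have "real N * (\<theta> N)\<^sup>2 \<le> real N * \<theta> N"
      using \<theta>01[OF elim(1)] by (intro mult_left_mono) (auto simp: power2_eq_square mult_left_le)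
    then have "1 \<le> real N * \<theta> N" using elim by linarith
    then have "1 / real N \<le> \<theta> N" using elim by (simp add: divide_le_eq mult.commute)
    then have "2 * real (\<Delta> N) * (1 / real N) \<le> 2 * real (\<Delta> N) * \<theta> N" by (intro mult_left_mono) auto
    then show ?case by (simp add: u_def mult_ac)
  qed
qed

text \<open>\<open>q\<close> is the level \<open>p\<close> rounded to a multiple of \<open>1 / N\<close>, and \<open>\<rho>\<close> the standard deviation that
  belongs to \<open>p\<close>.\<close>

definition "\<rho> N j = sqrt (p N j * (1 - p N j))"
definition "lev N j = level N (p N j)"
definition "q N j = real (lev N j) / real N"

lemma p_bounds:
  assumes N: "2 \<le> N" and j: "j \<in> {1..\<Delta> N}"
  shows "0 < p N j \<and> p N j < 1" "1 \<le> 4 * real (\<Delta> N) * (p N j * (1 - p N j))"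
proof -
  have sm: "strict_mono_on {1..\<Delta> N} (p N)" using p01[OF N] by simp
  have mono: "p N 1 \<le> p N j" "p N j \<le> p N (\<Delta> N)"
    using strict_mono_on_leD[OF sm, of 1 j] strict_mono_on_leD[OF sm, of j "\<Delta> N"] j by auto
  define x where "x = 1 / (real (\<Delta> N) + 1)"
  have x: "0 < x" "x \<le> 1 / 2" using \<Delta>[OF N] by (auto simp: x_def divide_le_eq)
  have px: "x \<le> p N j" "p N j \<le> 1 - x" using mono p_lower[OF N] p_upper[OF N] by (auto simp: x_def)
  then show "0 < p N j \<and> p N j < 1" using x by auto
  have "0 \<le> (p N j - x) * (1 - x - p N j)" using px by (intro mult_nonneg_nonneg) auto
  then have "x * (1 - x) \<le> p N j * (1 - p N j)" by (simp add: algebra_simps)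
  moreover have "x * (1 / 2) \<le> x * (1 - x)" using x by (intro mult_left_mono) auto
  ultimately have "x / 2 \<le> p N j * (1 - p N j)" by linarith
  then have "4 * real (\<Delta> N) * (x / 2) \<le> 4 * real (\<Delta> N) * (p N j * (1 - p N j))" by (intro mult_left_mono) auto
  moreover have "1 \<le> 4 * real (\<Delta> N) * (x / 2)"
    using \<Delta>[OF N] by (simp add: x_def le_divide_eq)
  ultimately show "1 \<le> 4 * real (\<Delta> N) * (p N j * (1 - p N j))" by linarith
qed

lemma \<rho>_bounds:
  assumes N: "2 \<le> N" and j: "j \<in> {1..\<Delta> N}"
  shows "0 < \<rho> N j" "(\<rho> N j)\<^sup>2 = p N j * (1 - p N j)" "\<rho> N j \<le> 1" "1 \<le> 4 * real (\<Delta> N) * \<rho> N j"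
proof -
  note p = p_bounds[OF N j]
  have pos: "0 < p N j * (1 - p N j)" using p by auto
  show r0: "0 < \<rho> N j" using pos by (simp add: \<rho>_def)
  show sq: "(\<rho> N j)\<^sup>2 = p N j * (1 - p N j)" using pos by (simp add: \<rho>_def)
  have "p N j * (1 - p N j) \<le> 1" using p(1) by (intro mult_le_one) auto
  then show r1: "\<rho> N j \<le> 1" by (simp add: \<rho>_def)
  have "(\<rho> N j)\<^sup>2 \<le> \<rho> N j" using r0 r1 by (simp add: power2_eq_square mult_left_le)
  then have "4 * real (\<Delta> N) * (p N j * (1 - p N j)) \<le> 4 * real (\<Delta> N) * \<rho> N j"
    unfolding sq by (intro mult_left_mono) auto
  then show "1 \<le> 4 * real (\<Delta> N) * \<rho> N j" using p(2) by linarith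
qed

text \<open>Rounding the level to a multiple of \<open>1 / N\<close> changes the variance by a factor \<open>1 + O(\<Delta>(N) / N)\<close>,
  uniformly in the level.\<close>

lemma q_bounds:
  assumes N: "2 \<le> N" and j: "j \<in> {1..\<Delta> N}"
  shows "0 \<le> q N j" "q N j \<le> 1" "\<bar>q N j - p N j\<bar> \<le> 1 / (2 * real N)"
    and "\<bar>q N j * (1 - q N j) - (\<rho> N j)\<^sup>2\<bar> \<le> u N * (\<rho> N j)\<^sup>2"
proof -
  note p = p_bounds[OF N j]
  have N0: "0 < real N" using N by simp
  have lev: "\<bar>real (lev N j) - real N * p N j\<bar> \<le> 1 / 2" "lev N j \<le> N"
    using level_bounds[of "p N j" N] p by (auto simp: lev_def)
  show q0: "0 \<le> q N j" by (simp add: q_def)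
  show q1: "q N j \<le> 1" using lev(2) N0 by (simp add: q_def divide_le_eq)
  have "q N j - p N j = (real (lev N j) - real N * p N j) / real N"
    using N0 by (simp add: q_def diff_divide_distrib)
  then have "\<bar>q N j - p N j\<bar> = \<bar>real (lev N j) - real N * p N j\<bar> / real N"
    by (simp only: abs_divide abs_of_nat)
  also have "\<dots> \<le> 1 / 2 / real N" using lev(1) N0 by (intro divide_right_mono) auto
  finally show qp: "\<bar>q N j - p N j\<bar> \<le> 1 / (2 * real N)" by simp
  have "q N j * (1 - q N j) - p N j * (1 - p N j) = (q N j - p N j) * (1 - q N j - p N j)"
    by (simp add: algebra_simps)
  then have "\<bar>q N j * (1 - q N j) - p N j * (1 - p N j)\<bar> = \<bar>q N j - p N j\<bar> * \<bar>1 - q N j - p N j\<bar>"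
    by (simp add: abs_mult)
  also have "\<dots> \<le> 1 / (2 * real N) * 1" using qp q0 q1 p(1) by (intro mult_mono) auto
  also have "\<dots> \<le> 1 / (2 * real N) * (4 * real (\<Delta> N) * (p N j * (1 - p N j)))"
    using p(2) by (intro mult_left_mono) auto
  also have "\<dots> = u N * (p N j * (1 - p N j))" by (simp add: u_def)
  finally show "\<bar>q N j * (1 - q N j) - (\<rho> N j)\<^sup>2\<bar> \<le> u N * (\<rho> N j)\<^sup>2"
    by (simp add: \<rho>_bounds(2)[OF N j])
qed

lemma q_interior:
  assumes N: "2 \<le> N" and j: "j \<in> {1..\<Delta> N}" and u: "u N \<le> 1 / 2"
  shows "(\<rho> N j)\<^sup>2 / 2 \<le> q N j * (1 - q N j)" "q N j * (1 - q N j) \<le> (1 + u N) * (\<rho> N j)\<^sup>2"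
    "0 < q N j * (1 - q N j)" "0 < lev N j" "lev N j < N"
proof -
  have "u N * (\<rho> N j)\<^sup>2 \<le> 1 / 2 * (\<rho> N j)\<^sup>2" using u by (intro mult_right_mono) auto
  then show h: "(\<rho> N j)\<^sup>2 / 2 \<le> q N j * (1 - q N j)" "q N j * (1 - q N j) \<le> (1 + u N) * (\<rho> N j)\<^sup>2"
    using q_bounds(4)[OF N j] by (auto simp: distrib_right)
  have "0 < (\<rho> N j)\<^sup>2 / 2" using \<rho>_bounds(1)[OF N j] by simp
  then show pos: "0 < q N j * (1 - q N j)" using h(1) by (rule less_le_trans)
  then have "0 < q N j" "q N j < 1" using q_bounds(1,2)[OF N j] by (auto simp: zero_less_mult_iff)
  then show "0 < lev N j" "lev N j < N" using N by (auto simp: q_def zero_less_divide_iff divide_less_eq)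
qed

abbreviation "T_sts \<equiv> (\<lambda>N. T_stat (m N) (n N) (\<Delta> N) (p N))"
abbreviation "V_sts \<equiv> (\<lambda>N. V_stat (m N) (n N))"

text \<open>A union bound over the levels. The threshold at level \<open>j\<close> is \<open>w\<close> standard deviations, and
  \<open>w / sqrt v \<cdot> \<Delta>(N)\<close> bounds the argument of the exponential correction in Bernstein's inequality,
  because the standard deviations are at least of order \<open>sqrt v / \<Delta>(N)\<close>.\<close>

lemma null_T_finite:
  assumes N: "2 \<le> N" and ab: "0 < m N" "0 < n N" and u: "u N \<le> 1 / 2" and w: "0 < w"
    and W: "8 * (w / sqrt (v N)) * real (\<Delta> N) \<le> W" "exp W \<le> 2"
  shows "null_sup m n T_sts N w \<le> real N * ((real N + 1) * exp (- (w\<^sup>2 / (1 + u N) * (1 - exp W / 2))))"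
proof -
  interpret two_samples "m N" "n N" uniform_law uniform_law by (rule two_samples_uniform[OF ab])
  have mn: "m N + n N = N" using size N by simp
  have v: "\<sigma> = sqrt (v N)" "\<sigma>\<^sup>2 = v N" "0 < v N" using ab by (simp_all add: v_def \<sigma>_def)
  define s where "s j = w * \<sigma> * \<rho> N j" for j
  define E where "E j = {z \<in> space \<Omega>. real (y_low (m N) z (m N + n N) (lev N j)) \<ge> real (n N) * q N j + s j}" for j
  have Em: "E j \<in> sets \<Omega>" for j
    unfolding E_def by (rule y_low_event)
  have PE: "measure \<Omega> (E j) \<le> (real N + 1) * exp (- (w\<^sup>2 / (1 + u N) * (1 - exp W / 2)))" if j: "j \<in> {1..\<Delta> N}" for j
  proof -
    note qi = q_interior[OF N j u] and \<rho> = \<rho>_bounds[OF N j]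
    have s0: "0 < s j" using w \<sigma>_pos \<rho>(1) by (simp add: s_def)
    have sW: "s j / (q N j * (1 - q N j) * r) \<le> W" if r: "v N \<le> r" for r
    proof -
      have r0: "0 < r" using r v(3) by linarith
      have "s j / (q N j * (1 - q N j) * r) \<le> s j / ((\<rho> N j)\<^sup>2 / 2 * v N)"
      proof (rule divide_left_mono)
        show "(\<rho> N j)\<^sup>2 / 2 * v N \<le> q N j * (1 - q N j) * r"
          using qi(1) r v(3) qi(3) by (intro mult_mono) auto
        have "0 < (\<rho> N j)\<^sup>2 / 2 * v N" using \<rho>(1) v(3) by simp
        then show "0 < q N j * (1 - q N j) * r * ((\<rho> N j)\<^sup>2 / 2 * v N)"
          by (rule mult_pos_pos[OF mult_pos_pos[OF qi(3) r0]])
      qed (use s0 in simp)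
      also have "\<dots> = 2 * (w / sqrt (v N)) * (1 / \<rho> N j)"
      proof -
        have "\<sigma> / v N = 1 / sqrt (v N)" unfolding v(1) by (rule sqrt_divide_self[OF v(3)])
        have "s j / ((\<rho> N j)\<^sup>2 / 2 * v N) = 2 * w * (\<sigma> / v N) * (\<rho> N j / (\<rho> N j)\<^sup>2)"
          by (simp add: s_def mult_ac)
        also have "\<rho> N j / (\<rho> N j)\<^sup>2 = 1 / \<rho> N j" using \<rho>(1) by (simp add: power2_eq_square)
        finally show ?thesis by (simp add: \<open>\<sigma> / v N = 1 / sqrt (v N)\<close>)
      qed
      also have "\<dots> \<le> 2 * (w / sqrt (v N)) * (4 * real (\<Delta> N))"
        using \<rho>(1,4) w v(3) by (intro mult_left_mono) (auto simp: divide_le_eq)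
      finally show ?thesis using W(1) by simp
    qed
    have "measure \<Omega> (E j) \<le> (real (m N + n N) + 1) * exp (- ((s j)\<^sup>2 / (\<sigma>\<^sup>2 * (q N j * (1 - q N j)))) * (1 - exp W / 2))"
      unfolding E_def
    proof (rule y_low_null_tail[OF refl qi(4) _ _ s0 sW[OF v_le(1)] sW[OF v_le(2)]])
      show "lev N j < m N + n N" using qi(5) mn by simp
      show "q N j = real (lev N j) / real (m N + n N)" by (simp add: q_def mn)
    qed
    also have "\<dots> \<le> (real N + 1) * exp (- (w\<^sup>2 / (1 + u N) * (1 - exp W / 2)))"
    proof -
      have u0: "0 \<le> u N" by (simp add: u_def)
      have eq: "(s j)\<^sup>2 / (\<sigma>\<^sup>2 * (q N j * (1 - q N j))) = w\<^sup>2 * ((\<rho> N j)\<^sup>2 / (q N j * (1 - q N j)))"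
        using \<sigma>_pos by (simp add: s_def power_mult_distrib)
      have "1 / (1 + u N) \<le> (\<rho> N j)\<^sup>2 / (q N j * (1 - q N j))"
        using qi(2,3) u0 by (simp add: le_divide_eq divide_le_eq mult.commute)
      then have "w\<^sup>2 * (1 / (1 + u N)) \<le> w\<^sup>2 * ((\<rho> N j)\<^sup>2 / (q N j * (1 - q N j)))"
        by (rule mult_left_mono) simp
      then have "w\<^sup>2 / (1 + u N) \<le> (s j)\<^sup>2 / (\<sigma>\<^sup>2 * (q N j * (1 - q N j)))" unfolding eq by simp
      then have "w\<^sup>2 / (1 + u N) * (1 - exp W / 2) \<le> (s j)\<^sup>2 / (\<sigma>\<^sup>2 * (q N j * (1 - q N j))) * (1 - exp W / 2)"
        using W(2) by (intro mult_right_mono) auto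
      then show ?thesis by (simp add: mn)
    qed
    finally show ?thesis .
  qed
  have d1: "1 \<le> \<Delta> N" using \<Delta>[OF N] by simp
  have "null_sup m n T_sts N w = \<P>(z in \<Omega>. T_stat (m N) (n N) (\<Delta> N) (p N) (split_at (m N) z) > w)"
    unfolding pooled_law_eq[symmetric] by (rule null_sup_T) (use ab d1 p_bounds(1)[OF N] in blast)+
  also have "\<dots> \<le> measure \<Omega> (\<Union>j\<in>{1..\<Delta> N}. E j)"
  proof (rule P.finite_measure_mono_AE, rule AE_mp[OF AE_inj], intro AE_I2 impI)
    fix z assume inj: "inj_on z {..<m N + n N}"
      and z: "z \<in> {z \<in> space \<Omega>. w < T_stat (m N) (n N) (\<Delta> N) (p N) (split_at (m N) z)}"
    have "T_stat (m N) (n N) (\<Delta> N) (p N) (split_at (m N) z) = (MAX j\<in>{1..\<Delta> N}. T_of_counts (m N) (n N) (p N j) z)"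
      by (rule T_stat_eq_Max[OF ab p_bounds(1)[OF N] inj])
    moreover have "(MAX j\<in>{1..\<Delta> N}. T_of_counts (m N) (n N) (p N j) z) \<in> (\<lambda>j. T_of_counts (m N) (n N) (p N j) z) ` {1..\<Delta> N}"
      using d1 by (intro Max_in) auto
    ultimately obtain j where j: "j \<in> {1..\<Delta> N}" and wj: "w < T_of_counts (m N) (n N) (p N j) z" using z by auto
    have "T_of_counts (m N) (n N) (p N j) z
        = (real (y_low (m N) z (m N + n N) (lev N j)) - real (n N) * q N j) / (\<sigma> * \<rho> N j)"
      by (simp add: T_of_counts_def lev_def q_def \<rho>_def \<sigma>_def mn)
    then have "w * (\<sigma> * \<rho> N j) < real (y_low (m N) z (m N + n N) (lev N j)) - real (n N) * q N j"
      using wj \<sigma>_pos \<rho>_bounds(1)[OF N j] by (simp add: pos_less_divide_eq)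
    then have "z \<in> E j" using z by (simp add: E_def s_def mult_ac)
    then show "z \<in> (\<Union>j\<in>{1..\<Delta> N}. E j)" using j by blast
  qed (use Em in blast)
  also have "\<dots> \<le> (\<Sum>j\<in>{1..\<Delta> N}. measure \<Omega> (E j))"
    using Em by (intro P.finite_measure_subadditive_finite) auto
  also have "\<dots> \<le> (\<Sum>j\<in>{1..\<Delta> N}. (real N + 1) * exp (- (w\<^sup>2 / (1 + u N) * (1 - exp W / 2))))"
    by (intro sum_mono PE)
  also have "\<dots> = real (\<Delta> N) * ((real N + 1) * exp (- (w\<^sup>2 / (1 + u N) * (1 - exp W / 2))))" by simp
  also have "\<dots> \<le> real N * ((real N + 1) * exp (- (w\<^sup>2 / (1 + u N) * (1 - exp W / 2))))"
    using \<Delta>[OF N] by (intro mult_right_mono) auto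
  finally show ?thesis .
qed

text \<open>In \<open>null_T_finite\<close> both \<open>u N\<close> and \<open>W\<close> tend to \<open>0\<close>, so the factor in the exponent tends to \<open>1 / 2\<close>, and the
  polynomial factor is negligible.\<close>

lemma null_T_upper:
  assumes \<kappa>: "0 < \<kappa>" and \<delta>: "0 < \<delta>"
  shows "eventually (\<lambda>N. null_sup m n T_sts N (\<kappa> * b N) \<le> exp (- ((1 / 2 - \<delta>) * (\<kappa> * b N)\<^sup>2))) sequentially"
proof -
  \<comment> \<open>\<open>\<kappa> b / sqrt v = \<kappa> \<theta>\<close>, so this is the bound \<open>W\<close> of \<open>null_T_finite\<close> at \<open>w = \<kappa> b\<close>.\<close>
  define W where "W N = 8 * \<kappa> * (\<theta> N * real (\<Delta> N))" for N
  have W: "W \<longlonglongrightarrow> 0"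
  proof -
    have "(\<lambda>N. 8 * \<kappa> * (\<theta> N * real (\<Delta> N))) \<longlonglongrightarrow> 8 * \<kappa> * 0" by (intro tendsto_intros \<theta>\<Delta>)
    then show ?thesis by (simp add: W_def[abs_def])
  qed
  have "(\<lambda>N. 1 / (1 + u N) * (1 - exp (W N) / 2) - 2 * (ln (1 * real N + 1) / (b N)\<^sup>2) / \<kappa>\<^sup>2) \<longlonglongrightarrow> 1 / (1 + 0) * (1 - exp 0 / 2) - 2 * 0 / \<kappa>\<^sup>2"
    using \<kappa> by (intro tendsto_intros u_lim W ln_affine_over_b_sq) auto
  then have "eventually (\<lambda>N. 1 / 2 - \<delta> < 1 / (1 + u N) * (1 - exp (W N) / 2) - 2 * (ln (1 * real N + 1) / (b N)\<^sup>2) / \<kappa>\<^sup>2) sequentially"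
    using \<delta> by (intro order_tendstoD(1)) auto
  moreover have "eventually (\<lambda>N. exp (W N) < 2) sequentially"
    by (rule order_tendstoD(2)[OF tendsto_exp[OF W]]) simp
  moreover have "eventually (\<lambda>N. u N < 1 / 2) sequentially" by (rule order_tendstoD(2)[OF u_lim]) simp
  moreover have "eventually (\<lambda>N. 0 < b N) sequentially" using filterlim_at_top_dense[THEN iffD1, OF b_at_top] by blast
  ultimately show ?thesis
    using ev2 sizes_pos
  proof eventually_elim
    case (elim N)
    have v0: "0 < v N" using elim by (simp add: v_def)
    have w: "0 < \<kappa> * b N" using \<kappa> elim by simp
    have "8 * (\<kappa> * b N / sqrt (v N)) * real (\<Delta> N) \<le> W N" using v0 by (simp add: W_def b_def)
    then have "null_sup m n T_sts N (\<kappa> * b N)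
        \<le> real N * ((real N + 1) * exp (- ((\<kappa> * b N)\<^sup>2 / (1 + u N) * (1 - exp (W N) / 2))))"
      using elim w by (intro null_T_finite) auto
    also have "\<dots> \<le> (real N + 1) * ((real N + 1) * exp (- ((\<kappa> * b N)\<^sup>2 / (1 + u N) * (1 - exp (W N) / 2))))"
      by (intro mult_right_mono) auto
    also have "\<dots> = exp (2 * ln (real N + 1) - (\<kappa> * b N)\<^sup>2 / (1 + u N) * (1 - exp (W N) / 2))"
      by (simp add: exp_diff exp_minus field_simps exp_of_nat_mult[of 2, simplified] power2_eq_square)
    also have "\<dots> \<le> exp (- ((1 / 2 - \<delta>) * (\<kappa> * b N)\<^sup>2))"
    proof -
      have "(1 / 2 - \<delta>) * (\<kappa> * b N)\<^sup>2 \<le> (1 / (1 + u N) * (1 - exp (W N) / 2) - 2 * (ln (1 * real N + 1) / (b N)\<^sup>2) / \<kappa>\<^sup>2) * (\<kappa> * b N)\<^sup>2"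
        using elim by (intro mult_right_mono) auto
      also have "\<dots> = 1 / (1 + u N) * (1 - exp (W N) / 2) * (\<kappa> * b N)\<^sup>2
          - 2 * (ln (1 * real N + 1) / (b N)\<^sup>2) / \<kappa>\<^sup>2 * (\<kappa> * b N)\<^sup>2"
        by (rule left_diff_distrib)
      also have "1 / (1 + u N) * (1 - exp (W N) / 2) * (\<kappa> * b N)\<^sup>2 = (\<kappa> * b N)\<^sup>2 / (1 + u N) * (1 - exp (W N) / 2)"
        by (simp add: mult.commute)
      also have "2 * (ln (1 * real N + 1) / (b N)\<^sup>2) / \<kappa>\<^sup>2 * (\<kappa> * b N)\<^sup>2 = 2 * ln (real N + 1)"
        using elim \<kappa> by (simp add: power_mult_distrib)
      finally show ?thesis by simp
    qed
    finally show ?case .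
  qed
qed

text \<open>Since the gaps between consecutive levels vanish, every \<open>x \<in> (0, 1)\<close> is a limit of levels.\<close>

lemma levels_dense:
  assumes x: "0 < x" "x < 1"
  obtains j where "eventually (\<lambda>N. j N \<in> {1..\<Delta> N}) sequentially" "(\<lambda>N. p N (j N)) \<longlonglongrightarrow> x"
proof -
  define g where "g N = (MAX j\<in>{1..\<Delta> N + 1}. p N j - p N (j - 1))" for N
  have g: "g \<longlonglongrightarrow> 0" using gap by (simp add: g_def[abs_def])
  \<comment> \<open>The last level up to \<open>x\<close>; the next one lies beyond \<open>x\<close>, and index \<open>0\<close> keeps the set nonempty.\<close>
  define j where "j N = Max {i \<in> {0..\<Delta> N}. p N i \<le> x}" for N
  have key: "j N \<in> {1..\<Delta> N} \<and> \<bar>p N (j N) - x\<bar> \<le> g N" if N: "2 \<le> N" and gx: "g N < x" for N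
  proof -
    define S where "S = {i \<in> {0..\<Delta> N}. p N i \<le> x}"
    have S: "finite S" "0 \<in> S" using p_ends[OF N] x by (auto simp: S_def)
    have jmax: "j N = Max S" by (simp only: j_def S_def)
    have jS: "j N \<in> S" unfolding jmax using S by (intro Max_in) auto
    have up: "x < p N (Suc (j N))"
    proof (cases "j N = \<Delta> N")
      case True
      then show ?thesis using p_ends[OF N] x by simp
    next
      case False
      have "Suc (j N) \<notin> S"
      proof
        assume "Suc (j N) \<in> S"
        then have "Suc (j N) \<le> Max S" by (rule Max_ge[OF S(1)])
        then have "Suc (j N) \<le> j N" by (simp only: jmax)
        then show False by simp
      qed
      then show ?thesis using jS False by (auto simp: S_def)
    qed
    have "Suc (j N) \<in> {1..\<Delta> N + 1}" using jS by (simp add: S_def)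
    then have "p N (Suc (j N)) - p N (Suc (j N) - 1) \<in> (\<lambda>i. p N i - p N (i - 1)) ` {1..\<Delta> N + 1}"
      by (rule imageI)
    then have "p N (Suc (j N)) - p N (Suc (j N) - 1) \<le> g N"
      unfolding g_def by (intro Max_ge) auto
    then have d: "p N (Suc (j N)) - p N (j N) \<le> g N" by simp
    have "j N \<noteq> 0"
    proof
      assume "j N = 0"
      then show False using d up gx p_ends[OF N] by simp
    qed
    then show ?thesis using jS up d by (auto simp: S_def)
  qed
  have ev: "eventually (\<lambda>N. j N \<in> {1..\<Delta> N} \<and> \<bar>p N (j N) - x\<bar> \<le> g N) sequentially"
    using ev2 order_tendstoD(2)[OF g x(1)] by eventually_elim (rule key)
  have "(\<lambda>N. p N (j N) - x) \<longlonglongrightarrow> 0"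
    by (rule Lim_null_comparison[OF _ g]) (use ev in \<open>eventually_elim, simp\<close>)
  then have "(\<lambda>N. p N (j N)) \<longlonglongrightarrow> x" by (simp add: LIM_zero_iff)
  moreover have "eventually (\<lambda>N. j N \<in> {1..\<Delta> N}) sequentially" by (rule eventually_mono[OF ev]) simp
  ultimately show ?thesis by (rule that[rotated])
qed

lemma q_tendsto:
  assumes j: "eventually (\<lambda>N. j N \<in> {1..\<Delta> N}) sequentially" and x: "(\<lambda>N. p N (j N)) \<longlonglongrightarrow> x"
  shows "(\<lambda>N. q N (j N)) \<longlonglongrightarrow> x"
proof -
  have "(\<lambda>N. 1 / 2 * inverse (real N)) \<longlonglongrightarrow> 1 / 2 * 0" by (intro tendsto_intros LIMSEQ_inverse_real_of_nat tendsto_inverse_0_at_top filterlim_real_sequentially)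
  then have i: "(\<lambda>N. 1 / (2 * real N)) \<longlonglongrightarrow> 0" by (simp add: inverse_eq_divide)
  have "(\<lambda>N. q N (j N) - p N (j N)) \<longlonglongrightarrow> 0"
    by (rule Lim_null_comparison[OF _ i]) (use ev2 j in \<open>eventually_elim, simp add: q_bounds(3)\<close>)
  then have "(\<lambda>N. q N (j N) - p N (j N) + p N (j N)) \<longlonglongrightarrow> 0 + x" by (intro tendsto_intros x)
  then show ?thesis by simp
qed

text \<open>One level near \<open>1 / 2\<close> suffices: all levels are standardised to variance \<open>1\<close>, and near the median
  \<open>uniform_T_ge\<close> is sharp.\<close>

lemma null_T_lower:
  assumes \<kappa>: "0 < \<kappa>" and \<delta>: "0 < \<delta>"
  shows "eventually (\<lambda>N. exp (- ((1 / 2 + \<delta>) * (\<kappa> * b N)\<^sup>2)) \<le> null_sup m n T_sts N (\<kappa> * b N)) sequentially"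
proof -
  obtain j where j: "eventually (\<lambda>N. j N \<in> {1..\<Delta> N}) sequentially" "(\<lambda>N. p N (j N)) \<longlonglongrightarrow> 1 / 2"
    using levels_dense[of "1 / 2"] by auto
  have \<rho>: "(\<lambda>N. \<rho> N (j N)) \<longlonglongrightarrow> 1 / 2"
  proof -
    have "(\<lambda>N. \<rho> N (j N)) \<longlonglongrightarrow> sqrt (1 / 2 * (1 - 1 / 2))" unfolding \<rho>_def by (intro tendsto_intros j(2))
    moreover have "sqrt (1 / 2 * (1 - 1 / 2)) = (1 / 2 :: real)" using sqrt_variance_le[of "1 / 2"] by simp
    ultimately show ?thesis by (simp only:)
  qed
  have q: "(\<lambda>N. q N (j N)) \<longlonglongrightarrow> 1 / 2" by (rule q_tendsto[OF j])
  have w: "filterlim (\<lambda>N. \<kappa> * b N) at_top sequentially"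
    by (rule filterlim_tendsto_pos_mult_at_top[OF tendsto_const \<kappa> b_at_top])
  have wv: "(\<lambda>N. \<kappa> * b N / sqrt (v N)) \<longlonglongrightarrow> 0"
  proof (rule Lim_transform_eventually)
    show "(\<lambda>N. \<kappa> * \<theta> N) \<longlonglongrightarrow> 0" using tendsto_mult[OF tendsto_const \<theta>_lim, of \<kappa>] by simp
    show "eventually (\<lambda>N. \<kappa> * \<theta> N = \<kappa> * b N / sqrt (v N)) sequentially"
      using filterlim_at_top_dense[THEN iffD1, OF v_at_top, rule_format, of 0] by eventually_elim (simp add: b_def)
  qed
  have M: "(\<lambda>N. ln (real N + 1) / (\<kappa> * b N)\<^sup>2) \<longlonglongrightarrow> 0"
  proof -
    have "(\<lambda>N. ln (1 * real N + 1) / (b N)\<^sup>2 * (1 / \<kappa>\<^sup>2)) \<longlonglongrightarrow> 0 * (1 / \<kappa>\<^sup>2)"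
      by (intro tendsto_intros ln_affine_over_b_sq) simp
    then show ?thesis by (simp add: power_mult_distrib mult.commute)
  qed
  have q1: "eventually (\<lambda>N. 1 / 4 < q N (j N)) sequentially" by (rule order_tendstoD(1)[OF q]) simp
  have q2: "eventually (\<lambda>N. q N (j N) < 3 / 4) sequentially" by (rule order_tendstoD(2)[OF q]) simp
  note S = surplus_exponent[OF v_at_top w wv \<rho> q M _ \<delta>, simplified]
  have half: "2 * (1 / 2)\<^sup>2 + \<delta> = 1 / 2 + \<delta>" by (simp add: power2_eq_square)
  show ?thesis
    using S(1) surplus_exponent(2)[OF v_at_top w wv \<rho> q M _ \<delta>, unfolded half, OF of_nat_0_le_iff] j(1) ev2 sizes_pos
      q1 q2 b_at_top[unfolded filterlim_at_top_dense, rule_format, of 0]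
  proof eventually_elim
    case (elim N)
    have mn: "m N + n N = N" using size elim by simp
    have small: "sqrt (v N) * \<rho> N (j N) * (\<kappa> * b N) + 1 \<le> real (m N) / 8" "sqrt (v N) * \<rho> N (j N) * (\<kappa> * b N) + 1 \<le> real (n N) / 8"
      using elim v_le[of N] by (auto simp: mult_ac)
    have d1: "1 \<le> \<Delta> N" using \<Delta>[of N] elim by simp
    have "exp (- ((1 / 2 + \<delta>) * (\<kappa> * b N)\<^sup>2)) \<le> exp (- ((sqrt (v N) * \<rho> N (j N) * (\<kappa> * b N) + 1)\<^sup>2 / (2 * v N * (q N (j N) * (1 - q N (j N)))))
          * (1 + 100 * ((sqrt (v N) * \<rho> N (j N) * (\<kappa> * b N) + 1) / v N))) / (real N + 1)\<^sup>2"
      using elim by simp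
    also have "\<dots> \<le> \<P>(z in pooled_law (m N) (n N) uniform_law uniform_law. T_stat (m N) (n N) (\<Delta> N) (p N) (split_at (m N) z) > \<kappa> * b N)"
      using uniform_T_ge[of "m N" "n N" "\<Delta> N" "p N" "j N" "q N (j N)" "\<kappa> * b N"] elim small p_bounds(1)[of N] \<kappa>
      unfolding mn v_def[symmetric, unfolded mn] v_def[of N, symmetric] \<rho>_def[of N "j N", symmetric]
      by (simp add: q_def lev_def v_def mn)
    also have "\<dots> = null_sup m n T_sts N (\<kappa> * b N)"
      using elim d1 p_bounds(1)[of N] by (intro null_sup_T[symmetric]) auto
    finally show ?case .
  qed
qed

end

section \<open>Asymptotics under the alternatives\<close>

text \<open>Hoeffding's inequality for the number of all observations up to \<open>t\<close>, whose mean is \<open>(a + b) H\<close>.\<close>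

lemma (in two_samples) total_count_tails:
  assumes H: "real a * cdf P t + real b * cdf Q t = real (a + b) * H" and h: "0 \<le> h"
  shows "H \<le> x - h \<Longrightarrow> \<P>(z in \<Omega>. real (card {i. i < a + b \<and> z i \<le> t}) \<ge> real (a + b) * x) \<le> exp (- 2 * h\<^sup>2 * real (a + b))"
    and "x + h \<le> H \<Longrightarrow> \<P>(z in \<Omega>. real (card {i. i < a + b \<and> z i \<le> t}) \<le> real (a + b) * x) \<le> exp (- 2 * h\<^sup>2 * real (a + b))"
proof -
  define N where "N = real (a + b)"
  have N: "0 \<le> N" by (simp add: N_def)
  have card: "real (card {i. i < a + b \<and> z i \<le> t}) = real (count_x z {..t}) + real (count_y z {..t})" for z
    unfolding count_add[symmetric] by simp
  have mean: "r * (real a * measure P {..t}) + r * (real b * measure Q {..t}) = r * (N * H)" for r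
    using H by (simp add: cdf_def2 N_def distrib_left[symmetric])
  have sq: "(r\<^sup>2 * real a + r\<^sup>2 * real b) / 8 = r\<^sup>2 * N / 8" for r :: real
    by (simp add: N_def distrib_left)
  have ms: "{z \<in> space \<Omega>. r * real (count_x z {..t}) + r * real (count_y z {..t}) \<ge> k} \<in> sets \<Omega>" for r k
    by (rule borel_measurable_le[OF borel_measurable_const measurable_weighted_count]) simp_all
  {
    assume le: "H \<le> x - h"
    have "\<P>(z in \<Omega>. real (card {i. i < a + b \<and> z i \<le> t}) \<ge> N * x)
        \<le> \<P>(z in \<Omega>. (4 * h) * real (count_x z {..t}) + (4 * h) * real (count_y z {..t}) \<ge> 4 * h * (N * x))"
      by (rule P.finite_measure_mono[OF _ ms]) (use h in \<open>auto simp: card distrib_left[symmetric] intro: mult_left_mono\<close>)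
    also have "\<dots> \<le> exp (- (4 * h * (N * x)) + 4 * h * (N * H) + (4 * h)\<^sup>2 * N / 8)"
      using pooled_Hoeffding[of "{..t}" "{..t}" "4 * h * (N * x)" "4 * h" "4 * h"] unfolding mean sq by simp
    also have "\<dots> \<le> exp (- 2 * h\<^sup>2 * N)"
    proof -
      have "4 * h * (N * H) \<le> 4 * h * (N * (x - h))" using h N le by (intro mult_left_mono) auto
      then show ?thesis by (simp add: algebra_simps power2_eq_square)
    qed
    finally show "\<P>(z in \<Omega>. real (card {i. i < a + b \<and> z i \<le> t}) \<ge> real (a + b) * x) \<le> exp (- 2 * h\<^sup>2 * real (a + b))"
      unfolding N_def .
  }
  {
    assume le: "x + h \<le> H"
    have "\<P>(z in \<Omega>. real (card {i. i < a + b \<and> z i \<le> t}) \<le> N * x)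
        \<le> \<P>(z in \<Omega>. (- 4 * h) * real (count_x z {..t}) + (- 4 * h) * real (count_y z {..t}) \<ge> - 4 * h * (N * x))"
    proof (rule P.finite_measure_mono[OF _ ms], rule subsetI)
      fix z assume z: "z \<in> {z \<in> space \<Omega>. real (card {i. i < a + b \<and> z i \<le> t}) \<le> N * x}"
      have alg: "- 4 * h * K \<le> - 4 * h * X + - 4 * h * Y" if "X + Y \<le> K" for X Y K :: real
      proof -
        have "4 * h * (X + Y) \<le> 4 * h * K" using that h by (intro mult_left_mono) auto
        then show ?thesis by (simp add: distrib_left)
      qed
      have "real (count_x z {..t}) + real (count_y z {..t}) \<le> N * x"
        using z unfolding card[symmetric] by simp
      from alg[OF this] show "z \<in> {z \<in> space \<Omega>. - 4 * h * (N * x) \<le> - 4 * h * real (count_x z {..t}) + - 4 * h * real (count_y z {..t})}"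
        using z by blast
    qed
    also have "\<dots> \<le> exp (- (- 4 * h * (N * x)) + - 4 * h * (N * H) + (- 4 * h)\<^sup>2 * N / 8)"
      using pooled_Hoeffding[of "{..t}" "{..t}" "- 4 * h * (N * x)" "- 4 * h" "- 4 * h"] unfolding mean sq by simp
    also have "\<dots> \<le> exp (- 2 * h\<^sup>2 * N)"
    proof -
      have "4 * h * (N * (x + h)) \<le> 4 * h * (N * H)" using h N le by (intro mult_left_mono) auto
      then show ?thesis by (simp add: algebra_simps power2_eq_square)
    qed
    finally show "\<P>(z in \<Omega>. real (card {i. i < a + b \<and> z i \<le> t}) \<le> real (a + b) * x) \<le> exp (- 2 * h\<^sup>2 * real (a + b))"
      unfolding N_def .
  }
qed

lemma continuous_df_surj:
  assumes "continuous_df K" "0 < x" "x < 1"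
  obtains t where "K t = x"
  using cdf_surj[OF continuous_df_law(1)[OF assms(1)] _ assms(2,3)] assms(1)
  unfolding continuous_df_law(2)[OF assms(1)] by (auto simp: continuous_df_def)

context efficiency_setting
begin

definition "Pa N = contaminated J F (\<theta> N)"
definition "Qa N = contaminated J G (\<theta> N)"

lemma alt_df:
  assumes N: "2 \<le> N"
  shows "continuous_df (\<lambda>z. (1 - \<theta> N) * J z + \<theta> N * F z)" "continuous_df (\<lambda>z. (1 - \<theta> N) * J z + \<theta> N * G z)"
  using \<theta>01[OF N] by (auto intro!: continuous_df_convex J_df F G)

lemma alt_law:
  assumes N: "2 \<le> N"
  shows "real_distribution (Pa N)" "real_distribution (Qa N)"
    and "cdf (Pa N) z = (1 - \<theta> N) * J z + \<theta> N * F z" "cdf (Qa N) z = (1 - \<theta> N) * J z + \<theta> N * G z"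
    and "continuous_on UNIV (cdf (Pa N))" "continuous_on UNIV (cdf (Qa N))"
  using continuous_df_law[OF alt_df(1)[OF N]] continuous_df_law[OF alt_df(2)[OF N]] alt_df[OF N]
  by (simp_all add: Pa_def Qa_def contaminated_def continuous_df_def)

lemma alt_two_samples: "2 \<le> N \<Longrightarrow> 0 < m S \<Longrightarrow> 0 < n S \<Longrightarrow> two_samples (m S) (n S) (Pa N) (Qa N)"
  by (intro two_samples.intro alt_law)

lemma alt_difference: "2 \<le> N \<Longrightarrow> cdf (Qa N) z - cdf (Pa N) z = \<theta> N * D z"
  by (simp add: alt_law D_def algebra_simps)

text \<open>The pooled sample has nearly the distribution function \<open>J\<close>: the mean of the two alternatives
  with the weights \<open>\<eta>\<close>, \<open>1 - \<eta>\<close> is \<open>J\<close> exactly, and the actual weights differ from these by little.\<close>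

lemma alt_mixture:
  assumes N: "2 \<le> N"
  shows "real (m N) * cdf (Pa N) z + real (n N) * cdf (Qa N) z
    = real N * (J z + \<theta> N * (\<eta> - real (m N) / real N) * D z)"
proof -
  have n: "real (n N) = real N - real (m N)" using size[of N] N by (metis add_diff_cancel_left' of_nat_add order_trans one_le_numeral)
  have alg: "real N * (x + s * (e - y) * d) = real N * x + s * (real N * e - real N * y) * d" for x s e y d :: real
    by (simp add: algebra_simps)
  have "real N * (J z + \<theta> N * (\<eta> - real (m N) / real N) * D z)
      = real N * J z + \<theta> N * (real N * \<eta> - real (m N)) * D z"
    unfolding alg using N by (simp del: mult_cancel_left mult_cancel_right)
  moreover have "M * ((1 - s) * j + s * f) + (K - M) * ((1 - s) * j + s * g) = K * j + s * (K * \<eta> - M) * (g - f)"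
    if "j = \<eta> * f + (1 - \<eta>) * g" for M s j f g K :: real
    unfolding that by (simp add: algebra_simps)
  note this[OF J_eq, of "real (m N)" "\<theta> N" z "real N"]
  ultimately show ?thesis by (simp only: n alt_law[OF N] D_def)
qed

lemma abs_D_le_1: "\<bar>D z\<bar> \<le> 1"
  using F01[of z] G01[of z] by (simp add: D_def)

text \<open>Bounds the distance between \<open>q N j\<close> and \<open>J\<close> at the point where the expected proportion of
  observations is \<open>q N j\<close>.\<close>

definition "h N = 2 * \<theta> N / c"

lemma h_lim: "h \<longlonglongrightarrow> 0"
proof -
  have "(\<lambda>N. 2 * \<theta> N / c) \<longlonglongrightarrow> 2 * 0 / c" using c by (intro tendsto_intros \<theta>_lim) auto
  then show ?thesis by (simp add: h_def[abs_def])
qed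

text \<open>\<open>t_lev N j\<close> is the point below which the expected number of observations is the level. In units of
  \<open>b\<close>, \<open>B N j\<close> is the centre of the statistic at level \<open>j\<close>, and \<open>r\<close> bounds the ratio of the standard
  deviation \<open>sqrt (J (1 - J))\<close> at this point to \<open>\<rho> N j\<close>.\<close>

definition "t_lev N j = (SOME t. real (m N) * cdf (Pa N) t + real (n N) * cdf (Qa N) t = real (lev N j))"
definition "B N j = D (t_lev N j) / \<rho> N j"
definition "r N = sqrt ((1 + u N) / (1 - h N))"

lemma r_lim: "r \<longlonglongrightarrow> 1"
proof -
  have "(\<lambda>N. sqrt ((1 + u N) / (1 - h N))) \<longlonglongrightarrow> sqrt ((1 + 0) / (1 - 0))"
    by (intro tendsto_intros u_lim h_lim) simp
  then show ?thesis by (simp add: r_def[abs_def])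
qed

lemma t_lev:
  assumes N: "2 \<le> N" and mn: "0 < m N" "0 < n N" and j: "j \<in> {1..\<Delta> N}" and u: "u N \<le> 1 / 2"
  shows "real (m N) * cdf (Pa N) (t_lev N j) + real (n N) * cdf (Qa N) (t_lev N j) = real (lev N j)"
proof -
  have N0: "0 < real N" using N by simp
  have sz: "real (m N) + real (n N) = real N" using size[of N] N by (metis of_nat_add order_trans one_le_numeral)
  define l where "l = real (n N) / real N"
  have l: "0 \<le> l" "l \<le> 1" "1 - l = real (m N) / real N"
    using sz N0 by (auto simp: l_def field_simps)
  have dfs: "continuous_df (cdf (Pa N))" "continuous_df (cdf (Qa N))"
    using continuous_df_law[OF alt_df(1)[OF N]] continuous_df_law[OF alt_df(2)[OF N]] alt_df[OF N]
    by (simp_all add: Pa_def Qa_def contaminated_def)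
  have "0 < real (lev N j) / real N" "real (lev N j) / real N < 1" using q_interior(4,5)[OF N j u] by auto
  then obtain t where "(1 - l) * cdf (Pa N) t + l * cdf (Qa N) t = real (lev N j) / real N"
    using continuous_df_surj[OF continuous_df_convex[OF dfs l(1,2)]] by metis
  then have "real N * ((1 - l) * cdf (Pa N) t + l * cdf (Qa N) t) = real N * (real (lev N j) / real N)" by (rule arg_cong)
  moreover have "real N * (1 - l) = real (m N)" "real N * l = real (n N)"
    unfolding l(3) using N0 by (simp_all add: l_def)
  ultimately have "real (m N) * cdf (Pa N) t + real (n N) * cdf (Qa N) t = real (lev N j)"
    using N0 by (simp add: distrib_left mult.assoc[symmetric])
  then show ?thesis unfolding t_lev_def by (rule someI)
qed

text \<open>The expectation of the rank count exceeds its null value by \<open>v \<theta> D t\<close>, so the statistic at level \<open>j\<close>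
  is centred at \<open>b N * B N j\<close>. The first bound for \<open>B\<close> gives the upper limit \<open>Amax\<close>; the second shows
  that levels near \<open>0\<close> and \<open>1\<close> do not compete for the maximum.\<close>

lemma center:
  assumes N: "2 \<le> N" and mn: "0 < m N" "0 < n N" and j: "j \<in> {1..\<Delta> N}" and u: "u N \<le> 1 / 2" and h: "h N \<le> 1 / 2"
  defines "t \<equiv> t_lev N j"
  shows "real (n N) * cdf (Qa N) t = real (n N) * q N j + v N * (\<theta> N * D t)"
    and "\<bar>q N j - J t\<bar> \<le> h N" and "B N j \<le> Amax * r N" and "B N j \<le> 2 / c * \<rho> N j * (r N)\<^sup>2"
proof -
  have N0: "0 < real N" using N by simp
  have sz: "real (m N) + real (n N) = real N" using size[of N] N by (metis of_nat_add order_trans one_le_numeral)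
  note tl = t_lev[OF N mn j u, folded t_def] and \<rho> = \<rho>_bounds[OF N j] and th = \<theta>01[OF N]
  have v: "v N = real (m N) * real (n N) / real N" by (simp add: v_def sz)
  have q: "real N * q N j = real (m N) * cdf (Pa N) t + real (n N) * cdf (Qa N) t"
    using tl N0 by (simp add: q_def)
  show "real (n N) * cdf (Qa N) t = real (n N) * q N j + v N * (\<theta> N * D t)"
  proof -
    have "real N * (real (n N) * q N j + v N * (\<theta> N * D t))
        = real (n N) * (real N * q N j) + real (m N) * real (n N) * (cdf (Qa N) t - cdf (Pa N) t)"
      using N0 by (simp add: v alt_difference[OF N] algebra_simps)
    also have "\<dots> = (real (m N) + real (n N)) * (real (n N) * cdf (Qa N) t)"
      unfolding q by (simp add: algebra_simps)
    finally have "real N * (real (n N) * q N j + v N * (\<theta> N * D t)) = real N * (real (n N) * cdf (Qa N) t)"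
      unfolding sz .
    then show ?thesis using N0 by simp
  qed
  have "real N * q N j = real N * (J t + \<theta> N * (\<eta> - real (m N) / real N) * D t)"
    unfolding q by (rule alt_mixture[OF N])
  then have qJ: "q N j - J t = \<theta> N * ((\<eta> - real (m N) / real N) * D t)" using N0 by simp
  define X where "X = J t * (1 - J t)"
  have X: "0 \<le> X" "X \<le> 1" using J01[of t] by (auto simp: X_def intro: mult_le_one)
  have d: "\<bar>q N j - J t\<bar> \<le> h N * X"
  proof -
    have "\<bar>\<eta> - real (m N) / real N\<bar> \<le> 1"
    proof -
      have "0 \<le> real (m N) / real N" "real (m N) / real N \<le> 1" using sz N0 by (auto simp: divide_le_eq)
      then show ?thesis using \<eta> by linarith
    qed
    then have "\<bar>\<eta> - real (m N) / real N\<bar> * \<bar>D t\<bar> \<le> 1 * (2 / c * X)"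
      using abs_D_le[of t] by (intro mult_mono) (auto simp: X_def)
    then have "\<theta> N * (\<bar>\<eta> - real (m N) / real N\<bar> * \<bar>D t\<bar>) \<le> \<theta> N * (1 * (2 / c * X))"
      using th by (intro mult_left_mono) auto
    then show ?thesis unfolding qJ using th by (simp add: abs_mult h_def mult_ac)
  qed
  have h0: "0 \<le> h N" using th c by (simp add: h_def)
  show "\<bar>q N j - J t\<bar> \<le> h N" using d mult_left_mono[OF X(2) h0] by simp
  have "\<bar>q N j * (1 - q N j) - X\<bar> \<le> h N * X"
  proof -
    have e: "q N j * (1 - q N j) - X = (q N j - J t) * (1 - q N j - J t)" by (simp add: X_def algebra_simps)
    have "\<bar>1 - q N j - J t\<bar> \<le> 1" using q_bounds(1,2)[OF N j] J01[of t] by (simp add: abs_le_iff)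
    then have "\<bar>q N j - J t\<bar> * \<bar>1 - q N j - J t\<bar> \<le> h N * X * 1" using d by (intro mult_mono) auto
    then show ?thesis unfolding e by (simp add: abs_mult)
  qed
  then have "(1 - h N) * X \<le> q N j * (1 - q N j)" by (simp add: algebra_simps abs_le_iff)
  also have "\<dots> \<le> (1 + u N) * (\<rho> N j)\<^sup>2" by (rule q_interior(2)[OF N j u])
  finally have "X \<le> (1 + u N) / (1 - h N) * (\<rho> N j)\<^sup>2"
    using h by (simp add: pos_le_divide_eq mult.commute)
  moreover have "(1 + u N) / (1 - h N) = (r N)\<^sup>2"
    using h by (simp add: r_def u_def)
  ultimately have Xr: "X \<le> (r N * \<rho> N j)\<^sup>2" by (simp add: power_mult_distrib)
  have r0: "0 \<le> r N" using h by (simp add: r_def u_def)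
  have sX: "sqrt X \<le> r N * \<rho> N j"
    using Xr r0 \<rho>(1) by (intro real_le_lsqrt) auto
  have DA: "D t = A t * sqrt X"
  proof (cases "D t = 0")
    case True
    then show ?thesis by (simp add: A_def)
  next
    case False
    then show ?thesis using J_pos_if_D[of t] by (simp add: A_def X_def)
  qed
  have "A t * sqrt X \<le> Amax * sqrt X" using zA(3) X by (intro mult_right_mono) auto
  also have "\<dots> \<le> Amax * (r N * \<rho> N j)" using sX Amax_pos by (intro mult_left_mono) auto
  finally show "B N j \<le> Amax * r N"
    unfolding B_def t_def[symmetric] DA[symmetric] using \<rho>(1) by (simp add: pos_divide_le_eq mult_ac)
  have "D t \<le> 2 / c * X" using abs_D_le[of t] unfolding X_def by linarith
  also have "\<dots> \<le> 2 / c * (r N * \<rho> N j)\<^sup>2" using Xr c by (intro mult_left_mono) auto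
  finally show "B N j \<le> 2 / c * \<rho> N j * (r N)\<^sup>2"
    unfolding B_def t_def[symmetric] using \<rho>(1) by (simp add: pos_divide_le_eq power2_eq_square mult_ac)
qed

lemma ev_small: "eventually (\<lambda>N. 2 \<le> N \<and> 0 < m N \<and> 0 < n N \<and> u N \<le> 1 / 2 \<and> h N \<le> 1 / 2 \<and> 0 < b N) sequentially"
proof -
  have "eventually (\<lambda>N. u N < 1 / 2) sequentially" "eventually (\<lambda>N. h N < 1 / 2) sequentially"
    by (rule order_tendstoD(2)[OF u_lim], simp, rule order_tendstoD(2)[OF h_lim], simp)
  moreover have "eventually (\<lambda>N. 0 < b N) sequentially" using filterlim_at_top_dense[THEN iffD1, OF b_at_top] by blast
  ultimately show ?thesis using ev2 sizes_pos by eventually_elim auto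
qed

lemma center_tendsto:
  assumes j: "eventually (\<lambda>N. j N \<in> {1..\<Delta> N}) sequentially" and p: "(\<lambda>N. p N (j N)) \<longlonglongrightarrow> J zA"
  shows "(\<lambda>N. B N (j N)) \<longlonglongrightarrow> Amax"
proof -
  have q: "(\<lambda>N. q N (j N)) \<longlonglongrightarrow> J zA" by (rule q_tendsto[OF j p])
  have "(\<lambda>N. q N (j N) - J (t_lev N (j N))) \<longlonglongrightarrow> 0"
    by (rule Lim_null_comparison[OF _ h_lim]) (use ev_small j in \<open>eventually_elim, simp add: center(2)\<close>)
  then have "(\<lambda>N. q N (j N) - (q N (j N) - J (t_lev N (j N)))) \<longlonglongrightarrow> J zA - 0" by (intro tendsto_intros q)
  then have Jt: "(\<lambda>N. J (t_lev N (j N))) \<longlonglongrightarrow> J zA" by simp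
  have "(\<lambda>N. 2 / c * \<bar>J (t_lev N (j N)) - J zA\<bar>) \<longlonglongrightarrow> 2 / c * \<bar>J zA - J zA\<bar>" by (intro tendsto_intros Jt)
  then have "(\<lambda>N. 2 / c * \<bar>J (t_lev N (j N)) - J zA\<bar>) \<longlonglongrightarrow> 0" by simp
  then have "(\<lambda>N. D (t_lev N (j N)) - D zA) \<longlonglongrightarrow> 0"
    by (rule Lim_null_comparison[rotated]) (use D_lipschitz in \<open>auto intro!: always_eventually\<close>)
  then have Dt: "(\<lambda>N. D (t_lev N (j N))) \<longlonglongrightarrow> D zA" by (simp add: LIM_zero_iff)
  have "(\<lambda>N. D (t_lev N (j N)) / sqrt (p N (j N) * (1 - p N (j N)))) \<longlonglongrightarrow> D zA / sqrt (J zA * (1 - J zA))"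
    using zA(1,2) by (intro tendsto_intros Dt p) auto
  then show ?thesis by (simp add: B_def \<rho>_def Amax_def A_def)
qed

text \<open>On \<open>good N \<delta>\<close> the statistics of all levels are within \<open>\<delta> b\<close> of their centres.\<close>

definition "\<Omega>a N = pooled_law (m N) (n N) (Pa N) (Qa N)"
definition "Tj N j z = T_of_counts (m N) (n N) (p N j) z"
definition "Tp N z = T_stat (m N) (n N) (\<Delta> N) (p N) (split_at (m N) z)"
definition "good N \<delta> = {z \<in> space (\<Omega>a N). inj_on z {..<N} \<and> (\<forall>j\<in>{1..\<Delta> N}. \<bar>Tj N j z - b N * B N j\<bar> < \<delta> * b N)}"

text \<open>By \<open>ln_affine_over_b_sq\<close> the linear factor is absorbed by half of the exponent.\<close>

lemma exp_b_sq_lim: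
  assumes "0 \<le> C" "0 < g"
  shows "(\<lambda>N. (C * real N + 1) * exp (- (g * (b N)\<^sup>2))) \<longlonglongrightarrow> 0"
proof (rule tendsto_sandwich[OF _ _ tendsto_const])
  have f: "filterlim (\<lambda>N. g / 2 * (b N)\<^sup>2) at_top sequentially"
    using assms by (intro filterlim_tendsto_pos_mult_at_top[OF tendsto_const _ b_sq_at_top]) auto
  show "(\<lambda>N. exp (- (g / 2 * (b N)\<^sup>2))) \<longlonglongrightarrow> 0"
    by (rule filterlim_compose[OF exp_at_bot]) (use f in \<open>simp only: filterlim_uminus_at_top[symmetric]\<close>)
  show "eventually (\<lambda>N. 0 \<le> (C * real N + 1) * exp (- (g * (b N)\<^sup>2))) sequentially"
    using assms by (intro always_eventually allI mult_nonneg_nonneg) auto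
  have "eventually (\<lambda>N. ln (C * real N + 1) / (b N)\<^sup>2 < g / 2) sequentially"
    using assms by (intro order_tendstoD(2)[OF ln_affine_over_b_sq]) auto
  then show "eventually (\<lambda>N. (C * real N + 1) * exp (- (g * (b N)\<^sup>2)) \<le> exp (- (g / 2 * (b N)\<^sup>2))) sequentially"
    using ev_small
  proof eventually_elim
    case (elim N)
    have C1: "0 < C * real N + 1" using assms by (intro add_nonneg_pos) auto
    have "ln (C * real N + 1) \<le> g / 2 * (b N)\<^sup>2" using elim by (simp add: divide_less_eq)
    then have "C * real N + 1 \<le> exp (g / 2 * (b N)\<^sup>2)" using C1 by (metis exp_le_cancel_iff exp_ln)
    then have "(C * real N + 1) * exp (- (g * (b N)\<^sup>2)) \<le> exp (g / 2 * (b N)\<^sup>2) * exp (- (g * (b N)\<^sup>2))"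
      by (intro mult_right_mono) auto
    also have "\<dots> = exp (- (g / 2 * (b N)\<^sup>2))" by (simp add: exp_add[symmetric])
    finally show ?case .
  qed
qed

text \<open>By \<open>y_low_deviation\<close> and a union bound over the levels. The variance parameter there is of order
  \<open>N q (1 - q)\<close>, and the deviation \<open>\<delta> b\<close>, in units of standard deviations, stays within the range in which
  the exponent is quadratic, which is what the smallness of \<open>\<theta>\<^sub>N \<Delta>(N)\<close> ensures.\<close>

lemma good_finite:
  assumes N: "2 \<le> N" and mn: "0 < m N" "0 < n N" and u: "u N \<le> 1 / 2" and h: "h N \<le> 1 / 2" and b: "0 < b N"
    and \<delta>: "0 < \<delta>" "8 * \<delta> * (\<theta> N * real (\<Delta> N)) \<le> 1"
  shows "\<exists>X \<in> sets (\<Omega>a N). X \<subseteq> good N \<delta> \<and>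
    measure (\<Omega>a N) (space (\<Omega>a N) - X) \<le> 4 * real N * exp (- (\<delta>\<^sup>2 / 8 * (v N / real N)\<^sup>2 * (b N)\<^sup>2))"
proof -
  interpret TS: two_samples "m N" "n N" "Pa N" "Qa N" by (rule alt_two_samples[OF N mn])
  have sz: "m N + n N = N" using size N by simp
  have N0: "0 < real N" using N by simp
  have v: "TS.\<sigma> = sqrt (v N)" "0 < v N" using mn by (simp_all add: v_def TS.\<sigma>_def)
  have vN: "v N \<le> real N" using v_le(1)[of N] sz by linarith
  define s where "s j = \<delta> * b N * (sqrt (v N) * \<rho> N j)" for j
  define E where "E j = {z \<in> space TS.\<Omega>. \<bar>real (y_low (m N) z (m N + n N) (lev N j)) - real (n N) * cdf (Qa N) (t_lev N j)\<bar> \<ge> s j}" for j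
  have Em: "E j \<in> sets TS.\<Omega>" for j unfolding E_def by (rule TS.y_low_event)
  obtain Z where Z: "Z \<in> null_sets TS.\<Omega>" "{z \<in> space TS.\<Omega>. \<not> inj_on z {..<m N + n N}} \<subseteq> Z"
    using AE_E2[OF TS.AE_inj] AE_E[OF TS.AE_inj] by (auto simp: null_sets_def)
  have PE: "measure TS.\<Omega> (E j) \<le> 4 * exp (- (\<delta>\<^sup>2 / 8 * (v N / real N)\<^sup>2 * (b N)\<^sup>2))" if j: "j \<in> {1..\<Delta> N}" for j
  proof -
    note qi = q_interior[OF N j u] and \<rho> = \<rho>_bounds[OF N j] and tl = t_lev[OF N mn j u]
    \<comment> \<open>Bounds both binomial variances: each is \<open>k w (1 - w)\<close> with \<open>k w\<close> and \<open>k (1 - w)\<close> at most \<open>N q\<close> and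
      \<open>N (1 - q)\<close>.\<close>
    define \<kappa> where "\<kappa> = (real N)\<^sup>2 * (q N j * (1 - q N j)) / v N"
    have \<kappa>0: "0 < \<kappa>" using N0 qi(3) v(2) by (simp add: \<kappa>_def)
    have Nq: "real N * q N j = real (lev N j)" using N0 by (simp add: q_def)
    define x y where "x = cdf (Pa N) (t_lev N j)" and "y = cdf (Qa N) (t_lev N j)"
    have xy: "0 \<le> x" "x \<le> 1" "0 \<le> y" "y \<le> 1"
      by (simp_all add: x_def y_def TS.X.cdf_nonneg TS.Y.cdf_nonneg TS.X.cdf_bounded_prob TS.Y.cdf_bounded_prob)
    have mix: "real (m N) * x + real (n N) * y = real N * q N j" using tl unfolding Nq x_def y_def .
    have szr: "real (m N) + real (n N) = real N" using sz by (metis of_nat_add)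
    then have mix': "real (m N) * (1 - x) + real (n N) * (1 - y) = real N * (1 - q N j)"
      using mix by (simp add: algebra_simps)
    have var: "k * (w * (1 - w)) \<le> \<kappa>"
      if k: "0 < k" "v N \<le> k" and w: "0 \<le> w" "w \<le> 1" "k * w \<le> real N * q N j" "k * (1 - w) \<le> real N * (1 - q N j)" for k w
    proof -
      have "(k * w) * (k * (1 - w)) \<le> (real N * q N j) * (real N * (1 - q N j))"
        by (rule mult_mono[OF w(3,4)]) (use k w N0 q_bounds(1)[OF N j] in auto)
      then have "k * (k * (w * (1 - w))) \<le> (real N)\<^sup>2 * (q N j * (1 - q N j))" by (simp add: power2_eq_square mult_ac)
      moreover have "v N * (k * (w * (1 - w))) \<le> k * (k * (w * (1 - w)))"
        using k w by (intro mult_right_mono) auto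
      ultimately show ?thesis using v(2) by (simp add: \<kappa>_def le_divide_eq mult.commute)
    qed
    have \<kappa>1: "real (m N) * (x * (1 - x)) \<le> \<kappa>"
    proof (rule var)
      have "0 \<le> real (n N) * y" "0 \<le> real (n N) * (1 - y)" using xy by auto
      then show "real (m N) * x \<le> real N * q N j" "real (m N) * (1 - x) \<le> real N * (1 - q N j)"
        using mix mix' by linarith+
    qed (use mn xy v_le in auto)
    have \<kappa>2: "real (n N) * (y * (1 - y)) \<le> \<kappa>"
    proof (rule var)
      have "0 \<le> real (m N) * x" "0 \<le> real (m N) * (1 - x)" using xy by auto
      then show "real (n N) * y \<le> real N * q N j" "real (n N) * (1 - y) \<le> real N * (1 - q N j)"
        using mix mix' by linarith+
    qed (use mn xy v_le in auto)
    have s0: "0 \<le> s j" using \<delta> b \<rho>(1) v(2) by (simp add: s_def)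
    have sv: "s j = \<delta> * (\<theta> N * v N * \<rho> N j)"
      using v(2) by (simp add: s_def b_def)
    have s\<kappa>: "s j \<le> \<kappa>"
    proof -
      have "\<delta> * \<theta> N \<le> \<rho> N j / 2"
      proof -
        have "\<delta> * \<theta> N * 1 \<le> \<delta> * \<theta> N * (4 * real (\<Delta> N) * \<rho> N j)"
          using \<delta> \<theta>01[OF N] \<rho>(4) by (intro mult_left_mono) auto
        also have "\<dots> = 8 * \<delta> * (\<theta> N * real (\<Delta> N)) * (\<rho> N j / 2)" by simp
        also have "\<dots> \<le> 1 * (\<rho> N j / 2)" using \<delta>(2) \<rho>(1) by (intro mult_right_mono) auto
        finally show ?thesis by simp
      qed
      then have "\<delta> * \<theta> N * \<rho> N j \<le> \<rho> N j / 2 * \<rho> N j" using \<rho>(1) by (intro mult_right_mono) auto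
      also have "\<dots> \<le> q N j * (1 - q N j)" using qi(1) by (simp add: power2_eq_square)
      finally have 1: "\<delta> * \<theta> N * \<rho> N j \<le> q N j * (1 - q N j)" .
      have vv: "v N * v N \<le> real N * real N" using vN v(2) by (intro mult_mono) auto
      have "(\<delta> * \<theta> N * \<rho> N j) * (v N * v N) \<le> (q N j * (1 - q N j)) * (real N * real N)"
        by (rule mult_mono[OF 1 vv]) (use qi(3) v(2) in \<open>auto simp: less_imp_le\<close>)
      then show ?thesis using v(2) by (simp add: sv \<kappa>_def le_divide_eq power2_eq_square mult_ac)
    qed
    have "measure TS.\<Omega> (E j) \<le> 4 * exp (- ((s j)\<^sup>2 / (4 * \<kappa>)))"
      unfolding E_def
      by (rule TS.y_low_deviation[OF _ tl \<kappa>0 \<kappa>1[unfolded x_def] \<kappa>2[unfolded y_def] s0 s\<kappa>])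
         (use qi(5) sz in simp)
    also have "\<dots> \<le> 4 * exp (- (\<delta>\<^sup>2 / 8 * (v N / real N)\<^sup>2 * (b N)\<^sup>2))"
    proof -
      have "\<delta>\<^sup>2 / 8 * (v N / real N)\<^sup>2 * (b N)\<^sup>2 \<le> (s j)\<^sup>2 / (4 * \<kappa>)"
      proof -
        have "(s j)\<^sup>2 / (4 * \<kappa>) = \<delta>\<^sup>2 * (b N)\<^sup>2 * (v N / real N)\<^sup>2 / 4 * ((\<rho> N j)\<^sup>2 / (q N j * (1 - q N j)))"
          using v(2) N0 by (simp add: s_def \<kappa>_def power_mult_distrib power_divide power2_eq_square[of "v N"] mult_ac)
        moreover have "1 / 2 \<le> (\<rho> N j)\<^sup>2 / (q N j * (1 - q N j))"
        proof -
          have "(1 + u N) * (\<rho> N j)\<^sup>2 \<le> 2 * (\<rho> N j)\<^sup>2" using u by (intro mult_right_mono) auto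
          then have "q N j * (1 - q N j) \<le> 2 * (\<rho> N j)\<^sup>2" using qi(2) by linarith
          then show ?thesis using qi(3) by (simp add: le_divide_eq)
        qed
        then have "\<delta>\<^sup>2 * (b N)\<^sup>2 * (v N / real N)\<^sup>2 / 4 * (1 / 2)
            \<le> \<delta>\<^sup>2 * (b N)\<^sup>2 * (v N / real N)\<^sup>2 / 4 * ((\<rho> N j)\<^sup>2 / (q N j * (1 - q N j)))"
          by (intro mult_left_mono) auto
        ultimately show ?thesis by (simp add: mult_ac)
      qed
      then show ?thesis by simp
    qed
    finally show ?thesis .
  qed
  define X where "X = space TS.\<Omega> - (Z \<union> (\<Union>j\<in>{1..\<Delta> N}. E j))"
  have \<Omega>: "\<Omega>a N = TS.\<Omega>" by (simp add: \<Omega>a_def TS.pooled_law_eq)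
  have Un: "(\<Union>j\<in>{1..\<Delta> N}. E j) \<in> sets TS.\<Omega>" using Em by blast
  have Zs: "Z \<in> sets TS.\<Omega>" using Z(1) by (rule null_setsD2)
  have "X \<in> sets TS.\<Omega>" unfolding X_def by (intro sets.Diff sets.top sets.Un Zs Un)
  moreover have "X \<subseteq> good N \<delta>"
  proof
    fix z assume zX: "z \<in> X"
    then have z: "z \<in> space TS.\<Omega>" "inj_on z {..<N}" using Z(2) sz by (auto simp: X_def)
    have "\<bar>Tj N j z - b N * B N j\<bar> < \<delta> * b N" if j: "j \<in> {1..\<Delta> N}" for j
    proof -
      note \<rho> = \<rho>_bounds[OF N j]
      define y where "y = real (y_low (m N) z (m N + n N) (lev N j))"
      have less: "\<bar>y - real (n N) * cdf (Qa N) (t_lev N j)\<bar> < s j"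
      proof -
        have "z \<notin> E j" using zX j unfolding X_def by blast
        then show ?thesis using z(1) unfolding E_def y_def by (simp only: mem_Collect_eq not_le simp_thms)
      qed
      have pos: "0 < sqrt (v N) * \<rho> N j" using v(2) \<rho>(1) by simp
      have "Tj N j z = (y - real (n N) * q N j) / (sqrt (v N) * \<rho> N j)"
        by (simp add: Tj_def T_of_counts_def y_def lev_def q_def \<rho>_def v_def sz)
      moreover have "b N * B N j = v N * (\<theta> N * D (t_lev N j)) / (sqrt (v N) * \<rho> N j)"
      proof -
        have "v N / sqrt (v N) = sqrt (v N)" using v(2) by (intro real_div_sqrt) simp
        then have "v N * (\<theta> N * D (t_lev N j)) / (sqrt (v N) * \<rho> N j) = sqrt (v N) * (\<theta> N * D (t_lev N j)) / \<rho> N j"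
          by (metis divide_divide_eq_left times_divide_eq_left)
        then show ?thesis by (simp add: b_def B_def mult_ac)
      qed
      ultimately have "Tj N j z - b N * B N j = (y - real (n N) * cdf (Qa N) (t_lev N j)) / (sqrt (v N) * \<rho> N j)"
        unfolding center(1)[OF N mn j u h] by (simp add: diff_divide_distrib add_divide_distrib)
      then have "\<bar>Tj N j z - b N * B N j\<bar> = \<bar>y - real (n N) * cdf (Qa N) (t_lev N j)\<bar> / (sqrt (v N) * \<rho> N j)"
        using pos by (simp only: abs_divide abs_of_pos)
      also have "\<dots> < s j / (sqrt (v N) * \<rho> N j)" using less pos by (rule divide_strict_right_mono)
      also have "\<dots> = \<delta> * b N" using v(2) \<rho>(1) by (simp add: s_def)
      finally show ?thesis .
    qed
    with z show "z \<in> good N \<delta>" by (simp add: good_def \<Omega>)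
  qed
  moreover have "measure TS.\<Omega> (space TS.\<Omega> - X) \<le> 4 * real N * exp (- (\<delta>\<^sup>2 / 8 * (v N / real N)\<^sup>2 * (b N)\<^sup>2))"
  proof -
    have "space TS.\<Omega> - X \<subseteq> Z \<union> (\<Union>j\<in>{1..\<Delta> N}. E j)" by (auto simp: X_def)
    then have "measure TS.\<Omega> (space TS.\<Omega> - X) \<le> measure TS.\<Omega> (Z \<union> (\<Union>j\<in>{1..\<Delta> N}. E j))"
      by (rule TS.P.finite_measure_mono) (intro sets.Un Zs Un)
    also have "\<dots> \<le> measure TS.\<Omega> Z + measure TS.\<Omega> (\<Union>j\<in>{1..\<Delta> N}. E j)" by (intro measure_Un_le Zs Un)
    also have "measure TS.\<Omega> Z = 0" using Z(1) by (simp add: null_sets_def measure_def)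
    also have "measure TS.\<Omega> (\<Union>j\<in>{1..\<Delta> N}. E j) \<le> (\<Sum>j\<in>{1..\<Delta> N}. measure TS.\<Omega> (E j))"
      using Em by (intro TS.P.finite_measure_subadditive_finite) auto
    also have "\<dots> \<le> (\<Sum>j\<in>{1..\<Delta> N}. 4 * exp (- (\<delta>\<^sup>2 / 8 * (v N / real N)\<^sup>2 * (b N)\<^sup>2)))" by (intro sum_mono PE)
    also have "\<dots> = real (\<Delta> N) * (4 * exp (- (\<delta>\<^sup>2 / 8 * (v N / real N)\<^sup>2 * (b N)\<^sup>2)))" by simp
    also have "\<dots> \<le> real N * (4 * exp (- (\<delta>\<^sup>2 / 8 * (v N / real N)\<^sup>2 * (b N)\<^sup>2)))"
      using \<Delta>[OF N] by (intro mult_right_mono) auto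
    finally show ?thesis by simp
  qed
  ultimately show ?thesis unfolding \<Omega> by blast
qed

lemma good_limit:
  assumes \<delta>: "0 < \<delta>"
  obtains X where "eventually (\<lambda>N. X N \<in> sets (\<Omega>a N) \<and> X N \<subseteq> good N \<delta>) sequentially"
    "(\<lambda>N. measure (\<Omega>a N) (space (\<Omega>a N) - X N)) \<longlonglongrightarrow> 0"
proof -
  define bound where "bound N = 4 * real N * exp (- (\<delta>\<^sup>2 / 8 * (v N / real N)\<^sup>2 * (b N)\<^sup>2))" for N
  define X where "X N = (SOME X. X \<in> sets (\<Omega>a N) \<and> X \<subseteq> good N \<delta> \<and> measure (\<Omega>a N) (space (\<Omega>a N) - X) \<le> bound N)" for N
  have "(\<lambda>N. 8 * \<delta> * (\<theta> N * real (\<Delta> N))) \<longlonglongrightarrow> 8 * \<delta> * 0" by (intro tendsto_intros \<theta>\<Delta>)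
  then have "eventually (\<lambda>N. 8 * \<delta> * (\<theta> N * real (\<Delta> N)) < 1) sequentially" by (intro order_tendstoD(2)) auto
  then have X: "eventually (\<lambda>N. X N \<in> sets (\<Omega>a N) \<and> X N \<subseteq> good N \<delta> \<and> measure (\<Omega>a N) (space (\<Omega>a N) - X N) \<le> bound N) sequentially"
    using ev_small
  proof eventually_elim
    case (elim N)
    then have "\<exists>X. X \<in> sets (\<Omega>a N) \<and> X \<subseteq> good N \<delta> \<and> measure (\<Omega>a N) (space (\<Omega>a N) - X) \<le> bound N"
      using good_finite[of N \<delta>] \<delta> unfolding bound_def by auto
    then show ?case unfolding X_def by (rule someI_ex)
  qed
  define g where "g = \<delta>\<^sup>2 / 8 * (\<omega> / 2)\<^sup>2"
  have g: "0 < g" using \<delta> \<omega> by (simp add: g_def)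
  have vN: "eventually (\<lambda>N. \<omega> / 2 < v N / real N) sequentially" using \<omega> by (intro order_tendstoD(1)[OF v_over_N]) simp
  have "(\<lambda>N. measure (\<Omega>a N) (space (\<Omega>a N) - X N)) \<longlonglongrightarrow> 0"
  proof (rule tendsto_sandwich[OF _ _ tendsto_const exp_b_sq_lim[OF _ g]])
    show "eventually (\<lambda>N. measure (\<Omega>a N) (space (\<Omega>a N) - X N) \<le> (4 * real N + 1) * exp (- (g * (b N)\<^sup>2))) sequentially"
      using X vN
    proof eventually_elim
      case (elim N)
      have "(\<omega> / 2)\<^sup>2 \<le> (v N / real N)\<^sup>2" using elim \<omega> by (intro power_mono) auto
      then have "g * (b N)\<^sup>2 \<le> \<delta>\<^sup>2 / 8 * (v N / real N)\<^sup>2 * (b N)\<^sup>2"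
        unfolding g_def by (intro mult_right_mono mult_left_mono) auto
      then have "bound N \<le> 4 * real N * exp (- (g * (b N)\<^sup>2))"
        unfolding bound_def by (intro mult_left_mono) auto
      also have "\<dots> \<le> (4 * real N + 1) * exp (- (g * (b N)\<^sup>2))" by (intro mult_right_mono) auto
      finally show ?case using elim by simp
    qed
  qed simp_all
  then show ?thesis using X by (intro that[of X]) (auto elim: eventually_mono)
qed

end

section \<open>The power of the linear-rank test\<close>

text \<open>Indices outside \<open>J\<close> may be dropped if one index of \<open>J\<close> beats them all.\<close>

lemma Max_image_restrict:
  fixes f :: "'a \<Rightarrow> real"
  assumes "finite I" "J \<subseteq> I" "j \<in> J" and le: "\<And>i. i \<in> I - J \<Longrightarrow> f i \<le> f j"
  shows "(MAX i\<in>I. f i) = (MAX i\<in>J. f i)"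
proof (rule Max_eqI)
  have J: "finite J" by (rule finite_subset[OF assms(2,1)])
  show "finite (f ` I)" using assms(1) by simp
  have "(MAX i\<in>J. f i) \<in> f ` J" using J assms(3) by (intro Max_in) auto
  then show "(MAX i\<in>J. f i) \<in> f ` I" using assms(2) by blast
  have up: "f i \<le> (MAX i\<in>J. f i)" if "i \<in> J" for i using J that by (intro Max_ge) auto
  show "y \<le> (MAX i\<in>J. f i)" if y: "y \<in> f ` I" for y
  proof -
    obtain i where i: "i \<in> I" "y = f i" using y by blast
    show ?thesis
    proof (cases "i \<in> J")
      case True
      then show ?thesis using up i by simp
    next
      case False
      then show ?thesis using le[of i] up[OF assms(3)] i by simp
    qed
  qed
qed

lemma (in two_samples) total_count_measurable:
  "(\<lambda>z. real (card {i. i < a + b \<and> z i \<le> t})) \<in> borel_measurable \<Omega>"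
proof -
  have "(\<lambda>z. 1 * real (count_x z {..t}) + 1 * real (count_y z {..t})) \<in> borel_measurable \<Omega>"
    by (rule measurable_weighted_count) simp_all
  moreover have "1 * real (count_x z {..t}) + 1 * real (count_y z {..t}) = real (card {i. i < a + b \<and> z i \<le> t})" for z
    unfolding count_add[symmetric] by simp
  ultimately show ?thesis by (simp only:)
qed

context efficiency_setting
begin

lemma \<Omega>a_prob: "2 \<le> N \<Longrightarrow> 0 < m N \<Longrightarrow> 0 < n N \<Longrightarrow> prob_space (\<Omega>a N)"
proof -
  assume N: "2 \<le> N" "0 < m N" "0 < n N"
  interpret TS: two_samples "m N" "n N" "Pa N" "Qa N" by (rule alt_two_samples[OF N])
  show ?thesis unfolding \<Omega>a_def TS.pooled_law_eq by (rule TS.P.prob_space_axioms)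
qed

lemma Tp_event: "2 \<le> N \<Longrightarrow> 0 < m N \<Longrightarrow> 0 < n N \<Longrightarrow> {z \<in> space (\<Omega>a N). Tp N z > w} \<in> sets (\<Omega>a N)"
proof -
  assume N: "2 \<le> N" "0 < m N" "0 < n N"
  interpret TS: two_samples "m N" "n N" "Pa N" "Qa N" by (rule alt_two_samples[OF N])
  show ?thesis unfolding \<Omega>a_def Tp_def TS.pooled_law_eq by (rule TS.T_event)
qed

lemma exceed_T:
  "2 \<le> N \<Longrightarrow> exceed_prob m n T_sts N (Pa N) (Qa N) w = measure (\<Omega>a N) {z \<in> space (\<Omega>a N). Tp N z > w}"
  unfolding \<Omega>a_def Tp_def by (rule exceed_prob_T[OF alt_law(1,2)])

lemma good_Max:
  assumes N: "2 \<le> N" and mn: "0 < m N" "0 < n N" and z: "z \<in> good N \<delta>"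
  shows "Tp N z = (MAX j\<in>{1..\<Delta> N}. Tj N j z)"
proof -
  have inj: "inj_on z {..<m N + n N}" using z size[of N] N by (simp add: good_def)
  show ?thesis unfolding Tp_def Tj_def by (rule T_stat_eq_Max[OF mn p_bounds(1)[OF N] inj])
qed

text \<open>On the good event every level stays below \<open>b (Amax r + \<epsilon> / 2)\<close>, and \<open>r \<longlongrightarrow> 1\<close>.\<close>

lemma T_small:
  assumes \<epsilon>: "0 < \<epsilon>"
  shows "(\<lambda>N. exceed_prob m n T_sts N (Pa N) (Qa N) ((Amax + \<epsilon>) * b N)) \<longlonglongrightarrow> 0"
proof -
  have "0 < \<epsilon> / 2" using \<epsilon> by simp
  then obtain X where X: "eventually (\<lambda>N. X N \<in> sets (\<Omega>a N) \<and> X N \<subseteq> good N (\<epsilon> / 2)) sequentially"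
    "(\<lambda>N. measure (\<Omega>a N) (space (\<Omega>a N) - X N)) \<longlonglongrightarrow> 0" by (rule good_limit)
  have "(\<lambda>N. Amax * r N) \<longlonglongrightarrow> Amax * 1" by (intro tendsto_intros r_lim)
  then have ev: "eventually (\<lambda>N. Amax * r N < Amax + \<epsilon> / 2) sequentially"
    by (rule order_tendstoD(2)) (use \<epsilon> in simp)
  show ?thesis
  proof (rule tendsto_sandwich[OF _ _ tendsto_const X(2)])
    show "eventually (\<lambda>N. 0 \<le> exceed_prob m n T_sts N (Pa N) (Qa N) ((Amax + \<epsilon>) * b N)) sequentially"
      by (simp add: exceed_prob_def)
    show "eventually (\<lambda>N. exceed_prob m n T_sts N (Pa N) (Qa N) ((Amax + \<epsilon>) * b N)
        \<le> measure (\<Omega>a N) (space (\<Omega>a N) - X N)) sequentially"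
      using X(1) ev ev_small
    proof eventually_elim
      case (elim N)
      then have N: "2 \<le> N" "0 < m N" "0 < n N" by auto
      interpret prob_space "\<Omega>a N" by (rule \<Omega>a_prob[OF N])
      have le: "Tp N z \<le> (Amax + \<epsilon>) * b N" if z: "z \<in> X N" for z
      proof -
        have g: "z \<in> good N (\<epsilon> / 2)" using elim z by blast
        have "Tj N j z \<le> (Amax + \<epsilon>) * b N" if j: "j \<in> {1..\<Delta> N}" for j
        proof -
          have "\<bar>Tj N j z - b N * B N j\<bar> < \<epsilon> / 2 * b N" using g j by (simp add: good_def)
          moreover have "B N j \<le> Amax * r N" by (rule center(3)[OF N j]) (use elim in auto)
          then have "b N * B N j \<le> b N * (Amax + \<epsilon> / 2)" using elim by (intro mult_left_mono) auto
          ultimately have "Tj N j z \<le> b N * (Amax + \<epsilon> / 2) + \<epsilon> / 2 * b N" by linarith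
          then show ?thesis by (simp add: algebra_simps)
        qed
        then show ?thesis unfolding good_Max[OF N g] using \<Delta>[OF N(1)] by (intro Max.boundedI) auto
      qed
      then have "{z \<in> space (\<Omega>a N). Tp N z > (Amax + \<epsilon>) * b N} \<subseteq> space (\<Omega>a N) - X N"
        by (force simp: not_le[symmetric])
      then show ?case unfolding exceed_T[OF N(1)]
        by (rule finite_measure_mono) (use elim in blast)
    qed
  qed
qed

text \<open>One level near the maximiser of \<open>A_star\<close> suffices.\<close>

lemma T_large:
  assumes \<epsilon>: "0 < \<epsilon>"
  shows "(\<lambda>N. exceed_prob m n T_sts N (Pa N) (Qa N) ((Amax - \<epsilon>) * b N)) \<longlonglongrightarrow> 1"
proof -
  have "0 < \<epsilon> / 2" using \<epsilon> by simp
  then obtain X where X: "eventually (\<lambda>N. X N \<in> sets (\<Omega>a N) \<and> X N \<subseteq> good N (\<epsilon> / 2)) sequentially"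
    "(\<lambda>N. measure (\<Omega>a N) (space (\<Omega>a N) - X N)) \<longlonglongrightarrow> 0" by (rule good_limit)
  obtain j where j: "eventually (\<lambda>N. j N \<in> {1..\<Delta> N}) sequentially" "(\<lambda>N. p N (j N)) \<longlonglongrightarrow> J zA"
    by (rule levels_dense[OF zA(1,2)])
  have ev: "eventually (\<lambda>N. Amax - \<epsilon> / 2 < B N (j N)) sequentially"
    by (rule order_tendstoD(1)[OF center_tendsto[OF j]]) (use \<epsilon> in simp)
  have lim: "(\<lambda>N. 1 - measure (\<Omega>a N) (space (\<Omega>a N) - X N)) \<longlonglongrightarrow> 1"
    using tendsto_diff[OF tendsto_const[of 1] X(2)] by simp
  show ?thesis
  proof (rule tendsto_sandwich[OF _ _ lim tendsto_const])
    show "eventually (\<lambda>N. exceed_prob m n T_sts N (Pa N) (Qa N) ((Amax - \<epsilon>) * b N) \<le> 1) sequentially"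
      using ev2 by eventually_elim (intro exceed_prob_le_1 alt_law)
    show "eventually (\<lambda>N. 1 - measure (\<Omega>a N) (space (\<Omega>a N) - X N)
        \<le> exceed_prob m n T_sts N (Pa N) (Qa N) ((Amax - \<epsilon>) * b N)) sequentially"
      using X(1) ev ev_small j(1)
    proof eventually_elim
      case (elim N)
      then have N: "2 \<le> N" "0 < m N" "0 < n N" by auto
      interpret prob_space "\<Omega>a N" by (rule \<Omega>a_prob[OF N])
      have "(Amax - \<epsilon>) * b N < Tp N z" if z: "z \<in> X N" for z
      proof -
        have g: "z \<in> good N (\<epsilon> / 2)" using elim z by blast
        have "\<bar>Tj N (j N) z - b N * B N (j N)\<bar> < \<epsilon> / 2 * b N" using g elim by (simp add: good_def)
        moreover have "b N * (Amax - \<epsilon> / 2) \<le> b N * B N (j N)" using elim by (intro mult_left_mono) auto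
        ultimately have "b N * (Amax - \<epsilon> / 2) - \<epsilon> / 2 * b N < Tj N (j N) z" by linarith
        also have "\<dots> \<le> Tp N z" unfolding good_Max[OF N g] using elim by (intro Max_ge) auto
        finally show ?thesis by (simp add: algebra_simps)
      qed
      moreover have Xs: "X N \<in> sets (\<Omega>a N)" using elim by simp
      ultimately have "X N \<subseteq> {z \<in> space (\<Omega>a N). Tp N z > (Amax - \<epsilon>) * b N}"
        using sets.sets_into_space[OF Xs] by auto
      then have "prob (X N) \<le> prob {z \<in> space (\<Omega>a N). Tp N z > (Amax - \<epsilon>) * b N}"
        by (rule finite_measure_mono) (rule Tp_event[OF N])
      then show ?case unfolding exceed_T[OF N(1)] prob_compl[OF Xs] by simp
    qed
  qed
qed

text \<open>Near the extreme levels the statistics stay well below the maximum, so on the good event \<open>T\<close> is a maximum over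
  middle levels, where \<open>T_atom_le\<close> applies: two points \<open>s\<close> and \<open>t\<close> with \<open>J s\<close> and \<open>1 - J t\<close> small but fixed enclose all
  of them.\<close>

lemma T_atoms:
  obtains \<gamma> where "0 < \<gamma>"
    "eventually (\<lambda>N. \<forall>w. measure (\<Omega>a N) {z \<in> space (\<Omega>a N). Tp N z = w} \<le> 1 - 2 * \<gamma>) sequentially"
proof -
  \<comment> \<open>Levels with variance below \<open>\<tau>\<close> have centres at most \<open>Amax / 4\<close> by the last bound of \<open>center\<close>, since \<open>r\<^sup>2 < 2\<close>.\<close>
  define \<tau> where "\<tau> = (c * Amax / 16)\<^sup>2"
  have cA: "0 < c * Amax" using c Amax_pos by simp
  have \<tau>0: "0 < \<tau>" unfolding \<tau>_def by (rule zero_less_power) (use cA in simp)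
  have cA1: "c * Amax \<le> 1"
  proof -
    have s: "sqrt (J zA * (1 - J zA)) \<le> 1 / 2" using sqrt_variance_le[OF zA(1,2)] by blast
    have "Amax \<le> 2 / c * sqrt (J zA * (1 - J zA))" using A_le[of zA] by (simp add: Amax_def)
    also have "\<dots> \<le> 2 / c * (1 / 2)" using c s by (intro mult_left_mono) auto
    finally show ?thesis using c by (simp add: field_simps)
  qed
  have \<tau>1: "\<tau> < 1"
  proof -
    have "(c * Amax / 16)\<^sup>2 \<le> (1 / 16)\<^sup>2" using cA cA1 by (intro power_mono) auto
    then show ?thesis by (simp add: \<tau>_def power2_eq_square)
  qed
  have "0 < \<tau> / 4" "\<tau> / 4 < 1" using \<tau>0 \<tau>1 by auto
  then obtain s where s: "J s = \<tau> / 4" by (rule continuous_df_surj[OF J_df])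
  have "0 < 1 - \<tau> / 4" "1 - \<tau> / 4 < 1" using \<tau>0 \<tau>1 by auto
  then obtain t where t: "J t = 1 - \<tau> / 4" by (rule continuous_df_surj[OF J_df])
  note st = s t
  have s_le_t: "s \<le> t"
  proof (rule ccontr)
    assume "\<not> s \<le> t"
    then have "J t \<le> J s" by (intro mono(3)) simp
    then show False using \<tau>1 by (simp add: st)
  qed
  have "0 < Amax / 8" using Amax_pos by simp
  then obtain X where X: "eventually (\<lambda>N. X N \<in> sets (\<Omega>a N) \<and> X N \<subseteq> good N (Amax / 8)) sequentially"
    "(\<lambda>N. measure (\<Omega>a N) (space (\<Omega>a N) - X N)) \<longlonglongrightarrow> 0" by (rule good_limit)
  obtain j where j: "eventually (\<lambda>N. j N \<in> {1..\<Delta> N}) sequentially" "(\<lambda>N. p N (j N)) \<longlonglongrightarrow> J zA"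
    by (rule levels_dense[OF zA(1,2)])
  have Bj: "eventually (\<lambda>N. 7 / 8 * Amax < B N (j N)) sequentially"
    by (rule order_tendstoD(1)[OF center_tendsto[OF j]]) (use Amax_pos in simp)
  have "(\<lambda>N. (r N)\<^sup>2) \<longlonglongrightarrow> 1\<^sup>2" by (intro tendsto_intros r_lim)
  then have r2: "eventually (\<lambda>N. (r N)\<^sup>2 < 2) sequentially" by (rule order_tendstoD(2)) simp
  have X1: "eventually (\<lambda>N. measure (\<Omega>a N) (space (\<Omega>a N) - X N) < \<tau>\<^sup>2 / 512) sequentially"
    by (rule order_tendstoD(2)[OF X(2)]) (use \<tau>0 in simp)
  have \<theta>s: "eventually (\<lambda>N. \<theta> N < \<tau> / 12) sequentially"
    by (rule order_tendstoD(2)[OF \<theta>_lim]) (use \<tau>0 in simp)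
  have tail: "(\<lambda>N. 2 * exp (- 2 * (\<tau> / 6)\<^sup>2 * real N)) \<longlonglongrightarrow> 0"
    using \<tau>0 by real_asymp
  have tails: "eventually (\<lambda>N. 2 * exp (- 2 * (\<tau> / 6)\<^sup>2 * real N) < \<tau>\<^sup>2 / 512) sequentially"
    by (rule order_tendstoD(2)[OF tail]) (use \<tau>0 in simp)
  have large: "eventually (\<lambda>N. 6 / \<tau> < real N) sequentially"
    using filterlim_real_sequentially unfolding filterlim_at_top_dense by blast
  have "eventually (\<lambda>N. \<forall>w. measure (\<Omega>a N) {z \<in> space (\<Omega>a N). Tp N z = w} \<le> 1 - 2 * (\<tau>\<^sup>2 / 256)) sequentially"
    using X(1) X1 Bj r2 \<theta>s tails large j(1) ev_small
  proof eventually_elim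
    case (elim N)
    then have N: "2 \<le> N" "0 < m N" "0 < n N" by auto
    interpret TS: two_samples "m N" "n N" "Pa N" "Qa N" by (rule alt_two_samples[OF N])
    have \<Omega>: "\<Omega>a N = TS.\<Omega>" by (simp add: \<Omega>a_def TS.pooled_law_eq)
    have sz: "m N + n N = N" using size N by simp
    have szr: "real (m N) + real (n N) = real N" using sz by (metis of_nat_add)
    have N\<tau>: "6 < real N * \<tau>" using elim \<tau>0 by (simp add: divide_less_eq)
    define I where "I = {i \<in> {1..\<Delta> N}. c * Amax / 16 \<le> \<rho> N i}"
    have outside: "B N i \<le> Amax / 4" if i: "i \<in> {1..\<Delta> N}" "i \<notin> I" for i
    proof -
      have "\<rho> N i \<le> c * Amax / 16" using i by (simp add: I_def)
      then have "2 / c * \<rho> N i \<le> 2 / c * (c * Amax / 16)" using c by (intro mult_left_mono) auto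
      then have le: "2 / c * \<rho> N i \<le> Amax / 8" using c by simp
      have "B N i \<le> 2 / c * \<rho> N i * (r N)\<^sup>2" by (rule center(4)[OF N i(1)]) (use elim in auto)
      also have "\<dots> \<le> Amax / 8 * 2" by (rule mult_mono[OF le]) (use elim Amax_pos in auto)
      finally show ?thesis by simp
    qed
    have jI: "j N \<in> I"
    proof (rule ccontr)
      assume "j N \<notin> I"
      then have "B N (j N) \<le> Amax / 4" using elim by (intro outside) auto
      then show False using elim Amax_pos by simp
    qed
    have middle: "T_stat (m N) (n N) (\<Delta> N) (p N) (split_at (m N) z) = (MAX i\<in>I. T_of_counts (m N) (n N) (p N i) z)"
      if z: "z \<in> X N" for z
    proof -
      have g: "z \<in> good N (Amax / 8)" using elim z by blast
      have near: "\<bar>Tj N i z - b N * B N i\<bar> < Amax / 8 * b N" if "i \<in> {1..\<Delta> N}" for i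
        using g that by (simp add: good_def)
      have "Tj N i z \<le> Tj N (j N) z" if i: "i \<in> {1..\<Delta> N} - I" for i
      proof -
        have "b N * B N i \<le> b N * (Amax / 4)" "b N * (7 / 8 * Amax) \<le> b N * B N (j N)"
          using outside[of i] i elim by (intro mult_left_mono; simp)+
        moreover have "\<bar>Tj N i z - b N * B N i\<bar> < Amax / 8 * b N" "\<bar>Tj N (j N) z - b N * B N (j N)\<bar> < Amax / 8 * b N"
          using near i elim by auto
        moreover have "0 \<le> b N * Amax" using elim Amax_pos by simp
        moreover have "b N * (Amax / 4) = (b N * Amax) / 4" "b N * (7 / 8 * Amax) = 7 / 8 * (b N * Amax)"
          "Amax / 8 * b N = (b N * Amax) / 8" by simp_all
        ultimately show ?thesis by linarith
      qed
      then have "(MAX i\<in>{1..\<Delta> N}. Tj N i z) = (MAX i\<in>I. Tj N i z)"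
        by (intro Max_image_restrict[OF _ _ jI]) (auto simp: I_def)
      then show ?thesis using good_Max[OF N g] by (simp add: Tp_def Tj_def)
    qed
    have pI: "0 < p N i \<and> p N i < 1" "\<tau> \<le> p N i" "\<tau> \<le> 1 - p N i" if i: "i \<in> I" for i
    proof -
      have i1: "i \<in> {1..\<Delta> N}" "c * Amax / 16 \<le> \<rho> N i" using i by (auto simp: I_def)
      show p: "0 < p N i \<and> p N i < 1" by (rule p_bounds(1)[OF N(1) i1(1)])
      have "\<tau> \<le> (\<rho> N i)\<^sup>2" unfolding \<tau>_def using cA i1(2) by (intro power_mono) auto
      then have le: "\<tau> \<le> p N i * (1 - p N i)" using \<rho>_bounds(2)[OF N(1) i1(1)] by simp
      moreover have "p N i * (1 - p N i) \<le> p N i" "p N i * (1 - p N i) \<le> 1 - p N i"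
        using p by (auto simp: mult_left_le mult_left_le_one_le)
      ultimately show "\<tau> \<le> p N i" "\<tau> \<le> 1 - p N i" by auto
    qed
    define R1 where "R1 = {z \<in> space TS.\<Omega>. real (card {i. i < m N + n N \<and> z i \<le> s}) \<ge> real (m N + n N) * (\<tau> / 2)}"
    define R2 where "R2 = {z \<in> space TS.\<Omega>. real (card {i. i < m N + n N \<and> z i \<le> t}) \<le> real (m N + n N) * (1 - \<tau> / 2)}"
    have R12: "R1 \<in> sets TS.\<Omega>" "R2 \<in> sets TS.\<Omega>"
      unfolding R1_def R2_def
      by (rule borel_measurable_le[OF borel_measurable_const TS.total_count_measurable],
          rule borel_measurable_le[OF TS.total_count_measurable borel_measurable_const])
    define R where "R = space TS.\<Omega> - (R1 \<union> R2)"
    have R: "R \<in> sets TS.\<Omega>" unfolding R_def using R12 by blast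
    have rest: "card {i. i < m N + n N \<and> z i \<le> s} < level (m N + n N) (p N i)
        \<and> level (m N + n N) (p N i) + 2 \<le> card {i. i < m N + n N \<and> z i \<le> t}" if z: "z \<in> R" and i: "i \<in> I" for z i
    proof -
      have lev: "\<bar>real (level (m N + n N) (p N i)) - real N * p N i\<bar> \<le> 1 / 2"
        using level_bounds(1)[of "p N i" "m N + n N"] pI(1)[OF i] by (simp add: sz)
      have f1: "real N * \<tau> \<le> real N * p N i" using pI(2)[OF i] by (intro mult_left_mono) auto
      have "real N * \<tau> \<le> real N * (1 - p N i)" using pI(3)[OF i] by (intro mult_left_mono) auto
      then have f2: "real N * \<tau> \<le> real N - real N * p N i" by (simp add: right_diff_distrib)
      have l: "real N * \<tau> - 1 / 2 \<le> real (level (m N + n N) (p N i))"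
          "real (level (m N + n N) (p N i)) \<le> real N - real N * \<tau> + 1 / 2"
        using lev f1 f2 by linarith+
      have e: "real N * (\<tau> / 2) = (real N * \<tau>) / 2" "real N * (1 - \<tau> / 2) = real N - (real N * \<tau>) / 2"
        by (simp_all add: right_diff_distrib)
      have "real (card {i. i < m N + n N \<and> z i \<le> s}) < real N * (\<tau> / 2)"
        "real N * (1 - \<tau> / 2) < real (card {i. i < m N + n N \<and> z i \<le> t})"
        using z by (auto simp: R_def R1_def R2_def sz not_le)
      then have "real (card {i. i < m N + n N \<and> z i \<le> s}) < real (level (m N + n N) (p N i))"
        "real (level (m N + n N) (p N i)) + 2 \<le> real (card {i. i < m N + n N \<and> z i \<le> t})"
        using l N\<tau> e by linarith+
      then show ?thesis by linarith
    qed
    have H: "real (m N) * cdf (Pa N) x + real (n N) * cdf (Qa N) x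
        = real (m N + n N) * (J x + \<theta> N * (\<eta> - real (m N) / real N) * D x)" for x
      using alt_mixture[OF N(1), of x] by (simp add: sz)
    have shift: "\<bar>\<theta> N * (\<eta> - real (m N) / real N) * D x\<bar> \<le> \<tau> / 12" for x
    proof -
      have "0 \<le> real (m N) / real N" "real (m N) / real N \<le> 1" using szr N by (auto simp: divide_le_eq)
      then have "\<bar>\<eta> - real (m N) / real N\<bar> \<le> 1" using \<eta> by linarith
      then have "\<bar>\<eta> - real (m N) / real N\<bar> * \<bar>D x\<bar> \<le> 1" using abs_D_le_1[of x] by (intro mult_le_one) auto
      then have "\<theta> N * (\<bar>\<eta> - real (m N) / real N\<bar> * \<bar>D x\<bar>) \<le> \<theta> N"
        using \<theta>01[OF N(1)] by (intro mult_left_le) auto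
      also have "\<theta> N \<le> \<tau> / 12" using elim by (blast intro: less_imp_le)
      finally have "\<theta> N * (\<bar>\<eta> - real (m N) / real N\<bar> * \<bar>D x\<bar>) \<le> \<tau> / 12" .
      moreover have "\<bar>\<theta> N * (\<eta> - real (m N) / real N) * D x\<bar> = \<theta> N * (\<bar>\<eta> - real (m N) / real N\<bar> * \<bar>D x\<bar>)"
        using \<theta>01[OF N(1)] by (simp add: abs_mult)
      ultimately show ?thesis by (simp only:)
    qed
    have h0: "0 \<le> \<tau> / 6" using \<tau>0 by simp
    have Hs: "J s + \<theta> N * (\<eta> - real (m N) / real N) * D s \<le> \<tau> / 2 - \<tau> / 6"
    proof -
      have "\<tau> / 4 + \<theta> N * (\<eta> - real (m N) / real N) * D s \<le> \<tau> / 4 + \<tau> / 12"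
        using abs_le_D1[OF shift[of s]] by (rule add_left_mono)
      also have "\<tau> / 4 + \<tau> / 12 = \<tau> / 2 - \<tau> / 6" by (simp add: field_simps)
      finally show ?thesis unfolding st .
    qed
    have Ht: "1 - \<tau> / 2 + \<tau> / 6 \<le> J t + \<theta> N * (\<eta> - real (m N) / real N) * D t"
    proof -
      have "- (\<tau> / 12) \<le> \<theta> N * (\<eta> - real (m N) / real N) * D t"
        using abs_le_D2[OF shift[of t]] by (simp only: minus_le_iff)
      then have "1 - \<tau> / 4 + - (\<tau> / 12) \<le> 1 - \<tau> / 4 + \<theta> N * (\<eta> - real (m N) / real N) * D t"
        by (rule add_left_mono)
      moreover have "1 - \<tau> / 4 + - (\<tau> / 12) = 1 - \<tau> / 2 + \<tau> / 6" by (simp add: field_simps)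
      ultimately show ?thesis unfolding st by (simp only:)
    qed
    have P1: "measure TS.\<Omega> R1 \<le> exp (- 2 * (\<tau> / 6)\<^sup>2 * real (m N + n N))"
      unfolding R1_def by (rule TS.total_count_tails(1)[OF H h0 Hs])
    have P2: "measure TS.\<Omega> R2 \<le> exp (- 2 * (\<tau> / 6)\<^sup>2 * real (m N + n N))"
      unfolding R2_def by (rule TS.total_count_tails(2)[OF H h0 Ht])
    have "space TS.\<Omega> - R = R1 \<union> R2" by (auto simp: R_def R1_def R2_def)
    then have PR: "measure TS.\<Omega> (space TS.\<Omega> - R) \<le> \<tau>\<^sup>2 / 512"
      using measure_Un_le[OF R12] P1 P2 elim by (simp add: sz)
    have \<theta>h: "1 / 2 \<le> 1 - \<theta> N" "0 \<le> \<theta> N" using elim \<tau>1 \<theta>01[OF N(1)] by auto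
    have low: "\<tau> / 8 \<le> (1 - \<theta> N) * (\<tau> / 4) + \<theta> N * x" if "0 \<le> x" for x
    proof -
      have "1 / 2 * (\<tau> / 4) \<le> (1 - \<theta> N) * (\<tau> / 4)" using \<theta>h \<tau>0 by (intro mult_right_mono) auto
      moreover have "0 \<le> \<theta> N * x" using \<theta>h that by simp
      moreover have "1 / 2 * (\<tau> / 4) = \<tau> / 8" by simp
      ultimately show ?thesis by linarith
    qed
    have cdfs: "\<tau> / 8 \<le> cdf (Pa N) s" "\<tau> / 8 \<le> cdf (Qa N) s" "\<tau> / 8 \<le> 1 - cdf (Pa N) t" "\<tau> / 8 \<le> 1 - cdf (Qa N) t"
    proof -
      show "\<tau> / 8 \<le> cdf (Pa N) s" "\<tau> / 8 \<le> cdf (Qa N) s"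
        using low[of "F s"] low[of "G s"] F01 G01 by (simp_all add: alt_law[OF N(1)] st)
      have "1 - ((1 - \<theta> N) * (1 - \<tau> / 4) + \<theta> N * x) = (1 - \<theta> N) * (\<tau> / 4) + \<theta> N * (1 - x)" for x
        by (simp add: algebra_simps)
      then show "\<tau> / 8 \<le> 1 - cdf (Pa N) t" "\<tau> / 8 \<le> 1 - cdf (Qa N) t"
        using low[of "1 - F t"] low[of "1 - G t"] F01 G01 by (simp_all only: alt_law[OF N(1)] st) auto
    qed
    have prods: "\<tau>\<^sup>2 / 64 \<le> cdf (Pa N) s * (1 - cdf (Qa N) t)" "\<tau>\<^sup>2 / 64 \<le> (1 - cdf (Pa N) t) * cdf (Qa N) s"
      using mult_mono[OF cdfs(1,4)] mult_mono[OF cdfs(3,2)] \<tau>0 cdfs by (simp_all add: power2_eq_square)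
    have atom: "\<P>(z in TS.\<Omega>. T_stat (m N) (n N) (\<Delta> N) (p N) (split_at (m N) z) = w)
        \<le> 1 - min (cdf (Pa N) s * (1 - cdf (Qa N) t)) ((1 - cdf (Pa N) t) * cdf (Qa N) s)
          + measure TS.\<Omega> (space TS.\<Omega> - X N) + measure TS.\<Omega> (space TS.\<Omega> - R)" for w
      by (rule TS.T_atom_le[where J=I and d="\<Delta> N" and p="p N" and s=s and t=t, OF s_le_t _ _ pI(1) _ middle R rest]) (use jI elim \<Omega> in \<open>auto simp: I_def\<close>)
    show ?case
    proof
      fix w
      have "measure TS.\<Omega> (space TS.\<Omega> - X N) \<le> \<tau>\<^sup>2 / 512" using elim by (simp add: \<Omega>)
      then show "measure (\<Omega>a N) {z \<in> space (\<Omega>a N). Tp N z = w} \<le> 1 - 2 * (\<tau>\<^sup>2 / 256)"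
        using atom[of w] min.boundedI[OF prods] PR zero_le_power2[of \<tau>] unfolding \<Omega> Tp_def by linarith
    qed
  qed
  then show ?thesis by (rule that[rotated]) (use \<tau>0 in simp)
qed

end

section \<open>The sample size needed by the Kolmogorov-Smirnov test\<close>

context efficiency_setting
begin

lemma T_exceed_antimono:
  assumes N: "2 \<le> N" and w: "w \<le> w'"
  shows "exceed_prob m n T_sts N (Pa N) (Qa N) w' \<le> exceed_prob m n T_sts N (Pa N) (Qa N) w"
proof -
  obtain B where "regular_statistic m n T_sts N B" by (rule T_regular)
  then interpret regular_statistic m n T_sts N B .
  show ?thesis by (rule exceed_prob_antimono[OF alt_law(1,2)[OF N] w])
qed

lemma power_bounded_below:
  assumes \<alpha>: "\<alpha> \<in> levels_star m n T_sts Pa Qa"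
  obtains x where "0 < x" "eventually (\<lambda>N. x < test_power m n T_sts N (\<alpha> N) (Pa N) (Qa N)) sequentially"
proof -
  have inf: "0 < liminf (\<lambda>N. ereal (test_power m n T_sts N (\<alpha> N) (Pa N) (Qa N)))"
    using \<alpha> by (simp add: levels_star_def)
  obtain x where x: "0 < ereal x" "ereal x < liminf (\<lambda>N. ereal (test_power m n T_sts N (\<alpha> N) (Pa N) (Qa N)))"
    using ereal_dense2[OF inf] by blast
  show ?thesis using that[of x] x(1) less_LiminfD[OF x(2)] by simp
qed

lemma power_bounded_above:
  assumes \<alpha>: "\<alpha> \<in> levels_star m n T_sts Pa Qa"
  obtains y where "y < 1" "eventually (\<lambda>N. test_power m n T_sts N (\<alpha> N) (Pa N) (Qa N) < y) sequentially"
proof -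
  have sup: "limsup (\<lambda>N. ereal (test_power m n T_sts N (\<alpha> N) (Pa N) (Qa N))) < 1"
    using \<alpha> by (simp add: levels_star_def)
  obtain y where y: "limsup (\<lambda>N. ereal (test_power m n T_sts N (\<alpha> N) (Pa N) (Qa N))) < ereal y" "ereal y < 1"
    using ereal_dense2[OF sup] by blast
  show ?thesis using that[of y] y(2) Limsup_lessD[OF y(1)] by simp
qed

lemma level_01: "\<alpha> \<in> levels_star m n U P Q \<Longrightarrow> 0 < \<alpha> N \<and> \<alpha> N < 1"
  by (simp add: levels_star_def levels_def)

text \<open>Power bounded away from \<open>0\<close> forces the critical value below \<open>(Amax + \<epsilon>) b\<close>, where the null tail is still
  at least \<open>exp (- l\<^sup>2 b\<^sup>2 / 2)\<close>.\<close>

lemma level_lower: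
  assumes \<alpha>: "\<alpha> \<in> levels_star m n T_sts Pa Qa" and l: "Amax < l"
  shows "eventually (\<lambda>N. exp (- (l\<^sup>2 / 2 * (b N)\<^sup>2)) \<le> \<alpha> N) sequentially"
proof -
  define \<epsilon> where "\<epsilon> = (l - Amax) / 2"
  define \<kappa> where "\<kappa> = Amax + \<epsilon>"
  \<comment> \<open>Chosen such that \<open>(1 / 2 + \<delta>) \<kappa>\<^sup>2 = l\<^sup>2 / 2\<close>.\<close>
  define \<delta> where "\<delta> = (l\<^sup>2 / \<kappa>\<^sup>2 - 1) / 2"
  have \<epsilon>: "0 < \<epsilon>" using l by (simp add: \<epsilon>_def)
  have "2 * \<kappa> = Amax + l" by (simp add: \<kappa>_def \<epsilon>_def field_simps)
  then have \<kappa>: "0 < \<kappa>" "\<kappa> < l" using l Amax_pos by linarith+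
  have "\<kappa>\<^sup>2 < l\<^sup>2" using \<kappa> by (intro power_strict_mono) auto
  then have \<delta>: "0 < \<delta>" using \<kappa> by (simp add: \<delta>_def)
  obtain x where xy: "0 < x" "eventually (\<lambda>N. x < test_power m n T_sts N (\<alpha> N) (Pa N) (Qa N)) sequentially"
    by (rule power_bounded_below[OF \<alpha>])
  have small: "eventually (\<lambda>N. exceed_prob m n T_sts N (Pa N) (Qa N) (\<kappa> * b N) < x) sequentially"
    unfolding \<kappa>_def by (rule order_tendstoD(2)[OF T_small[OF \<epsilon>] xy(1)])
  show ?thesis using xy(2) small null_T_lower[OF \<kappa>(1) \<delta>] ev2
  proof eventually_elim
    case (elim N)
    obtain B where "regular_statistic m n T_sts N B" by (rule T_regular)
    then interpret regular_statistic m n T_sts N B .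
    have "crit_value m n T_sts N (\<alpha> N) < \<kappa> * b N"
    proof (rule ccontr)
      assume "\<not> crit_value m n T_sts N (\<alpha> N) < \<kappa> * b N"
      then have "test_power m n T_sts N (\<alpha> N) (Pa N) (Qa N) \<le> exceed_prob m n T_sts N (Pa N) (Qa N) (\<kappa> * b N)"
        unfolding test_power_def using elim by (intro T_exceed_antimono) auto
      then show False using elim by linarith
    qed
    then have "null_sup m n T_sts N (\<kappa> * b N) \<le> \<alpha> N"
      using level_01[OF \<alpha>, of N] by (intro null_sup_le_if_crit_less) auto
    moreover have eq: "(1 / 2 + \<delta>) * (\<kappa> * b N)\<^sup>2 = l\<^sup>2 / 2 * (b N)\<^sup>2"
    proof -
      have "(1 / 2 + \<delta>) * \<kappa>\<^sup>2 = l\<^sup>2 / 2" using \<kappa>(1) by (simp add: \<delta>_def field_simps)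
      then show ?thesis by (metis mult.assoc power_mult_distrib)
    qed
    moreover have "exp (- (l\<^sup>2 / 2 * (b N)\<^sup>2)) \<le> null_sup m n T_sts N (\<kappa> * b N)" unfolding eq[symmetric] using elim by blast
    ultimately show ?case by linarith
  qed
qed

text \<open>Power bounded away from \<open>1\<close> forces the critical value above \<open>(Amax - \<epsilon>) b\<close>, where the null tail is
  already at most \<open>exp (- l\<^sup>2 b\<^sup>2 / 2)\<close>.\<close>

lemma level_upper:
  assumes \<alpha>: "\<alpha> \<in> levels_star m n T_sts Pa Qa" and l: "0 < l" "l < Amax"
  shows "eventually (\<lambda>N. \<alpha> N \<le> exp (- (l\<^sup>2 / 2 * (b N)\<^sup>2))) sequentially"
proof -
  define \<epsilon> where "\<epsilon> = (Amax - l) / 2"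
  define \<kappa> where "\<kappa> = Amax - \<epsilon>"
  \<comment> \<open>Chosen such that \<open>(1 / 2 - \<delta>) \<kappa>\<^sup>2 = l\<^sup>2 / 2\<close>.\<close>
  define \<delta> where "\<delta> = (1 - l\<^sup>2 / \<kappa>\<^sup>2) / 2"
  have \<epsilon>: "0 < \<epsilon>" using l by (simp add: \<epsilon>_def)
  have \<kappa>: "l < \<kappa>" by (simp add: \<kappa>_def \<epsilon>_def field_simps) (use l in linarith)
  have \<kappa>0: "0 < \<kappa>" using \<kappa> l by simp
  have "l\<^sup>2 < \<kappa>\<^sup>2" using \<kappa> l by (intro power_strict_mono) auto
  then have \<delta>: "0 < \<delta>" using \<kappa>0 by (simp add: \<delta>_def)
  obtain y where xy: "y < 1" "eventually (\<lambda>N. test_power m n T_sts N (\<alpha> N) (Pa N) (Qa N) < y) sequentially"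
    by (rule power_bounded_above[OF \<alpha>])
  have large: "eventually (\<lambda>N. y < exceed_prob m n T_sts N (Pa N) (Qa N) (\<kappa> * b N)) sequentially"
    unfolding \<kappa>_def by (rule order_tendstoD(1)[OF T_large[OF \<epsilon>] xy(1)])
  show ?thesis using xy(2) large null_T_upper[OF \<kappa>0 \<delta>] ev2
  proof eventually_elim
    case (elim N)
    obtain B where "regular_statistic m n T_sts N B" by (rule T_regular)
    then interpret regular_statistic m n T_sts N B .
    have "\<kappa> * b N < crit_value m n T_sts N (\<alpha> N)"
    proof (rule ccontr)
      assume "\<not> \<kappa> * b N < crit_value m n T_sts N (\<alpha> N)"
      then have "exceed_prob m n T_sts N (Pa N) (Qa N) (\<kappa> * b N) \<le> test_power m n T_sts N (\<alpha> N) (Pa N) (Qa N)"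
        unfolding test_power_def using elim by (intro T_exceed_antimono) auto
      then show False using elim by linarith
    qed
    then have "\<alpha> N < null_sup m n T_sts N (\<kappa> * b N)"
      using level_01[OF \<alpha>, of N] by (intro less_null_sup_if_less_crit) auto
    moreover have eq: "(1 / 2 - \<delta>) * (\<kappa> * b N)\<^sup>2 = l\<^sup>2 / 2 * (b N)\<^sup>2"
    proof -
      have "(1 / 2 - \<delta>) * \<kappa>\<^sup>2 = l\<^sup>2 / 2" using \<kappa>0 by (simp add: \<delta>_def field_simps)
      then show ?thesis by (metis mult.assoc power_mult_distrib)
    qed
    moreover have "null_sup m n T_sts N (\<kappa> * b N) \<le> exp (- (l\<^sup>2 / 2 * (b N)\<^sup>2))" unfolding eq[symmetric] using elim by blast
    ultimately show ?case by linarith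
  qed
qed

lemma alt_V_antimono:
  assumes "2 \<le> N" "0 < m S" "0 < n S" "w \<le> w'"
  shows "exceed_prob m n V_sts S (Pa N) (Qa N) w' \<le> exceed_prob m n V_sts S (Pa N) (Qa N) w"
proof -
  interpret regular_statistic m n V_sts S "sqrt (real (m S) * real (n S) / real (m S + n S))"
    by (rule V_regular) (rule assms(2,3))+
  show ?thesis by (rule exceed_prob_antimono[OF alt_law(1,2)[OF assms(1)] assms(4)])
qed

lemma alt_V_lower:
  assumes N: "2 \<le> N" and mn: "0 < m S" "0 < n S" and w: "w \<le> sqrt (v S) * (\<theta> N * Dmax)"
  shows "1 - exp (- 2 * (sqrt (v S) * (\<theta> N * Dmax) - w)\<^sup>2) \<le> exceed_prob m n V_sts S (Pa N) (Qa N) w"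
proof -
  interpret TS: two_samples "m S" "n S" "Pa N" "Qa N" by (rule alt_two_samples[OF N mn])
  have \<sigma>: "TS.\<sigma> = sqrt (v S)" by (simp add: v_def TS.\<sigma>_def)
  have d: "\<theta> N * Dmax \<le> cdf (Qa N) zD - cdf (Pa N) zD" by (simp add: alt_difference[OF N] Dmax_def)
  show ?thesis
    using TS.V_lower_tail[OF d, of w] w
    unfolding exceed_prob_V[where m=m and n=n and S=S, OF alt_law(1,2)[OF N] mn] TS.pooled_law_eq \<sigma> by simp
qed

lemma alt_V_upper:
  assumes N: "2 \<le> N" and mn: "0 < m S" "0 < n S" and S: "1 \<le> S" and w: "sqrt (v S) * (\<theta> N * Dmax) + 1 \<le> w"
  shows "exceed_prob m n V_sts S (Pa N) (Qa N) w \<le> real S * exp (- 2 * (w - sqrt (v S) * (\<theta> N * Dmax) - 1)\<^sup>2)"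
proof -
  interpret TS: two_samples "m S" "n S" "Pa N" "Qa N" by (rule alt_two_samples[OF N mn])
  have \<sigma>: "TS.\<sigma> = sqrt (v S)" by (simp add: v_def TS.\<sigma>_def)
  have d: "cdf (Qa N) z - cdf (Pa N) z \<le> \<theta> N * Dmax" for z
    unfolding alt_difference[OF N] using zD(3)[of z] \<theta>01[OF N] by (intro mult_left_mono) auto
  show ?thesis
    using TS.V_upper_tail[OF d, of w] w
    unfolding exceed_prob_V[where m=m and n=n and S=S, OF alt_law(1,2)[OF N] mn] TS.pooled_law_eq \<sigma> size[OF S] by simp
qed

lemma exp_square_lim:
  assumes y: "filterlim y at_top sequentially"
  shows "(\<lambda>N. exp (- 2 * (y N)\<^sup>2)) \<longlonglongrightarrow> (0 :: real)"
proof -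
  have f: "filterlim (\<lambda>N. 2 * (y N)\<^sup>2) at_top sequentially"
    by (intro filterlim_tendsto_pos_mult_at_top[OF tendsto_const] filterlim_pow_at_top y) auto
  have "(\<lambda>N. exp (- (2 * (y N)\<^sup>2))) \<longlonglongrightarrow> 0"
    by (rule filterlim_compose[OF exp_at_bot]) (use f in \<open>simp only: filterlim_uminus_at_top[symmetric]\<close>)
  then show ?thesis by simp
qed

text \<open>With \<open>R\<^sup>2 = (s / N) b\<^sup>2\<close> the signal of \<open>V\<close> is asymptotically \<open>R Dmax\<close>. At a slightly smaller threshold
  \<open>R d\<close> the null tail is about \<open>exp (- 2 d\<^sup>2 R\<^sup>2)\<close>, which is below the level as soon as
  \<open>2 d\<^sup>2 K > Amax\<^sup>2 / 2\<close>. The sequence \<open>s\<close> is arbitrary, possibly of larger order than \<open>N\<close>, because the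
  efficiency asks for high power at all larger sample sizes.\<close>

lemma V_power_high:
  assumes \<alpha>: "\<alpha> \<in> levels_star m n T_sts Pa Qa" and K: "0 < K" "Amax / (2 * Dmax) < sqrt K"
    and s: "eventually (\<lambda>N. K * real N \<le> real (s N)) sequentially"
  shows "eventually (\<lambda>N. test_power m n T_sts N (\<alpha> N) (Pa N) (Qa N)
    \<le> test_power m n V_sts (s N) (\<alpha> N) (Pa N) (Qa N)) sequentially"
proof -
  have sK: "0 < sqrt K" using K by simp
  have "Amax / (2 * sqrt K) < Dmax" using K(2) sK Dmax_pos by (simp add: field_simps)
  then obtain d where d: "Amax / (2 * sqrt K) < d" "d < Dmax" using dense by blast
  have d0: "0 < d" using d(1) Amax_pos sK by (auto intro: less_trans[rotated])
  have "Amax < 2 * d * sqrt K" using d(1) sK by (simp add: field_simps)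
  then obtain l where l: "Amax < l" "l < 2 * d * sqrt K" using dense by blast
  have KN: "filterlim (\<lambda>N. K * real N) at_top sequentially"
    by (rule filterlim_tendsto_pos_mult_at_top[OF tendsto_const K(1) filterlim_real_sequentially])
  have s_top: "filterlim s sequentially sequentially"
    unfolding filterlim_sequentially_iff_filterlim_real by (rule filterlim_at_top_mono[OF KN s])
  have vs: "(\<lambda>N. v (s N) / real (s N)) \<longlonglongrightarrow> \<omega>" by (rule filterlim_compose[OF v_over_N s_top])
  have ss: "eventually (\<lambda>N. 0 < m (s N) \<and> 0 < n (s N)) sequentially" "eventually (\<lambda>N. 2 \<le> s N) sequentially"
    by (rule eventually_compose_filterlim[OF sizes_pos s_top], rule eventually_compose_filterlim[OF ev2 s_top])
  define R where "R N = sqrt (real (s N) / real N) * b N" for N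
  define w where "w N = sqrt (v (s N)) * \<theta> N * d" for N
  have RK: "eventually (\<lambda>N. sqrt K * b N \<le> R N \<and> K \<le> real (s N) / real N) sequentially"
    using s ev_small
  proof eventually_elim
    case (elim N)
    then have "K \<le> real (s N) / real N" by (simp add: le_divide_eq)
    then show ?case unfolding R_def using elim by (auto intro: mult_right_mono)
  qed
  have R_top: "filterlim R at_top sequentially"
  proof (rule filterlim_at_top_mono)
    show "filterlim (\<lambda>N. sqrt K * b N) at_top sequentially"
      by (rule filterlim_tendsto_pos_mult_at_top[OF tendsto_const sK b_at_top])
    show "eventually (\<lambda>N. sqrt K * b N \<le> R N) sequentially" using RK by eventually_elim simp
  qed
  have R_inv: "(\<lambda>N. 1 / R N) \<longlonglongrightarrow> 0"
    using tendsto_inverse_0_at_top[OF R_top] by (simp add: inverse_eq_divide)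
  have wR: "(\<lambda>N. w N / R N) \<longlonglongrightarrow> d"
  proof (rule Lim_transform_eventually)
    have "(\<lambda>N. d * sqrt (v (s N) / real (s N) / (v N / real N))) \<longlonglongrightarrow> d * sqrt (\<omega> / \<omega>)"
      using \<omega> by (intro tendsto_intros vs v_over_N) simp
    then show "(\<lambda>N. d * sqrt (v (s N) / real (s N) / (v N / real N))) \<longlonglongrightarrow> d" using \<omega> by simp
    show "eventually (\<lambda>N. d * sqrt (v (s N) / real (s N) / (v N / real N)) = w N / R N) sequentially"
      using ss ev_small
    proof eventually_elim
      case (elim N)
      have pos: "0 < sqrt (v N)" "0 < sqrt (real (s N))" "0 < sqrt (real N)" "0 < \<theta> N"
        using elim \<theta>01[of N] by (auto simp: v_def)
      have alg: "d * (a / b' / (c' / e)) = a * t * d / (b' / e * (c' * t))"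
        if "0 < b'" "0 < c'" "0 < e" "0 < t" for a b' c' e t :: real
        using that by (simp add: field_simps)
      show ?case unfolding w_def R_def b_def real_sqrt_divide by (rule alg[OF pos(2,1,3,4)])
    qed
  qed
  have w_top: "filterlim w at_top sequentially"
  proof -
    have "filterlim (\<lambda>N. w N / R N * R N) at_top sequentially"
      by (rule filterlim_tendsto_pos_mult_at_top[OF wR d0 R_top])
    moreover have "eventually (\<lambda>N. w N / R N * R N = w N) sequentially"
      using filterlim_at_top_dense[THEN iffD1, OF R_top, rule_format, of 0] by eventually_elim simp
    ultimately show ?thesis by (rule filterlim_mono_eventually[OF _ order_refl order_refl])
  qed
  have lnR: "(\<lambda>N. ln (real (s N)) / (R N)\<^sup>2) \<longlonglongrightarrow> 0"
  proof (rule tendsto_sandwich[OF _ _ tendsto_const])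
    have "(\<lambda>N. inverse ((b N)\<^sup>2) + ln (real N) / (b N)\<^sup>2 * (1 / K)) \<longlonglongrightarrow> 0 + 0 * (1 / K)"
      by (intro tendsto_intros tendsto_inverse_0_at_top b_sq_at_top ln_over_b_sq)
    then show "(\<lambda>N. inverse ((b N)\<^sup>2) + ln (real N) / (b N)\<^sup>2 * (1 / K)) \<longlonglongrightarrow> 0" by simp
    show "eventually (\<lambda>N. 0 \<le> ln (real (s N)) / (R N)\<^sup>2) sequentially"
      using ss(2) by eventually_elim simp
    show "eventually (\<lambda>N. ln (real (s N)) / (R N)\<^sup>2 \<le> inverse ((b N)\<^sup>2) + ln (real N) / (b N)\<^sup>2 * (1 / K)) sequentially"
      using RK ss(2) ev_small
    proof eventually_elim
      case (elim N)
      define x where "x = real (s N) / real N"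
      have x: "K \<le> x" "0 < x" using elim K by (auto simp: x_def)
      have R2: "(R N)\<^sup>2 = x * (b N)\<^sup>2" using x by (simp add: R_def power_mult_distrib x_def[symmetric])
      have "ln (real (s N)) = ln (x * real N)" using elim by (simp add: x_def)
      also have "\<dots> = ln x + ln (real N)" using x elim by (intro ln_mult_pos) auto
      also have "\<dots> \<le> x + ln (real N)" using ln_le_minus_one[OF x(2)] by simp
      finally have "ln (real (s N)) / (x * (b N)\<^sup>2) \<le> (x + ln (real N)) / (x * (b N)\<^sup>2)"
        using x by (intro divide_right_mono) auto
      also have "\<dots> = inverse ((b N)\<^sup>2) + ln (real N) / (b N)\<^sup>2 * (1 / x)"
        using x elim by (simp add: field_simps)
      also have "\<dots> \<le> inverse ((b N)\<^sup>2) + ln (real N) / (b N)\<^sup>2 * (1 / K)"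
        using x K elim by (intro add_left_mono mult_left_mono divide_left_mono) auto
      finally show ?case unfolding R2 .
    qed
  qed
  \<comment> \<open>\<open>y R\<^sup>2 \<ge> y K b\<^sup>2 = l\<^sup>2 b\<^sup>2 / 2\<close>, the exponent of the level.\<close>
  define y where "y = l\<^sup>2 / (2 * K)"
  have y: "0 < y" "y < 2 * d\<^sup>2"
  proof -
    have l0: "0 < l" using l(1) Amax_pos by simp
    then show "0 < y" using K by (simp add: y_def)
    have "l\<^sup>2 < (2 * d * sqrt K)\<^sup>2" using l(2) l0 by (intro power_strict_mono) auto
    then have "l\<^sup>2 < 4 * d\<^sup>2 * K" using K by (simp add: power_mult_distrib)
    then show "y < 2 * d\<^sup>2" using K by (simp add: y_def divide_less_eq mult_ac)
  qed
  have E: "(\<lambda>N. 2 * (w N / R N - 1 / R N)\<^sup>2 - ln (real (s N)) / (R N)\<^sup>2) \<longlonglongrightarrow> 2 * (d - 0)\<^sup>2 - 0"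
    by (intro tendsto_intros wR R_inv lnR)
  have Ee: "eventually (\<lambda>N. y < 2 * (w N / R N - 1 / R N)\<^sup>2 - ln (real (s N)) / (R N)\<^sup>2) sequentially"
    by (rule order_tendstoD(1)[OF E]) (use y in simp)
  have w1: "eventually (\<lambda>N. 1 < w N) sequentially" using w_top unfolding filterlim_at_top_dense by blast
  define g where "g = (Dmax - d) / d"
  have g: "0 < g" using d d0 by (simp add: g_def)
  have gw: "filterlim (\<lambda>N. g * w N) at_top sequentially"
    by (rule filterlim_tendsto_pos_mult_at_top[OF tendsto_const g w_top])
  have pl: "(\<lambda>N. 1 - exp (- 2 * (g * w N)\<^sup>2)) \<longlonglongrightarrow> 1"
    using tendsto_diff[OF tendsto_const[of 1] exp_square_lim[OF gw]] by simp
  obtain y1 where xy: "y1 < 1" "eventually (\<lambda>N. test_power m n T_sts N (\<alpha> N) (Pa N) (Qa N) < y1) sequentially"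
    by (rule power_bounded_above[OF \<alpha>])
  show ?thesis
    using xy(2) order_tendstoD(1)[OF pl xy(1)] w1 Ee RK ss ev_small level_lower[OF \<alpha> l(1)]
  proof eventually_elim
    case (elim N)
    have mn: "0 < m (s N)" "0 < n (s N)" and N: "2 \<le> N" and b0: "0 < b N" using elim by auto
    interpret V: regular_statistic m n V_sts "s N" "sqrt (real (m (s N)) * real (n (s N)) / real (m (s N) + n (s N)))"
      by (rule V_regular) (rule mn)+
    have "sqrt K * b N \<le> R N" using elim by blast
    then have R0: "0 < R N" using mult_pos_pos[OF sK b0] by linarith
    have s1: "1 \<le> s N" "0 < real (s N)" using elim by auto
    have sz: "m (s N) + n (s N) = s N" by (rule size[OF s1(1)])
    have "null_sup m n V_sts (s N) (w N) \<le> real (m (s N) + n (s N)) * exp (- 2 * (w N - 1)\<^sup>2)"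
      by (rule null_sup_V_le) (use mn elim in auto)
    also have "\<dots> = exp (ln (real (s N)) - 2 * (w N - 1)\<^sup>2)"
      unfolding sz using s1 by (simp add: exp_diff exp_minus divide_inverse)
    also have "\<dots> \<le> exp (- (l\<^sup>2 / 2 * (b N)\<^sup>2))"
    proof -
      have "(2 * (w N / R N - 1 / R N)\<^sup>2 - ln (real (s N)) / (R N)\<^sup>2) * (R N)\<^sup>2 = 2 * (w N - 1)\<^sup>2 - ln (real (s N))"
      proof -
        have alg: "(2 * (x / z) - y / z) * z = 2 * x - y" if "0 < z" for x y z :: real
          using that by (simp add: field_simps)
        have "(w N / R N - 1 / R N)\<^sup>2 = (w N - 1)\<^sup>2 / (R N)\<^sup>2"
          by (simp add: diff_divide_distrib[symmetric] power_divide)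
        then show ?thesis using alg[of "(R N)\<^sup>2"] R0 by simp
      qed
      moreover have "y \<le> 2 * (w N / R N - 1 / R N)\<^sup>2 - ln (real (s N)) / (R N)\<^sup>2"
        using elim by (blast intro: less_imp_le)
      then have "y * (R N)\<^sup>2 \<le> (2 * (w N / R N - 1 / R N)\<^sup>2 - ln (real (s N)) / (R N)\<^sup>2) * (R N)\<^sup>2"
        by (rule mult_right_mono) simp
      moreover have "l\<^sup>2 / 2 * (b N)\<^sup>2 \<le> y * (R N)\<^sup>2"
      proof -
        have "sqrt K * b N \<le> R N" using elim by blast
        then have "(sqrt K * b N)\<^sup>2 \<le> (R N)\<^sup>2" using b0 sK by (intro power_mono) auto
        then have "y * (K * (b N)\<^sup>2) \<le> y * (R N)\<^sup>2"
          using y K by (intro mult_left_mono) (auto simp: power_mult_distrib)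
        then show ?thesis using K by (simp add: y_def)
      qed
      ultimately show ?thesis by simp
    qed
    also have "\<dots> \<le> \<alpha> N" using elim by blast
    finally have crit: "crit_value m n V_sts (s N) (\<alpha> N) \<le> w N"
      using level_01[OF \<alpha>, of N] by (intro V.crit_value_le) auto
    have diff: "sqrt (v (s N)) * (\<theta> N * Dmax) - w N = g * w N"
      using d0 by (simp add: g_def w_def field_simps)
    have e: "test_power m n T_sts N (\<alpha> N) (Pa N) (Qa N) < y1" "y1 < 1 - exp (- 2 * (g * w N)\<^sup>2)" "1 < w N"
      using elim by blast+
    have "0 < g * w N" using g e(3) by simp
    then have le: "w N \<le> sqrt (v (s N)) * (\<theta> N * Dmax)" using diff by linarith
    have "1 - exp (- 2 * (g * w N)\<^sup>2) \<le> exceed_prob m n V_sts (s N) (Pa N) (Qa N) (w N)"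
      using alt_V_lower[OF N mn le] unfolding diff .
    also have "\<dots> \<le> test_power m n V_sts (s N) (\<alpha> N) (Pa N) (Qa N)"
      unfolding test_power_def by (rule alt_V_antimono[OF N mn crit])
    finally show ?case using e by linarith
  qed
qed

text \<open>The threshold \<open>\<kappa> b\<close> with \<open>\<kappa> < Amax / 2\<close> is exceeded under the null hypothesis with a probability above the
  level, so it is a lower bound for the critical value; and with \<open>\<kappa> > sqrt K Dmax\<close> it lies beyond the signal.\<close>

lemma V_power_low:
  assumes \<alpha>: "\<alpha> \<in> levels_star m n T_sts Pa Qa" and K: "0 < K" "sqrt K < Amax / (2 * Dmax)"
  shows "eventually (\<lambda>N. test_power m n V_sts (nat \<lfloor>K * real N\<rfloor>) (\<alpha> N) (Pa N) (Qa N)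
    < test_power m n T_sts N (\<alpha> N) (Pa N) (Qa N)) sequentially"
proof -
  have sK: "0 < sqrt K" using K by simp
  define s where "s N = nat \<lfloor>K * real N\<rfloor>" for N
  have s_le: "real (s N) \<le> K * real N" and s_ge: "K * real N - 1 \<le> real (s N)" for N
  proof -
    have "0 \<le> K * real N" using K by simp
    then have "real (s N) = of_int \<lfloor>K * real N\<rfloor>" by (simp add: s_def)
    then show "real (s N) \<le> K * real N" "K * real N - 1 \<le> real (s N)" by linarith+
  qed
  have s_top': "filterlim (\<lambda>N. real (s N)) at_top sequentially"
  proof (rule filterlim_at_top_mono)
    show "filterlim (\<lambda>N. - 1 + K * real N) at_top sequentially"
      by (intro filterlim_tendsto_add_at_top[OF tendsto_const] filterlim_tendsto_pos_mult_at_top[OF tendsto_const K(1) filterlim_real_sequentially])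
    show "eventually (\<lambda>N. - 1 + K * real N \<le> real (s N)) sequentially" using s_ge by (intro always_eventually) (simp add: algebra_simps)
  qed
  then have s_top: "filterlim s sequentially sequentially"
    unfolding filterlim_sequentially_iff_filterlim_real .
  have s_inv: "(\<lambda>N. inverse (real (s N))) \<longlonglongrightarrow> 0" by (rule tendsto_inverse_0_at_top[OF s_top'])
  have sN: "(\<lambda>N. real (s N) / real N) \<longlonglongrightarrow> K"
  proof (rule tendsto_sandwich[OF _ _ _ tendsto_const])
    have "(\<lambda>N. K - inverse (real N)) \<longlonglongrightarrow> K - 0"
      by (intro tendsto_intros tendsto_inverse_0_at_top filterlim_real_sequentially)
    then show "(\<lambda>N. K - inverse (real N)) \<longlonglongrightarrow> K" by simp
    show "eventually (\<lambda>N. K - inverse (real N) \<le> real (s N) / real N) sequentially"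
      using ev2
    proof eventually_elim
      case (elim N)
      have "(K * real N - 1) / real N \<le> real (s N) / real N" using s_ge[of N] by (intro divide_right_mono) auto
      then show ?case using elim by (simp add: diff_divide_distrib inverse_eq_divide)
    qed
    show "eventually (\<lambda>N. real (s N) / real N \<le> K) sequentially"
      using ev2 by eventually_elim (use s_le in \<open>simp add: divide_le_eq\<close>)
  qed
  have vs: "(\<lambda>N. v (s N) / real (s N)) \<longlonglongrightarrow> \<omega>" by (rule filterlim_compose[OF v_over_N s_top])
  have vs_top: "filterlim (\<lambda>N. v (s N)) at_top sequentially" by (rule filterlim_compose[OF v_at_top s_top])
  have ss: "eventually (\<lambda>N. 0 < m (s N) \<and> 0 < n (s N)) sequentially" "eventually (\<lambda>N. 2 \<le> s N) sequentially"
    by (rule eventually_compose_filterlim[OF sizes_pos s_top], rule eventually_compose_filterlim[OF ev2 s_top])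
  have ratio_v: "(\<lambda>N. sqrt (v (s N)) / sqrt (v N)) \<longlonglongrightarrow> sqrt K"
  proof (rule Lim_transform_eventually)
    have "(\<lambda>N. sqrt (v (s N) / real (s N) * (real (s N) / real N) / (v N / real N))) \<longlonglongrightarrow> sqrt (\<omega> * K / \<omega>)"
      using \<omega> by (intro tendsto_intros vs sN v_over_N) simp
    then show "(\<lambda>N. sqrt (v (s N) / real (s N) * (real (s N) / real N) / (v N / real N))) \<longlonglongrightarrow> sqrt K" using \<omega> by simp
    show "eventually (\<lambda>N. sqrt (v (s N) / real (s N) * (real (s N) / real N) / (v N / real N)) = sqrt (v (s N)) / sqrt (v N)) sequentially"
      using ss ev2 by eventually_elim (simp add: real_sqrt_divide)
  qed
  have "sqrt K * Dmax < Amax / 2" using K(2) Dmax_pos by (simp add: field_simps)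
  then obtain \<kappa> where \<kappa>: "sqrt K * Dmax < \<kappa>" "\<kappa> < Amax / 2" using dense by blast
  have \<kappa>0: "0 < \<kappa>" using \<kappa>(1) mult_pos_pos[OF sK Dmax_pos] by linarith
  have "2 * \<kappa> < Amax" using \<kappa>(2) by simp
  then obtain l where l: "2 * \<kappa> < l" "l < Amax" using dense by blast
  obtain l2 where l2: "l < l2" "l2 < Amax" using dense[OF l(2)] by blast
  have l0: "0 < l" "0 < l2" using l l2 \<kappa>0 by linarith+
  \<comment> \<open>Chosen such that \<open>(2 + \<delta>) \<kappa>\<^sup>2 = l\<^sup>2 / 2\<close>.\<close>
  define \<delta> where "\<delta> = l\<^sup>2 / (2 * \<kappa>\<^sup>2) - 2"
  have \<delta>: "0 < \<delta>"
  proof -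
    have "(2 * \<kappa>)\<^sup>2 < l\<^sup>2" using l(1) \<kappa>0 by (intro power_strict_mono) auto
    then show ?thesis using \<kappa>0 by (simp add: \<delta>_def less_divide_eq power_mult_distrib)
  qed
  \<comment> \<open>The largest variance of an indicator is attained at the median.\<close>
  define qs where "qs N = real (s N div 2) / real (s N)" for N
  have w: "filterlim (\<lambda>N. \<kappa> * b N) at_top sequentially"
    by (rule filterlim_tendsto_pos_mult_at_top[OF tendsto_const \<kappa>0 b_at_top])
  have wv: "(\<lambda>N. \<kappa> * b N / sqrt (v (s N))) \<longlonglongrightarrow> 0"
  proof (rule Lim_transform_eventually)
    have "(\<lambda>N. \<kappa> * \<theta> N / (sqrt (v (s N)) / sqrt (v N))) \<longlonglongrightarrow> \<kappa> * 0 / sqrt K"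
      using sK by (intro tendsto_intros \<theta>_lim ratio_v) simp
    then show "(\<lambda>N. \<kappa> * \<theta> N / (sqrt (v (s N)) / sqrt (v N))) \<longlonglongrightarrow> 0" by simp
    show "eventually (\<lambda>N. \<kappa> * \<theta> N / (sqrt (v (s N)) / sqrt (v N)) = \<kappa> * b N / sqrt (v (s N))) sequentially"
      by (intro always_eventually allI) (simp add: b_def mult_ac)
  qed
  have q: "qs \<longlonglongrightarrow> 1 / 2"
  proof -
    have "(\<lambda>N. qs N - 1 / 2) \<longlonglongrightarrow> 0"
    proof (rule Lim_null_comparison[OF _ s_inv])
      show "eventually (\<lambda>N. norm (qs N - 1 / 2) \<le> inverse (real (s N))) sequentially"
        using ss(2)
      proof eventually_elim
        case (elim N)
        have "2 * (s N div 2) \<le> s N" "s N \<le> 2 * (s N div 2) + 1" by simp_all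
        then have h: "2 * real (s N div 2) \<le> real (s N)" "real (s N) \<le> 2 * real (s N div 2) + 1" by linarith+
        have "qs N - 1 / 2 = (2 * real (s N div 2) - real (s N)) / (2 * real (s N))"
          using elim by (simp add: qs_def field_simps)
        then have "norm (qs N - 1 / 2) = \<bar>2 * real (s N div 2) - real (s N)\<bar> / (2 * real (s N))"
          using elim by (simp add: abs_divide)
        also have "\<dots> \<le> 2 / (2 * real (s N))" using h by (intro divide_right_mono) auto
        finally show ?case by (simp add: inverse_eq_divide)
      qed
    qed
    then show ?thesis by (simp add: LIM_zero_iff)
  qed
  have M: "(\<lambda>N. ln (real (s N) + 1) / (\<kappa> * b N)\<^sup>2) \<longlonglongrightarrow> 0"
  proof (rule tendsto_sandwich[OF _ _ tendsto_const])
    have "(\<lambda>N. ln (K * real N + 1) / (b N)\<^sup>2 * (1 / \<kappa>\<^sup>2)) \<longlonglongrightarrow> 0 * (1 / \<kappa>\<^sup>2)"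
      using K by (intro tendsto_intros ln_affine_over_b_sq) simp
    then show "(\<lambda>N. ln (K * real N + 1) / (b N)\<^sup>2 * (1 / \<kappa>\<^sup>2)) \<longlonglongrightarrow> 0" by simp
    show "eventually (\<lambda>N. 0 \<le> ln (real (s N) + 1) / (\<kappa> * b N)\<^sup>2) sequentially" by simp
    show "eventually (\<lambda>N. ln (real (s N) + 1) / (\<kappa> * b N)\<^sup>2 \<le> ln (K * real N + 1) / (b N)\<^sup>2 * (1 / \<kappa>\<^sup>2)) sequentially"
    proof (intro always_eventually allI)
      fix N
      have "ln (real (s N) + 1) \<le> ln (K * real N + 1)" using s_le[of N] by (intro ln_mono) auto
      then have "ln (real (s N) + 1) / (\<kappa> * b N)\<^sup>2 \<le> ln (K * real N + 1) / (\<kappa> * b N)\<^sup>2" by (intro divide_right_mono) auto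
      then show "ln (real (s N) + 1) / (\<kappa> * b N)\<^sup>2 \<le> ln (K * real N + 1) / (b N)\<^sup>2 * (1 / \<kappa>\<^sup>2)"
        by (simp add: power_mult_distrib mult.commute)
    qed
  qed
  have q1: "eventually (\<lambda>N. 1 / 4 < qs N) sequentially" by (rule order_tendstoD(1)[OF q]) simp
  have q2: "eventually (\<lambda>N. qs N < 3 / 4) sequentially" by (rule order_tendstoD(2)[OF q]) simp
  note S = surplus_exponent[OF vs_top w wv tendsto_const[of 1] q M of_nat_0_le_iff \<delta>, unfolded mult_1_right power_one]
  define g where "g = (\<kappa> - sqrt K * Dmax) / 2"
  have g: "0 < g" using \<kappa>(1) by (simp add: g_def)
  have gl: "(\<lambda>N. \<kappa> - sqrt (v (s N)) / sqrt (v N) * Dmax - inverse (b N)) \<longlonglongrightarrow> \<kappa> - sqrt K * Dmax - 0"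
    by (intro tendsto_intros ratio_v tendsto_inverse_0_at_top b_at_top)
  have ge: "eventually (\<lambda>N. g < \<kappa> - sqrt (v (s N)) / sqrt (v N) * Dmax - inverse (b N)) sequentially"
    by (rule order_tendstoD(1)[OF gl]) (use g in \<open>simp add: g_def\<close>)
  have "0 < 2 * g\<^sup>2" using g by simp
  note lim0 = exp_b_sq_lim[OF less_imp_le[OF K(1)] this]
  obtain x1 where xy: "0 < x1" "eventually (\<lambda>N. x1 < test_power m n T_sts N (\<alpha> N) (Pa N) (Qa N)) sequentially"
    by (rule power_bounded_below[OF \<alpha>])
  have "eventually (\<lambda>N. test_power m n V_sts (s N) (\<alpha> N) (Pa N) (Qa N)
    < test_power m n T_sts N (\<alpha> N) (Pa N) (Qa N)) sequentially"
    using xy(2) order_tendstoD(2)[OF lim0 xy(1)] ge S ss q1 q2 ev_small level_upper[OF \<alpha> l0(2) l2(2)]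
  proof eventually_elim
    case (elim N)
    have mn: "0 < m (s N)" "0 < n (s N)" and N: "2 \<le> N" and b0: "0 < b N" and s1: "1 \<le> s N" using elim by auto
    interpret V: regular_statistic m n V_sts "s N" "sqrt (real (m (s N)) * real (n (s N)) / real (m (s N) + n (s N)))"
      by (rule V_regular) (rule mn)+
    have sz: "m (s N) + n (s N) = s N" by (rule size[OF s1])
    have "\<alpha> N \<le> exp (- (l2\<^sup>2 / 2 * (b N)\<^sup>2))" using elim by blast
    also have "\<dots> < exp (- (l\<^sup>2 / 2 * (b N)\<^sup>2))"
    proof -
      have "l\<^sup>2 < l2\<^sup>2" using l0 l2 by (intro power_strict_mono) auto
      then show ?thesis using b0 by simp
    qed
    also have "l\<^sup>2 / 2 * (b N)\<^sup>2 = (2 + \<delta>) * (\<kappa> * b N)\<^sup>2"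
      using \<kappa>0 by (simp add: \<delta>_def power_mult_distrib)
    also have "exp (- ((2 + \<delta>) * (\<kappa> * b N)\<^sup>2)) \<le> exp (- ((sqrt (v (s N)) * (\<kappa> * b N) + 1)\<^sup>2 / (2 * v (s N) * (qs N * (1 - qs N))))
          * (1 + 100 * ((sqrt (v (s N)) * (\<kappa> * b N) + 1) / v (s N)))) / (real (s N) + 1)\<^sup>2"
      using elim by blast
    also have "\<dots> \<le> exceed_prob m n V_sts (s N) uniform_law uniform_law (\<kappa> * b N)"
    proof -
      have "sqrt (v (s N)) * (\<kappa> * b N) + 1 \<le> v (s N) / 8" using elim by blast
      then have small: "sqrt (v (s N)) * (\<kappa> * b N) + 1 \<le> real (m (s N)) / 8" "sqrt (v (s N)) * (\<kappa> * b N) + 1 \<le> real (n (s N)) / 8"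
        using v_le[of "s N"] by linarith+
      have qeq: "qs N = real (s N div 2) / real (m (s N) + n (s N))" by (simp only: qs_def sz)
      have q14: "1 / 4 \<le> qs N" "qs N \<le> 3 / 4" using elim by (blast intro: less_imp_le)+
      have w0: "0 \<le> \<kappa> * b N" using \<kappa>0 b0 by simp
      show ?thesis
        unfolding exceed_prob_V[where m=m and n=n and S="s N", OF uniform_law(1) uniform_law(1) mn]
        using uniform_V_ge[OF mn qeq q14 w0, folded v_def, OF small] unfolding sz .
    qed
    also have "\<dots> \<le> null_sup m n V_sts (s N) (\<kappa> * b N)" by (rule null_sup_ge[OF uniform_in_null_pairs])
    finally have crit: "\<kappa> * b N \<le> crit_value m n V_sts (s N) (\<alpha> N)"
      using level_01[OF \<alpha>, of N] by (intro V.le_crit_value) auto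
    define x where "x = \<kappa> * b N - sqrt (v (s N)) * (\<theta> N * Dmax) - 1"
    have x: "g * b N \<le> x"
    proof -
      have v0: "0 < sqrt (v N)" using elim by (simp add: v_def)
      have "g \<le> \<kappa> - sqrt (v (s N)) / sqrt (v N) * Dmax - inverse (b N)"
        using elim by (blast intro: less_imp_le)
      then have "g * b N \<le> (\<kappa> - sqrt (v (s N)) / sqrt (v N) * Dmax - inverse (b N)) * b N"
        by (rule mult_right_mono) (use b0 in simp)
      also have "\<dots> = \<kappa> * b N - sqrt (v (s N)) / sqrt (v N) * Dmax * b N - 1"
        using b0 by (simp add: left_diff_distrib)
      also have "sqrt (v (s N)) / sqrt (v N) * Dmax * b N = sqrt (v (s N)) * (\<theta> N * Dmax)"
        using v0 by (simp add: b_def)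
      finally show ?thesis by (simp add: x_def)
    qed
    have gb: "0 < g * b N" using g b0 by simp
    have "test_power m n V_sts (s N) (\<alpha> N) (Pa N) (Qa N) \<le> exceed_prob m n V_sts (s N) (Pa N) (Qa N) (\<kappa> * b N)"
      unfolding test_power_def by (rule alt_V_antimono[OF N mn crit])
    also have "\<dots> \<le> real (s N) * exp (- 2 * x\<^sup>2)"
      unfolding x_def by (rule alt_V_upper[OF N mn s1]) (use x gb in \<open>simp add: x_def\<close>)
    also have "\<dots> \<le> (K * real N + 1) * exp (- (2 * g\<^sup>2 * (b N)\<^sup>2))"
    proof (rule mult_mono)
      have "(g * b N)\<^sup>2 \<le> x\<^sup>2" using x gb by (intro power_mono) auto
      then show "exp (- 2 * x\<^sup>2) \<le> exp (- (2 * g\<^sup>2 * (b N)\<^sup>2))" by (simp add: power_mult_distrib)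
      show "real (s N) \<le> K * real N + 1" using s_le[of N] by simp
      show "0 \<le> K * real N + 1" using K by simp
    qed simp
    also have "\<dots> < x1" using elim by blast
    also have "x1 < test_power m n T_sts N (\<alpha> N) (Pa N) (Qa N)" using elim by blast
    finally show ?case .
  qed
  then show ?thesis unfolding s_def .
qed

lemma sqrt_efficiency:
  "sqrt (1 / 4 * (Amax / Dmax)\<^sup>2) = Amax / (2 * Dmax)" "0 < 1 / 4 * (Amax / Dmax)\<^sup>2"
proof -
  have sq: "1 / 4 * (Amax / Dmax)\<^sup>2 = (Amax / (2 * Dmax))\<^sup>2" by (simp add: power_divide power_mult_distrib)
  have pos: "0 < Amax / (2 * Dmax)" using Amax_pos Dmax_pos by simp
  show "sqrt (1 / 4 * (Amax / Dmax)\<^sup>2) = Amax / (2 * Dmax)"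
    unfolding sq real_sqrt_abs by (rule abs_of_pos[OF pos])
  show "0 < 1 / 4 * (Amax / Dmax)\<^sup>2" unfolding sq by (rule zero_less_power[OF pos])
qed

text \<open>Sample sizes above \<open>K N\<close> are all sufficient if \<open>K\<close> exceeds the asserted limit; if \<open>K\<close> is smaller,
  the sample size \<open>\<lfloor>K N\<rfloor>\<close> is insufficient, and then no smaller \<open>M\<close> is admissible.\<close>

lemma sample_size_limit:
  assumes \<alpha>: "\<alpha> \<in> levels_star m n T_sts Pa Qa"
  shows "(\<lambda>N. sample_size_needed m n T_sts V_sts Pa Qa \<alpha> N / ereal (real N)) \<longlonglongrightarrow> ereal (1 / 4 * (Amax / Dmax)\<^sup>2)"
proof (rule order_tendstoI)
  define e where "e = 1 / 4 * (Amax / Dmax)\<^sup>2"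
  note e = sqrt_efficiency[folded e_def]
  fix a assume "a < ereal (1 / 4 * (Amax / Dmax)\<^sup>2)"
  then have "max a 0 < ereal e" using e by (simp add: e_def)
  then obtain K where K: "max a 0 < ereal K" "ereal K < ereal e" using ereal_dense2 by blast
  have K0: "0 < K" "a < ereal K" using K(1) by auto
  have sK: "sqrt K < Amax / (2 * Dmax)" unfolding e(1)[symmetric] using K(2) by simp
  show "eventually (\<lambda>N. a < sample_size_needed m n T_sts V_sts Pa Qa \<alpha> N / ereal (real N)) sequentially"
    using V_power_low[OF \<alpha> K0(1) sK] ev2
  proof eventually_elim
    case (elim N)
    have "ereal (K * real N) \<le> sample_size_needed m n T_sts V_sts Pa Qa \<alpha> N"
      unfolding sample_size_needed_def
    proof (rule INF_greatest)
      fix M assume M: "M \<in> {M. 1 \<le> M \<and> (\<forall>k. test_power m n T_sts N (\<alpha> N) (Pa N) (Qa N)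
          \<le> test_power m n V_sts (M + k) (\<alpha> N) (Pa N) (Qa N))}"
      have "\<not> M \<le> nat \<lfloor>K * real N\<rfloor>"
      proof
        assume le: "M \<le> nat \<lfloor>K * real N\<rfloor>"
        have "test_power m n T_sts N (\<alpha> N) (Pa N) (Qa N)
          \<le> test_power m n V_sts (M + (nat \<lfloor>K * real N\<rfloor> - M)) (\<alpha> N) (Pa N) (Qa N)" using M by blast
        then show False using elim le by simp
      qed
      then have "K * real N \<le> real M" by linarith
      then show "ereal (K * real N) \<le> ereal (real M)" by simp
    qed
    then have "ereal (K * real N) / ereal (real N) \<le> sample_size_needed m n T_sts V_sts Pa Qa \<alpha> N / ereal (real N)"
      using elim by (intro ereal_divide_right_mono) auto
    then show ?case using elim K0(2) by (auto intro: less_le_trans)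
  qed
next
  define e where "e = 1 / 4 * (Amax / Dmax)\<^sup>2"
  note e = sqrt_efficiency[folded e_def]
  fix a assume "ereal (1 / 4 * (Amax / Dmax)\<^sup>2) < a"
  then obtain K1 where K1: "ereal e < ereal K1" "ereal K1 < a" unfolding e_def using ereal_dense2 by blast
  define K where "K = (e + K1) / 2"
  have K: "e < K" "K < K1" "0 < K" using K1(1) e(2) by (auto simp: K_def)
  have sK: "Amax / (2 * Dmax) < sqrt K" unfolding e(1)[symmetric] using K(1) by simp
  define good_size where "good_size N S \<longleftrightarrow> test_power m n T_sts N (\<alpha> N) (Pa N) (Qa N)
      \<le> test_power m n V_sts S (\<alpha> N) (Pa N) (Qa N)" for N S
  \<comment> \<open>A sequence of counterexamples to the uniform claim would itself have to be good eventually.\<close>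
  define s where "s N = (if \<exists>S. K * real N \<le> real S \<and> \<not> good_size N S
      then SOME S. K * real N \<le> real S \<and> \<not> good_size N S else nat \<lceil>K * real N\<rceil>)" for N
  have s: "K * real N \<le> real (s N) \<and> ((\<exists>S. K * real N \<le> real S \<and> \<not> good_size N S) \<longrightarrow> \<not> good_size N (s N))" for N
  proof (cases "\<exists>S. K * real N \<le> real S \<and> \<not> good_size N S")
    case True
    show ?thesis unfolding s_def if_P[OF True] using someI_ex[OF True] by blast
  next
    case False
    have "K * real N \<le> real (nat \<lceil>K * real N\<rceil>)" by linarith
    then show ?thesis unfolding s_def if_not_P[OF False] using False by blast
  qed
  have "eventually (\<lambda>N. good_size N (s N)) sequentially"
    unfolding good_size_def by (rule V_power_high[OF \<alpha> K(3) sK]) (use s in simp)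
  moreover have "eventually (\<lambda>N. 1 / (K1 - K) < real N) sequentially"
    using filterlim_real_sequentially unfolding filterlim_at_top_dense by blast
  ultimately show "eventually (\<lambda>N. sample_size_needed m n T_sts V_sts Pa Qa \<alpha> N / ereal (real N) < a) sequentially"
    using ev2
  proof eventually_elim
    case (elim N)
    define M where "M = nat \<lceil>K * real N\<rceil>"
    have KN: "0 < K * real N" using K elim by simp
    have M: "1 \<le> M" "K * real N \<le> real M" "real M \<le> K * real N + 1" using KN by (auto simp: M_def) linarith+
    have "good_size N (M + k)" for k
    proof (rule ccontr)
      assume "\<not> good_size N (M + k)"
      then have "\<exists>S. K * real N \<le> real S \<and> \<not> good_size N S" using M(2) by (intro exI[of _ "M + k"]) simp
      then show False using s[of N] elim by blast
    qed
    then have "sample_size_needed m n T_sts V_sts Pa Qa \<alpha> N \<le> ereal (real M)"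
      unfolding sample_size_needed_def using M(1) by (intro INF_lower) (simp add: good_size_def)
    also have "\<dots> \<le> ereal (K1 * real N)"
    proof -
      have "1 < (K1 - K) * real N" using elim K by (simp add: divide_less_eq mult.commute)
      then show ?thesis using M(3) by (simp add: left_diff_distrib)
    qed
    finally have "sample_size_needed m n T_sts V_sts Pa Qa \<alpha> N / ereal (real N) \<le> ereal (K1 * real N) / ereal (real N)"
      using elim by (intro ereal_divide_right_mono) auto
    then show ?case using elim K1(2) by (auto intro: le_less_trans)
  qed
qed

end

section \<open>Admissible levels and the efficiency\<close>

context efficiency_setting
begin

text \<open>Let \<open>w\<close> be the least value of \<open>T\<close> at which the exceedance probability under the alternative is at most
  \<open>1 - \<gamma>\<close>. The event \<open>T \<ge> w\<close> has a larger probability than \<open>1 - \<gamma>\<close>, so by \<open>T_atoms\<close> the power at \<open>w\<close> is at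
  least \<open>\<gamma>\<close>. The null tail at \<open>w\<close> serves as level. Its critical value is \<open>w\<close> itself, because \<open>w\<close> is attained
  with positive probability also under the null hypothesis (\<open>uniform_T_atom_pos\<close>).\<close>

lemma levels_star_nonempty: "levels_star m n T_sts Pa Qa \<noteq> {}"
proof -
  obtain \<gamma> where \<gamma>: "0 < \<gamma>"
    "eventually (\<lambda>N. \<forall>w. measure (\<Omega>a N) {z \<in> space (\<Omega>a N). Tp N z = w} \<le> 1 - 2 * \<gamma>) sequentially" by (rule T_atoms)
  define H where "H N w = exceed_prob m n T_sts N (Pa N) (Qa N) w" for N w
  define Vals where "Vals N = range (\<lambda>\<omega>. T_stat (m N) (n N) (\<Delta> N) (p N) \<omega>)" for N
  define w where "w N = Min {x \<in> Vals N. H N x \<le> 1 - \<gamma>}" for N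
  define a where "a N = null_sup m n T_sts N (w N)" for N
  define \<alpha> where "\<alpha> N = (if 0 < a N \<and> a N < 1 then a N else 1 / 2)" for N
  have main: "\<gamma> \<le> H N (w N) \<and> H N (w N) \<le> 1 - \<gamma>
      \<and> (0 < a N \<and> a N < 1 \<longrightarrow> crit_value m n T_sts N (a N) = w N)"
    if N: "2 \<le> N" and mn: "0 < m N" "0 < n N"
      and atoms: "\<forall>w. measure (\<Omega>a N) {z \<in> space (\<Omega>a N). Tp N z = w} \<le> 1 - 2 * \<gamma>" for N
  proof -
    interpret prob_space "\<Omega>a N" by (rule \<Omega>a_prob[OF N mn])
    have d1: "1 \<le> \<Delta> N" using \<Delta>[OF N] by simp
    have \<gamma>1: "0 \<le> 1 - \<gamma>"
      using order_trans[OF measure_nonneg spec[OF atoms, of 0]] \<gamma>(1) by simp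
    have fin: "finite (Vals N)" unfolding Vals_def by (rule finite_range_T_stat)
    have TV: "Tp N z \<in> Vals N" for z by (simp add: Tp_def Vals_def)
    have H: "H N x = prob {z \<in> space (\<Omega>a N). x < Tp N z}" for x unfolding H_def by (rule exceed_T[OF N])
    define W where "W = {x \<in> Vals N. H N x \<le> 1 - \<gamma>}"
    have "{z \<in> space (\<Omega>a N). Max (Vals N) < Tp N z} = {}"
      using Max_ge[OF fin TV] by (auto simp: not_less)
    then have "H N (Max (Vals N)) = 0" unfolding H by (simp only: measure_empty)
    moreover have "Max (Vals N) \<in> Vals N" using fin TV by (intro Max_in) auto
    ultimately have W: "finite W" "W \<noteq> {}" using fin \<gamma>1 by (auto simp: W_def)
    have wW: "w N = Min W" by (simp only: w_def W_def)
    have w_in: "w N \<in> Vals N" "H N (w N) \<le> 1 - \<gamma>" using Min_in[OF W] unfolding wW W_def by auto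
    have below: "1 - \<gamma> < H N x" if "x \<in> Vals N" "x < w N" for x
    proof (rule ccontr)
      assume "\<not> 1 - \<gamma> < H N x"
      then have "Min W \<le> x" using that by (intro Min_le[OF W(1)]) (simp add: W_def)
      then show False using that by (simp add: wW)
    qed
    have Tm: "Tp N \<in> borel_measurable (\<Omega>a N)"
      by (rule borel_measurableI_greater) (rule Tp_event[OF N mn])
    have eqm: "{z \<in> space (\<Omega>a N). Tp N z = x} \<in> sets (\<Omega>a N)" for x
      by (rule borel_measurable_eq[OF Tm borel_measurable_const])
    have gem: "{z \<in> space (\<Omega>a N). x \<le> Tp N z} \<in> sets (\<Omega>a N)" for x
      by (rule borel_measurable_le[OF borel_measurable_const Tm])
    have ge: "1 - \<gamma> < prob {z \<in> space (\<Omega>a N). w N \<le> Tp N z}"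
    proof (cases "{x \<in> Vals N. x < w N} = {}")
      case True
      then have "{z \<in> space (\<Omega>a N). w N \<le> Tp N z} = space (\<Omega>a N)" using TV by (auto simp: not_less)
      then show ?thesis using \<gamma>(1) prob_space by simp
    next
      case False
      define x where "x = Max {x \<in> Vals N. x < w N}"
      have fin': "finite {x \<in> Vals N. x < w N}" using fin by simp
      have x: "x \<in> Vals N" "x < w N" using Max_in[OF fin' False] unfolding x_def by auto
      have "w N \<le> Tp N z" if "x < Tp N z" for z
      proof (rule ccontr)
        assume "\<not> w N \<le> Tp N z"
        then have "Tp N z \<le> x" unfolding x_def using TV by (intro Max_ge[OF fin']) auto
        then show False using that by simp
      qed
      then have "H N x \<le> prob {z \<in> space (\<Omega>a N). w N \<le> Tp N z}"
        unfolding H by (intro finite_measure_mono gem) auto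
      then show ?thesis using below[OF x] by simp
    qed
    have "{z \<in> space (\<Omega>a N). w N \<le> Tp N z} = {z \<in> space (\<Omega>a N). w N < Tp N z} \<union> {z \<in> space (\<Omega>a N). Tp N z = w N}"
      by auto
    then have split: "prob {z \<in> space (\<Omega>a N). w N \<le> Tp N z} = H N (w N) + prob {z \<in> space (\<Omega>a N). Tp N z = w N}"
      unfolding H by (simp only:) (rule finite_measure_Union[OF Tp_event[OF N mn] eqm], auto)
    have lower: "\<gamma> \<le> H N (w N)" using split ge spec[OF atoms, of "w N"] by linarith
    have pos: "prob {z \<in> space (\<Omega>a N). Tp N z = w N} \<noteq> 0" using split ge w_in(2) by linarith
    obtain z0 where z0: "inj_on z0 {..<m N + n N}" "Tp N z0 = w N"
    proof (rule ccontr)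
      assume none: "\<not> thesis"
      interpret TS: two_samples "m N" "n N" "Pa N" "Qa N" by (rule alt_two_samples[OF N mn])
      have "AE z in \<Omega>a N. inj_on z {..<m N + n N}" unfolding \<Omega>a_def TS.pooled_law_eq by (rule TS.AE_inj)
      then have "AE z in \<Omega>a N. z \<notin> {z \<in> space (\<Omega>a N). Tp N z = w N}"
        using that none by (auto elim!: eventually_mono)
      then have "prob {z \<in> space (\<Omega>a N). Tp N z = w N} = 0" using prob_eq_0[OF eqm] by blast
      then show False using pos by simp
    qed
    have crit: "crit_value m n T_sts N (a N) = w N" if a: "0 < a N" "a N < 1"
    proof -
      obtain B where "regular_statistic m n T_sts N B" by (rule T_regular)
      then interpret R: regular_statistic m n T_sts N B .
      interpret U: two_samples "m N" "n N" uniform_law uniform_law by (rule two_samples_uniform[OF mn])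
      let ?T = "\<lambda>z. T_stat (m N) (n N) (\<Delta> N) (p N) (split_at (m N) z)"
      have ns: "null_sup m n T_sts N x = measure U.\<Omega> {z \<in> space U.\<Omega>. x < ?T z}" for x
        unfolding U.pooled_law_eq[symmetric] by (rule null_sup_T) (use mn d1 p_bounds(1)[OF N] in blast)+
      have Um: "?T \<in> borel_measurable U.\<Omega>" by (rule borel_measurableI_greater) (rule U.T_event)
      have Ueq: "{z \<in> space U.\<Omega>. ?T z = w N} \<in> sets U.\<Omega>"
        by (rule borel_measurable_eq[OF Um borel_measurable_const])
      have Upos: "0 < measure U.\<Omega> {z \<in> space U.\<Omega>. ?T z = w N}"
        using uniform_T_atom_pos[OF mn z0(1), of "\<Delta> N" "p N"] z0(2) unfolding U.pooled_law_eq Tp_def by simp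
      have le: "crit_value m n T_sts N (a N) \<le> w N" by (rule R.crit_value_le[OF a]) (simp add: a_def)
      have "x \<le> crit_value m n T_sts N (a N)" if x: "x < w N" for x
      proof (rule R.le_crit_value[OF a])
        have "measure U.\<Omega> ({z \<in> space U.\<Omega>. w N < ?T z} \<union> {z \<in> space U.\<Omega>. ?T z = w N})
            = measure U.\<Omega> {z \<in> space U.\<Omega>. w N < ?T z} + measure U.\<Omega> {z \<in> space U.\<Omega>. ?T z = w N}"
          by (rule U.P.finite_measure_Union[OF U.T_event Ueq]) auto
        moreover have "measure U.\<Omega> ({z \<in> space U.\<Omega>. w N < ?T z} \<union> {z \<in> space U.\<Omega>. ?T z = w N})
            \<le> measure U.\<Omega> {z \<in> space U.\<Omega>. x < ?T z}"
          by (rule U.P.finite_measure_mono[OF _ U.T_event]) (use x in auto)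
        ultimately show "a N < null_sup m n T_sts N x" unfolding a_def ns using Upos by linarith
      qed
      then have "w N \<le> crit_value m n T_sts N (a N)" by (rule dense_le)
      with le show ?thesis by simp
    qed
    show ?thesis using lower w_in(2) crit by blast
  qed
  have g1: "eventually (\<lambda>N. H N ((Amax + 1) * b N) < \<gamma>) sequentially"
    unfolding H_def by (rule order_tendstoD(2)[OF T_small \<gamma>(1)]) simp
  have g2: "eventually (\<lambda>N. 1 - \<gamma> < H N ((Amax - Amax / 2) * b N)) sequentially"
    unfolding H_def by (rule order_tendstoD(1)[OF T_large]) (use \<gamma>(1) Amax_pos in simp_all)
  have A1: "0 < Amax + 1" and A2: "0 < Amax - Amax / 2" using Amax_pos by simp_all
  define g where "g = (1 / 2 - 1 / 4) * (Amax - Amax / 2)\<^sup>2"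
  have g: "0 < g" using Amax_pos by (simp add: g_def)
  have half: "0 < (1 / 2 :: real)" "0 < (1 / 4 :: real)" by simp_all
  have good: "eventually (\<lambda>N. \<alpha> N = a N \<and> exp (- ((Amax + 1)\<^sup>2 * (b N)\<^sup>2)) \<le> \<alpha> N \<and> \<alpha> N \<le> exp (- (g * (b N)\<^sup>2))
      \<and> \<gamma> \<le> test_power m n T_sts N (\<alpha> N) (Pa N) (Qa N) \<and> test_power m n T_sts N (\<alpha> N) (Pa N) (Qa N) \<le> 1 - \<gamma>) sequentially"
    using g1 g2 \<gamma>(2) ev_small null_T_lower[OF A1 half(1)] null_T_upper[OF A2 half(2)]
  proof eventually_elim
    case (elim N)
    have N: "2 \<le> N" "0 < m N" "0 < n N" and b0: "0 < b N" using elim by auto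
    obtain B where "regular_statistic m n T_sts N B" by (rule T_regular)
    then interpret R: regular_statistic m n T_sts N B .
    note mainN = main[OF N] 
    have h: "\<gamma> \<le> H N (w N)" "H N (w N) \<le> 1 - \<gamma>" "0 < a N \<and> a N < 1 \<longrightarrow> crit_value m n T_sts N (a N) = w N"
      using mainN elim by blast+
    have w1: "w N \<le> (Amax + 1) * b N"
    proof (rule ccontr)
      assume "\<not> w N \<le> (Amax + 1) * b N"
      then have "H N (w N) \<le> H N ((Amax + 1) * b N)" unfolding H_def using N by (intro T_exceed_antimono) auto
      then show False using h elim by linarith
    qed
    have w2: "(Amax - Amax / 2) * b N \<le> w N"
    proof (rule ccontr)
      assume "\<not> (Amax - Amax / 2) * b N \<le> w N"
      then have "H N ((Amax - Amax / 2) * b N) \<le> H N (w N)" unfolding H_def using N by (intro T_exceed_antimono) auto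
      then show False using h elim by linarith
    qed
    have lo: "exp (- ((Amax + 1)\<^sup>2 * (b N)\<^sup>2)) \<le> a N"
    proof -
      have "exp (- ((Amax + 1)\<^sup>2 * (b N)\<^sup>2)) \<le> null_sup m n T_sts N ((Amax + 1) * b N)"
      proof -
        have eq: "(1 / 2 + 1 / 2) * ((Amax + 1) * b N)\<^sup>2 = (Amax + 1)\<^sup>2 * (b N)\<^sup>2" by (simp add: power_mult_distrib)
        show ?thesis unfolding eq[symmetric] using elim by blast
      qed
      also have "\<dots> \<le> a N" unfolding a_def by (rule R.null_sup_antimono[OF w1])
      finally show ?thesis .
    qed
    have up: "a N \<le> exp (- (g * (b N)\<^sup>2))"
    proof -
      have "a N \<le> null_sup m n T_sts N ((Amax - Amax / 2) * b N)" unfolding a_def by (rule R.null_sup_antimono[OF w2])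
      also have "\<dots> \<le> exp (- (g * (b N)\<^sup>2))"
      proof -
        have eq: "(1 / 2 - 1 / 4) * ((Amax - Amax / 2) * b N)\<^sup>2 = g * (b N)\<^sup>2"
          by (simp only: g_def power_mult_distrib mult.assoc)
        show ?thesis unfolding eq[symmetric] using elim by blast
      qed
      finally show ?thesis .
    qed
    have "0 < a N" using lo exp_gt_zero less_le_trans by blast
    moreover have "exp (- (g * (b N)\<^sup>2)) < 1" using g b0 by simp
    then have "a N < 1" using up by linarith
    ultimately have \<alpha>a: "\<alpha> N = a N" "crit_value m n T_sts N (\<alpha> N) = w N" using h(3) by (auto simp: \<alpha>_def)
    then show ?case using lo up h by (simp add: test_power_def H_def)
  qed
  have "\<alpha> \<in> levels"
    unfolding levels_def
  proof (intro CollectI conjI allI)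
    fix N show "0 < \<alpha> N" "\<alpha> N < 1" by (auto simp: \<alpha>_def)
  next
    show "\<alpha> \<longlonglongrightarrow> 0"
    proof (rule tendsto_sandwich[OF _ _ tendsto_const])
      show "eventually (\<lambda>N. 0 \<le> \<alpha> N) sequentially" by (intro always_eventually) (simp add: \<alpha>_def)
      show "eventually (\<lambda>N. \<alpha> N \<le> (0 * real N + 1) * exp (- (g * (b N)\<^sup>2))) sequentially"
        using good by eventually_elim simp
      show "(\<lambda>N. (0 * real N + 1) * exp (- (g * (b N)\<^sup>2))) \<longlonglongrightarrow> 0" by (rule exp_b_sq_lim[OF order_refl g])
    qed
    show "(\<lambda>N. ln (\<alpha> N) / real N) \<longlonglongrightarrow> 0"
    proof (rule Lim_null_comparison)
      have "(\<lambda>N. (Amax + 1)\<^sup>2 * (v N / real N * (\<theta> N)\<^sup>2)) \<longlonglongrightarrow> (Amax + 1)\<^sup>2 * (\<omega> * 0\<^sup>2)"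
        by (intro tendsto_intros v_over_N \<theta>_lim)
      then show "(\<lambda>N. (Amax + 1)\<^sup>2 * (v N / real N * (\<theta> N)\<^sup>2)) \<longlonglongrightarrow> 0" by simp
      show "eventually (\<lambda>N. norm (ln (\<alpha> N) / real N) \<le> (Amax + 1)\<^sup>2 * (v N / real N * (\<theta> N)\<^sup>2)) sequentially"
        using good ev2
      proof eventually_elim
        case (elim N)
        have \<alpha>01: "0 < \<alpha> N" "\<alpha> N < 1" by (auto simp: \<alpha>_def)
        have "- ((Amax + 1)\<^sup>2 * (b N)\<^sup>2) \<le> ln (\<alpha> N)" using elim \<alpha>01 by (simp add: ln_ge_iff)
        moreover have "ln (\<alpha> N) \<le> 0" using \<alpha>01 by simp
        ultimately have "\<bar>ln (\<alpha> N)\<bar> / real N \<le> (Amax + 1)\<^sup>2 * (b N)\<^sup>2 / real N" by (intro divide_right_mono) auto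
        then show ?case using elim by (simp add: b_sq abs_divide mult_ac)
      qed
    qed
  qed
  moreover have "0 < liminf (\<lambda>N. ereal (test_power m n T_sts N (\<alpha> N) (Pa N) (Qa N)))"
  proof -
    have "ereal \<gamma> \<le> liminf (\<lambda>N. ereal (test_power m n T_sts N (\<alpha> N) (Pa N) (Qa N)))"
    proof (rule Liminf_bounded, use good in eventually_elim)
      case (elim N)
      then have "\<gamma> \<le> test_power m n T_sts N (\<alpha> N) (Pa N) (Qa N)" by blast
      then show ?case by simp
    qed
    moreover have "0 < ereal \<gamma>" using \<gamma>(1) by simp
    ultimately show ?thesis by (rule less_le_trans[rotated])
  qed
  moreover have "limsup (\<lambda>N. ereal (test_power m n T_sts N (\<alpha> N) (Pa N) (Qa N))) < 1"
  proof -
    have "limsup (\<lambda>N. ereal (test_power m n T_sts N (\<alpha> N) (Pa N) (Qa N))) \<le> ereal (1 - \<gamma>)"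
    proof (rule Limsup_bounded, use good in eventually_elim)
      case (elim N)
      then have "test_power m n T_sts N (\<alpha> N) (Pa N) (Qa N) \<le> 1 - \<gamma>" by blast
      then show ?case by simp
    qed
    moreover have "ereal (1 - \<gamma>) < 1" using \<gamma>(1) by (simp add: one_ereal_def)
    ultimately show ?thesis by (rule le_less_trans)
  qed
  ultimately show ?thesis unfolding levels_star_def by blast
qed

end

theorem theorem6:
  fixes m n \<Delta> :: "nat \<Rightarrow> nat"
    and p :: "nat \<Rightarrow> nat \<Rightarrow> real"
    and \<theta> :: "nat \<Rightarrow> real"
    and F\<^sub>1 G\<^sub>1 J\<^sub>1 :: "real \<Rightarrow> real"
    and \<eta> :: real
  assumes "\<And>N. N \<ge> 1 \<Longrightarrow> m N + n N = N"
    and "continuous_df F\<^sub>1" and "continuous_df G\<^sub>1" and "\<exists>z. F\<^sub>1 z < G\<^sub>1 z"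
    and "0 < \<eta>" and "\<eta> < 1"
    and J1: "J\<^sub>1 = mix_df \<eta> F\<^sub>1 G\<^sub>1"
    and "mono_on {2..} \<Delta>" and "\<And>N. N \<ge> 2 \<Longrightarrow> 1 < \<Delta> N \<and> \<Delta> N \<le> N"
    and "\<And>N. N \<ge> 2 \<Longrightarrow> 0 < p N 1 \<and> strict_mono_on {1..\<Delta> N} (p N) \<and> p N (\<Delta> N) < 1"
    and "\<And>N. N \<ge> 2 \<Longrightarrow> p N 0 = 0 \<and> p N (\<Delta> N + 1) = 1"
    and i: "\<And>N. N \<ge> 2 \<Longrightarrow> p N 1 \<ge> 1 / (real (\<Delta> N) + 1)"
      "\<And>N. N \<ge> 2 \<Longrightarrow> p N (\<Delta> N) \<le> 1 - 1 / (real (\<Delta> N) + 1)"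
      "(\<lambda>N. MAX j\<in>{1..\<Delta> N + 1}. p N j - p N (j - 1)) \<longlonglongrightarrow> 0"
    and ii: "\<And>N. N \<ge> 2 \<Longrightarrow> 0 < \<theta> N \<and> \<theta> N < 1"
      "filterlim (\<lambda>N. real N * (\<theta> N)\<^sup>2 / (ln (real N))\<^sup>2) at_top sequentially"
      "\<exists>\<nu>. 0 < \<nu> \<and> \<nu> < 1 \<and> (\<lambda>N. \<theta> N powr (1 - \<nu>) * real (\<Delta> N)) \<longlonglongrightarrow> 0"
    and iii: "(\<lambda>N. real (m N) / real N) \<longlonglongrightarrow> \<eta>"
      "(\<lambda>N. \<theta> N * (real (m N) / real N - \<eta>) * sqrt (real N)) \<in> O(\<lambda>_. 1)"
  shows "\<exists>e :: real.
      has_intermediate_efficiency m n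
        (\<lambda>N. T_stat (m N) (n N) (\<Delta> N) (p N)) (\<lambda>N. V_stat (m N) (n N))
        (\<lambda>N. contaminated J\<^sub>1 F\<^sub>1 (\<theta> N)) (\<lambda>N. contaminated J\<^sub>1 G\<^sub>1 (\<theta> N)) (ereal e) \<and>
      e = 1 / 4 * ((SUP t\<in>{0<..<1}. A_star F\<^sub>1 G\<^sub>1 \<eta> t) / (SUP t\<in>{0<..<1}. A_bar F\<^sub>1 G\<^sub>1 \<eta> t))\<^sup>2 \<and>
      e = 1 / 4 * ((SUP z\<in>{z. 0 < J\<^sub>1 z \<and> J\<^sub>1 z < 1}. (G\<^sub>1 z - F\<^sub>1 z) / sqrt (J\<^sub>1 z * (1 - J\<^sub>1 z)))
                   / (SUP z. G\<^sub>1 z - F\<^sub>1 z))\<^sup>2 \<and>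
      e \<ge> 1 \<and>
      (e = 1 \<longleftrightarrow> (\<forall>t\<in>{0<..<1}. A_star F\<^sub>1 G\<^sub>1 \<eta> t \<le> A_star F\<^sub>1 G\<^sub>1 \<eta> (1 / 2)))"
proof -
  interpret efficiency_setting F\<^sub>1 G\<^sub>1 J\<^sub>1 \<eta> m n \<Delta> p \<theta>
    by (intro efficiency_setting.intro df_pair.intro efficiency_setting_axioms.intro assms)
  have "has_intermediate_efficiency m n T_sts V_sts Pa Qa (ereal (1 / 4 * (Amax / Dmax)\<^sup>2))"
    unfolding has_intermediate_efficiency_def using levels_star_nonempty sample_size_limit by blast
  then have "has_intermediate_efficiency m n T_sts V_sts (\<lambda>N. contaminated J\<^sub>1 F\<^sub>1 (\<theta> N))
      (\<lambda>N. contaminated J\<^sub>1 G\<^sub>1 (\<theta> N)) (ereal (1 / 4 * (Amax / Dmax)\<^sup>2))"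
    unfolding Pa_def[abs_def] Qa_def[abs_def] .
  then show ?thesis
    using efficiency_ge_1 unfolding SUP_eqs by (intro exI[of _ "1 / 4 * (Amax / Dmax)\<^sup>2"]) simp
qed

end
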